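(* (Setting in context.) Let $z_1=|z_1|\omega$, $z_2=|z_2|\eta\in\mathbb{C}\setminus\{0\}$, $b=|z_1||z_2|$. For $u,v\in[-1,1]$ let $a^{l}_{u,v}=-ib\cos(\frac{q(u,v)+2\pi l}{k})$, $l=0,\dots,k-1$, and $a^{k}_{u,v}=-ib\,\mathrm{Re}(\omega\bar\eta)$ be the $k+1$ roots of $B(s)A(s,q(u,v))$, and put $c^l_{u,v}=\Big[\frac{A(s,q(1,1))(s-a^{l}_{u,v})}{B(s)A(s,q(u,v))}\Big]_{s=a^{l}_{u,v}}$. Then for the dihedral group $I_{2k}$ with positive multiplicity $(\alpha,\beta)$ the Dunkl kernel is \[E_{\kappa}(z_{1},z_{2})=\Gamma(k(\alpha+\beta)+1)\int_{-1}^{1}\int_{-1}^{1}\int_{0}^{1}\Big[\sum_{l=0}^{k}c^l_{u,v}e^{a^{l}_{u,v}(1-\tau)}\Big]g_{\alpha+\beta}(\tau,q(u,v))\,d\tau\,d\mu_{\alpha}(u)\,d\mu_{\beta}(v),\] and for an odd-$k$ dihedral group $I_k$ with positive multiplicity $\alpha$, \[E_{\kappa}(z_{1},z_{2})=\Gamma(k\alpha+1)\int_{-1}^{1}\int_{0}^{1}\Big[\sum_{l=0}^{k}c^l_{u,1}e^{a^{l}_{u,1}(1-\tau)}\Big]g_{\alpha}(\tau,q(u,1))\,d\tau\,d\mu_{\alpha}(u).\]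
   Context: Identify $\mathbb{R}^2$ with $\mathbb{C}$; $I_N$ is the dihedral group of order $2N$. Dunkl operators: $T_if=\partial_if+\sum_{\alpha\in\mathcal R_+}\kappa(\alpha)\alpha_i\frac{f(x)-f(r_\alpha x)}{\langle\alpha,x\rangle}$, $\Delta_\kappa=T_1^2+T_2^2$, $\mathcal H_j(\upsilon_\kappa)$ = homogeneous degree-$j$ polynomials in $\ker\Delta_\kappa$. For $I_{2k}$, $\kappa=\alpha$ on one reflection class and $\beta$ on the other, weight $\upsilon_\kappa(z)=|\frac{z^k-\bar z^k}{2i}|^{2\alpha}|\frac{z^k+\bar z^k}{2}|^{2\beta}$, $\langle\kappa\rangle=k(\alpha+\beta)$; for odd $k$, $I_k$ has one class with value $\alpha$, weight $|\frac{z^k-\bar z^k}{2i}|^{2\alpha}$, $\langle\kappa\rangle=k\alpha$. $P_j(G;\omega,\eta)$ is the reproducing kernel of $\mathcal H_j(\upsilon_\kappa)$ on the unit circle for $\langle f,g\rangle=\int_{S^1}f\bar g\upsilon_\kappa d\sigma/\int_{S^1}\upsilon_\kappa d\sigma$. The Dunkl kernel is $E_\kappa(z_1,z_2)=2^{\langle\kappa\rangle}\Gamma(\langle\kappa\rangle+1)\sum_{j\ge0}(-i)^jb^{-\langle\kappa\rangle}J_{j+\langle\kappa\rangle}(b)P_j(G;\omega,\eta)$. $d\mu_\gamma(w)=c_\gamma(1+w)(1-w^2)^{\gamma-1}dw$ on $[-1,1]$, $c_\gamma=B(\frac12,\gamma)^{-1}$. $X(u,v)=(\mathrm{Im}\,\omega^{k})(\mathrm{Im}\,\eta^{k})u+(\mathrm{Re}\,\omega^{k})(\mathrm{Re}\,\eta^{k})v$,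 $q(u,v)=\arccos X(u,v)$, $A(s,q)=\prod_{l=0}^{k-1}(s+ib\cos(\frac{q+2\pi l}{k}))$, $B(s)=s+ib\,\mathrm{Re}(\omega\bar\eta)$, and $g_\gamma(t,q)=\mathcal L^{-1}\big(A(s,q)^{-\gamma}\big)(t)$ is the inverse Laplace transform of $s\mapsto A(s,q)^{-\gamma}$ (principal branch). The bracket defining $c^l_{u,v}$ means the value at $s=a^l_{u,v}$ of the rational function after cancelling the factor $s-a^l_{u,v}$.
   Formalization: Added assumption: the k+1 roots a^l_{u,v} are pairwise distinct for almost every u,v in [-1,1] (odd k: a^l_{u,1}, almost every u); otherwise, e.g. for odd k=1 and ω=η=1, the c^l are undefined or a common root is counted twice. *)

theory Defs
  imports "HOL-Analysis.Analysis"
begin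

text \<open>R^2 is identified with the complex plane.  Positive roots of the dihedral
group I_N (order 2N): rt N j = (sin(pi j/N), -cos(pi j/N)), j < N.  A multiplicity
function is given as kappa :: nat => real on the root indices j < N.\<close>

definition rt :: "nat \<Rightarrow> nat \<Rightarrow> complex" where
  "rt N j = Complex (sin (pi * real j / real N)) (- cos (pi * real j / real N))"

definition inner2 :: "complex \<Rightarrow> complex \<Rightarrow> real" where
  "inner2 a z = Re a * Re z + Im a * Im z"

definition refl2 :: "complex \<Rightarrow> complex \<Rightarrow> complex" where
  "refl2 a z = z - complex_of_real (2 * inner2 a z / (cmod a)\<^sup>2) * a"

definition coord :: "nat \<Rightarrow> complex \<Rightarrow> real" where
  "coord i a = (if i = 1 then Re a else Im a)"

definition pderiv2 :: "nat \<Rightarrow> (complex \<Rightarrow> complex) \<Rightarrow> complex \<Rightarrow> complex" where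
  "pderiv2 i f x = vector_derivative
      (\<lambda>t::real. f (x + (if i = 1 then complex_of_real t else \<i> * complex_of_real t))) (at 0)"

definition dunklT :: "nat \<Rightarrow> (nat \<Rightarrow> real) \<Rightarrow> nat \<Rightarrow> (complex \<Rightarrow> complex) \<Rightarrow> complex \<Rightarrow> complex" where
  "dunklT N kappa i f x = pderiv2 i f x +
     (\<Sum>j<N. complex_of_real (kappa j * coord i (rt N j)) *
        (f x - f (refl2 (rt N j) x)) / complex_of_real (inner2 (rt N j) x))"

definition dunkl_laplacian :: "nat \<Rightarrow> (nat \<Rightarrow> real) \<Rightarrow> (complex \<Rightarrow> complex) \<Rightarrow> complex \<Rightarrow> complex" where
  "dunkl_laplacian N kappa f x =
     dunklT N kappa 1 (dunklT N kappa 1 f) x + dunklT N kappa 2 (dunklT N kappa 2 f) x"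

text \<open>Points off all reflecting lines (an open set invariant under the group);
Dunkl-harmonicity of a polynomial is imposed there (it then extends by continuity).\<close>
definition off_lines :: "nat \<Rightarrow> complex \<Rightarrow> bool" where
  "off_lines N x \<longleftrightarrow> (\<forall>j<N. inner2 (rt N j) x \<noteq> 0)"

definition homog_poly :: "nat \<Rightarrow> (complex \<Rightarrow> complex) \<Rightarrow> bool" where
  "homog_poly d f \<longleftrightarrow> (\<exists>c::nat \<Rightarrow> complex. \<forall>z.
      f z = (\<Sum>m\<le>d. c m * complex_of_real (Re z ^ m * Im z ^ (d - m))))"

definition dunkl_harmonic :: "nat \<Rightarrow> (nat \<Rightarrow> real) \<Rightarrow> nat \<Rightarrow> (complex \<Rightarrow> complex) \<Rightarrow> bool" where
  "dunkl_harmonic N kappa d f \<longleftrightarrow>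
     homog_poly d f \<and> (\<forall>x. off_lines N x \<longrightarrow> dunkl_laplacian N kappa f x = 0)"

definition circ_ip :: "(complex \<Rightarrow> real) \<Rightarrow> (complex \<Rightarrow> complex) \<Rightarrow> (complex \<Rightarrow> complex) \<Rightarrow> complex" where
  "circ_ip w f g =
     (LINT t:{0..2*pi}|lborel. f (cis t) * cnj (g (cis t)) * complex_of_real (w (cis t)))
     / complex_of_real (LINT t:{0..2*pi}|lborel. w (cis t))"

text \<open>Reproducing kernel P_d(G; omega, eta) of H_d(v_kappa) (eta on the unit circle;
set to 0 off the circle so that the description is unique).\<close>
definition repker :: "nat \<Rightarrow> (nat \<Rightarrow> real) \<Rightarrow> (complex \<Rightarrow> real) \<Rightarrow> nat \<Rightarrow> complex \<Rightarrow> complex \<Rightarrow> complex" where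
  "repker N kappa w d = (THE P.
      (\<forall>eta. cmod eta = 1 \<longrightarrow> dunkl_harmonic N kappa d (\<lambda>om. P om eta)) \<and>
      (\<forall>eta om. cmod eta \<noteq> 1 \<longrightarrow> P om eta = 0) \<and>
      (\<forall>eta f. cmod eta = 1 \<longrightarrow> dunkl_harmonic N kappa d f \<longrightarrow>
                circ_ip w f (\<lambda>om. P om eta) = f eta))"

definition besselJ :: "real \<Rightarrow> real \<Rightarrow> real" where
  "besselJ nu x = (\<Sum>m. (-1) ^ m / (fact m * Gamma (real m + nu + 1)) * (x / 2) powr (2 * real m + nu))"

definition dunkl_kernel :: "nat \<Rightarrow> (nat \<Rightarrow> real) \<Rightarrow> (complex \<Rightarrow> real) \<Rightarrow> complex \<Rightarrow> complex \<Rightarrow> complex" where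
  "dunkl_kernel N kappa w z1 z2 =
     (let gam = (\<Sum>j<N. kappa j); b = cmod z1 * cmod z2;
          om = z1 / complex_of_real (cmod z1); eta = z2 / complex_of_real (cmod z2) in
      complex_of_real (2 powr gam * Gamma (gam + 1)) *
      (\<Sum>j. (- \<i>) ^ j * complex_of_real (b powr (- gam) * besselJ (real j + gam) b)
              * repker N kappa w j om eta))"

text \<open>Multiplicities and weights: I_{2k} with (alpha, beta); odd I_k with alpha.
Class of rt (2k) j with j even gets alpha (these lines give Im z^k), odd j gets beta.\<close>
definition kappa_even :: "nat \<Rightarrow> real \<Rightarrow> real \<Rightarrow> nat \<Rightarrow> real" where
  "kappa_even k al be j = (if even j then al else be)"

definition weight_even :: "nat \<Rightarrow> real \<Rightarrow> real \<Rightarrow> complex \<Rightarrow> real" where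
  "weight_even k al be z =
     \<bar>Im (z ^ k)\<bar> powr (2 * al) * \<bar>Re (z ^ k)\<bar> powr (2 * be)"

definition kappa_odd :: "real \<Rightarrow> nat \<Rightarrow> real" where
  "kappa_odd al j = al"

definition weight_odd :: "nat \<Rightarrow> real \<Rightarrow> complex \<Rightarrow> real" where
  "weight_odd k al z = \<bar>Im (z ^ k)\<bar> powr (2 * al)"

definition Xf :: "nat \<Rightarrow> complex \<Rightarrow> complex \<Rightarrow> real \<Rightarrow> real \<Rightarrow> real" where
  "Xf k om eta u v = Im (om ^ k) * Im (eta ^ k) * u + Re (om ^ k) * Re (eta ^ k) * v"

definition qf :: "nat \<Rightarrow> complex \<Rightarrow> complex \<Rightarrow> real \<Rightarrow> real \<Rightarrow> real" where
  "qf k om eta u v = arccos (Xf k om eta u v)"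

definition Apoly :: "nat \<Rightarrow> real \<Rightarrow> real \<Rightarrow> complex \<Rightarrow> complex" where
  "Apoly k b q s = (\<Prod>l<k. s + \<i> * complex_of_real (b * cos ((q + 2 * pi * real l) / real k)))"

definition Bpoly :: "real \<Rightarrow> complex \<Rightarrow> complex \<Rightarrow> complex \<Rightarrow> complex" where
  "Bpoly b om eta s = s + \<i> * complex_of_real (b * Re (om * cnj eta))"

definition aroot :: "nat \<Rightarrow> real \<Rightarrow> complex \<Rightarrow> complex \<Rightarrow> real \<Rightarrow> nat \<Rightarrow> complex" where
  "aroot k b om eta q l =
     (if l < k then - \<i> * complex_of_real (b * cos ((q + 2 * pi * real l) / real k))
      else - \<i> * complex_of_real (b * Re (om * cnj eta)))"

text \<open>c^l: value at s = a^l of A(s,q(1,1)) (s - a^l) / (B(s) A(s,q)) after cancelling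
s - a^l, using B(s) A(s,q) = prod_{m=0..k} (s - a^m).\<close>
definition ccoef :: "nat \<Rightarrow> real \<Rightarrow> complex \<Rightarrow> complex \<Rightarrow> real \<Rightarrow> nat \<Rightarrow> complex" where
  "ccoef k b om eta q l =
     Apoly k b (qf k om eta 1 1) (aroot k b om eta q l) /
     (\<Prod>m\<in>{0..k} - {l}. aroot k b om eta q l - aroot k b om eta q m)"

text \<open>A(s,q)^(-gam), principal branch on each factor (analytic for Re s > 0).\<close>
definition Apow :: "nat \<Rightarrow> real \<Rightarrow> real \<Rightarrow> real \<Rightarrow> complex \<Rightarrow> complex" where
  "Apow k b gam q s = (\<Prod>l<k. (s + \<i> * complex_of_real (b * cos ((q + 2 * pi * real l) / real k)))
                                   powr (- complex_of_real gam))"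

definition gfun :: "nat \<Rightarrow> real \<Rightarrow> real \<Rightarrow> real \<Rightarrow> real \<Rightarrow> complex" where
  "gfun k b gam q = (THE g.
      (\<forall>t\<le>0. g t = 0) \<and> continuous_on {0<..} g \<and>
      (\<forall>s. Re s > 0 \<longrightarrow>
          set_integrable lborel {0<..} (\<lambda>t. exp (- (s * complex_of_real t)) * g t) \<and>
          (LINT t:{0<..}|lborel. exp (- (s * complex_of_real t)) * g t) = Apow k b gam q s))"

definition dmu :: "real \<Rightarrow> real \<Rightarrow> real" where
  "dmu gam w = (1 / Beta (1/2) gam) * (1 + w) * (1 - w\<^sup>2) powr (gam - 1)"

definition csum :: "nat \<Rightarrow> real \<Rightarrow> complex \<Rightarrow> complex \<Rightarrow> real \<Rightarrow> real \<Rightarrow> complex" where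
  "csum k b om eta q tau =
     (\<Sum>l\<le>k. ccoef k b om eta q l * exp (aroot k b om eta q l * complex_of_real (1 - tau)))"

end

theory Submission
  imports Defs
begin

text \<open>
  The reproducing kernel is made explicit first. Write V(m,X) for the m-th Gegenbauer polynomial of
  index lam + 1 (lam = alpha + beta, resp. alpha), homogenised and averaged over
  X = X(u,v) against d mu_alpha(u) d mu_beta(v). For the rank-one product group I_2 the combination
  V(m) - cnj z x V(m-1) is annihilated by the complex Dunkl operator Tb = (T_1 + i T_2)/2; composing with
  z^k and multiplying by (omega cnj eta)^r gives such functions for the dihedral group. A moment
  recursion on the circle shows that they are orthogonal to everything except their own monomial,
  and the real combination P_n = F_n + cnj omega eta cnj F_(n-1) is harmonic and reproducing. The odd groups are the
  case beta = 0, where mu_beta degenerates to the point mass at v = 1.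

  It remains to prove, for a fixed value X = cos q, that the tau-integral is the Bessel series in the
  unaveraged kernels. Both sides are values at t = 1 of functions on the half line: a convolution, with Laplace
  transform A(s,q(1,1)) A(s,q)^(-lam-1) / B(s) by partial fractions, and a power series in t. With
  zeta = -ir and b/(2s) = r/(1-r^2) one has s + ibc = s/(1-r^2) (1 - 2 zeta c + zeta^2), so the Laplace
  transform of the power series becomes the generating function of the kernels at zeta, which is the
  same expression. Lerch's theorem identifies the functions, and averaging over u and v
  finishes the proof, because the roots fail to be distinct for at most three values of X.
\<close>

section \<open>Dunkl operators in complex coordinates\<close>

text \<open>Averaging over u and v is an intertwining operator: on averaged powers of X the Dunkl
  operators of I_2 act as partial derivatives do on powers of the inner product, so Gegenbauer
  identities survive it. The index lam + 1, not lam, is forced by the Laplace side, where A^(-lam)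
  from g meets a further 1/A from the partial fractions. Up to scaling the numerator A(s,q(1,1)) is
  (1 - zeta^k e^k)(1 - zeta^k cnj e^k) with e = omega cnj eta; in the generating function of the F_n
  one factor comes from the term cnj z x V(m-1), the other from the geometric sum over r < k.

  Orthogonality of harmonics of different degrees is bypassed. The F_j are summed to a kernel K_n
  reproducing all homogeneous polynomials of degree n on the circle, P_n equals K_n - |z|^2 K_(n-2),
  and P_n is reproducing because no nonzero multiple of |z|^2 is harmonic.

  The two Laplace transforms are compared for large real s only. There the factors of A, divided by
  a common positive number, are close to 1, so principal powers multiply and all series
  converge.\<close>

definition eps :: "nat \<Rightarrow> nat \<Rightarrow> complex" where
  "eps N j = cis (2 * pi * real j / real N)"

section \<open>Differentiability in Wirtinger form\<close>

definition wirt :: "(complex \<Rightarrow> complex) \<Rightarrow> complex \<Rightarrow> complex \<Rightarrow> complex \<Rightarrow> bool" where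
  "wirt f a b z \<longleftrightarrow> (f has_derivative (\<lambda>h. a * h + b * cnj h)) (at z)"

definition dz :: "(complex \<Rightarrow> complex) \<Rightarrow> complex \<Rightarrow> complex" where
  "dz f z = (pderiv2 1 f z - \<i> * pderiv2 2 f z) / 2"

definition dzb :: "(complex \<Rightarrow> complex) \<Rightarrow> complex \<Rightarrow> complex" where
  "dzb f z = (pderiv2 1 f z + \<i> * pderiv2 2 f z) / 2"

lemma wirt_dz: assumes "wirt f a b z" shows "dz f z = a" "dzb f z = b"
proof -
  have D: "(f has_derivative (\<lambda>h. a * h + b * cnj h)) (at (z + c * complex_of_real 0))" for c
    using assms by (simp add: wirt_def)
  have "((\<lambda>t::real. f (z + c * complex_of_real t)) has_vector_derivative (a * c + b * cnj c)) (at 0)" for c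
  proof -
    have "((\<lambda>t::real. z + c * complex_of_real t) has_derivative (\<lambda>t. c * complex_of_real t)) (at 0)"
      by (auto intro!: derivative_eq_intros)
    from has_derivative_compose[OF this D]
    show ?thesis unfolding has_vector_derivative_def
      by (simp add: algebra_simps scaleR_conv_of_real)
  qed
  from this[of 1] this[of \<i>] have p: "pderiv2 1 f z = a + b" "pderiv2 2 f z = a * \<i> - b * \<i>"
    unfolding pderiv2_def by (simp_all add: vector_derivative_at)
  show "dz f z = a" "dzb f z = b" unfolding dz_def dzb_def p by (simp_all add: algebra_simps)
qed

lemma wirt_const [intro]: "wirt (\<lambda>z. c) 0 0 z"
  by (simp add: wirt_def)

lemma wirt_ident [intro]: "wirt (\<lambda>z. z) 1 0 z"
  by (simp add: wirt_def)

lemma wirt_cnj_ident [intro]: "wirt (\<lambda>z. cnj z) 0 1 z"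
  by (auto simp: wirt_def intro!: derivative_eq_intros)

lemma wirt_add: "wirt f a b z \<Longrightarrow> wirt g c d z \<Longrightarrow> wirt (\<lambda>z. f z + g z) (a + c) (b + d) z"
  unfolding wirt_def by (erule has_derivative_eq_rhs[OF has_derivative_add], assumption) (auto simp: algebra_simps)

lemma wirt_mult: "wirt f a b z \<Longrightarrow> wirt g c d z \<Longrightarrow>
   wirt (\<lambda>z. f z * g z) (a * g z + f z * c) (b * g z + f z * d) z"
  unfolding wirt_def by (erule has_derivative_eq_rhs[OF has_derivative_mult], assumption) (auto simp: algebra_simps)

lemma wirt_cmult: "wirt f a b z \<Longrightarrow> wirt (\<lambda>z. c * f z) (c * a) (c * b) z"
  using wirt_mult[OF wirt_const[of c]] by simp

lemma wirt_cnj: "wirt f a b z \<Longrightarrow> wirt (\<lambda>z. cnj (f z)) (cnj b) (cnj a) z"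
  unfolding wirt_def
  by (drule has_derivative_cnj) (erule has_derivative_eq_rhs, auto simp: algebra_simps)

lemma wirt_compose: "wirt g c d z \<Longrightarrow> wirt f a b (g z) \<Longrightarrow>
   wirt (\<lambda>z. f (g z)) (a * c + b * cnj d) (a * d + b * cnj c) z"
  unfolding wirt_def by (drule (1) has_derivative_compose) (erule has_derivative_eq_rhs, auto simp: algebra_simps)

lemma wirt_power: "wirt (\<lambda>z. z ^ n) (of_nat n * z ^ (n - 1)) 0 z"
proof (induction n)
  case (Suc n)
  from wirt_mult[OF wirt_ident this] show ?case
    by (cases n) (simp_all add: algebra_simps)
qed (use wirt_const[of 1] in simp)

lemma wirt_cong: "wirt f a b z \<Longrightarrow> open U \<Longrightarrow> z \<in> U \<Longrightarrow> (\<And>w. w \<in> U \<Longrightarrow> f w = g w) \<Longrightarrow> wirt g a b z"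
  unfolding wirt_def by (erule has_derivative_transform_within_open)

definition wd :: "(complex \<Rightarrow> complex) \<Rightarrow> complex \<Rightarrow> bool" where
  "wd f z \<longleftrightarrow> (\<exists>a b. wirt f a b z)"

lemma wd_wirt: "wd f z \<Longrightarrow> wirt f (dz f z) (dzb f z) z"
  by (metis wd_def wirt_dz)

text \<open>In complex coordinates the j-th reflection is z -> \<open>eps N j * cnj z\<close>. On
  its line the denominator vanishes and division by zero makes \<open>dq\<close> equal to 0, so
  statements that need a genuine divided difference exclude the line.\<close>

definition dq :: "nat \<Rightarrow> nat \<Rightarrow> (complex \<Rightarrow> complex) \<Rightarrow> complex \<Rightarrow> complex" where
  "dq N j f z = (f z - f (eps N j * cnj z)) / (z - eps N j * cnj z)"

text \<open>Off the lines \<open>Tz\<close> is (T_1 - i T_2)/2 and \<open>Tb\<close> is (T_1 + i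
  T_2)/2, see \<open>dunklT_eq\<close>. For zero multiplicities they are the Wirtinger
  derivatives.\<close>

definition Tz :: "nat \<Rightarrow> (nat \<Rightarrow> real) \<Rightarrow> (complex \<Rightarrow> complex) \<Rightarrow> complex \<Rightarrow> complex" where
  "Tz N ka f z = dz f z + (\<Sum>j<N. of_real (ka j) * dq N j f z)"

definition Tb :: "nat \<Rightarrow> (nat \<Rightarrow> real) \<Rightarrow> (complex \<Rightarrow> complex) \<Rightarrow> complex \<Rightarrow> complex" where
  "Tb N ka f z = dzb f z - (\<Sum>j<N. of_real (ka j) * eps N j * dq N j f z)"

definition reg :: "nat \<Rightarrow> (nat \<Rightarrow> real) \<Rightarrow> complex \<Rightarrow> bool" where
  "reg N ka z \<longleftrightarrow> (\<forall>j<N. ka j \<noteq> 0 \<longrightarrow> z \<noteq> eps N j * cnj z)"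

lemma eps_cnj [simp]: "eps N j * cnj (eps N j) = 1" "cnj (eps N j) * eps N j = 1"
  by (simp_all add: eps_def cis_cnj cis_mult)

lemma eps_cnj_left [simp]: "eps N j * (cnj (eps N j) * x) = x"
  unfolding mult.assoc[symmetric] by simp

lemma eps_nz [simp]: "eps N j \<noteq> 0" by (simp add: eps_def)

lemma cnj_eps: "cnj (eps N j) = 1 / eps N j"
  using eps_cnj(1)[of N j] by (simp add: field_simps)

lemma rt_eq: "rt N j = - \<i> * cis (pi * real j / real N)"
  by (simp add: rt_def complex_eq_iff)

lemma inner2_rt: "complex_of_real (inner2 (rt N j) z) =
   \<i> / 2 * cis (- (pi * real j / real N)) * (z - eps N j * cnj z)"
proof -
  have e: "eps N j = cis (pi * real j / real N) * cis (pi * real j / real N)"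
    by (simp add: eps_def cis_mult mult.assoc)
  have c: "cis (- (pi * real j / real N)) * cis (pi * real j / real N) = 1"
    by (simp add: cis_mult)
  have "cis (- (pi * real j / real N)) * (z - eps N j * cnj z)
    = cis (- (pi * real j / real N)) * z - (cis (- (pi * real j / real N)) * cis (pi * real j / real N)) * (cis (pi * real j / real N) * cnj z)"
    unfolding e by (simp add: algebra_simps)
  then have *: "cis (- (pi * real j / real N)) * (z - eps N j * cnj z)
    = cis (- (pi * real j / real N)) * z - cis (pi * real j / real N) * cnj z"
    unfolding c by simp
  show ?thesis
    unfolding mult.assoc * by (simp add: inner2_def rt_def complex_eq_iff)
qed

lemma inner2_rt_0: "inner2 (rt N j) z = 0 \<longleftrightarrow> z = eps N j * cnj z"
proof -
  have "inner2 (rt N j) z = 0 \<longleftrightarrow> complex_of_real (inner2 (rt N j) z) = 0" by simp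
  also have "\<dots> \<longleftrightarrow> z = eps N j * cnj z" unfolding inner2_rt by simp
  finally show ?thesis .
qed

lemma off_lines_iff: "off_lines N z \<longleftrightarrow> (\<forall>j<N. z \<noteq> eps N j * cnj z)"
  by (simp add: off_lines_def inner2_rt_0)

lemma off_lines_reg: "off_lines N z \<Longrightarrow> reg N ka z"
  by (simp add: off_lines_iff reg_def)

lemma refl2_rt: "refl2 (rt N j) z = eps N j * cnj z"
proof -
  have 1: "cmod (rt N j) = 1" by (simp add: rt_eq norm_mult)
  have "complex_of_real (2 * inner2 (rt N j) z / (cmod (rt N j))\<^sup>2) * rt N j
     = (2 * complex_of_real (inner2 (rt N j) z)) * rt N j" by (simp add: 1)
  also have "\<dots> = (cis (- (pi * real j / real N)) * cis (pi * real j / real N)) * (z - eps N j * cnj z)"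
    unfolding inner2_rt unfolding rt_eq by (simp add: field_simps)
  also have "\<dots> = z - eps N j * cnj z" by (simp add: cis_mult)
  finally show ?thesis by (simp add: refl2_def)
qed

lemma dunklT_eq:
  assumes "off_lines N z"
  shows "dunklT N ka 1 f z = Tz N ka f z + Tb N ka f z"
        "dunklT N ka 2 f z = \<i> * (Tz N ka f z - Tb N ka f z)"
proof -
  \<comment> \<open>With theta = pi j / N the denominator of the reflection term is (i/2) e^(-i
    theta) times that of \<open>dq\<close>. The same constant can be split off each coordinate of
    the root, which leaves the coefficients 1 - eps and i (1 + eps).\<close>
  have A: "complex_of_real (ka j * coord i (rt N j)) * (f z - f (refl2 (rt N j) z)) / complex_of_real (inner2 (rt N j) z)
    = of_real (ka j) * (if i = 1 then 1 - eps N j else \<i> * (1 + eps N j)) * dq N j f z" if "j < N" for i j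
  proof -
    let ?c = "cis (pi * real j / real N)"
    have e: "eps N j = ?c * ?c" by (simp add: eps_def cis_mult mult.assoc)
    have ci: "cis (- (pi * real j / real N)) = 1 / ?c"
      by (simp add: eq_divide_eq cis_mult)
    have re: "of_real (sin (pi * real j / real N)) = \<i> / 2 * (1 / ?c - ?c)"
      "of_real (cos (pi * real j / real N)) = (1 / ?c + ?c) / 2"
      unfolding ci[symmetric] by (simp_all add: complex_eq_iff)
    have c: "of_real (coord i (rt N j)) = (\<i> / 2 * cis (- (pi * real j / real N))) * (if i = 1 then 1 - eps N j else \<i> * (1 + eps N j))"
      unfolding e ci by (simp add: coord_def rt_def re) (simp add: field_simps)
    have gen: "K \<noteq> 0 \<Longrightarrow> x * (K * D) * F / (K * l) = x * D * (F / l)" for x K D F l :: complex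
      by simp
    show ?thesis
      unfolding inner2_rt dq_def refl2_rt of_real_mult c by (rule gen) simp
  qed
  have B: "dunklT N ka i f z = pderiv2 i f z + 
    (\<Sum>j<N. of_real (ka j) * (if i = 1 then 1 - eps N j else \<i> * (1 + eps N j)) * dq N j f z)" for i
    unfolding dunklT_def by (intro arg_cong2[where f = "(+)"] refl sum.cong A) auto
  have p: "pderiv2 1 f z = dz f z + dzb f z" "pderiv2 2 f z = \<i> * (dz f z - dzb f z)"
    by (simp_all add: dz_def dzb_def field_simps)
  have s1: "(\<Sum>j<N. of_real (ka j) * (1 - eps N j) * dq N j f z) = 
     (\<Sum>j<N. of_real (ka j) * dq N j f z) - (\<Sum>j<N. of_real (ka j) * eps N j * dq N j f z)"
    unfolding sum_subtractf[symmetric] by (rule sum.cong) (simp_all add: algebra_simps)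
  have s2: "(\<Sum>j<N. of_real (ka j) * (\<i> * (1 + eps N j)) * dq N j f z) = 
     \<i> * ((\<Sum>j<N. of_real (ka j) * dq N j f z) + (\<Sum>j<N. of_real (ka j) * eps N j * dq N j f z))"
    unfolding sum.distrib[symmetric] sum_distrib_left by (rule sum.cong) (simp_all add: algebra_simps)
  show "dunklT N ka 1 f z = Tz N ka f z + Tb N ka f z"
    using B[of 1] unfolding Tz_def Tb_def p by (simp add: s1)
  show "dunklT N ka 2 f z = \<i> * (Tz N ka f z - Tb N ka f z)"
    using B[of 2] unfolding Tz_def Tb_def p by (simp add: s2) (simp add: algebra_simps)
qed

lemma open_off_lines: "open {z. off_lines N z}"
proof -
  have "{z. off_lines N z} = (\<Inter>j<N. {z. z - eps N j * cnj z \<noteq> 0})"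
    by (auto simp: off_lines_iff)
  also have "open \<dots>"
    by (intro open_INT finite_lessThan ballI open_Collect_neq continuous_intros)
  finally show ?thesis .
qed

lemma eps_mod: "N > 0 \<Longrightarrow> eps N (i mod N) = eps N i"
proof -
  assume N: "N > 0"
  have "eps N i = cis (2 * pi * real (i mod N) / real N + 2 * pi * real (i div N))"
    unfolding eps_def
  proof (rule arg_cong[where f = cis])
    have "real i = real N * real (i div N) + real (i mod N)"
      by (metis of_nat_add of_nat_mult mult_div_mod_eq)
    then show "2 * pi * real i / real N = 2 * pi * real (i mod N) / real N + 2 * pi * real (i div N)"
      using N by (simp add: field_simps)
  qed
  also have "\<dots> = eps N (i mod N)"
    by (simp add: eps_def flip: cis_mult)
  finally show ?thesis by simp
qed

lemma eps_add: "eps N (i + j) = eps N i * eps N j"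
  by (simp add: eps_def cis_mult add_divide_distrib distrib_left)

lemma eps_self: "N > 0 \<Longrightarrow> eps N N = 1"
  by (simp add: eps_def)

text \<open>Reflecting the line of index i in the line of index j gives index 2 j - i modulo N. This
  is the index l of the proof, with N - i in place of -i to stay within the naturals.\<close>

lemma off_lines_refl:
  assumes "off_lines N z" "j < N" shows "off_lines N (eps N j * cnj z)"
  unfolding off_lines_iff
proof (intro allI impI notI)
  fix i assume i: "i < N" and eq: "eps N j * cnj z = eps N i * cnj (eps N j * cnj z)"
  have N: "N > 0" using i by simp
  define l where "l = (2 * j + (N - i)) mod N"
  have "eps N l * eps N i = eps N j * eps N j"
  proof -
    have "eps N (N - i) * eps N i = 1"
      using i eps_self[OF N] by (simp flip: eps_add)
    moreover have "eps N l = eps N j * eps N j * eps N (N - i)"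
      unfolding l_def eps_mod[OF N] eps_add mult_2 ..
    ultimately show ?thesis by simp
  qed
  then have l: "eps N l = eps N j * eps N j * cnj (eps N i)"
    by (metis eps_cnj(1) mult.assoc mult.right_neutral)
  have "eps N j * (cnj (eps N i) * (eps N j * cnj z)) = (eps N j * cnj (eps N j)) * (cnj (eps N i) * eps N i) * z"
    using arg_cong[OF eq, of "\<lambda>x. eps N j * (cnj (eps N i) * x)"]
    by (simp only: complex_cnj_mult complex_cnj_cnj mult_ac)
  then have "eps N l * cnj z = z" by (simp add: l mult_ac)
  moreover have "l < N" using N by (simp add: l_def)
  ultimately show False using assms(1) by (auto simp: off_lines_iff)
qed

text \<open>The operators are not local: the value at z involves f near z and at the reflected
  points. The complement of the lines is open and invariant under the reflections, so agreement
  there controls both kinds of terms.\<close>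

lemma T_cong:
  assumes "off_lines N z" "\<And>w. off_lines N w \<Longrightarrow> f w = g w" "wd f z"
  shows "Tz N ka f z = Tz N ka g z" "Tb N ka f z = Tb N ka g z"
proof -
  have w: "wirt g (dz f z) (dzb f z) z"
    by (rule wirt_cong[OF wd_wirt[OF assms(3)] open_off_lines[of N]]) (use assms in auto)
  have d: "dq N j f z = dq N j g z" if "j < N" for j
    using that assms off_lines_refl[OF assms(1) that] by (simp add: dq_def)
  show "Tz N ka f z = Tz N ka g z" "Tb N ka f z = Tb N ka g z"
    using d wirt_dz[OF w] by (simp_all add: Tz_def Tb_def)
qed

section \<open>Linearity and product rules for the Dunkl operators\<close>

lemma dq_add: "dq N j (\<lambda>z. f z + g z) z = dq N j f z + dq N j g z"
  by (simp add: dq_def add_divide_distrib diff_divide_distrib)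

lemma dq_cmult: "dq N j (\<lambda>z. c * f z) z = c * dq N j f z"
  by (simp add: dq_def diff_divide_distrib right_diff_distrib)

text \<open>The conjugate of z - eps cnj z is -cnj eps times the same number. This sign and factor
  are what makes conjugation exchange \<open>Tz\<close> and \<open>Tb\<close> in
  \<open>T_cnj\<close>.\<close>

lemma dq_cnj: "dq N j (\<lambda>z. cnj (f z)) z = - cnj (eps N j * dq N j f z)"
proof (cases "z = eps N j * cnj z")
  case False
  have l: "cnj (z - eps N j * cnj z) = - cnj (eps N j) * (z - eps N j * cnj z)"
    using eps_cnj[of N j] by (simp only: complex_cnj_diff complex_cnj_mult complex_cnj_cnj) algebra
  have gen: "c \<noteq> 0 \<Longrightarrow> F / l = - (c * (F / (- c * l)))" for F l c :: complex by simp
  show ?thesis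
    unfolding dq_def complex_cnj_mult complex_cnj_divide complex_cnj_diff[of "f z"] l
    by (rule gen) simp
qed (simp add: dq_def)

lemma dq_mult_z: "z \<noteq> eps N j * cnj z \<Longrightarrow> dq N j (\<lambda>z. z * g z) z = z * dq N j g z + g (eps N j * cnj z)"
  by (simp add: dq_def field_simps)

lemma dq_mult_cnj: assumes "z \<noteq> eps N j * cnj z"
  shows "dq N j (\<lambda>z. cnj z * g z) z = cnj z * dq N j g z - cnj (eps N j) * g (eps N j * cnj z)"
proof -
  have gen: "l \<noteq> 0 \<Longrightarrow> (w * D - e * G * l) / l = w * (D / l) - e * G" for w D e G l :: complex
    by (simp add: diff_divide_distrib)
  have "cnj z * g z - cnj (eps N j * cnj z) * g (eps N j * cnj z) = 
     cnj z * (g z - g (eps N j * cnj z)) - cnj (eps N j) * g (eps N j * cnj z) * (z - eps N j * cnj z)"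
    using eps_cnj[of N j] by (simp only: complex_cnj_mult complex_cnj_cnj) algebra
  then show ?thesis unfolding dq_def using assms gen by simp
qed

lemma wd_const [simp]: "wd (\<lambda>z. c) z"
  unfolding wd_def using wirt_const by metis

lemma wd_ident [simp]: "wd (\<lambda>z. z) z"
  unfolding wd_def using wirt_ident by metis

lemma wd_cnj_ident [simp]: "wd cnj z"
  unfolding wd_def using wirt_cnj_ident by metis

lemma wd_add [simp]: "wd f z \<Longrightarrow> wd g z \<Longrightarrow> wd (\<lambda>z. f z + g z) z"
  unfolding wd_def using wirt_add by metis

lemma wd_mult [simp]: "wd f z \<Longrightarrow> wd g z \<Longrightarrow> wd (\<lambda>z. f z * g z) z"
  unfolding wd_def using wirt_mult by metis

lemma wd_cnj [simp]: "wd f z \<Longrightarrow> wd (\<lambda>z. cnj (f z)) z"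
  unfolding wd_def using wirt_cnj by metis

lemma wd_power [simp]: "wd (\<lambda>z. z ^ n) z"
  unfolding wd_def using wirt_power by metis

lemma T_add:
  assumes "wd f z" "wd g z"
  shows "Tz N ka (\<lambda>z. f z + g z) z = Tz N ka f z + Tz N ka g z"
        "Tb N ka (\<lambda>z. f z + g z) z = Tb N ka f z + Tb N ka g z"
  using wirt_dz[OF wirt_add[OF assms[THEN wd_wirt]]]
  by (simp_all add: Tz_def Tb_def dq_add algebra_simps sum.distrib)

lemma T_cmult:
  assumes "wd f z"
  shows "Tz N ka (\<lambda>z. c * f z) z = c * Tz N ka f z" "Tb N ka (\<lambda>z. c * f z) z = c * Tb N ka f z"
  using wirt_dz[OF wirt_cmult[OF wd_wirt[OF assms]]]
  by (simp_all add: Tz_def Tb_def dq_cmult algebra_simps sum_distrib_left)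

lemma T_cnj:
  assumes "wd f z"
  shows "Tz N ka (\<lambda>z. cnj (f z)) z = cnj (Tb N ka f z)" "Tb N ka (\<lambda>z. cnj (f z)) z = cnj (Tz N ka f z)"
proof -
  note w = wirt_dz[OF wirt_cnj[OF wd_wirt[OF assms]]]
  show "Tz N ka (\<lambda>z. cnj (f z)) z = cnj (Tb N ka f z)"
    by (simp add: Tz_def Tb_def dq_cnj w sum_negf mult.assoc)
  show "Tb N ka (\<lambda>z. cnj (f z)) z = cnj (Tz N ka f z)"
    by (simp add: Tz_def Tb_def dq_cnj w sum_negf mult.assoc)
qed

lemma T_mult:
  assumes "wd g z" "reg N ka z"
  shows "Tz N ka (\<lambda>z. z * g z) z = z * Tz N ka g z + g z + (\<Sum>j<N. of_real (ka j) * g (eps N j * cnj z))"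
    and "Tb N ka (\<lambda>z. z * g z) z = z * Tb N ka g z - (\<Sum>j<N. of_real (ka j) * eps N j * g (eps N j * cnj z))"
    and "Tb N ka (\<lambda>z. cnj z * g z) z = cnj z * Tb N ka g z + g z + (\<Sum>j<N. of_real (ka j) * g (eps N j * cnj z))"
    and "Tz N ka (\<lambda>z. cnj z * g z) z = cnj z * Tz N ka g z - (\<Sum>j<N. of_real (ka j) * cnj (eps N j) * g (eps N j * cnj z))"
proof -
  have 1: "of_real (ka j) * dq N j (\<lambda>z. z * g z) z = of_real (ka j) * (z * dq N j g z + g (eps N j * cnj z))"
    "of_real (ka j) * dq N j (\<lambda>z. cnj z * g z) z = of_real (ka j) * (cnj z * dq N j g z - cnj (eps N j) * g (eps N j * cnj z))"
    if "j < N" for j using that assms(2) dq_mult_z[of z N j g] dq_mult_cnj[of z N j g] by (cases "ka j = 0"; auto simp: reg_def)+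
  have 2: "of_real (ka j) * eps N j * dq N j (\<lambda>z. z * g z) z = of_real (ka j) * eps N j * (z * dq N j g z + g (eps N j * cnj z))"
    "of_real (ka j) * eps N j * dq N j (\<lambda>z. cnj z * g z) z = of_real (ka j) * (eps N j * cnj z * dq N j g z - g (eps N j * cnj z))"
    if "j < N" for j using 1[OF that] eps_cnj[of N j] by algebra+
  note w = wirt_dz[OF wirt_mult[OF wirt_ident wd_wirt[OF assms(1)]]] wirt_dz[OF wirt_mult[OF wirt_cnj_ident wd_wirt[OF assms(1)]]]
  have S: "(\<Sum>j<N. of_real (ka j) * dq N j (\<lambda>z. z * g z) z) = z * (\<Sum>j<N. of_real (ka j) * dq N j g z) + (\<Sum>j<N. of_real (ka j) * g (eps N j * cnj z))"
    "(\<Sum>j<N. of_real (ka j) * dq N j (\<lambda>z. cnj z * g z) z) = cnj z * (\<Sum>j<N. of_real (ka j) * dq N j g z) - (\<Sum>j<N. of_real (ka j) * cnj (eps N j) * g (eps N j * cnj z))"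
    "(\<Sum>j<N. of_real (ka j) * eps N j * dq N j (\<lambda>z. z * g z) z) = z * (\<Sum>j<N. of_real (ka j) * eps N j * dq N j g z) + (\<Sum>j<N. of_real (ka j) * eps N j * g (eps N j * cnj z))"
    "(\<Sum>j<N. of_real (ka j) * eps N j * dq N j (\<lambda>z. cnj z * g z) z) = cnj z * (\<Sum>j<N. of_real (ka j) * eps N j * dq N j g z) - (\<Sum>j<N. of_real (ka j) * g (eps N j * cnj z))"
    unfolding sum_distrib_left sum.distrib[symmetric] sum_subtractf[symmetric]
    by (intro sum.cong refl, simp only: lessThan_iff 1 2, simp add: algebra_simps)+
  show "Tz N ka (\<lambda>z. z * g z) z = z * Tz N ka g z + g z + (\<Sum>j<N. of_real (ka j) * g (eps N j * cnj z))"
    by (simp add: Tz_def Tb_def w S) (simp add: algebra_simps)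
  show "Tb N ka (\<lambda>z. z * g z) z = z * Tb N ka g z - (\<Sum>j<N. of_real (ka j) * eps N j * g (eps N j * cnj z))"
    by (simp add: Tz_def Tb_def w S) (simp add: algebra_simps)
  show "Tb N ka (\<lambda>z. cnj z * g z) z = cnj z * Tb N ka g z + g z + (\<Sum>j<N. of_real (ka j) * g (eps N j * cnj z))"
    by (simp add: Tz_def Tb_def w S) (simp add: algebra_simps)
  show "Tz N ka (\<lambda>z. cnj z * g z) z = cnj z * Tz N ka g z - (\<Sum>j<N. of_real (ka j) * cnj (eps N j) * g (eps N j * cnj z))"
    by (simp add: Tz_def Tb_def w S) (simp add: algebra_simps)
qed

text \<open>|z|^2 is invariant under all reflections, so the ordinary Leibniz rule holds: the sums
  over reflected points in \<open>T_mult\<close> cancel.\<close>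

lemma T_mult_rho:
  assumes "wd g z" "reg N ka z"
  shows "Tz N ka (\<lambda>z. z * cnj z * g z) z = cnj z * g z + z * cnj z * Tz N ka g z"
        "Tb N ka (\<lambda>z. z * cnj z * g z) z = z * g z + z * cnj z * Tb N ka g z"
  using T_mult(1,2)[of "\<lambda>z. cnj z * g z" z N ka] T_mult(3,4)[OF assms] assms
  by (simp_all add: mult.assoc) (simp_all add: cnj_eps algebra_simps sum_distrib_left)

lemma T_const: "Tz N ka (\<lambda>_. c) z = 0" "Tb N ka (\<lambda>_. c) z = 0"
  using wirt_dz[OF wirt_const] by (simp_all add: Tz_def Tb_def dq_def)

lemma T_sum:
  assumes "\<And>i. i \<in> A \<Longrightarrow> wd (f i) z" "finite A"
  shows "Tz N ka (\<lambda>z. \<Sum>i\<in>A. f i z) z = (\<Sum>i\<in>A. Tz N ka (f i) z)"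
        "Tb N ka (\<lambda>z. \<Sum>i\<in>A. f i z) z = (\<Sum>i\<in>A. Tb N ka (f i) z)"
        "wd (\<lambda>z. \<Sum>i\<in>A. f i z) z"
  using assms(2,1) by (induction A rule: finite_induct) (simp_all add: T_const T_add)

section \<open>Homogeneous polynomials\<close>

text \<open>The second argument is a parameter on which the coefficients depend continuously. This
  allows integration over the parameter underneath the Dunkl operators, see
  \<open>LL_hpp\<close>.\<close>

definition hpp :: "nat \<Rightarrow> (complex \<Rightarrow> complex \<Rightarrow> complex) \<Rightarrow> bool" where
  "hpp n G \<longleftrightarrow> (\<exists>c. (\<forall>i. continuous_on UNIV (c i)) \<and>
     (\<forall>z x. G z x = (\<Sum>i\<le>n. c i x * (z ^ (n - i) * cnj z ^ i))))"

definition hp :: "nat \<Rightarrow> (complex \<Rightarrow> complex) \<Rightarrow> bool" where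
  "hp n f \<longleftrightarrow> hpp n (\<lambda>z _. f z)"

lemma hpp_mono:
  assumes "continuous_on UNIV c" "i \<le> n"
  shows "hpp n (\<lambda>z x. c x * (z ^ (n - i) * cnj z ^ i))"
  unfolding hpp_def
proof (intro exI[of _ "\<lambda>j x. if j = i then c x else 0"] conjI allI)
  show "continuous_on UNIV (\<lambda>x. if j = i then c x else 0)" for j
    using assms(1) by (cases "j = i") auto
  show "c x * (z ^ (n - i) * cnj z ^ i) = (\<Sum>j\<le>n. (if j = i then c x else 0) * (z ^ (n - j) * cnj z ^ j))" for z x
  proof -
    have "(\<Sum>j\<le>n. (if j = i then c x else 0) * (z ^ (n - j) * cnj z ^ j)) = (\<Sum>j\<le>n. if j = i then c x * (z ^ (n - j) * cnj z ^ j) else 0)"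
      by (intro sum.cong) auto
    then show ?thesis using assms(2) by simp
  qed
qed

lemma hpp_add:
  assumes "hpp n F" "hpp n G" shows "hpp n (\<lambda>z x. F z x + G z x)"
proof -
  obtain c where c: "\<And>i. continuous_on UNIV (c i)" "\<And>z x. F z x = (\<Sum>i\<le>n. c i x * (z ^ (n - i) * cnj z ^ i))"
    using assms(1) by (auto simp: hpp_def)
  obtain d where d: "\<And>i. continuous_on UNIV (d i)" "\<And>z x. G z x = (\<Sum>i\<le>n. d i x * (z ^ (n - i) * cnj z ^ i))"
    using assms(2) by (auto simp: hpp_def)
  show ?thesis unfolding hpp_def c(2) d(2)
    by (intro exI[of _ "\<lambda>i x. c i x + d i x"] conjI allI continuous_on_add c(1) d(1)) (simp add: sum.distrib distrib_right)
qed

lemma hpp_0: "hpp n (\<lambda>z x. 0)"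
  unfolding hpp_def by (intro exI[of _ "\<lambda>i x. 0"]) auto

lemma hpp_sum: "(\<And>i. i \<in> A \<Longrightarrow> hpp n (F i)) \<Longrightarrow> hpp n (\<lambda>z x. \<Sum>i\<in>A. F i z x)"
  by (induction A rule: infinite_finite_induct) (auto intro: hpp_0 hpp_add)

lemma hpp_mult:
  assumes "hpp n F" "hpp m G" shows "hpp (n + m) (\<lambda>z x. F z x * G z x)"
proof -
  obtain c where c: "\<And>i. continuous_on UNIV (c i)" "\<And>z x. F z x = (\<Sum>i\<le>n. c i x * (z ^ (n - i) * cnj z ^ i))"
    using assms(1) by (auto simp: hpp_def)
  obtain d where d: "\<And>i. continuous_on UNIV (d i)" "\<And>z x. G z x = (\<Sum>i\<le>m. d i x * (z ^ (m - i) * cnj z ^ i))"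
    using assms(2) by (auto simp: hpp_def)
  have "hpp (n + m) (\<lambda>z x. \<Sum>i\<le>n. \<Sum>j\<le>m. (c i x * d j x) * (z ^ (n + m - (i + j)) * cnj z ^ (i + j)))"
    by (intro hpp_sum hpp_mono continuous_intros c d) auto
  also have "(\<lambda>z x. \<Sum>i\<le>n. \<Sum>j\<le>m. (c i x * d j x) * (z ^ (n + m - (i + j)) * cnj z ^ (i + j))) = (\<lambda>z x. F z x * G z x)"
  proof (intro ext)
    fix z x
    have "(c i x * d j x) * (z ^ (n + m - (i + j)) * cnj z ^ (i + j)) = 
      (c i x * (z ^ (n - i) * cnj z ^ i)) * (d j x * (z ^ (m - j) * cnj z ^ j))" if "i \<le> n" "j \<le> m" for i j
    proof -
      have "n + m - (i + j) = (n - i) + (m - j)" using that by simp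
      then show ?thesis by (simp only: power_add mult_ac)
    qed
    then show "(\<Sum>i\<le>n. \<Sum>j\<le>m. (c i x * d j x) * (z ^ (n + m - (i + j)) * cnj z ^ (i + j))) = F z x * G z x"
      unfolding c(2) d(2) sum_product by (intro sum.cong refl) auto
  qed
  finally show ?thesis .
qed

lemma hpp_coeff: "continuous_on UNIV c \<Longrightarrow> hpp 0 (\<lambda>z x. c x)"
  using hpp_mono[of c 0 0] by simp

lemma hpp_ident: "hpp (Suc 0) (\<lambda>z x. z)" "hpp (Suc 0) (\<lambda>z x. cnj z)"
  using hpp_mono[of "\<lambda>_. 1" 0 "Suc 0"] hpp_mono[of "\<lambda>_. 1" "Suc 0" "Suc 0"] by simp_all

lemma hpp_scale: "continuous_on UNIV c \<Longrightarrow> hpp n F \<Longrightarrow> hpp n (\<lambda>z x. c x * F z x)"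
  using hpp_mult[OF hpp_coeff, of c n F] by simp

lemma hpp_power: "hpp n F \<Longrightarrow> hpp (k * n) (\<lambda>z x. F z x ^ k)"
  by (induction k) (use hpp_mult hpp_coeff[of "\<lambda>_. 1"] in \<open>auto simp: continuous_on_const\<close>)

lemma hpp_compose_power:
  assumes "hpp n F" "continuous_on UNIV g" shows "hpp (k * n) (\<lambda>z x. F (z ^ k) (g x))"
proof -
  obtain c where c: "\<And>i. continuous_on UNIV (c i)" "\<And>z x. F z x = (\<Sum>i\<le>n. c i x * (z ^ (n - i) * cnj z ^ i))"
    using assms(1) by (auto simp: hpp_def)
  have "hpp (k * n) (\<lambda>z x. \<Sum>i\<le>n. c i (g x) * (z ^ (k * n - k * i) * cnj z ^ (k * i)))"
    by (intro hpp_sum hpp_mono continuous_on_compose2[OF c(1) assms(2)]) auto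
  also have "(\<lambda>z x. \<Sum>i\<le>n. c i (g x) * (z ^ (k * n - k * i) * cnj z ^ (k * i))) = (\<lambda>z x. F (z ^ k) (g x))"
    by (auto simp: fun_eq_iff c(2) power_mult[symmetric] diff_mult_distrib2)
  finally show ?thesis .
qed

lemma hpp_cnj: assumes "hpp n F" shows "hpp n (\<lambda>z x. cnj (F z x))"
proof -
  obtain c where c: "\<And>i. continuous_on UNIV (c i)" "\<And>z x. F z x = (\<Sum>i\<le>n. c i x * (z ^ (n - i) * cnj z ^ i))"
    using assms(1) by (auto simp: hpp_def)
  have "hpp n (\<lambda>z x. \<Sum>i\<le>n. cnj (c i x) * (z ^ (n - (n - i)) * cnj z ^ (n - i)))"
    by (intro hpp_sum hpp_mono continuous_intros c) auto
  also have "(\<lambda>z x. \<Sum>i\<le>n. cnj (c i x) * (z ^ (n - (n - i)) * cnj z ^ (n - i))) = (\<lambda>z x. cnj (F z x))"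
    by (auto simp: fun_eq_iff c(2) mult_ac intro!: sum.cong)
  finally show ?thesis .
qed

lemma hpp_hp: assumes "hpp n F" shows "hp n (\<lambda>z. F z x)"
proof -
  obtain c where c: "\<And>i. continuous_on UNIV (c i)" "\<And>z x. F z x = (\<Sum>i\<le>n. c i x * (z ^ (n - i) * cnj z ^ i))"
    using assms(1) by (auto simp: hpp_def)
  show ?thesis unfolding hp_def hpp_def
    by (intro exI[of _ "\<lambda>i _. c i x"]) (auto simp: c(2))
qed

lemma hp_iff: "hp n f \<longleftrightarrow> (\<exists>c. \<forall>z. f z = (\<Sum>i\<le>n. c i * (z ^ (n - i) * cnj z ^ i)))"
proof
  assume "hp n f"
  then obtain c :: "nat \<Rightarrow> complex \<Rightarrow> complex" where "\<And>z x. f z = (\<Sum>i\<le>n. c i x * (z ^ (n - i) * cnj z ^ i))"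
    by (auto simp: hp_def hpp_def)
  from this[of _ "0::complex"] show "\<exists>c. \<forall>z. f z = (\<Sum>i\<le>n. c i * (z ^ (n - i) * cnj z ^ i))"
    by (intro exI[of _ "\<lambda>i. c i 0"]) simp
next
  assume "\<exists>c. \<forall>z. f z = (\<Sum>i\<le>n. c i * (z ^ (n - i) * cnj z ^ i))"
  then obtain c where "\<And>z. f z = (\<Sum>i\<le>n. c i * (z ^ (n - i) * cnj z ^ i))" by blast
  then show "hp n f" unfolding hp_def hpp_def
    by (intro exI[of _ "\<lambda>i _. c i"]) simp
qed

lemma hp_coeffs:
  assumes "hp n f" obtains c where "\<And>z. f z = (\<Sum>i\<le>n. c i * (z ^ (n - i) * cnj z ^ i))"
  using assms unfolding hp_iff by blast

lemma hp_add: "hp n f \<Longrightarrow> hp n g \<Longrightarrow> hp n (\<lambda>z. f z + g z)"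
  unfolding hp_def by (rule hpp_add)
lemma hp_0: "hp n (\<lambda>z. 0)" unfolding hp_def by (rule hpp_0)
lemma hp_sum: "(\<And>i. i \<in> A \<Longrightarrow> hp n (f i)) \<Longrightarrow> hp n (\<lambda>z. \<Sum>i\<in>A. f i z)"
  unfolding hp_def by (rule hpp_sum)
lemma hp_mult: "hp n f \<Longrightarrow> hp m g \<Longrightarrow> hp (n + m) (\<lambda>z. f z * g z)"
  unfolding hp_def by (rule hpp_mult)
lemma hp_ident: "hp (Suc 0) (\<lambda>z. z)" "hp (Suc 0) (\<lambda>z. cnj z)"
  unfolding hp_def by (rule hpp_ident)+
lemma hp_cmult: "hp n f \<Longrightarrow> hp n (\<lambda>z. c * f z)"
  unfolding hp_def by (intro hpp_scale continuous_intros)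
lemma hp_diff: "hp n f \<Longrightarrow> hp n g \<Longrightarrow> hp n (\<lambda>z. f z - g z)"
  using hp_add[of n f "\<lambda>z. -1 * g z"] hp_cmult[of n g "-1"] by simp
lemma hp_power: "hp n f \<Longrightarrow> hp (k * n) (\<lambda>z. f z ^ k)"
  unfolding hp_def by (rule hpp_power)
lemma hp_mult_z: "hp n f \<Longrightarrow> hp (Suc n) (\<lambda>z. z * f z)" "hp n f \<Longrightarrow> hp (Suc n) (\<lambda>z. cnj z * f z)"
  using hp_mult[OF hp_ident(1)] hp_mult[OF hp_ident(2)] by simp_all
lemma hp_mult_rho: "hp n f \<Longrightarrow> hp (Suc (Suc n)) (\<lambda>z. z * cnj z * f z)"
  using hp_mult_z(1)[OF hp_mult_z(2)] by (simp add: mult.assoc)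

lemma hp_mono: "a + b = n \<Longrightarrow> hp n (\<lambda>z. z ^ a * cnj z ^ b)"
  using hp_mult[OF hp_power[OF hp_ident(1), of a] hp_power[OF hp_ident(2), of b]] by simp

lemma hp_refl:
  assumes "hp n f" shows "hp n (\<lambda>z. f (e * cnj z))"
proof -
  obtain c where c: "\<And>z. f z = (\<Sum>i\<le>n. c i * (z ^ (n - i) * cnj z ^ i))"
    using assms by (auto simp: hp_iff)
  have "f (e * cnj z) = (\<Sum>i\<le>n. (c i * e ^ (n - i) * cnj e ^ i) * (z ^ i * cnj z ^ (n - i)))" for z
    unfolding c by (intro sum.cong) (auto simp: power_mult_distrib)
  then show ?thesis by (simp only:) (intro hp_sum hp_cmult hp_mono, auto)
qed

lemma hp_induct [consumes 1, case_names mono add cmult]: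
  assumes "hp n f"
  assumes mono: "\<And>a b. a + b = n \<Longrightarrow> P (\<lambda>z. z ^ a * cnj z ^ b)"
  assumes add: "\<And>f g. hp n f \<Longrightarrow> hp n g \<Longrightarrow> P f \<Longrightarrow> P g \<Longrightarrow> P (\<lambda>z. f z + g z)"
  assumes cmult: "\<And>f c. hp n f \<Longrightarrow> P f \<Longrightarrow> P (\<lambda>z. c * f z)"
  shows "P f"
proof -
  obtain c where c: "\<And>z. f z = (\<Sum>i\<le>n. c i * (z ^ (n - i) * cnj z ^ i))"
    using assms by (auto simp: hp_iff)
  have m: "P (\<lambda>z. c i * (z ^ (n - i) * cnj z ^ i))" "hp n (\<lambda>z. c i * (z ^ (n - i) * cnj z ^ i))" if "i \<le> n" for i
    using that by (intro cmult mono hp_mono hp_cmult; simp)+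
  have "P (\<lambda>z. \<Sum>i\<le>l. c i * (z ^ (n - i) * cnj z ^ i))" if "l \<le> n" for l
    using that
  proof (induction l)
    case (Suc l)
    then show ?case
      unfolding sum.atMost_Suc by (intro add hp_sum m) auto
  qed (use m(1)[of 0] in simp)
  from this[of n] have "P (\<lambda>z. \<Sum>i\<le>n. c i * (z ^ (n - i) * cnj z ^ i))" by simp
  then show ?thesis unfolding c[symmetric] .
qed

lemma wirt_mono: "wirt (\<lambda>z. z ^ a * cnj z ^ b) (of_nat a * (z ^ (a - 1) * cnj z ^ b)) (of_nat b * (z ^ a * cnj z ^ (b - 1))) z"
  using wirt_mult[OF wirt_power[of a] wirt_cnj[OF wirt_power[of b]], of z] by (simp add: algebra_simps)

lemma hp_wirt:
  assumes "hp n f"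
  shows "\<exists>g h. hp (n - 1) g \<and> hp (n - 1) h \<and> (\<forall>z. wirt f (g z) (h z) z)"
  using assms
proof (induction rule: hp_induct)
  case (mono a b)
  have "hp (n - 1) (\<lambda>z. of_nat a * (z ^ (a - 1) * cnj z ^ b))"
    using mono hp_0 by (cases "a = 0") (auto intro!: hp_cmult hp_mono)
  moreover have "hp (n - 1) (\<lambda>z. of_nat b * (z ^ a * cnj z ^ (b - 1)))"
    using mono hp_0 by (cases "b = 0") (auto intro!: hp_cmult hp_mono)
  ultimately show ?case using wirt_mono by blast
next
  case (add f g)
  then obtain a b c d where "hp (n - 1) a" "hp (n - 1) b" "hp (n - 1) c" "hp (n - 1) d"
    "\<forall>z. wirt f (a z) (b z) z" "\<forall>z. wirt g (c z) (d z) z" by blast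
  then show ?case by (intro exI[of _ "\<lambda>z. a z + c z"] exI[of _ "\<lambda>z. b z + d z"]) (simp add: hp_add wirt_add)
next
  case (cmult f c)
  then obtain a b where "hp (n - 1) a" "hp (n - 1) b" "\<forall>z. wirt f (a z) (b z) z" by blast
  then show ?case by (intro exI[of _ "\<lambda>z. c * a z"] exI[of _ "\<lambda>z. c * b z"]) (simp add: hp_cmult wirt_cmult)
qed

lemma hp_wd [simp]: "hp n f \<Longrightarrow> wd f z"
  using hp_wirt wd_def by metis

text \<open>Induction on the exponents by means of \<open>dq_mult_z\<close> and
  \<open>dq_mult_cnj\<close>. The polynomial describes \<open>dq\<close> off the line only, as
  \<open>dq\<close> is 0 on it.\<close>

lemma hp_dq:
  assumes "hp n f"
  shows "\<exists>g. hp (n - 1) g \<and> (\<forall>z. z \<noteq> eps N j * cnj z \<longrightarrow> dq N j f z = g z)"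
  using assms
proof (induction rule: hp_induct)
  case (mono a b)
  have "\<exists>g. hp (a + b - 1) g \<and> (\<forall>z. z \<noteq> eps N j * cnj z \<longrightarrow> dq N j (\<lambda>z. z ^ a * cnj z ^ b) z = g z)"
  proof (induction a)
    case 0
    show ?case
    proof (induction b)
      case 0
      show ?case by (intro exI[of _ "\<lambda>z. 0"]) (auto simp: hp_0 dq_def)
    next
      case (Suc b)
      then obtain g where g: "hp (b - 1) g" "\<And>z. z \<noteq> eps N j * cnj z \<Longrightarrow> dq N j (\<lambda>z. cnj z ^ b) z = g z" by auto
      \<comment> \<open>For b = 0 the truncated degree b - 1 is again 0, and multiplication by cnj z
        would give degree 1 instead of 0. In this case \<open>dq\<close> vanishes, so the zero
        function serves.\<close>
      have "\<exists>g'. hp b g' \<and> (\<forall>z. z \<noteq> eps N j * cnj z \<longrightarrow> cnj z * g z = g' z)"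
      proof (cases "b = 0")
        case True
        then have "g z = 0" if "z \<noteq> eps N j * cnj z" for z using g(2)[OF that] by (simp add: dq_def)
        then show ?thesis by (intro exI[of _ "\<lambda>z. 0"]) (auto simp: hp_0)
      next
        case False
        then show ?thesis using hp_mult_z(2)[OF g(1)] by auto
      qed
      then obtain g' where g': "hp b g'" "\<And>z. z \<noteq> eps N j * cnj z \<Longrightarrow> cnj z * g z = g' z" by blast
      let ?r = "\<lambda>z. cnj (eps N j) * cnj (eps N j * cnj z) ^ b"
      have "hp b ?r"
        using hp_refl[OF hp_mono[of 0 b b], of "eps N j"] by (intro hp_cmult) simp
      with g'(1) have "hp b (\<lambda>z. g' z - ?r z)" 
        by (rule hp_diff)
      moreover have "dq N j (\<lambda>z. cnj z ^ Suc b) z = g' z - ?r z" if "z \<noteq> eps N j * cnj z" for z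
        using dq_mult_cnj[OF that, of "\<lambda>z. cnj z ^ b"] g(2)[OF that] g'(2)[OF that] by simp
      ultimately show ?case by (intro exI[of _ "\<lambda>z. g' z - ?r z"]) simp
    qed
  next
    case (Suc a)
    then obtain g where g: "hp (a + b - 1) g" "\<And>z. z \<noteq> eps N j * cnj z \<Longrightarrow> dq N j (\<lambda>z. z ^ a * cnj z ^ b) z = g z" by auto
    have "\<exists>g'. hp (a + b) g' \<and> (\<forall>z. z \<noteq> eps N j * cnj z \<longrightarrow> z * g z = g' z)"
    proof (cases "a + b = 0")
      case True
      then have "g z = 0" if "z \<noteq> eps N j * cnj z" for z using g(2)[OF that] by (simp add: dq_def)
      then show ?thesis by (intro exI[of _ "\<lambda>z. 0"]) (auto simp: hp_0)
    next
      case False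
      then show ?thesis using hp_mult_z(1)[OF g(1)] by auto
    qed
    then obtain g' where g': "hp (a + b) g'" "\<And>z. z \<noteq> eps N j * cnj z \<Longrightarrow> z * g z = g' z" by blast
    let ?r = "\<lambda>z. (eps N j * cnj z) ^ a * cnj (eps N j * cnj z) ^ b"
    have "hp (a + b) ?r" using hp_refl[OF hp_mono[of a b "a + b"], of "eps N j"] by simp
    then have "hp (a + b) (\<lambda>z. g' z + ?r z)" by (rule hp_add[OF g'(1)])
    moreover have "dq N j (\<lambda>z. z ^ Suc a * cnj z ^ b) z = g' z + ?r z" if "z \<noteq> eps N j * cnj z" for z
      using dq_mult_z[OF that, of "\<lambda>z. z ^ a * cnj z ^ b"] g(2)[OF that] g'(2)[OF that] by (simp add: mult.assoc)
    ultimately show ?case by (intro exI[of _ "\<lambda>z. g' z + ?r z"]) simp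
  qed
  then show ?case using mono by simp
next
  case (add f g)
  then obtain f' g' where "hp (n - 1) f'" "\<forall>z. z \<noteq> eps N j * cnj z \<longrightarrow> dq N j f z = f' z"
     "hp (n - 1) g'" "\<forall>z. z \<noteq> eps N j * cnj z \<longrightarrow> dq N j g z = g' z" by blast
  then show ?case by (intro exI[of _ "\<lambda>z. f' z + g' z"]) (auto simp: dq_add hp_add)
next
  case (cmult f c)
  then obtain f' where "hp (n - 1) f'" "\<forall>z. z \<noteq> eps N j * cnj z \<longrightarrow> dq N j f z = f' z" by blast
  then show ?case by (intro exI[of _ "\<lambda>z. c * f' z"]) (auto simp: dq_cmult hp_cmult)
qed

lemma hp_T:
  assumes "hp n f"
  shows "\<exists>g h. hp (n - 1) g \<and> hp (n - 1) h \<and> (\<forall>z. reg N ka z \<longrightarrow> Tz N ka f z = g z \<and> Tb N ka f z = h z)"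
proof -
  obtain a b where ab: "hp (n - 1) a" "hp (n - 1) b" "\<And>z. wirt f (a z) (b z) z"
    using hp_wirt[OF assms] by blast
  have "\<forall>j. \<exists>g. hp (n - 1) g \<and> (\<forall>z. z \<noteq> eps N j * cnj z \<longrightarrow> dq N j f z = g z)"
    using hp_dq[OF assms] by blast
  then obtain q where q: "\<And>j. hp (n - 1) (q j)" "\<And>j z. z \<noteq> eps N j * cnj z \<Longrightarrow> dq N j f z = q j z"
    by metis
  have "reg N ka z \<Longrightarrow> Tz N ka f z = a z + (\<Sum>j<N. of_real (ka j) * q j z)" for z
    unfolding Tz_def wirt_dz[OF ab(3)] by (intro arg_cong2[where f = "(+)"] refl sum.cong) (auto simp: reg_def q(2))
  moreover have "reg N ka z \<Longrightarrow> Tb N ka f z = b z - (\<Sum>j<N. of_real (ka j) * eps N j * q j z)" for z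
    unfolding Tb_def wirt_dz[OF ab(3)] by (intro arg_cong2[where f = "(-)"] refl sum.cong) (auto simp: reg_def q(2))
  moreover have "hp (n - 1) (\<lambda>z. a z + (\<Sum>j<N. of_real (ka j) * q j z))" "hp (n - 1) (\<lambda>z. b z - (\<Sum>j<N. of_real (ka j) * eps N j * q j z))"
    by (intro hp_add hp_diff hp_sum hp_cmult ab q)+
  ultimately show ?thesis by blast
qed

text \<open>Euler's identity for homogeneous functions. In z \<open>Tz\<close> + cnj z
  \<open>Tb\<close> each reflection term is multiplied by z - eps cnj z, which cancels its
  denominator.\<close>

lemma euler:
  assumes "hp n f" "reg N ka z"
  shows "z * Tz N ka f z + cnj z * Tb N ka f z =
    (of_nat n + of_real (\<Sum>j<N. ka j)) * f z - (\<Sum>j<N. of_real (ka j) * f (eps N j * cnj z))"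
proof -
  have e: "z * dz f z + cnj z * dzb f z = of_nat n * f z"
    using assms(1)
  proof (induction rule: hp_induct)
    case (mono a b)
    show ?case unfolding wirt_dz[OF wirt_mono] mono[symmetric]
      by (cases a; cases b) (auto simp: algebra_simps)
  next
    case (add f g)
    then show ?case using wirt_dz[OF wirt_add[OF wd_wirt wd_wirt], of f z g] by (simp add: algebra_simps)
  next
    case (cmult f c)
    then show ?case using wirt_dz[OF wirt_cmult[OF wd_wirt], of f z c]
      by (simp add: mult.left_commute[of _ c] flip: distrib_left)
  qed
  have "(of_real (ka j) * (z * dq N j f z) - of_real (ka j) * (cnj z * eps N j * dq N j f z)) = of_real (ka j) * (f z - f (eps N j * cnj z))" if "j < N" for j
  proof (cases "ka j = 0")
    case False
    then have "z - eps N j * cnj z \<noteq> 0" using assms(2) that by (auto simp: reg_def)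
    then have "(z - eps N j * cnj z) * dq N j f z = f z - f (eps N j * cnj z)" by (simp add: dq_def)
    moreover have "of_real (ka j) * (z * dq N j f z) - of_real (ka j) * (cnj z * eps N j * dq N j f z) = of_real (ka j) * ((z - eps N j * cnj z) * dq N j f z)"
      by (simp add: algebra_simps)
    ultimately show ?thesis by simp
  qed simp
  then have "(\<Sum>j<N. of_real (ka j) * (z * dq N j f z) - of_real (ka j) * (cnj z * eps N j * dq N j f z)) = (\<Sum>j<N. of_real (ka j) * (f z - f (eps N j * cnj z)))"
    by (intro sum.cong) auto
  then show ?thesis using e
    by (simp add: Tz_def Tb_def algebra_simps sum.distrib sum_subtractf sum_distrib_left sum_distrib_right)
qed

text \<open>The sum over reflected points in \<open>euler\<close> cancels the one in the product
  rule for z. This relation is what makes the conjugate half of the kernel harmonic in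
  \<open>SS_PP\<close>.\<close>

lemma Tz_mult_of_Tb_0:
  assumes "hp n f" "reg N ka z" "Tb N ka f z = 0"
  shows "Tz N ka (\<lambda>z. z * f z) z = (of_nat n + 1 + of_real (\<Sum>j<N. ka j)) * f z"
  using euler[OF assms(1,2)] T_mult(1)[OF hp_wd[OF assms(1)] assms(2)] assms(3) by (simp add: algebra_simps)

text \<open>With both orders present, T_1^2 + T_2^2 = 2 (\<open>Tz\<close> \<open>Tb\<close> +
  \<open>Tb\<close> \<open>Tz\<close>) is a formal identity that does not presuppose that the
  operators commute.\<close>

definition SS :: "nat \<Rightarrow> (nat \<Rightarrow> real) \<Rightarrow> (complex \<Rightarrow> complex) \<Rightarrow> complex \<Rightarrow> complex" where
  "SS N ka f z = Tz N ka (Tb N ka f) z + Tb N ka (Tz N ka f) z"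

lemma wd_cong: "wd f z \<Longrightarrow> off_lines N z \<Longrightarrow> (\<And>w. off_lines N w \<Longrightarrow> f w = g w) \<Longrightarrow> wd g z"
  unfolding wd_def using wirt_cong[OF _ open_off_lines[of N], of f _ _ z g] by (metis mem_Collect_eq)

lemma hp_Twd:
  assumes "hp n f" "off_lines N z" shows "wd (Tz N ka f) z" "wd (Tb N ka f) z"
proof -
  obtain g h where "hp (n - 1) g" "hp (n - 1) h" "\<And>z. reg N ka z \<Longrightarrow> Tz N ka f z = g z \<and> Tb N ka f z = h z"
    using hp_T[OF assms(1)] by metis
  note g = this
  show "wd (Tz N ka f) z"
    by (rule wd_cong[OF hp_wd[OF g(1)] assms(2)]) (simp add: g(3) off_lines_reg)
  show "wd (Tb N ka f) z"
    by (rule wd_cong[OF hp_wd[OF g(2)] assms(2)]) (simp add: g(3) off_lines_reg)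
qed

lemma T_lin:
  assumes "wd f z" "wd g z"
  shows "Tz N ka (\<lambda>z. a * f z + b * g z) z = a * Tz N ka f z + b * Tz N ka g z"
        "Tb N ka (\<lambda>z. a * f z + b * g z) z = a * Tb N ka f z + b * Tb N ka g z"
  using T_add[OF wd_mult[OF wd_const assms(1)] wd_mult[OF wd_const assms(2)], of N ka a b] T_cmult[OF assms(1)] T_cmult[OF assms(2)]
  by simp_all

lemma dunkl_laplacian_SS:
  assumes f: "hp n f" and z: "off_lines N z"
  shows "dunkl_laplacian N ka f z = 2 * SS N ka f z"
proof -
  note w = hp_Twd[OF f z, of ka]
  let ?A = "Tz N ka f" and ?B = "Tb N ka f"
  have 1: "wd (\<lambda>z. 1 * ?A z + 1 * ?B z) z" and 2: "wd (\<lambda>z. \<i> * ?A z + (- \<i>) * ?B z) z"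
    by (intro wd_add wd_mult wd_const w)+
  have e1: "off_lines N w \<Longrightarrow> 1 * ?A w + 1 * ?B w = dunklT N ka 1 f w" for w by (simp only: dunklT_eq(1) mult_1)
  have e2: "off_lines N w \<Longrightarrow> \<i> * ?A w + (- \<i>) * ?B w = dunklT N ka 2 f w" for w
    by (simp only: dunklT_eq(2)) (simp add: algebra_simps)
  have 3: "dunklT N ka 1 (dunklT N ka 1 f) z = Tz N ka ?A z + Tz N ka ?B z + (Tb N ka ?A z + Tb N ka ?B z)"
  proof -
    have "Tz N ka (\<lambda>z. 1 * ?A z + 1 * ?B z) z = Tz N ka (dunklT N ka 1 f) z"
      "Tb N ka (\<lambda>z. 1 * ?A z + 1 * ?B z) z = Tb N ka (dunklT N ka 1 f) z"
      by (rule T_cong[OF z e1 1], assumption)+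
    then show ?thesis unfolding dunklT_eq(1)[OF z, of ka "dunklT N ka 1 f"] T_lin[OF w] by simp
  qed
  have 4: "dunklT N ka 2 (dunklT N ka 2 f) z = \<i> * (\<i> * Tz N ka ?A z + (-\<i>) * Tz N ka ?B z - (\<i> * Tb N ka ?A z + (-\<i>) * Tb N ka ?B z))"
  proof -
    have "Tz N ka (\<lambda>z. \<i> * ?A z + (- \<i>) * ?B z) z = Tz N ka (dunklT N ka 2 f) z"
      "Tb N ka (\<lambda>z. \<i> * ?A z + (- \<i>) * ?B z) z = Tb N ka (dunklT N ka 2 f) z"
      by (rule T_cong[OF z e2 2], assumption)+
    then show ?thesis unfolding dunklT_eq(2)[OF z, of ka "dunklT N ka 2 f"] T_lin[OF w] by simp
  qed
  show ?thesis unfolding dunkl_laplacian_def SS_def 3 4 by (simp add: algebra_simps)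
qed

lemma SS_poly:
  assumes "hp n f"
  shows "\<exists>g. hp (n - 2) g \<and> (\<forall>z. off_lines N z \<longrightarrow> SS N ka f z = g z)"
proof -
  obtain a b where ab: "hp (n - 1) a" "hp (n - 1) b" "\<And>z. reg N ka z \<Longrightarrow> Tz N ka f z = a z \<and> Tb N ka f z = b z"
    using hp_T[OF assms(1)] by metis
  obtain a' where a': "hp (n - 2) a'" "\<And>z. reg N ka z \<Longrightarrow> Tb N ka a z = a' z"
    using hp_T[OF ab(1)] by (metis diff_diff_left one_add_one)
  obtain b' where b': "hp (n - 2) b'" "\<And>z. reg N ka z \<Longrightarrow> Tz N ka b z = b' z"
    using hp_T[OF ab(2)] by (metis diff_diff_left one_add_one)
  have "SS N ka f z = b' z + a' z" if z: "off_lines N z" for z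
    unfolding SS_def
    using T_cong(2)[OF z _ hp_Twd(1)[OF assms z], where g = a and ka = ka] T_cong(1)[OF z _ hp_Twd(2)[OF assms z], where g = b and ka = ka] z
    by (simp add: off_lines_reg ab a' b')
  then show ?thesis using hp_add[OF b'(1) a'(1)] by blast
qed

text \<open>The sl_2 relation between the Laplacian and multiplication by |z|^2. The product rules
  for z and cnj z leave sums over reflected points, which \<open>euler\<close> eliminates.\<close>

lemma SS_rho:
  assumes g: "hp n g" and z: "off_lines N z"
  shows "SS N ka (\<lambda>z. z * cnj z * g z) z = z * cnj z * SS N ka g z + 2 * (of_nat n + of_real (\<Sum>j<N. ka j) + 1) * g z"
proof -
  obtain a b where ab: "hp (n - 1) a" "hp (n - 1) b" "\<And>z. reg N ka z \<Longrightarrow> Tz N ka g z = a z \<and> Tb N ka g z = b z"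
    using hp_T[OF g] by metis
  note r = off_lines_reg[OF z]
  have h: "hp (Suc (Suc n)) (\<lambda>z. z * cnj z * g z)" by (rule hp_mult_rho[OF g])
  have A: "Tz N ka (\<lambda>z. z * cnj z * g z) w = cnj w * g w + w * cnj w * a w"
    and B: "Tb N ka (\<lambda>z. z * cnj z * g z) w = w * g w + w * cnj w * b w" if "off_lines N w" for w
    using T_mult_rho[OF hp_wd[OF g] off_lines_reg[OF that]] ab(3)[OF off_lines_reg[OF that]] by simp_all
  have "Tz N ka (Tb N ka (\<lambda>z. z * cnj z * g z)) z = Tz N ka (\<lambda>w. w * g w + w * cnj w * b w) z"
    by (rule T_cong(1)[OF z B hp_Twd(2)[OF h z]])
  also have "\<dots> = Tz N ka (\<lambda>w. w * g w) z + Tz N ka (\<lambda>w. w * cnj w * b w) z"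
    by (rule T_add) (use g ab in auto)
  also have "\<dots> = z * a z + g z + (\<Sum>j<N. of_real (ka j) * g (eps N j * cnj z)) + (cnj z * b z + z * cnj z * Tz N ka b z)"
    using T_mult(1)[OF hp_wd[OF g] r] T_mult_rho(1)[OF hp_wd[OF ab(2)] r] ab(3)[OF r] by simp
  finally have 1: "Tz N ka (Tb N ka (\<lambda>z. z * cnj z * g z)) z = \<dots>" .
  have "Tb N ka (Tz N ka (\<lambda>z. z * cnj z * g z)) z = Tb N ka (\<lambda>w. cnj w * g w + w * cnj w * a w) z"
    by (rule T_cong(2)[OF z A hp_Twd(1)[OF h z]])
  also have "\<dots> = Tb N ka (\<lambda>w. cnj w * g w) z + Tb N ka (\<lambda>w. w * cnj w * a w) z"
    by (rule T_add) (use g ab in auto)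
  also have "\<dots> = cnj z * b z + g z + (\<Sum>j<N. of_real (ka j) * g (eps N j * cnj z)) + (z * a z + z * cnj z * Tb N ka a z)"
    using T_mult(3)[OF hp_wd[OF g] r] T_mult_rho(2)[OF hp_wd[OF ab(1)] r] ab(3)[OF r] by simp
  finally have 2: "Tb N ka (Tz N ka (\<lambda>z. z * cnj z * g z)) z = \<dots>" .
  have 3: "SS N ka g z = Tz N ka b z + Tb N ka a z"
    unfolding SS_def
    using T_cong(2)[OF z _ hp_Twd(1)[OF g z], where g = a and ka = ka] T_cong(1)[OF z _ hp_Twd(2)[OF g z], where g = b and ka = ka]
    by (simp add: off_lines_reg ab)
  have "z * a z + cnj z * b z = (of_nat n + of_real (\<Sum>j<N. ka j)) * g z - (\<Sum>j<N. of_real (ka j) * g (eps N j * cnj z))"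
    using euler[OF g r[of ka]] ab(3)[OF r] by simp
  then show ?thesis unfolding SS_def[of N ka "\<lambda>z. z * cnj z * g z"] 1 2 3
    by algebra
qed

lemma SS_rho_power:
  assumes g: "hp n g"
  shows "\<exists>c::real. (i > 0 \<longrightarrow> (\<forall>j<N. ka j \<ge> 0) \<longrightarrow> c > 0) \<and> (\<forall>z. off_lines N z \<longrightarrow>
    SS N ka (\<lambda>z. (z * cnj z) ^ i * g z) z = (z * cnj z) ^ i * SS N ka g z + of_real c * (z * cnj z) ^ (i - 1) * g z)"
proof (induction i)
  case 0
  show ?case by (intro exI[of _ 0]) auto
next
  case (Suc i)
  then obtain c where c: "i > 0 \<Longrightarrow> (\<forall>j<N. ka j \<ge> 0) \<Longrightarrow> c > 0" "\<And>z. off_lines N z \<Longrightarrow>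
    SS N ka (\<lambda>z. (z * cnj z) ^ i * g z) z = (z * cnj z) ^ i * SS N ka g z + of_real c * (z * cnj z) ^ (i - 1) * g z"
    by blast
  have h: "hp (i * Suc (Suc 0) + n) (\<lambda>z. (z * cnj z) ^ i * g z)"
    by (rule hp_mult[OF hp_power g]) (use hp_mono[of 1 1 "Suc (Suc 0)"] in simp)
  \<comment> \<open>For i = 0 the induction hypothesis yields c * g = 0 off the lines but no sign of
    c, so 0 is taken in its place.\<close>
  define c' where "c' = (if i = 0 then 0 else c) + 2 * (real (i * 2 + n) + (\<Sum>j<N. ka j) + 1)"
  have "SS N ka (\<lambda>z. (z * cnj z) ^ Suc i * g z) z = (z * cnj z) ^ Suc i * SS N ka g z + of_real c' * (z * cnj z) ^ (Suc i - 1) * g z"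
    if z: "off_lines N z" for z
  proof -
    have "SS N ka (\<lambda>z. (z * cnj z) ^ Suc i * g z) z = z * cnj z * ((z * cnj z) ^ i * SS N ka g z + of_real c * (z * cnj z) ^ (i - 1) * g z)
      + 2 * (of_nat (i * Suc (Suc 0) + n) + of_real (\<Sum>j<N. ka j) + 1) * ((z * cnj z) ^ i * g z)"
      using SS_rho[OF h z, of ka] unfolding c(2)[OF z] by (simp add: mult.assoc)
    also have "\<dots> = (z * cnj z) ^ Suc i * SS N ka g z + of_real c' * (z * cnj z) ^ (Suc i - 1) * g z"
    proof (cases i)
      case 0
      with c(2)[OF z] show ?thesis by (simp add: c'_def algebra_simps c(2)[OF z])
    next
      case (Suc l)
      then show ?thesis by (simp add: c'_def algebra_simps)
    qed
    finally show ?thesis .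
  qed
  moreover have "c' > 0" if "\<forall>j<N. ka j \<ge> 0"
    using c(1) that sum_nonneg[of "{..<N}" ka] by (cases "i = 0") (auto simp: c'_def intro!: add_pos_pos add_nonneg_pos)
  ultimately show ?case by blast
qed

lemma hp_continuous: "hp n f \<Longrightarrow> continuous_on A f"
  by (erule hp_coeffs) (auto intro!: continuous_intros)

lemma hp_homogeneous:
  assumes "hp n f" shows "f (of_real t * z) = of_real t ^ n * f z"
proof -
  obtain c where c: "\<And>z. f z = (\<Sum>i\<le>n. c i * (z ^ (n - i) * cnj z ^ i))" using hp_coeffs[OF assms] by blast
  have "t ^ (n - i) * t ^ i = t ^ n" if "i \<le> n" for i using that by (simp flip: power_add)
  then have "c i * ((of_real t * z) ^ (n - i) * cnj (of_real t * z) ^ i) = of_real t ^ n * (c i * (z ^ (n - i) * cnj z ^ i))" if "i \<le> n" for i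
    using that by (simp add: power_mult_distrib mult_ac flip: of_real_power of_real_mult)
  then show ?thesis unfolding c sum_distrib_left by (intro sum.cong) auto
qed

text \<open>The set of disagreement is open and contained in finitely many lines, hence negligible,
  hence empty.\<close>

lemma off_lines_dense:
  assumes "continuous_on UNIV f" "continuous_on UNIV g" "\<And>z. off_lines N z \<Longrightarrow> f z = g z"
  shows "f z = (g z :: complex)"
proof -
  have op: "open {z. f z \<noteq> g z}" by (intro open_Collect_neq assms)
  have "inner2 a z = a \<bullet> z" for a z by (simp add: inner2_def inner_complex_def)
  then have "off_lines N z \<longleftrightarrow> (\<forall>j<N. rt N j \<bullet> z \<noteq> 0)" for z
    by (simp add: off_lines_def)
  with assms(3) have "{z. f z \<noteq> g z} \<subseteq> (\<Union>j<N. {z. rt N j \<bullet> z = 0})"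
    by blast
  moreover have "negligible (\<Union>j<N. {z. rt N j \<bullet> z = 0})"
    by (rule negligible_Union) (auto intro!: negligible_hyperplane simp: rt_eq)
  ultimately have "negligible {z. f z \<noteq> g z}" by (rule negligible_subset[rotated])
  then have "{z. f z \<noteq> g z} = {}" using op open_not_negligible by blast
  then show ?thesis by blast
qed

lemma off_lines_nz: "N > 0 \<Longrightarrow> off_lines N z \<Longrightarrow> z \<noteq> 0"
  by (auto simp: off_lines_iff)

lemma SS_cmult:
  assumes "hp n f" "off_lines N z"
  shows "SS N ka (\<lambda>z. c * f z) z = c * SS N ka f z"
proof -
  have "Tz N ka (Tb N ka (\<lambda>z. c * f z)) z = Tz N ka (\<lambda>z. c * Tb N ka f z) z"
    "Tb N ka (Tz N ka (\<lambda>z. c * f z)) z = Tb N ka (\<lambda>z. c * Tz N ka f z) z"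
    by (intro T_cong[OF assms(2)] hp_Twd[OF hp_cmult[OF assms(1)] assms(2)] T_cmult[OF hp_wd[OF assms(1)]])+
  then show ?thesis using hp_Twd[OF assms] by (simp add: SS_def T_cmult distrib_left)
qed

lemma SS_add:
  assumes "hp n f" "hp n g" "off_lines N z"
  shows "SS N ka (\<lambda>z. f z + g z) z = SS N ka f z + SS N ka g z"
proof -
  have "Tz N ka (Tb N ka (\<lambda>z. f z + g z)) z = Tz N ka (\<lambda>z. Tb N ka f z + Tb N ka g z) z"
    "Tb N ka (Tz N ka (\<lambda>z. f z + g z)) z = Tb N ka (\<lambda>z. Tz N ka f z + Tz N ka g z) z"
    by (intro T_cong[OF assms(3)] hp_Twd[OF hp_add[OF assms(1,2)] assms(3)] T_add[OF hp_wd[OF assms(1)] hp_wd[OF assms(2)]])+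
  then show ?thesis using hp_Twd[OF assms(1,3)] hp_Twd[OF assms(2,3)] by (simp add: SS_def T_add)
qed

lemma SS_sum:
  assumes "finite A" "\<And>i. i \<in> A \<Longrightarrow> hp n (f i)" "off_lines N z"
  shows "SS N ka (\<lambda>z. \<Sum>i\<in>A. f i z) z = (\<Sum>i\<in>A. SS N ka (f i) z)"
  using assms(1,2)
proof (induction A rule: finite_induct)
  case empty
  have "Tz N ka (\<lambda>z. 0) = (\<lambda>z. 0)" "Tb N ka (\<lambda>z. 0) = (\<lambda>z. 0)" by (simp_all add: T_const fun_eq_iff)
  then show ?case by (simp add: SS_def)
next
  case (insert x F)
  then show ?case using SS_add[OF _ hp_sum assms(3), of n "f x" F f] by simp
qed

text \<open>No nonzero multiple of |z|^2 is harmonic. By \<open>SS_rho_power\<close>, after division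
  by |z|^(2(i-1)), c u = -|z|^2 s with s = \<open>SS\<close> u and c > 0. So |z|^(2(i+1)) s is
  harmonic too, and s has degree n - 2; the induction closes because i is arbitrary.\<close>

lemma SS_rho_zero:
  assumes "\<forall>j<N. ka j \<ge> 0" "N > 0" "hp n u" "i > 0"
    and "\<And>z. off_lines N z \<Longrightarrow> SS N ka (\<lambda>z. (z * cnj z) ^ i * u z) z = 0"
  shows "u z = 0"
  using assms(3-)
proof (induction n arbitrary: u i z rule: less_induct)
  case (less n)
  obtain c where c: "c > 0" "\<And>z. off_lines N z \<Longrightarrow> 
     SS N ka (\<lambda>z. (z * cnj z) ^ i * u z) z = (z * cnj z) ^ i * SS N ka u z + of_real c * (z * cnj z) ^ (i - 1) * u z"
    using SS_rho_power[OF less.prems(1), of i N ka] less.prems(2) assms(1) by blast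
  obtain s where s: "hp (n - 2) s" "\<And>z. off_lines N z \<Longrightarrow> SS N ka u z = s z"
    using SS_poly[OF less.prems(1)] by blast
  have "u z = of_real (- 1 / c) * (z * cnj z * s z)" if z: "off_lines N z" for z
  proof -
    have nz: "z * cnj z \<noteq> 0" using off_lines_nz[OF assms(2) z] by simp
    have "(z * cnj z) ^ (i - 1) * (z * cnj z * s z + of_real c * u z) = 0"
      using c(2)[OF z] less.prems(3)[OF z] less.prems(2) s(2)[OF z] by (cases i) (simp_all add: algebra_simps)
    then have "z * cnj z * s z + of_real c * u z = 0" using nz by simp
    then have "of_real c * u z = - (z * cnj z * s z)" by (simp add: eq_neg_iff_add_eq_0 add.commute)
    then show ?thesis using c(1) by (simp add: field_simps)
  qed
  note u_off = this
  have "continuous_on UNIV (\<lambda>z. of_real (- 1 / c) * (z * cnj z * s z))"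
    by (intro continuous_intros hp_continuous[OF s(1)])
  then have u: "u z = of_real (- 1 / c) * (z * cnj z * s z)" for z
    by (rule off_lines_dense[OF hp_continuous[OF less.prems(1)] _ u_off])
  show "u z = 0"
  proof (cases "n < 2")
    \<comment> \<open>The truncated degree n - 2 is 0, so s is constant on rays and u, a multiple of
      |z|^2 s, scales by 4 when z is doubled. Homogeneity of degree n < 2 gives the factor 1 or 2
      instead.\<close>
    case True
    then have s0: "s (of_real 2 * z) = s z" using hp_homogeneous[OF s(1), of 2 z] by simp
    have "u (of_real 2 * z) = 4 * u z" unfolding u s0 by simp
    then have "(4 - of_real 2 ^ n) * u z = 0" using hp_homogeneous[OF less.prems(1), of 2 z] by (simp add: algebra_simps)
    moreover have "n = 0 \<or> n = 1" using True by auto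
    ultimately show ?thesis by auto
  next
    case False
    have h: "hp (Suc i * Suc (Suc 0) + (n - 2)) (\<lambda>z. (z * cnj z) ^ Suc i * s z)"
      by (rule hp_mult[OF hp_power s(1)]) (use hp_mono[of 1 1 "Suc (Suc 0)"] in simp)
    have "SS N ka (\<lambda>z. (z * cnj z) ^ Suc i * s z) z = 0" if z: "off_lines N z" for z
    proof -
      have "(\<lambda>z. (z * cnj z) ^ i * u z) = (\<lambda>z. of_real (- 1 / c) * ((z * cnj z) ^ Suc i * s z))"
        unfolding u by (simp add: fun_eq_iff)
      then have "of_real (- 1 / c) * SS N ka (\<lambda>z. (z * cnj z) ^ Suc i * s z) z = 0"
        using less.prems(3)[OF z] SS_cmult[OF h z, of ka "of_real (- 1 / c)"] by simp
      then show ?thesis using c(1) by simp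
    qed
    then have "s z = 0" using less.IH[OF _ s(1), of "Suc i" z] False by simp
    then show ?thesis using u by simp
  qed
qed

lemma homog_poly_hp: "homog_poly d f \<longleftrightarrow> hp d f"
proof
  assume "homog_poly d f"
  then obtain c where c: "\<And>z. f z = (\<Sum>m\<le>d. c m * complex_of_real (Re z ^ m * Im z ^ (d - m)))"
    by (auto simp: homog_poly_def)
  have re: "hp (Suc 0) (\<lambda>z. complex_of_real (Re z))" "hp (Suc 0) (\<lambda>z. complex_of_real (Im z))"
  proof -
    have "(\<lambda>z. complex_of_real (Re z)) = (\<lambda>z. (1/2) * (z + cnj z))" "(\<lambda>z. complex_of_real (Im z)) = (\<lambda>z. (1 / (2 * \<i>)) * (z - cnj z))"
      by (auto simp: fun_eq_iff complex_eq_iff complex_add_cnj complex_diff_cnj)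
    then show "hp (Suc 0) (\<lambda>z. complex_of_real (Re z))" "hp (Suc 0) (\<lambda>z. complex_of_real (Im z))"
      by (simp_all only: hp_cmult hp_add hp_diff hp_ident)
  qed
  have "hp d (\<lambda>z. complex_of_real (Re z) ^ m * complex_of_real (Im z) ^ (d - m))" if "m \<le> d" for m
    using hp_mult[OF hp_power[OF re(1), of m] hp_power[OF re(2), of "d - m"]] that by simp
  then show "hp d f" unfolding c[abs_def] by (intro hp_sum hp_cmult) simp
next
  have z: "homog_poly (Suc d) (\<lambda>z. (of_real (a * Re z) + \<i> * of_real (b * Im z)) * f z)" if "homog_poly d f" for d f a b
  proof -
    obtain c where c: "\<And>z. f z = (\<Sum>m\<le>d. c m * complex_of_real (Re z ^ m * Im z ^ (d - m)))"
      using \<open>homog_poly d f\<close> by (auto simp: homog_poly_def)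
    show ?thesis unfolding homog_poly_def
    proof (intro exI allI)
      fix z
      let ?t = "\<lambda>m. complex_of_real (Re z ^ m * Im z ^ (Suc d - m))"
      have 1: "of_real (Re z) * f z = (\<Sum>m\<le>Suc d. (if m = 0 then 0 else c (m - 1)) * ?t m)"
        unfolding c sum.atMost_Suc_shift by (simp add: sum_distrib_left mult_ac)
      have 2: "of_real (Im z) * f z = (\<Sum>m\<le>Suc d. (if m \<le> d then c m else 0) * ?t m)"
        unfolding c by (simp add: sum_distrib_left mult_ac Suc_diff_le)
      have "(of_real (a * Re z) + \<i> * of_real (b * Im z)) * f z = of_real a * (of_real (Re z) * f z) + \<i> * of_real b * (of_real (Im z) * f z)"
        by (simp add: algebra_simps)
      also have "\<dots> = (\<Sum>m\<le>Suc d. (of_real a * (if m = 0 then 0 else c (m - 1)) + \<i> * of_real b * (if m \<le> d then c m else 0)) * ?t m)"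
        unfolding 1 2 sum_distrib_left sum.distrib[symmetric] by (intro sum.cong) (auto simp: algebra_simps)
      finally show "(of_real (a * Re z) + \<i> * of_real (b * Im z)) * f z = \<dots>" .
    qed
  qed
  have m: "homog_poly (a + b) (\<lambda>z. z ^ a * cnj z ^ b)" for a b
  proof (induction a)
    case 0
    show ?case
    proof (induction b)
      case 0
      show ?case unfolding homog_poly_def by (intro exI[of _ "\<lambda>_. 1"]) simp
    next
      case (Suc b)
      have "(\<lambda>z. of_real (1 * Re z) + \<i> * of_real (- 1 * Im z)) = cnj" by (auto simp: complex_eq_iff fun_eq_iff)
      then have e: "of_real (1 * Re z) + \<i> * of_real (- 1 * Im z) = cnj z" for z by (rule fun_cong)
      with z[OF Suc, of 1 "-1", unfolded e] show ?case by simp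
    qed
  next
    case (Suc a)
    have "of_real (1 * Re z) + \<i> * of_real (1 * Im z) = z" for z by (auto simp: complex_eq_iff)
    with z[OF Suc, of 1 1] show ?case by (simp only: power_Suc mult.assoc add_Suc)
  qed
  have add: "homog_poly d (\<lambda>z. f z + g z)" if F: "homog_poly d f" "homog_poly d g" for f g
  proof -
    obtain c where "\<And>z. f z = (\<Sum>m\<le>d. c m * complex_of_real (Re z ^ m * Im z ^ (d - m)))"
      using F(1) unfolding homog_poly_def by blast
    moreover obtain c' where "\<And>z. g z = (\<Sum>m\<le>d. c' m * complex_of_real (Re z ^ m * Im z ^ (d - m)))"
      using F(2) unfolding homog_poly_def by blast
    ultimately show ?thesis unfolding homog_poly_def
      by (intro exI[of _ "\<lambda>m. c m + c' m"]) (simp add: sum.distrib distrib_right)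
  qed
  have cm: "homog_poly d (\<lambda>z. x * f z)" if F: "homog_poly d f" for f x
  proof -
    obtain c where "\<And>z. f z = (\<Sum>m\<le>d. c m * complex_of_real (Re z ^ m * Im z ^ (d - m)))"
      using F unfolding homog_poly_def by blast
    then show ?thesis unfolding homog_poly_def
      by (intro exI[of _ "\<lambda>m. x * c m"]) (simp add: sum_distrib_left mult.assoc)
  qed
  assume "hp d f" then show "homog_poly d f"
  proof (induction rule: hp_induct)
    case (mono a b) then show ?case using m[of a b] by simp
  qed (use add cm in auto)
qed

lemma dunkl_harmonic_iff:
  "dunkl_harmonic N ka d f \<longleftrightarrow> hp d f \<and> (\<forall>z. off_lines N z \<longrightarrow> SS N ka f z = 0)"
  unfolding dunkl_harmonic_def homog_poly_hp using dunkl_laplacian_SS[of d f N _ ka] by auto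

section \<open>The functions annihilated by the conjugate operator\<close>

text \<open>Index 0 of I_2 is the reflection z -> cnj z and index 1 is z -> -cnj z. Under z -> z^k
  they become the reflections belonging to al and be.\<close>

definition kap2 :: "real \<Rightarrow> real \<Rightarrow> nat \<Rightarrow> real" where
  "kap2 al be j = (if j = 0 then al else be)"

lemma eps2 [simp]: "eps 2 0 = 1" "eps 2 (Suc 0) = -1"
  by (simp_all add: eps_def)

lemma sum2: "(\<Sum>j<2. f j) = f 0 + f (Suc 0)" for f :: "nat \<Rightarrow> 'a::comm_monoid_add"
  by (simp add: numeral_2_eq_2)

lemma reg2: "reg 2 (kap2 al be) z \<longleftrightarrow> (al \<noteq> 0 \<longrightarrow> Im z \<noteq> 0) \<and> (be \<noteq> 0 \<longrightarrow> Re z \<noteq> 0)"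
proof -
  have "(\<forall>j<2. P j) \<longleftrightarrow> P 0 \<and> P (Suc 0)" for P :: "nat \<Rightarrow> bool"
    by (auto simp: less_2_cases_iff)
  then show ?thesis by (auto simp: reg_def kap2_def complex_eq_iff)
qed

text \<open>Moments of \<open>mu\<close>, see \<open>nu_moment\<close>; for be = 0 they are those of the point mass at 1.\<close>

primrec am :: "real \<Rightarrow> nat \<Rightarrow> real" where
  "am be 0 = 1"
| "am be (Suc j) = am be j * real (Suc j) / (real (Suc j) + (if even j then 2 * be else 0))"

lemma am_Suc:
  assumes "be \<ge> 0"
  shows "(real (Suc j) + (if odd (Suc j) then 2 * be else 0)) * am be (Suc j) = real (Suc j) * am be j"
proof -
  have "real (Suc j) + (if even j then 2 * be else 0) > 0" using assms by (simp add: add_pos_nonneg)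
  then show ?thesis by (simp del: of_nat_Suc)
qed

lemma am_0: "am 0 j = 1"
  by (induction j) (simp_all del: of_nat_Suc)

lemma sum_shift0:
  fixes G H :: "nat \<Rightarrow> 'a::comm_monoid_add"
  assumes "G 0 = 0" "\<And>j. j \<le> q \<Longrightarrow> G (Suc j) = H j"
  shows "sum G {..Suc q} = sum H {..q}"
  unfolding sum.atMost_Suc_shift using assms by simp

lemma sum_last0:
  fixes G H :: "nat \<Rightarrow> 'a::comm_monoid_add"
  assumes "G (Suc q) = 0" "\<And>j. j \<le> q \<Longrightarrow> G j = H j"
  shows "sum G {..Suc q} = sum H {..q}"
  unfolding sum.atMost_Suc using assms by simp

section \<open>Action of the conjugate operator on real monomials\<close>

definition cmon :: "nat \<Rightarrow> nat \<Rightarrow> complex \<Rightarrow> complex" where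
  "cmon j l z = of_real (Re z) ^ j * of_real (Im z) ^ l"

lemma wirt_Re: "wirt (\<lambda>z. of_real (Re z)) (1/2) (1/2) z"
proof -
  have "(\<lambda>z. complex_of_real (Re z)) = (\<lambda>z. (1/2) * z + (1/2) * cnj z)" by (auto simp: fun_eq_iff complex_eq_iff)
  then show ?thesis using wirt_add[OF wirt_cmult[OF wirt_ident] wirt_cmult[OF wirt_cnj_ident], of "1/2" "1/2" z] by simp
qed

lemma wirt_Im: "wirt (\<lambda>z. of_real (Im z)) (- \<i>/2) (\<i>/2) z"
proof -
  have "(\<lambda>z. complex_of_real (Im z)) = (\<lambda>z. (- \<i>/2) * z + (\<i>/2) * cnj z)" by (auto simp: fun_eq_iff complex_eq_iff)
  then show ?thesis using wirt_add[OF wirt_cmult[OF wirt_ident] wirt_cmult[OF wirt_cnj_ident], of "-\<i>/2" "\<i>/2" z] by simp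
qed

lemma wirt_cmon: "wirt (cmon j l)
   (of_nat j * cmon (j - 1) l z / 2 - \<i> * of_nat l * cmon j (l - 1) z / 2)
   (of_nat j * cmon (j - 1) l z / 2 + \<i> * of_nat l * cmon j (l - 1) z / 2) z"
proof -
  have 1: "wirt (\<lambda>z. of_real (Re z) ^ j) (of_nat j * of_real (Re z) ^ (j - 1) / 2) (of_nat j * of_real (Re z) ^ (j - 1) / 2) z"
    using wirt_compose[OF wirt_Re wirt_power[of j]] by simp
  have 2: "wirt (\<lambda>z. of_real (Im z) ^ l) (- \<i> * of_nat l * of_real (Im z) ^ (l - 1) / 2) (\<i> * of_nat l * of_real (Im z) ^ (l - 1) / 2) z"
    using wirt_compose[OF wirt_Im wirt_power[of l]] by (simp add: mult_ac)
  show ?thesis using wirt_mult[OF 1 2] unfolding cmon_def by (simp add: algebra_simps)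
qed

text \<open>A reflection term is nonzero only if the exponent of the reflected coordinate is odd. It
  then lowers this exponent by one, just as the derivative does, and adds twice the multiplicity to
  the factor.\<close>

lemma Tb_cmon:
  assumes "reg 2 (kap2 al be) z"
  shows "Tb 2 (kap2 al be) (cmon j l) z =
    (of_real (real j + (if odd j then 2 * be else 0)) * cmon (j - 1) l z
     + \<i> * of_real (real l + (if odd l then 2 * al else 0)) * cmon j (l - 1) z) / 2"
proof -
  have d1: "z - cnj z = 2 * \<i> * of_real (Im z)" and d2: "z + cnj z = 2 * of_real (Re z)"
    by (simp_all add: complex_eq_iff)
  have 1: "of_real al * dq 2 0 (cmon j l) z = - \<i> * of_real (if odd l then al else 0) * cmon j (l - 1) z"
  proof (cases "al = 0")
    case False
    then have nz: "Im z \<noteq> 0" using assms by (simp add: reg2)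
    show ?thesis
    proof (cases "odd l")
      case True
      then obtain l' where l: "l = Suc l'" "even l'" by (cases l) auto
      then show ?thesis using nz
        by (simp add: dq_def d1 cmon_def field_simps)
    next
      case False
      then show ?thesis by (simp add: dq_def cmon_def)
    qed
  qed simp
  have 2: "of_real be * dq 2 (Suc 0) (cmon j l) z = of_real (if odd j then be else 0) * cmon (j - 1) l z"
  proof (cases "be = 0")
    case False
    then have nz: "Re z \<noteq> 0" using assms by (simp add: reg2)
    show ?thesis
    proof (cases "odd j")
      case True
      then obtain l' where l: "j = Suc l'" "even l'" by (cases j) auto
      then show ?thesis using nz
        by (simp add: dq_def d2 cmon_def field_simps)
    next
      case False
      then show ?thesis by (simp add: dq_def cmon_def)
    qed
  qed simp
  show ?thesis
    unfolding Tb_def sum2 wirt_dz[OF wirt_cmon] using 1 2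
    by (simp add: kap2_def field_simps)
qed

text \<open>The mean of (Im z Im x u + Re z Re x v)^p over u and v.\<close>

definition YY :: "real \<Rightarrow> real \<Rightarrow> nat \<Rightarrow> complex \<Rightarrow> complex \<Rightarrow> complex" where
  "YY al be p z x = (\<Sum>j\<le>p. of_real (real (p choose j) * am be j * am al (p - j)) *
     cmon j (p - j) x * cmon j (p - j) z)"

lemma hpp_Re: "hpp (Suc 0) (\<lambda>z x. complex_of_real (Re z))" "hpp (Suc 0) (\<lambda>z x. complex_of_real (Im z))"
proof -
  have "(\<lambda>z. complex_of_real (Re z)) = (\<lambda>z. (1/2) * z + (1/2) * cnj z)" 
    "(\<lambda>z. complex_of_real (Im z)) = (\<lambda>z. (- \<i>/2) * z + (\<i>/2) * cnj z)" by (auto simp: fun_eq_iff complex_eq_iff)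
  then have e: "(\<lambda>z x::complex. complex_of_real (Re z)) = (\<lambda>z x. (1/2) * z + (1/2) * cnj z)"
    "(\<lambda>z x::complex. complex_of_real (Im z)) = (\<lambda>z x. (- \<i>/2) * z + (\<i>/2) * cnj z)"
    by (auto dest: fun_cong)
  show "hpp (Suc 0) (\<lambda>z x. complex_of_real (Re z))" "hpp (Suc 0) (\<lambda>z x. complex_of_real (Im z))"
    unfolding e by (intro hpp_add hpp_scale continuous_intros hpp_ident)+
qed

lemma hpp_cmon: "hpp (j + l) (\<lambda>z x. cmon j l z)"
  unfolding cmon_def using hpp_mult[OF hpp_power[OF hpp_Re(1), of j] hpp_power[OF hpp_Re(2), of l]] by simp

lemma hpp_YY: "hpp p (YY al be p)"
proof -
  have "hpp p (\<lambda>z x. of_real (real (p choose j) * am be j * am al (p - j)) * cmon j (p - j) x * cmon j (p - j) z)" if "j \<le> p" for j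
    using that by (intro hpp_scale) (use hpp_cmon[of j "p - j"] in \<open>auto simp: cmon_def intro!: continuous_intros\<close>)
  then have "hpp p (\<lambda>z x. YY al be p z x)" unfolding YY_def by (intro hpp_sum) auto
  then show ?thesis by simp
qed

lemma cnj_cmon [simp]: "cnj (cmon j l z) = cmon j l z" by (simp add: cmon_def)

lemma cnj_YY [simp]: "cnj (YY al be p z x) = YY al be p z x" by (simp add: YY_def)

lemma YY_sym: "YY al be p z x = YY al be p x z" by (simp add: YY_def mult_ac)

text \<open>The denominators in \<open>am\<close> are exactly the factors produced by
  \<open>Tb_cmon\<close>. They cancel, and \<open>Tb\<close> acts on \<open>YY\<close> as the
  derivative with respect to cnj z acts on (Re z Re x + Im z Im x)^p.\<close>

lemma Tb_YY:
  assumes "reg 2 (kap2 al be) z" "al \<ge> 0" "be \<ge> 0"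
  shows "Tb 2 (kap2 al be) (\<lambda>z. YY al be p z x) z = of_nat p / 2 * x * YY al be (p - 1) z x"
proof (cases p)
  case 0
  then show ?thesis using Tb_cmon[OF assms(1), of 0 0] by (simp add: YY_def T_const cmon_def)
next
  case (Suc q)
  let ?c = "\<lambda>j. of_real (real (p choose j) * am be j * am al (p - j)) * cmon j (p - j) x"
  have w: "wd (cmon j l) z" for j l using wirt_cmon wd_def by blast
  have "Tb 2 (kap2 al be) (\<lambda>z. YY al be p z x) z = (\<Sum>j\<le>p. ?c j * Tb 2 (kap2 al be) (cmon j (p - j)) z)"
    unfolding YY_def by (subst T_sum(2)) (auto intro!: sum.cong T_cmult wd_mult[OF wd_const w] w)
  also have "\<dots> = (\<Sum>j\<le>p. ?c j * of_real (real j + (if odd j then 2 * be else 0)) * cmon (j - 1) (p - j) z) / 2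
    + \<i> * (\<Sum>j\<le>p. ?c j * of_real (real (p - j) + (if odd (p - j) then 2 * al else 0)) * cmon j (p - j - 1) z) / 2"
    unfolding Tb_cmon[OF assms(1)] sum_distrib_left sum_divide_distrib sum.distrib[symmetric]
    by (intro sum.cong refl) (simp only: ring_distribs add_divide_distrib times_divide_eq_right mult_ac)
  also have "(\<Sum>j\<le>p. ?c j * of_real (real j + (if odd j then 2 * be else 0)) * cmon (j - 1) (p - j) z)
     = of_nat p * of_real (Re x) * YY al be q z x"
  proof -
    have "?c (Suc j) * of_real (real (Suc j) + (if odd (Suc j) then 2 * be else 0)) * cmon j (p - Suc j) z
       = of_nat p * of_real (Re x) * (of_real (real (q choose j) * am be j * am al (q - j)) * cmon j (q - j) x * cmon j (q - j) z)" for j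
    proof -
      have "real (p choose Suc j) * am be (Suc j) * am al (q - j) * (real (Suc j) + (if odd (Suc j) then 2 * be else 0))
         = (real (Suc j) * real (p choose Suc j)) * am be j * am al (q - j)"
        using arg_cong[OF am_Suc[OF assms(3), of j], of "\<lambda>t. real (p choose Suc j) * am al (q - j) * t"] by (simp only: mult_ac)
      also have "real (Suc j) * real (p choose Suc j) = real p * real (q choose j)"
        unfolding Suc of_nat_mult[symmetric] Suc_times_binomial_eq by simp
      finally have e: "real (p choose Suc j) * am be (Suc j) * am al (p - Suc j) * (real (Suc j) + (if odd (Suc j) then 2 * be else 0))
         = real p * (real (q choose j) * am be j * am al (q - j))" using Suc by (simp only: diff_Suc_Suc mult.assoc)
      have "?c (Suc j) * of_real (real (Suc j) + (if odd (Suc j) then 2 * be else 0)) * cmon j (p - Suc j) z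
         = of_real (real (p choose Suc j) * am be (Suc j) * am al (p - Suc j) * (real (Suc j) + (if odd (Suc j) then 2 * be else 0))) * cmon (Suc j) (p - Suc j) x * cmon j (p - Suc j) z"
        by (simp only: of_real_mult mult_ac)
      then show ?thesis unfolding e by (simp add: Suc cmon_def mult_ac)
    qed
    note T = this
    show ?thesis unfolding YY_def sum_distrib_left unfolding Suc
      by (rule sum_shift0) (simp, use T in \<open>simp only: Suc diff_Suc_1\<close>)
  qed
  also have "(\<Sum>j\<le>p. ?c j * of_real (real (p - j) + (if odd (p - j) then 2 * al else 0)) * cmon j (p - j - 1) z)
     = of_nat p * of_real (Im x) * YY al be q z x"
  proof -
    have "?c j * of_real (real (p - j) + (if odd (p - j) then 2 * al else 0)) * cmon j (p - j - 1) z
       = of_nat p * of_real (Im x) * (of_real (real (q choose j) * am be j * am al (q - j)) * cmon j (q - j) x * cmon j (q - j) z)" if "j \<le> q" for j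
    proof -
      have pj: "p - j = Suc (q - j)" using Suc that by simp
      have "real (p choose j) * am be j * am al (Suc (q - j)) * (real (Suc (q - j)) + (if odd (Suc (q - j)) then 2 * al else 0))
         = (real (Suc (q - j)) * real (p choose j)) * am be j * am al (q - j)"
        using arg_cong[OF am_Suc[OF assms(2), of "q - j"], of "\<lambda>t. real (p choose j) * am be j * t"] by (simp only: mult_ac)
      also have "real (Suc (q - j)) * real (p choose j) = real p * real (q choose j)"
        using binomial_absorb_comp[of p j] pj Suc by (simp add: of_nat_mult[symmetric] mult.commute del: of_nat_mult of_nat_Suc)
      finally have e: "real (p choose j) * am be j * am al (p - j) * (real (p - j) + (if odd (p - j) then 2 * al else 0))
         = real p * (real (q choose j) * am be j * am al (q - j))" unfolding pj by (simp only: mult.assoc)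
      have "?c j * of_real (real (p - j) + (if odd (p - j) then 2 * al else 0)) * cmon j (p - j - 1) z
         = of_real (real (p choose j) * am be j * am al (p - j) * (real (p - j) + (if odd (p - j) then 2 * al else 0))) * cmon j (p - j) x * cmon j (p - j - 1) z"
        by (simp only: of_real_mult mult_ac)
      then show ?thesis unfolding e by (simp add: pj cmon_def mult_ac)
    qed
    note T = this
    show ?thesis unfolding YY_def sum_distrib_left unfolding Suc
      by (rule sum_last0) (simp, use T in \<open>simp only: Suc diff_Suc_1\<close>)
  qed
  finally have *: "Tb 2 (kap2 al be) (\<lambda>z. YY al be p z x) z = of_nat p * (of_real (Re x) + \<i> * of_real (Im x)) * YY al be q z x / 2"
    by (simp add: algebra_simps add_divide_distrib)
  have "of_real (Re x) + \<i> * of_real (Im x) = x" by (simp add: complex_eq_iff)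
  then show ?thesis using * Suc by simp
qed

text \<open>Coefficients of the Gegenbauer polynomial of index s and degree m.\<close>

definition cmi :: "real \<Rightarrow> nat \<Rightarrow> nat \<Rightarrow> real" where
  "cmi s m i = (if 2 * i \<le> m then (-1) ^ i * pochhammer s (m - i) * 2 ^ (m - 2 * i) / (fact i * fact (m - 2 * i)) else 0)"

text \<open>Together with \<open>cmi_b\<close> this is the coefficientwise form of Tb V(n+1) = x Tb
  (cnj z V(n)) for unit x, the identity behind \<open>Tb_dd\<close>.\<close>

lemma cmi_a: "cmi s (Suc n) i * real (Suc n - 2 * i) / 2 = (s + real n - real i) * cmi s n i"
proof (cases "2 * i \<le> n")
  case True
  then obtain l where n: "n = 2 * i + l" by (metis le_iff_add)
  have e: "Suc (2 * i + l) - i = Suc (i + l)" "Suc (2 * i + l) - 2 * i = Suc l" "2 * i + l - i = i + l" by simp_all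
  show ?thesis
    unfolding n cmi_def e
    by (simp add: pochhammer_Suc divide_simps del: of_nat_Suc)
next
  case False
  then show ?thesis by (cases "2 * i \<le> Suc n") (auto simp: cmi_def)
qed

lemma cmi_b: "real (Suc i) * cmi s (Suc n) (Suc i) = - real (n - 2 * i) / 2 * cmi s n i"
proof (cases "2 * i < n")
  case True
  then obtain l where n: "n = Suc (2 * i + l)" by (metis less_iff_Suc_add)
  have e: "Suc (Suc (2 * i + l)) - Suc i = Suc (i + l)" "Suc (Suc (2 * i + l)) - 2 * Suc i = l" "Suc (2 * i + l) - i = Suc (i + l)"
    "Suc (2 * i + l) - 2 * i = Suc l" by simp_all
  show ?thesis
    unfolding n cmi_def e by (simp add: divide_simps del: of_nat_Suc)
next
  case False
  then show ?thesis by (auto simp: cmi_def)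
qed

text \<open>Missing degrees are filled up with powers of |z|^2, so the function is homogeneous in z,
  while x is meant to be a unit. Symmetry in z and x accordingly holds for equal moduli.\<close>

definition VV :: "real \<Rightarrow> real \<Rightarrow> nat \<Rightarrow> complex \<Rightarrow> complex \<Rightarrow> complex" where
  "VV al be m z x = (\<Sum>i\<le>m. of_real (cmi (al + be + 1) m i) * ((z * cnj z) ^ i * YY al be (m - 2 * i) z x))"

lemma hpp_rho_power: "hpp (2 * i) (\<lambda>z x. (z * cnj z) ^ i)"
  using hpp_power[OF hpp_mult[OF hpp_ident], of i] by (simp add: mult_2_right mult_2)

lemma hpp_VV: "hpp m (VV al be m)"
proof -
  have "hpp m (\<lambda>z x. of_real (cmi (al + be + 1) m i) * ((z * cnj z) ^ i * YY al be (m - 2 * i) z x))" if "i \<le> m" for i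
  proof (cases "2 * i \<le> m")
    case True
    then have "hpp (2 * i + (m - 2 * i)) (\<lambda>z x. (z * cnj z) ^ i * YY al be (m - 2 * i) z x)"
      by (intro hpp_mult hpp_rho_power hpp_YY)
    then show ?thesis using True by (intro hpp_scale continuous_intros) simp
  next
    case False
    then show ?thesis by (simp add: cmi_def hpp_0)
  qed
  then have "hpp m (\<lambda>z x. VV al be m z x)" unfolding VV_def by (intro hpp_sum) auto
  then show ?thesis by simp
qed

lemma cnj_VV [simp]: "cnj (VV al be m z x) = VV al be m z x"
  by (simp add: VV_def mult.commute)

lemma VV_sym: "z * cnj z = x * cnj x \<Longrightarrow> VV al be m z x = VV al be m x z"
  by (simp add: VV_def YY_sym[of al be _ z x])

lemma VV_0 [simp]: "VV al be 0 z x = 1"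
  by (simp add: VV_def YY_def cmi_def cmon_def)

lemma Tb_rho_power:
  assumes "wd g z" "reg N ka z"
  shows "Tb N ka (\<lambda>z. (z * cnj z) ^ i * g z) z = of_nat i * z * (z * cnj z) ^ (i - 1) * g z + (z * cnj z) ^ i * Tb N ka g z"
proof (induction i)
  case (Suc i)
  have w: "wd (\<lambda>z. (z * cnj z) ^ i * g z) z"
    unfolding power_mult_distrib complex_cnj_power[symmetric] by (intro wd_mult wd_power wd_cnj assms)
  show ?case using T_mult_rho(2)[OF w assms(2)] Suc
    by (cases i) (simp_all add: mult.assoc algebra_simps)
qed simp

lemma Tb_VV:
  assumes "reg 2 (kap2 al be) z" "al \<ge> 0" "be \<ge> 0"
  shows "Tb 2 (kap2 al be) (\<lambda>z. VV al be m z x) z = (\<Sum>i\<le>m. of_real (cmi (al + be + 1) m i) *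
     (of_nat i * z * (z * cnj z) ^ (i - 1) * YY al be (m - 2 * i) z x +
      (z * cnj z) ^ i * (of_nat (m - 2 * i) / 2 * x * YY al be (m - 2 * i - 1) z x)))"
proof -
  have w: "wd (\<lambda>z. YY al be p z x) z" for p by (rule hp_wd[OF hpp_hp[OF hpp_YY]])
  have w2: "wd (\<lambda>z. (z * cnj z) ^ i * YY al be p z x) z" for i p
    unfolding power_mult_distrib complex_cnj_power[symmetric] by (intro wd_mult wd_power wd_cnj w)
  show ?thesis
    unfolding VV_def
    by (subst T_sum(2)) (auto intro!: sum.cong simp: T_cmult[OF w2] Tb_rho_power[OF w assms(1)] Tb_YY[OF assms] w2)
qed

definition dd :: "real \<Rightarrow> real \<Rightarrow> nat \<Rightarrow> complex \<Rightarrow> complex \<Rightarrow> complex" where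
  "dd al be m z x = VV al be m z x - cnj z * x * (if m = 0 then 0 else VV al be (m - 1) z x)"

lemma hpp_dd: "hpp m (dd al be m)"
proof (cases m)
  case 0
  have "hpp m (\<lambda>z x. dd al be m z x)" unfolding dd_def using hpp_coeff[of "\<lambda>_. 1"] 0 by simp
  then show ?thesis by simp
next
  case (Suc n)
  have "hpp (Suc n) (\<lambda>z x. VV al be (Suc n) z x + (- x) * (cnj z * VV al be n z x))"
    by (intro hpp_add hpp_VV hpp_scale continuous_intros hpp_mult[OF hpp_ident(2) hpp_VV, simplified])
  then show ?thesis unfolding dd_def[abs_def] by (simp add: Suc algebra_simps)
qed

lemma Tb_dd:
  assumes z: "reg 2 (kap2 al be) z" and "al \<ge> 0" "be \<ge> 0" and x: "x * cnj x = 1"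
  shows "Tb 2 (kap2 al be) (\<lambda>z. dd al be m z x) z = 0"
proof (cases m)
  case 0
  then show ?thesis by (simp add: dd_def T_const)
next
  case (Suc n)
  note T = Tb_VV[OF assms(1-3)]
  have h: "hp n (\<lambda>z. VV al be n z x)" by (rule hpp_hp[OF hpp_VV])
  let ?c = "\<lambda>m i. complex_of_real (cmi (al + be + 1) m i)"
  let ?r = "z * cnj z" and ?Y = "\<lambda>p. YY al be p z x"
  have tz: "Tz 2 (kap2 al be) (\<lambda>z. VV al be n z x) z = cnj (Tb 2 (kap2 al be) (\<lambda>z. VV al be n z x) z)"
    using T_cnj(1)[OF hp_wd[OF h], of 2 "kap2 al be" z] by simp
  \<comment> \<open>Euler's identity trades \<open>Tb\<close> of cnj z V(n) for \<open>Tz\<close> of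
    V(n), so the values at reflected points drop out. As V is real, \<open>Tz\<close> V is the
    conjugate of the known \<open>Tb\<close> V.\<close>
  have "Tb 2 (kap2 al be) (\<lambda>z. cnj z * VV al be n z x) z =
     (of_nat n + 1 + of_real (al + be)) * VV al be n z x - z * Tz 2 (kap2 al be) (\<lambda>z. VV al be n z x) z"
    using euler[OF h z] T_mult(3)[OF hp_wd[OF h] z] by (simp add: sum2 kap2_def algebra_simps)
  also have "\<dots> = (\<Sum>i\<le>n. of_real ((al + be + 1) + real n - real i) * ?c n i * (?r ^ i * ?Y (n - 2 * i))
      - of_nat (n - 2 * i) / 2 * ?c n i * z * cnj x * ?r ^ i * ?Y (n - 2 * i - 1))"
  proof -
    have "(of_nat n + 1 + of_real (al + be)) * (?c n i * (?r ^ i * ?Y (n - 2 * i)))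
       - z * cnj (?c n i * (of_nat i * z * ?r ^ (i - 1) * ?Y (n - 2 * i) + ?r ^ i * (of_nat (n - 2 * i) / 2 * x * ?Y (n - 2 * i - 1))))
      = of_real ((al + be + 1) + real n - real i) * ?c n i * (?r ^ i * ?Y (n - 2 * i))
      - of_nat (n - 2 * i) / 2 * ?c n i * z * cnj x * ?r ^ i * ?Y (n - 2 * i - 1)" for i
      by (cases i) (simp_all add: algebra_simps)
    then show ?thesis
      unfolding tz T unfolding VV_def cnj_sum sum_distrib_left sum_subtractf[symmetric]
      by (intro sum.cong refl)
  qed
  finally have F: "Tb 2 (kap2 al be) (\<lambda>z. cnj z * VV al be n z x) z = \<dots>" .
  have R: "x * Tb 2 (kap2 al be) (\<lambda>z. cnj z * VV al be n z x) z = 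
     (\<Sum>i\<le>n. of_real ((al + be + 1) + real n - real i) * ?c n i * x * (?r ^ i * ?Y (n - 2 * i))
      - of_nat (n - 2 * i) / 2 * ?c n i * z * ?r ^ i * ?Y (n - 2 * i - 1))"
  proof -
    have "x * (A * C * R - B * C * z * cnj x * R' * Y) = A * C * x * R - B * C * z * R' * Y" for A B C R R' Y
      using x by algebra
    then show ?thesis
      unfolding F sum_distrib_left by (simp only:)
  qed
  have "Tb 2 (kap2 al be) (\<lambda>z. VV al be m z x) z =
     (\<Sum>i\<le>m. ?c m i * (of_nat i * z * ?r ^ (i - 1) * ?Y (m - 2 * i)))
      + (\<Sum>i\<le>m. ?c m i * (?r ^ i * (of_nat (m - 2 * i) / 2 * x * ?Y (m - 2 * i - 1))))"
    unfolding T by (simp only: ring_distribs sum.distrib)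
  also have "(\<Sum>i\<le>m. ?c m i * (of_nat i * z * ?r ^ (i - 1) * ?Y (m - 2 * i))) =
     (\<Sum>i\<le>n. - (of_nat (n - 2 * i) / 2 * ?c n i * z * ?r ^ i * ?Y (n - 2 * i - 1)))"
  proof -
    have "?c m (Suc i) * (of_nat (Suc i) * z * ?r ^ i * ?Y (m - 2 * Suc i)) = - (of_nat (n - 2 * i) / 2 * ?c n i * z * ?r ^ i * ?Y (n - 2 * i - 1))" for i
    proof -
      have "?c m (Suc i) * of_nat (Suc i) = complex_of_real (real (Suc i) * cmi (al + be + 1) (Suc n) (Suc i))" by (simp add: Suc)
      also have "\<dots> = - of_nat (n - 2 * i) / 2 * ?c n i" unfolding cmi_b by simp
      finally have "?c m (Suc i) * of_nat (Suc i) = - of_nat (n - 2 * i) / 2 * ?c n i" .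
      moreover have "m - 2 * Suc i = n - 2 * i - 1" using Suc by simp
      ultimately show ?thesis by (simp only: mult.assoc[symmetric]) simp
    qed
    note T = this
    show ?thesis unfolding Suc by (rule sum_shift0) (simp, use T in \<open>simp only: Suc diff_Suc_1\<close>)
  qed
  also have "(\<Sum>i\<le>m. ?c m i * (?r ^ i * (of_nat (m - 2 * i) / 2 * x * ?Y (m - 2 * i - 1)))) =
     (\<Sum>i\<le>n. of_real ((al + be + 1) + real n - real i) * ?c n i * x * (?r ^ i * ?Y (n - 2 * i)))"
  proof -
    have "?c m i * (?r ^ i * (of_nat (m - 2 * i) / 2 * x * ?Y (m - 2 * i - 1))) = 
       of_real ((al + be + 1) + real n - real i) * ?c n i * x * (?r ^ i * ?Y (n - 2 * i))" for i
    proof -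
      have "?c m i * (of_nat (m - 2 * i) / 2) = complex_of_real (cmi (al + be + 1) (Suc n) i * real (Suc n - 2 * i) / 2)" by (simp add: Suc)
      also have "\<dots> = of_real ((al + be + 1) + real n - real i) * ?c n i" unfolding cmi_a by simp
      finally have "?c m i * (of_nat (m - 2 * i) / 2) = of_real ((al + be + 1) + real n - real i) * ?c n i" .
      from arg_cong[OF this, of "\<lambda>t. t * x * (?r ^ i * ?Y (n - 2 * i))"]
      have "?c m i * (of_nat (m - 2 * i) / 2) * x * (?r ^ i * ?Y (n - 2 * i)) = of_real ((al + be + 1) + real n - real i) * ?c n i * x * (?r ^ i * ?Y (n - 2 * i))" .
      moreover have "m - 2 * i - 1 = n - 2 * i" using Suc by simp
      ultimately show ?thesis by (simp only: mult_ac)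
    qed
    note T = this
    have "?c m m = 0" using Suc by (simp add: cmi_def)
    then show ?thesis unfolding Suc by (intro sum_last0) (simp, use T in \<open>simp only: Suc\<close>)
  qed
  finally have L: "Tb 2 (kap2 al be) (\<lambda>z. VV al be m z x) z = x * Tb 2 (kap2 al be) (\<lambda>z. cnj z * VV al be n z x) z"
    unfolding R by (simp add: sum_subtractf sum_negf)
  have w1: "wd (\<lambda>z. VV al be m z x) z" by (rule hp_wd[OF hpp_hp[OF hpp_VV]])
  have w2: "wd (\<lambda>z. cnj z * VV al be n z x) z" by (intro wd_mult wd_cnj_ident hp_wd[OF h])
  have "(\<lambda>z. dd al be m z x) = (\<lambda>z. 1 * VV al be m z x + (- x) * (cnj z * VV al be n z x))"
    by (simp add: dd_def Suc fun_eq_iff)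
  then show ?thesis using T_lin(2)[OF w1 w2, of 2 "kap2 al be" 1 "- x"] L by simp
qed

section \<open>Integration over the circle\<close>

lemma integral_periodic_shift:
  fixes f :: "real \<Rightarrow> complex"
  assumes cont: "continuous_on UNIV f" and per: "\<And>t. f (t + T) = f t" and T: "T \<ge> 0"
  shows "integral {0..T} (\<lambda>t. f (t + c)) = integral {0..T} f"
proof -
  have int: "f integrable_on {a..b}" for a b
    by (intro integrable_continuous_real continuous_on_subset[OF cont]) auto
  have ge: "integral {0..T} (\<lambda>t. f (t + c)) = integral {0..T} f" if c: "c \<ge> 0" "c \<le> T" for c
  proof -
    have "integral {0..T} (\<lambda>t. f (t + c)) = integral {c..T + c} f"
      using integral_shift_Icc_real[of 0 T f c] by (simp add: o_def add.commute)
    also have "\<dots> = integral {c..T} f + integral {T..T + c} f"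
      using Henstock_Kurzweil_Integration.integral_combine[OF _ _ int, of c T "T + c"] c by simp
    also have "integral {T..T + c} f = integral {0..c} f"
      using integral_shift_Icc_real[of 0 c f T] per by (simp add: o_def add.commute)
    also have "integral {c..T} f + integral {0..c} f = integral {0..T} f"
      using Henstock_Kurzweil_Integration.integral_combine[OF _ _ int, of 0 c T] c by (simp add: add.commute)
    finally show ?thesis .
  qed
  show ?thesis
  proof (cases "T = 0")
    case False
    then have T: "T > 0" using T by simp
    define n where "n = \<lfloor>c / T\<rfloor>"
    have "f (t + of_int m * T) = f t" for t m
    proof (induction m rule: int_induct[where k = 0])
      case (step1 i) then show ?case using per[of "t + of_int i * T"] by (simp add: algebra_simps)
    next
      case (step2 i) then show ?case using per[of "t + of_int (i - 1) * T"] by (simp add: algebra_simps)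
    qed simp
    from this[of "t + (c - of_int n * T)" n for t] have "(\<lambda>t. f (t + c)) = (\<lambda>t. f (t + (c - of_int n * T)))"
      by (simp add: algebra_simps)
    moreover have "c - of_int n * T \<ge> 0" "c - of_int n * T \<le> T"
      using T floor_divide_lower[OF T, of c] floor_divide_upper[OF T, of c] by (simp_all add: n_def algebra_simps)
    ultimately show ?thesis using ge by simp
  qed simp
qed

lemma integral_periodic_reflect:
  fixes f :: "real \<Rightarrow> complex"
  assumes cont: "continuous_on UNIV f" and per: "\<And>t. f (t + T) = f t" and T: "T \<ge> 0"
  shows "integral {0..T} (\<lambda>t. f (c - t)) = integral {0..T} f"
proof -
  have "integral {0..T} (\<lambda>t. f (c - t)) = integral {-T..0} (\<lambda>t. f (c + t))"
    using Henstock_Kurzweil_Integration.integral_reflect_real[of 0 "-T" "\<lambda>t. f (c + t)"] by simp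
  also have "\<dots> = integral {0..T} (\<lambda>t. f (t + (c - T)))"
    using integral_shift_Icc_real[of 0 T "\<lambda>t. f (c + t)" "-T"] by (simp add: o_def algebra_simps)
  also have "\<dots> = integral {0..T} f" by (rule integral_periodic_shift[OF assms])
  finally show ?thesis .
qed

lemma integral_periodic_multiple:
  fixes f :: "real \<Rightarrow> complex"
  assumes cont: "continuous_on UNIV f" and per: "\<And>t. f (t + T) = f t" and T: "T \<ge> 0" and k: "k > 0"
  shows "integral {0..T} (\<lambda>t. f (real k * t)) = integral {0..T} f"
proof -
  have int: "f integrable_on {a..b}" for a b
    by (intro integrable_continuous_real continuous_on_subset[OF cont]) auto
  have shift: "f (t + real n * T) = f t" for t n
  proof (induction n)
    case (Suc n)
    then show ?case using per[of "t + real n * T"] by (simp add: algebra_simps)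
  qed simp
  have sum: "integral {0..real n * T} f = of_nat n * integral {0..T} f" for n
  proof (induction n)
    case (Suc n)
    have "integral {0..real (Suc n) * T} f = integral {0..real n * T} f + integral {real n * T..real (Suc n) * T} f"
      using Henstock_Kurzweil_Integration.integral_combine[OF _ _ int, of 0 "real n * T" "real (Suc n) * T"] T by (simp add: algebra_simps)
    also have "integral {real n * T..real (Suc n) * T} f = integral {0..T} f"
      using integral_shift_Icc_real[of 0 T f "real n * T"] shift by (simp add: o_def algebra_simps)
    finally show ?case using Suc by (simp add: algebra_simps)
  qed simp
  have "((\<lambda>t. f (real k *\<^sub>R t + 0)) has_integral (integral {0..real k * T} f /\<^sub>R real k ^ DIM(real))) 
    (cbox ((0 - 0) /\<^sub>R real k) ((real k * T - 0) /\<^sub>R real k))"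
    by (rule has_integral_affinity') (use int k in \<open>auto intro: integrable_integral\<close>)
  then have "integral {0..T} (\<lambda>t. f (real k * t)) = integral {0..real k * T} f /\<^sub>R real k"
    using k by (intro integral_unique) (simp add: mult.assoc[symmetric])
  then show ?thesis unfolding sum using k by (simp add: scaleR_conv_of_real field_simps)
qed

text \<open>The case be = 0 is separated because 0 powr 0 = 0 would make the weight discontinuous at
  the zeros of cos.\<close>

definition w1 :: "real \<Rightarrow> real \<Rightarrow> real \<Rightarrow> real" where
  "w1 al be t = \<bar>sin t\<bar> powr (2 * al) * (if be = 0 then 1 else \<bar>cos t\<bar> powr (2 * be))"

lemma w1_cont: "al > 0 \<Longrightarrow> be \<ge> 0 \<Longrightarrow> continuous_on A (w1 al be)"
  unfolding w1_def
  by (cases "be = 0") (auto intro!: continuous_intros continuous_on_powr')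

lemma w1_nonneg [simp]: "w1 al be t \<ge> 0"
  by (simp add: w1_def)

lemma w1_sym [simp]: "w1 al be (- t) = w1 al be t" "w1 al be (pi - t) = w1 al be t" "w1 al be (t + pi) = w1 al be t"
  by (simp_all add: w1_def)

lemma w1_per [simp]: "w1 al be (t + 2 * pi) = w1 al be t"
  using w1_sym(3)[of al be "t + pi"] w1_sym(3)[of al be t] by (simp add: add.assoc)

definition LL :: "real \<Rightarrow> real \<Rightarrow> nat \<Rightarrow> (complex \<Rightarrow> complex) \<Rightarrow> complex" where
  "LL al be k f = integral {0..2 * pi} (\<lambda>t. f (cis t) * of_real (w1 al be (real k * t)))"

lemma w1_cont_k: "al > 0 \<Longrightarrow> be \<ge> 0 \<Longrightarrow> continuous_on A (\<lambda>t. w1 al be (real k * t))"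
  using continuous_on_compose2[OF w1_cont[of al be UNIV], of A "\<lambda>t. real k * t"] by (auto intro!: continuous_intros)

lemma LL_integrand_cont:
  fixes f :: "complex \<Rightarrow> complex"
  assumes "al > 0" "be \<ge> 0" "continuous_on UNIV f"
  shows "continuous_on A (\<lambda>t. f (cis t) * of_real (w1 al be (real k * t)))"
proof -
  have "continuous_on A cis" by (rule continuous_on_cis[OF continuous_on_id])
  then have "continuous_on A (\<lambda>t. f (cis t))" using continuous_on_compose2[OF assms(3), of A cis] by simp
  then show ?thesis by (intro continuous_intros w1_cont_k assms)
qed

lemma LL_integrable:
  fixes f :: "complex \<Rightarrow> complex"
  assumes "al > 0" "be \<ge> 0" "continuous_on UNIV f"
  shows "(\<lambda>t. f (cis t) * of_real (w1 al be (real k * t))) integrable_on {a..b}"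
  by (rule integrable_continuous_real[OF LL_integrand_cont[OF assms]])

lemma LL_add:
  assumes "al > 0" "be \<ge> 0" "continuous_on UNIV f" "continuous_on UNIV g"
  shows "LL al be k (\<lambda>z. f z + g z) = LL al be k f + LL al be k g"
  unfolding LL_def distrib_right by (intro integral_add LL_integrable assms)

lemma LL_cmult: "LL al be k (\<lambda>z. c * f z) = c * LL al be k f"
  unfolding LL_def mult.assoc by simp

lemma LL_diff:
  assumes "al > 0" "be \<ge> 0" "continuous_on UNIV f" "continuous_on UNIV g"
  shows "LL al be k (\<lambda>z. f z - g z) = LL al be k f - LL al be k g"
  unfolding LL_def left_diff_distrib by (intro integral_diff LL_integrable assms)

lemma LL_sum:
  assumes "al > 0" "be \<ge> 0" "finite A" "\<And>i. i \<in> A \<Longrightarrow> continuous_on UNIV (f i)"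
  shows "LL al be k (\<lambda>z. \<Sum>i\<in>A. f i z) = (\<Sum>i\<in>A. LL al be k (f i))"
  unfolding LL_def sum_distrib_right by (intro integral_sum LL_integrable assms)

lemma LL_lin:
  assumes "al > 0" "be \<ge> 0" "continuous_on UNIV f" "continuous_on UNIV g"
  shows "LL al be k (\<lambda>z. a * f z + b * g z) = a * LL al be k f + b * LL al be k g"
  using LL_add[OF assms(1,2) continuous_on_mult[OF continuous_on_const assms(3)] continuous_on_mult[OF continuous_on_const assms(4)], of k a b]
  by (simp only: LL_cmult)

lemma LL_lincomb:
  assumes "al > 0" "be \<ge> 0" "finite A" "\<And>i. i \<in> A \<Longrightarrow> continuous_on UNIV (f i)"
  shows "LL al be k (\<lambda>z. \<Sum>i\<in>A. c i * f i z) = (\<Sum>i\<in>A. c i * LL al be k (f i))"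
  using LL_sum[OF assms(1-3), of "\<lambda>i z. c i * f i z" k] continuous_on_mult[OF continuous_on_const assms(4)]
  by (simp only: LL_cmult)

lemma LL_cong: "(\<And>z. cmod z = 1 \<Longrightarrow> f z = g z) \<Longrightarrow> LL al be k f = LL al be k g"
  unfolding LL_def by (intro integral_cong) simp

lemma LL_cnj: "LL al be k (\<lambda>z. cnj (f z)) = cnj (LL al be k f)"
proof -
  have "(\<lambda>t. cnj (f (cis t)) * of_real (w1 al be (real k * t))) = (\<lambda>t. cnj (f (cis t) * of_real (w1 al be (real k * t))))" by simp
  then show ?thesis unfolding LL_def by (simp add: Henstock_Kurzweil_Integration.integral_cnj)
qed

lemma LL_pos:
  assumes "al > 0" "be \<ge> 0" "k > 0" shows "LL al be k (\<lambda>z. 1) \<noteq> 0"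
proof
  assume 0: "LL al be k (\<lambda>z. 1) = 0"
  let ?w = "\<lambda>t. w1 al be (real k * t)"
  have "(?w has_integral integral {0..2*pi} ?w) {0..2*pi}"
    by (intro integrable_integral integrable_continuous_real w1_cont_k assms)
  then have "((\<lambda>t. complex_of_real (?w t)) has_integral of_real (integral {0..2*pi} ?w)) {0..2*pi}"
    by (rule has_integral_of_real)
  from integral_unique[OF this] have "complex_of_real (integral {0..2*pi} ?w) = 0" using 0 by (simp add: LL_def)
  then have "integral {0..2*pi} ?w = 0" by (simp only: of_real_eq_0_iff)
  then have "\<forall>t\<in>{0..2*pi}. ?w t = 0"
    by (subst (asm) integral_eq_0_iff) (auto intro!: w1_cont_k assms)
  moreover have "pi / (4 * real k) \<in> {0..2*pi}" 
  proof -
    have "pi / (4 * real k) \<le> pi / 1" by (rule divide_left_mono) (use assms(3) in auto)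
    also have "\<dots> \<le> 2 * pi" by simp
    finally show ?thesis by simp
  qed
  ultimately have "?w (pi / (4 * real k)) = 0" by blast
  moreover have "real k * (pi / (4 * real k)) = pi / 4" using assms(3) by simp
  ultimately have "w1 al be (pi / 4) = 0" by metis
  then show False by (simp add: w1_def sin_45 cos_45 split: if_splits)
qed

lemma LL_refl:
  assumes "al > 0" "be \<ge> 0" "continuous_on UNIV f"
  shows "LL al be (Suc 0) (\<lambda>z. f (cnj z)) = LL al be (Suc 0) f"
    and "LL al be (Suc 0) (\<lambda>z. f (- cnj z)) = LL al be (Suc 0) f"
    and "LL al be (Suc 0) (\<lambda>z. f (- z)) = LL al be (Suc 0) f"
proof -
  let ?F = "\<lambda>t. f (cis t) * of_real (w1 al be t)"
  have c: "continuous_on UNIV ?F" using LL_integrand_cont[OF assms, of UNIV "Suc 0"] by simp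
  have p: "?F (t + 2 * pi) = ?F t" for t using cis_mult[of t "2 * pi"] by simp
  have e: "f (cis (0 - t)) = f (cnj (cis t))" "f (cis (pi - t)) = f (- cnj (cis t))" "f (cis (t + pi)) = f (- cis t)" for t
    by (rule arg_cong[where f = f], simp add: complex_eq_iff)+
  have w: "w1 al be (0 - t) = w1 al be t" for t by simp
  show "LL al be (Suc 0) (\<lambda>z. f (cnj z)) = LL al be (Suc 0) f"
    using integral_periodic_reflect[OF c p, of 0] unfolding LL_def e(1) w by simp
  show "LL al be (Suc 0) (\<lambda>z. f (- cnj z)) = LL al be (Suc 0) f"
    using integral_periodic_reflect[OF c p, of pi] unfolding LL_def e(2) w1_sym by simp
  show "LL al be (Suc 0) (\<lambda>z. f (- z)) = LL al be (Suc 0) f"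
    using integral_periodic_shift[OF c p, of pi] unfolding LL_def e(3) w1_sym by simp
qed

section \<open>Moments of the weighted circle for I_2\<close>

abbreviation "L1 al be \<equiv> LL al be (Suc 0)"

lemma cmon_cont: "continuous_on A (cmon a b)"
  unfolding cmon_def by (intro continuous_intros)

lemma L1_cmon_odd:
  assumes "al > 0" "be \<ge> 0" "odd a \<or> odd b"
  shows "L1 al be (cmon a b) = 0"
proof -
  note r = LL_refl[OF assms(1,2) cmon_cont[of UNIV a b]]
  have "cmon a b (cnj z) = (-1) ^ b * cmon a b z" "cmon a b (- cnj z) = (-1) ^ a * cmon a b z" for z
    by (simp_all add: cmon_def power_minus[of "of_real (Im z)"] power_minus[of "of_real (Re z)"])
  with r(1,2) have "(-1) ^ b * L1 al be (cmon a b) = L1 al be (cmon a b)" "(-1) ^ a * L1 al be (cmon a b) = L1 al be (cmon a b)"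
    by (simp_all add: LL_cmult)
  then show ?thesis using assms(3) by (auto simp: eq_commute[of "- _"])
qed

lemma w1_alt: "w1 al be t = (sin t)\<^sup>2 powr al * (if be = 0 then 1 else (cos t)\<^sup>2 powr be)"
proof -
  have "\<bar>x\<bar> powr (2 * p) = x\<^sup>2 powr p" for x p :: real
    by (cases "x = 0") (simp_all add: powr_powr[symmetric] )
  then show ?thesis by (simp add: w1_def)
qed

lemma sq_powr_deriv:
  assumes "(f has_real_derivative f') (at t)" "f t \<noteq> 0"
  shows "((\<lambda>t. (f t)\<^sup>2 powr p) has_real_derivative (2 * p * (f t)\<^sup>2 powr p * f' / f t)) (at t)"
proof -
  have pos: "(f t)\<^sup>2 > 0" using assms(2) by simp
  have "((\<lambda>t. (f t)\<^sup>2) has_real_derivative (2 * f t * f')) (at t)"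
    by (auto intro!: derivative_eq_intros assms(1))
  from DERIV_fun_powr[OF this pos, of p]
  have "((\<lambda>t. (f t)\<^sup>2 powr p) has_real_derivative (p * (f t)\<^sup>2 powr (p - 1) * (2 * f t * f'))) (at t)" by simp
  moreover have "(f t)\<^sup>2 powr (p - 1) = (f t)\<^sup>2 powr p / (f t)\<^sup>2" using pos by (simp add: powr_diff)
  moreover have "x \<noteq> 0 \<Longrightarrow> p * (Q / x\<^sup>2) * (2 * x * f') = 2 * p * Q * f' / x" for x Q
    by (simp add: power2_eq_square)
  ultimately show ?thesis using assms(2) by simp
qed

lemma w1_deriv:
  assumes s: "sin t \<noteq> 0" and c: "cos t \<noteq> 0"
  shows "(w1 al be has_real_derivative (w1 al be t * (2 * al * cos t / sin t - 2 * be * sin t / cos t))) (at t)"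
proof -
  have 1: "((\<lambda>t. (sin t)\<^sup>2 powr al) has_real_derivative (2 * al * (sin t)\<^sup>2 powr al * cos t / sin t)) (at t)"
    using sq_powr_deriv[of sin "cos t" t al] s DERIV_sin by simp
  have 2: "((\<lambda>t. if be = 0 then 1 else (cos t)\<^sup>2 powr be) has_real_derivative (2 * be * (if be = 0 then 1 else (cos t)\<^sup>2 powr be) * (- sin t) / cos t)) (at t)"
  proof (cases "be = 0")
    case False
    then show ?thesis using sq_powr_deriv[of cos "- sin t" t be] c DERIV_cos by simp
  qed simp
  have "((\<lambda>t. (sin t)\<^sup>2 powr al * (if be = 0 then 1 else (cos t)\<^sup>2 powr be)) has_real_derivative (w1 al be t * (2 * al * cos t / sin t - 2 * be * sin t / cos t))) (at t)"
    by (rule DERIV_cong[OF DERIV_mult[OF 1 2]]) (simp add: w1_alt algebra_simps)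
  then show ?thesis by (simp add: w1_alt[abs_def])
qed

text \<open>The derivative of cos^(a+1) sin^(b+1) times the weight integrates to zero over a period.
  The exponents 2 al and 2 be of the weight are added to b + 1 and a + 1.\<close>

lemma L1_rec_aux:
  assumes al: "al > 0" and be: "be \<ge> 0"
  shows "of_real (real b + 1 + 2 * al) * L1 al be (cmon (Suc (Suc a)) b) = of_real (real a + 1 + 2 * be) * L1 al be (cmon a (Suc (Suc b)))"
proof -
  let ?H = "\<lambda>t. cos t ^ Suc a * sin t ^ Suc b * w1 al be t"
  let ?h = "\<lambda>t. ((real b + 1 + 2 * al) * (cos t ^ Suc (Suc a) * sin t ^ b) - (real a + 1 + 2 * be) * (cos t ^ a * sin t ^ Suc (Suc b))) * w1 al be t"
  \<comment> \<open>Where sin or cos vanishes the weight need not be differentiable, so the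
    fundamental theorem is used in the form that allows a finite exceptional set.\<close>
  define S where "S = {t \<in> {0..2*pi}. sin t = 0 \<or> cos t = 0}"
  have "S \<subseteq> (\<lambda>n. real n * (pi / 2)) ` {..4}"
  proof
    fix t assume t: "t \<in> S"
    then have "sin (2 * t) = 0" by (auto simp: S_def sin_double)
    then obtain i :: int where i: "2 * t = of_int i * pi" by (auto simp: sin_zero_iff_int2)
    have a: "0 \<le> of_int i * pi" "of_int i * pi \<le> 4 * pi" using t unfolding i[symmetric] by (auto simp: S_def)
    then have "0 \<le> (of_int i :: real)" "(of_int i :: real) \<le> 4" using pi_gt_zero by (auto simp: zero_le_mult_iff mult_le_cancel_right)
    then have "0 \<le> i" "i \<le> 4" by linarith+
    then have "t = real (nat i) * (pi / 2)" "nat i \<le> 4" using i by auto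
    then show "t \<in> (\<lambda>n. real n * (pi / 2)) ` {..4}" by blast
  qed
  then have fin: "finite S" using finite_subset by blast
  have "(?h has_integral (?H (2 * pi) - ?H 0)) {0..2 * pi}"
  proof (rule fundamental_theorem_of_calculus_strong[OF fin])
    show "continuous_on {0..2 * pi} ?H" by (intro continuous_intros w1_cont al be)
    fix t assume t: "t \<in> {0..2 * pi} - S"
    then have s: "sin t \<noteq> 0" and c: "cos t \<noteq> 0" by (auto simp: S_def)
    have 1: "((\<lambda>t. cos t ^ Suc a) has_real_derivative (- real (Suc a) * cos t ^ a * sin t)) (at t)"
      "((\<lambda>t. sin t ^ Suc b) has_real_derivative (real (Suc b) * sin t ^ b * cos t)) (at t)"
      using DERIV_power[OF DERIV_cos, of "Suc a"] DERIV_power[OF DERIV_sin, of "Suc b"]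
      by (simp_all add: algebra_simps)
    have "(?H has_real_derivative ?h t) (at t)"
      by (rule DERIV_cong[OF DERIV_mult[OF DERIV_mult[OF 1] w1_deriv[OF s c]]])
         (use s c in \<open>simp add: field_simps\<close>)
    then show "(?H has_vector_derivative ?h t) (at t)"
      by (simp add: has_real_derivative_iff_has_vector_derivative)
  qed simp
  then have "(?h has_integral 0) {0..2 * pi}" by simp
  then have "((\<lambda>t. complex_of_real (?h t)) has_integral of_real 0) {0..2 * pi}" by (rule has_integral_of_real)
  then have "integral {0..2*pi} (\<lambda>t. complex_of_real (?h t)) = 0" by (simp add: integral_unique)
  also have "integral {0..2*pi} (\<lambda>t. complex_of_real (?h t)) =
    L1 al be (\<lambda>z. of_real (real b + 1 + 2 * al) * cmon (Suc (Suc a)) b z - of_real (real a + 1 + 2 * be) * cmon a (Suc (Suc b)) z)"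
    unfolding LL_def cmon_def by (intro integral_cong) simp
  also have "\<dots> = of_real (real b + 1 + 2 * al) * L1 al be (cmon (Suc (Suc a)) b) - of_real (real a + 1 + 2 * be) * L1 al be (cmon a (Suc (Suc b)))"
    by (subst LL_diff) (auto simp: LL_cmult al be intro!: continuous_intros cmon_cont)
  finally show ?thesis by simp
qed

lemma L1_pyth:
  assumes al: "al > 0" and be: "be \<ge> 0"
  shows "L1 al be (cmon (Suc (Suc a)) b) + L1 al be (cmon a (Suc (Suc b))) = L1 al be (cmon a b)"
proof -
  have "L1 al be (cmon (Suc (Suc a)) b) + L1 al be (cmon a (Suc (Suc b))) = L1 al be (\<lambda>z. cmon (Suc (Suc a)) b z + cmon a (Suc (Suc b)) z)"
    by (rule LL_add[symmetric]) (auto simp: al be intro!: cmon_cont)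
  also have "\<dots> = L1 al be (cmon a b)"
  proof (rule LL_cong)
    fix z assume "cmod z = 1"
    then have "(of_real (Re z))\<^sup>2 + (of_real (Im z))\<^sup>2 = (1::complex)"
      by (metis cmod_power2 of_real_1 of_real_add of_real_power one_power2)
    then have "cmon a b z * ((of_real (Re z))\<^sup>2 + (of_real (Im z))\<^sup>2) = cmon a b z" by simp
    then show "cmon (Suc (Suc a)) b z + cmon a (Suc (Suc b)) z = cmon a b z"
      by (simp add: cmon_def power2_eq_square algebra_simps)
  qed
  finally show ?thesis .
qed

text \<open>\<open>L1_rec_aux\<close> gives the ratio of two moments and \<open>L1_pyth\<close>
  their sum, which determines both. For the other parities both sides vanish by symmetry.\<close>

lemma L1_rec:
  assumes al: "al > 0" and be: "be \<ge> 0"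
  shows "of_real (real a + real b + 1 + 2 * (al + be)) * L1 al be (cmon (Suc a) b) = 
      of_real (real a + (if odd a then 2 * be else 0)) * L1 al be (cmon (a - 1) b)" (is ?A)
  and "of_real (real a + real b + 1 + 2 * (al + be)) * L1 al be (cmon a (Suc b)) = 
      of_real (real b + (if odd b then 2 * al else 0)) * L1 al be (cmon a (b - 1))" (is ?B)
proof -
  show ?A
  proof (cases "even a \<or> odd b")
    case True
    then have "L1 al be (cmon (Suc a) b) = 0" "a > 0 \<Longrightarrow> L1 al be (cmon (a - 1) b) = 0"
      by (intro L1_cmon_odd al be; auto)+
    then show ?thesis using True by (cases "a = 0") auto
  next
    case False
    then obtain a' where a: "a = Suc a'" by (cases a) auto
    have gen: "p * X = q * Y \<Longrightarrow> X + Y = Z \<Longrightarrow> (p + q) * X = q * Z" for p q X Y Z :: complex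
      by (auto simp: algebra_simps)
    show ?thesis using gen[OF L1_rec_aux[OF al be, of b a'] L1_pyth[OF al be, of a' b]] False
      unfolding a of_real_add[symmetric] by (simp add: algebra_simps)
  qed
  show ?B
  proof (cases "even b \<or> odd a")
    case True
    then have "L1 al be (cmon a (Suc b)) = 0" "b > 0 \<Longrightarrow> L1 al be (cmon a (b - 1)) = 0"
      by (intro L1_cmon_odd al be; auto)+
    then show ?thesis using True by (cases "b = 0") auto
  next
    case False
    then obtain b' where b: "b = Suc b'" by (cases b) auto
    have gen: "p * X = q * Y \<Longrightarrow> X + Y = Z \<Longrightarrow> (p + q) * Y = p * Z" for p q X Y Z :: complex
      by (auto simp: algebra_simps)
    show ?thesis using gen[OF L1_rec_aux[OF al be, of b' a] L1_pyth[OF al be, of a b']] False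
      unfolding b of_real_add[symmetric] by (simp add: algebra_simps)
  qed
qed

text \<open>Integration by parts, the analogue of the divergence theorem for the disc. It is checked
  on real monomials, where \<open>L1_rec\<close> has the same factors as \<open>Tb_cmon\<close>. The
  function g is the continuous extension of \<open>Tb\<close> h across the lines.\<close>

lemma LL_Tb:
  assumes al: "al > 0" and be: "be \<ge> 0" and h: "hp (Suc d) h" and g: "continuous_on UNIV g"
    and eq: "\<And>z. off_lines 2 z \<Longrightarrow> Tb 2 (kap2 al be) h z = g z"
  shows "2 * L1 al be g = of_real (real d + 2 + 2 * (al + be)) * L1 al be (\<lambda>z. z * h z)"
proof -
  have "homog_poly (Suc d) h" using h homog_poly_hp by blast
  then obtain c where c: "\<And>z. h z = (\<Sum>m\<le>Suc d. c m * cmon m (Suc d - m) z)"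
    unfolding homog_poly_def cmon_def by auto
  have w: "wd (cmon j l) z" for j l z using wirt_cmon wd_def by blast
  let ?t = "\<lambda>j l z. (of_real (real j + (if odd j then 2 * be else 0)) * cmon (j - 1) l z
     + \<i> * of_real (real l + (if odd l then 2 * al else 0)) * cmon j (l - 1) z) / 2"
  have tc: "continuous_on UNIV (?t j l)" for j l
    by (intro continuous_on_divide continuous_on_add continuous_on_mult continuous_on_const cmon_cont) simp
  have "Tb 2 (kap2 al be) h z = (\<Sum>m\<le>Suc d. c m * ?t m (Suc d - m) z)" if z: "off_lines 2 z" for z
  proof -
    have h: "h = (\<lambda>z. \<Sum>m\<le>Suc d. c m * cmon m (Suc d - m) z)" using c by blast
    have "Tb 2 (kap2 al be) h z = (\<Sum>m\<le>Suc d. Tb 2 (kap2 al be) (\<lambda>z. c m * cmon m (Suc d - m) z) z)"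
      unfolding h by (rule T_sum(2)) (simp_all add: wd_mult[OF wd_const w])
    then show ?thesis by (simp only: T_cmult(2)[OF w] Tb_cmon[OF off_lines_reg[OF z]])
  qed
  then have teq: "g z = (\<Sum>m\<le>Suc d. c m * ?t m (Suc d - m) z)" if "off_lines 2 z" for z using that eq by simp
  have "continuous_on UNIV (\<lambda>z. \<Sum>m\<le>Suc d. c m * ?t m (Suc d - m) z)"
    by (intro continuous_on_sum continuous_on_mult continuous_on_const tc)
  then have g2: "g z = (\<Sum>m\<le>Suc d. c m * ?t m (Suc d - m) z)" for z
    by (rule off_lines_dense[where N = 2, OF g _ teq])
  have M: "2 * L1 al be (?t a b) = of_real (real a + real b + 1 + 2 * (al + be)) * L1 al be (\<lambda>z. z * cmon a b z)" for a b
  proof -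
    have "2 * L1 al be (?t a b) = L1 al be (\<lambda>z. of_real (real a + (if odd a then 2 * be else 0)) * cmon (a - 1) b z
     + (\<i> * of_real (real b + (if odd b then 2 * al else 0))) * cmon a (b - 1) z)"
      unfolding LL_cmult[symmetric] by (rule LL_cong) simp
    also have "\<dots> = of_real (real a + (if odd a then 2 * be else 0)) * L1 al be (cmon (a - 1) b)
     + (\<i> * of_real (real b + (if odd b then 2 * al else 0))) * L1 al be (cmon a (b - 1))"
      by (rule LL_lin[OF al be cmon_cont cmon_cont])
    also have "\<dots> = of_real (real a + real b + 1 + 2 * (al + be)) * (L1 al be (cmon (Suc a) b) + \<i> * L1 al be (cmon a (Suc b)))"
    proof -
      have gen: "c * A = e * B \<Longrightarrow> c * A' = e' * B' \<Longrightarrow> e * B + (\<i> * e') * B' = c * (A + \<i> * A')" for c A e B A' e' B' :: complex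
        by (simp add: distrib_left mult.left_commute[of c] mult.assoc)
      show ?thesis by (rule gen[OF L1_rec[OF al be, of a b]])
    qed
    also have "L1 al be (cmon (Suc a) b) + \<i> * L1 al be (cmon a (Suc b)) = L1 al be (\<lambda>z. 1 * cmon (Suc a) b z + \<i> * cmon a (Suc b) z)"
      by (subst LL_lin[OF al be cmon_cont cmon_cont]) simp
    also have "\<dots> = L1 al be (\<lambda>z. z * cmon a b z)"
    proof (rule LL_cong)
      fix z :: complex
      have "z * cmon a b z = (of_real (Re z) + \<i> * of_real (Im z)) * cmon a b z" by (simp add: complex_eq[symmetric])
      then show "1 * cmon (Suc a) b z + \<i> * cmon a (Suc b) z = z * cmon a b z"
        by (simp add: cmon_def algebra_simps)
    qed
    finally show ?thesis .
  qed
  have "2 * L1 al be g = (\<Sum>m\<le>Suc d. c m * (2 * L1 al be (?t m (Suc d - m))))"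
    unfolding g2[abs_def] by (subst LL_lincomb[OF al be finite_atMost tc]) (simp only: sum_distrib_left mult.left_commute)
  also have "\<dots> = (\<Sum>m\<le>Suc d. c m * (of_real (real d + 2 + 2 * (al + be)) * L1 al be (\<lambda>z. z * cmon m (Suc d - m) z)))"
    unfolding M by (intro sum.cong refl) (simp add: of_nat_diff)
  also have "\<dots> = of_real (real d + 2 + 2 * (al + be)) * (\<Sum>m\<le>Suc d. c m * L1 al be (\<lambda>z. z * cmon m (Suc d - m) z))"
    by (simp only: sum_distrib_left mult.left_commute)
  also have "(\<Sum>m\<le>Suc d. c m * L1 al be (\<lambda>z. z * cmon m (Suc d - m) z)) = L1 al be (\<lambda>z. \<Sum>m\<le>Suc d. c m * (z * cmon m (Suc d - m) z))"
    by (rule LL_lincomb[OF al be finite_atMost, symmetric]) (intro continuous_on_mult continuous_on_id cmon_cont)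
  also have "(\<lambda>z. \<Sum>m\<le>Suc d. c m * (z * cmon m (Suc d - m) z)) = (\<lambda>z. z * h z)"
    unfolding c by (simp only: sum_distrib_left mult.left_commute)
  finally show ?thesis .
qed

text \<open>The difference between the product rule for a Dunkl operator and Leibniz' rule is odd
  under the reflections, so it does not contribute to integrals over the circle.\<close>

lemma L1_leibniz:
  assumes al: "al > 0" and be: "be \<ge> 0" and f: "hp m f" and g: "hp j g" and mj: "m + j = Suc d"
    and Tf: "\<And>z. off_lines 2 z \<Longrightarrow> Tb 2 (kap2 al be) f z = 0"
    and gb: "continuous_on UNIV gb" "\<And>z. off_lines 2 z \<Longrightarrow> Tb 2 (kap2 al be) g z = gb z"
  shows "of_real (real m + real j + 1 + 2 * (al + be)) * L1 al be (\<lambda>z. z * f z * g z) = 2 * L1 al be (\<lambda>z. f z * gb z)"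
proof -
  have "\<forall>i. \<exists>q. hp (m - 1) q \<and> (\<forall>z. z \<noteq> eps 2 i * cnj z \<longrightarrow> dq 2 i f z = q z)"
    using hp_dq[OF f] by blast
  then obtain qf where qf: "\<And>i. hp (m - 1) (qf i)" "\<And>i z. z \<noteq> eps 2 i * cnj z \<Longrightarrow> dq 2 i f z = qf i z" by metis
  have "\<forall>i. \<exists>q. hp (j - 1) q \<and> (\<forall>z. z \<noteq> eps 2 i * cnj z \<longrightarrow> dq 2 i g z = q z)"
    using hp_dq[OF g] by blast
  then obtain qg where qg: "\<And>i. hp (j - 1) (qg i)" "\<And>i z. z \<noteq> eps 2 i * cnj z \<Longrightarrow> dq 2 i g z = qg i z" by metis
  define u where "u i z = qf i z * qg i z * (z - eps 2 i * cnj z)" for i z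
  have uc: "continuous_on UNIV (u i)" for i
    unfolding u_def by (intro continuous_intros hp_continuous[OF qf(1)] hp_continuous[OF qg(1)])
  have fc: "continuous_on UNIV f" "continuous_on UNIV g" by (intro hp_continuous[OF f] hp_continuous[OF g])+
  have nz: "z \<noteq> eps 2 i * cnj z" if "off_lines 2 z" "i < 2" for z i using that by (auto simp: off_lines_iff)
  have eq: "Tb 2 (kap2 al be) (\<lambda>z. f z * g z) z = f z * gb z + of_real al * u 0 z - of_real be * u (Suc 0) z" if z: "off_lines 2 z" for z
  proof -
    have d: "dq 2 i (\<lambda>z. f z * g z) z = f z * dq 2 i g z + dq 2 i f z * g z - u i z" if "i < 2" for i
    proof -
      note n = nz[OF z that]
      have gen: "l \<noteq> 0 \<Longrightarrow> (a * b - c * e) / l = a * ((b - e) / l) + (a - c) / l * b - (a - c) / l * ((b - e) / l) * l" for a b c e l :: complex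
        by (simp add: field_simps)
      show ?thesis unfolding u_def qf(2)[OF n, symmetric] qg(2)[OF n, symmetric] unfolding dq_def
        by (rule gen) (use n in simp)
    qed
    have "dzb (\<lambda>z. f z * g z) z = dzb f z * g z + f z * dzb g z"
      using wirt_dz(2)[OF wirt_mult[OF wd_wirt wd_wirt]] hp_wd f g by blast
    then have "Tb 2 (kap2 al be) (\<lambda>z. f z * g z) z = Tb 2 (kap2 al be) f z * g z + f z * Tb 2 (kap2 al be) g z + of_real al * u 0 z - of_real be * u (Suc 0) z"
    proof -
      have d01: "dq 2 0 (\<lambda>z. f z * g z) z = f z * dq 2 0 g z + dq 2 0 f z * g z - u 0 z"
        "dq 2 (Suc 0) (\<lambda>z. f z * g z) z = f z * dq 2 (Suc 0) g z + dq 2 (Suc 0) f z * g z - u (Suc 0) z"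
        by (rule d, simp)+
      show ?thesis unfolding Tb_def sum2 d01 \<open>dzb (\<lambda>z. f z * g z) z = _\<close> by (simp add: kap2_def algebra_simps)
    qed
    then show ?thesis by (simp add: Tf[OF z] gb(2)[OF z])
  qed
  \<comment> \<open>u i changes sign under the reflection of index i while the weight is invariant,
    so the integral is its own negative. For this the quotients are replaced by polynomials, which
    also have values on the lines.\<close>
  have u0: "L1 al be (u i) = 0" if "i = 0 \<or> i = Suc 0" for i
  proof -
    let ?s = "\<lambda>z. eps 2 i * cnj z"
    have inv: "?s (?s z) = z" for z by (simp add: mult.assoc)
    have "u i (?s z) = (-1) * u i z" if z: "off_lines 2 z" for z
    proof -
      have i2: "i < 2" using \<open>i = 0 \<or> i = Suc 0\<close> by auto
      have n2: "?s z \<noteq> eps 2 i * cnj (?s z)" using nz[OF off_lines_refl[OF z i2] i2] .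
      have dqs: "dq 2 i h (?s z) = dq 2 i h z" for h
        unfolding dq_def inv by (metis minus_diff_eq minus_divide_divide)
      have q: "qf i (?s z) = qf i z" "qg i (?s z) = qg i z"
        using qf(2)[OF n2] qf(2)[OF nz[OF z i2]] qg(2)[OF n2] qg(2)[OF nz[OF z i2]] dqs by simp_all
      show ?thesis unfolding u_def q inv by (simp add: algebra_simps)
    qed
    moreover have "continuous_on UNIV (\<lambda>z. u i (?s z))"
      by (rule continuous_on_compose2[OF uc[of i]]) (auto intro!: continuous_intros)
    moreover have "continuous_on UNIV (\<lambda>z. (-1) * u i z)" by (intro continuous_on_mult continuous_on_const uc)
    ultimately have "u i (?s z) = (-1) * u i z" for z by (intro off_lines_dense[of "\<lambda>z. u i (?s z)" "\<lambda>z. (-1) * u i z" 2 z])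
    then have "L1 al be (\<lambda>z. u i (?s z)) = (-1) * L1 al be (u i)" by (simp only: LL_cmult)
    moreover have "L1 al be (\<lambda>z. u i (?s z)) = L1 al be (u i)"
      using that LL_refl(1,2)[OF al be uc[of i]] by auto
    ultimately have "2 * L1 al be (u i) = 0" by (simp add: algebra_simps)
    then show ?thesis by simp
  qed
  have c1: "continuous_on UNIV (\<lambda>z. f z * gb z)" by (intro continuous_on_mult fc gb)
  have gc: "continuous_on UNIV (\<lambda>z. f z * gb z + of_real al * u 0 z - of_real be * u (Suc 0) z)"
    by (intro continuous_on_diff continuous_on_add continuous_on_mult continuous_on_const uc c1 fc gb)
  have h: "hp (Suc d) (\<lambda>z. f z * g z)" using hp_mult[OF f g] mj by simp
  have "2 * L1 al be (\<lambda>z. f z * gb z + of_real al * u 0 z - of_real be * u (Suc 0) z)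
    = of_real (real d + 2 + 2 * (al + be)) * L1 al be (\<lambda>z. z * (f z * g z))"
    by (rule LL_Tb[OF al be h gc eq])
  also have "L1 al be (\<lambda>z. f z * gb z + of_real al * u 0 z - of_real be * u (Suc 0) z) = L1 al be (\<lambda>z. f z * gb z)"
  proof -
    have "L1 al be (\<lambda>z. f z * gb z + of_real al * u 0 z - of_real be * u (Suc 0) z)
      = L1 al be (\<lambda>z. 1 * (f z * gb z) + 1 * (of_real al * u 0 z + (- of_real be) * u (Suc 0) z))"
      by (rule LL_cong) simp
    also have "\<dots> = 1 * L1 al be (\<lambda>z. f z * gb z) + 1 * L1 al be (\<lambda>z. of_real al * u 0 z + (- of_real be) * u (Suc 0) z)"
      by (rule LL_lin[OF al be c1]) (intro continuous_on_add continuous_on_mult continuous_on_const uc)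
    also have "L1 al be (\<lambda>z. of_real al * u 0 z + (- of_real be) * u (Suc 0) z) = 0"
      by (subst LL_lin[OF al be uc uc]) (simp add: u0)
    finally show ?thesis by simp
  qed
  finally have "2 * L1 al be (\<lambda>z. f z * gb z) = of_real (real d + 2 + 2 * (al + be)) * L1 al be (\<lambda>z. z * (f z * g z))" .
  moreover have "real d + 2 + 2 * (al + be) = real m + real j + 1 + 2 * (al + be)" using mj by linarith
  ultimately show ?thesis by (simp only: mult.assoc)
qed

lemma kap2_simps [simp]: "kap2 al be 0 = al" "kap2 al be (Suc 0) = be"
  by (simp_all add: kap2_def)

lemma unit_cnj: "cmod z = 1 \<Longrightarrow> z * cnj z = 1"
  using complex_norm_square[of z] by simp

lemma Tb_pow:
  assumes "off_lines 2 z"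
  shows "Tb 2 (kap2 al be) (\<lambda>z. z ^ j) z = - (\<Sum>i<j. of_real (al - be * (-1) ^ i) * (z ^ (j - 1 - i) * cnj z ^ i))"
proof (induction j)
  case (Suc j)
  have "Tb 2 (kap2 al be) (\<lambda>z. z ^ Suc j) z = z * Tb 2 (kap2 al be) (\<lambda>z. z ^ j) z - of_real (al - be * (-1) ^ j) * cnj z ^ j"
    using T_mult(2)[OF wd_power off_lines_reg[OF assms], of "kap2 al be" j]
    by (simp add: sum2 power_minus[of "cnj z"] algebra_simps)
  also have "z * Tb 2 (kap2 al be) (\<lambda>z. z ^ j) z = - (\<Sum>i<j. of_real (al - be * (-1) ^ i) * (z ^ (Suc j - 1 - i) * cnj z ^ i))"
  proof -
    have "z * (of_real (al - be * (-1) ^ i) * (z ^ (j - 1 - i) * cnj z ^ i)) = of_real (al - be * (-1) ^ i) * (z ^ (Suc j - 1 - i) * cnj z ^ i)" if "i < j" for i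
    proof -
      have "Suc j - 1 - i = Suc (j - 1 - i)" using that by simp
      then show ?thesis by (simp add: mult_ac)
    qed
    then show ?thesis unfolding Suc mult_minus_right sum_distrib_left by (intro arg_cong[where f = uminus] sum.cong refl) simp
  qed
  finally show ?case by simp
qed (simp add: T_const)

lemma Tb_cnj_pow:
  assumes "off_lines 2 z"
  shows "Tb 2 (kap2 al be) (\<lambda>z. cnj z ^ Suc j) z =
    of_real (real j + 1 + al + be) * cnj z ^ j + (\<Sum>i<j. of_real (al + be * (-1) ^ (j - i)) * (z ^ (j - i) * cnj z ^ i))"
proof (induction j)
  case 0
  show ?case using T_mult(3)[OF wd_const off_lines_reg[OF assms], of "kap2 al be" 1]
    by (simp add: sum2 T_const)
next
  case (Suc j)
  have w: "wd (\<lambda>z. cnj z ^ Suc j) z" using wd_cnj[OF wd_power[of "Suc j" z]] by simp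
  have "Tb 2 (kap2 al be) (\<lambda>z. cnj z ^ Suc (Suc j)) z = cnj z * Tb 2 (kap2 al be) (\<lambda>z. cnj z ^ Suc j) z + cnj z ^ Suc j + of_real (al + be * (-1) ^ Suc j) * z ^ Suc j"
    using T_mult(3)[OF w off_lines_reg[OF assms], of "kap2 al be"]
    by (simp add: sum2 power_minus[of z] algebra_simps)
  also have "\<dots> = of_real (real (Suc j) + 1 + al + be) * cnj z ^ Suc j + (of_real (al + be * (-1) ^ Suc j) * z ^ Suc j + 
      (\<Sum>i<j. of_real (al + be * (-1) ^ (j - i)) * (z ^ (j - i) * cnj z ^ Suc i)))"
    unfolding Suc by (simp add: algebra_simps sum_distrib_left)
  also have "of_real (al + be * (-1) ^ Suc j) * z ^ Suc j + (\<Sum>i<j. of_real (al + be * (-1) ^ (j - i)) * (z ^ (j - i) * cnj z ^ Suc i))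
     = (\<Sum>i<Suc j. of_real (al + be * (-1) ^ (Suc j - i)) * (z ^ (Suc j - i) * cnj z ^ i))"
    unfolding sum.lessThan_Suc_shift by simp
  finally show ?case .
qed

text \<open>The model case is f = z^m with zero multiplicities. \<open>L1_leibniz\<close> against
  z^(j-1), respectively cnj z^(j+1), leads back to smaller powers, and the two families feed each
  other, hence the joint induction. The exponent j = m + 1 is included because it occurs in
  \<open>FF_orth\<close>.\<close>

lemma L1_orth:
  assumes al: "al > 0" and be: "be \<ge> 0" and f: "hp m f"
    and Tf: "\<And>z. off_lines 2 z \<Longrightarrow> Tb 2 (kap2 al be) f z = 0"
  shows "(j \<le> Suc m \<longrightarrow> 0 < j + m \<longrightarrow> L1 al be (\<lambda>z. f z * z ^ j) = 0) \<and> (j < m \<longrightarrow> L1 al be (\<lambda>z. f z * cnj z ^ j) = 0)"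
proof (induction j rule: less_induct)
  case (less j)
  have fc: "continuous_on UNIV f" by (rule hp_continuous[OF f])
  have mono: "L1 al be (\<lambda>z. f z * (z ^ p * cnj z ^ q)) = 
     (if q \<le> p then L1 al be (\<lambda>z. f z * z ^ (p - q)) else L1 al be (\<lambda>z. f z * cnj z ^ (q - p)))" for p q
  proof -
    have "z ^ p * cnj z ^ q = (if q \<le> p then z ^ (p - q) else cnj z ^ (q - p))" if "cmod z = 1" for z
    proof -
      have 1: "z * cnj z = 1" using that by (rule unit_cnj)
      show ?thesis
      proof (cases "q \<le> p")
        case True
        then have "z ^ p = z ^ (p - q) * z ^ q" by (simp flip: power_add)
        then have "z ^ p * cnj z ^ q = z ^ (p - q) * (z * cnj z) ^ q" by (simp add: power_mult_distrib)
        then show ?thesis using True 1 by simp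
      next
        case False
        then have "cnj z ^ q = cnj z ^ (q - p) * cnj z ^ p" by (simp flip: power_add)
        then have "z ^ p * cnj z ^ q = cnj z ^ (q - p) * (z * cnj z) ^ p" by (simp add: power_mult_distrib)
        then show ?thesis using False 1 by simp
      qed
    qed
    then show ?thesis by (auto intro!: LL_cong)
  qed
  have fm: "continuous_on UNIV (\<lambda>z. f z * (z ^ p * cnj z ^ q))" for p q
    by (intro continuous_intros fc)
  have low: "L1 al be (\<lambda>z. f z * (z ^ p * cnj z ^ q)) = 0" if "p - q < j" "q - p < j" "p - q < Suc m" "q - p < m" "p \<noteq> q \<or> 0 < m" for p q
    unfolding mono using less[of "p - q"] less[of "q - p"] that by (cases "q \<le> p") auto
  \<comment> \<open>On the circle the monomials of Tb z^(j-1) become powers of z or cnj z with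
    exponent at most j - 2. The second claim covers cnj z^(j-2) exactly if j - 2 < m, that is j
    \<le> m + 1.\<close>
  have A: "L1 al be (\<lambda>z. f z * z ^ j) = 0" if j: "j \<le> Suc m" "0 < j" 
  proof (cases "m = 0")
    case True
    then have j1: "j = 1" using that by simp
    obtain c where c: "\<And>z. f z = c" using f True by (auto simp: hp_iff)
    have "L1 al be (\<lambda>z. z) = L1 al be (\<lambda>z. 1 * cmon 1 0 z + \<i> * cmon 0 1 z)"
      by (rule LL_cong) (simp add: cmon_def complex_eq[symmetric])
    also have "\<dots> = 0" by (subst LL_lin[OF al be cmon_cont cmon_cont]) (simp add: L1_cmon_odd al be)
    finally show ?thesis using c j1 by (simp add: LL_cmult)
  next
    case False
    then obtain d where d: "m + (j - 1) = Suc d" by (cases m) auto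
    have "of_real (real m + real (j - 1) + 1 + 2 * (al + be)) * L1 al be (\<lambda>z. z * f z * z ^ (j - 1)) =
      2 * L1 al be (\<lambda>z. f z * (- (\<Sum>i<j - 1. of_real (al - be * (-1) ^ i) * (z ^ (j - 1 - 1 - i) * cnj z ^ i))))"
      by (rule L1_leibniz[OF al be f _ d Tf _ Tb_pow])
         (use hp_power[OF hp_ident(1), of "j - 1"] in \<open>auto intro!: continuous_intros\<close>)
    also have "L1 al be (\<lambda>z. f z * (- (\<Sum>i<j - 1. of_real (al - be * (-1) ^ i) * (z ^ (j - 1 - 1 - i) * cnj z ^ i)))) = 
      L1 al be (\<lambda>z. \<Sum>i<j - 1. (- of_real (al - be * (-1) ^ i)) * (f z * (z ^ (j - 1 - 1 - i) * cnj z ^ i)))"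
      by (rule LL_cong) (simp only: mult_minus_right mult_minus_left sum_negf sum_distrib_left mult.left_commute)
    also have "\<dots> = (\<Sum>i<j - 1. (- of_real (al - be * (-1) ^ i)) * L1 al be (\<lambda>z. f z * (z ^ (j - 1 - 1 - i) * cnj z ^ i)))"
      by (rule LL_lincomb[OF al be finite_lessThan fm])
    also have "\<dots> = 0"
      by (rule sum.neutral) (use False j in \<open>auto simp: low\<close>)
    finally have "of_real (real m + real (j - 1) + 1 + 2 * (al + be)) * L1 al be (\<lambda>z. z * f z * z ^ (j - 1)) = 0" by simp
    moreover have "complex_of_real (real m + real (j - 1) + 1 + 2 * (al + be)) \<noteq> 0"
      unfolding of_real_eq_0_iff using al be by (simp add: add_pos_nonneg less_imp_neq[THEN not_sym])
    ultimately have "L1 al be (\<lambda>z. z * f z * z ^ (j - 1)) = 0" by simp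
    moreover have "(\<lambda>z. z * f z * z ^ (j - 1)) = (\<lambda>z. f z * z ^ j)"
      using j by (cases j) (auto simp: fun_eq_iff)
    ultimately show ?thesis by simp
  qed
  \<comment> \<open>On the circle z cnj z^(j+1) = cnj z^j, so the same integral appears on both
    sides of the Leibniz formula. The coefficients differ by m - j, which is nonzero for j <
    m.\<close>
  have B: "L1 al be (\<lambda>z. f z * cnj z ^ j) = 0" if j: "j < m"
  proof -
    have d: "m + Suc j = Suc (m + j)" by simp
    have "of_real (real m + real (Suc j) + 1 + 2 * (al + be)) * L1 al be (\<lambda>z. z * f z * cnj z ^ Suc j) =
      2 * L1 al be (\<lambda>z. f z * (of_real (real j + 1 + al + be) * cnj z ^ j + (\<Sum>i<j. of_real (al + be * (-1) ^ (j - i)) * (z ^ (j - i) * cnj z ^ i))))"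
      by (rule L1_leibniz[OF al be f _ d Tf _ Tb_cnj_pow])
         (use hp_power[OF hp_ident(2), of "Suc j"] in \<open>auto intro!: continuous_intros\<close>)
    also have "L1 al be (\<lambda>z. f z * (of_real (real j + 1 + al + be) * cnj z ^ j + (\<Sum>i<j. of_real (al + be * (-1) ^ (j - i)) * (z ^ (j - i) * cnj z ^ i)))) = 
      L1 al be (\<lambda>z. of_real (real j + 1 + al + be) * (f z * cnj z ^ j) + 1 * (\<Sum>i<j. of_real (al + be * (-1) ^ (j - i)) * (f z * (z ^ (j - i) * cnj z ^ i))))"
      by (rule LL_cong) (simp add: sum_distrib_left algebra_simps)
    also have "\<dots> = of_real (real j + 1 + al + be) * L1 al be (\<lambda>z. f z * cnj z ^ j) + 1 * L1 al be (\<lambda>z. \<Sum>i<j. of_real (al + be * (-1) ^ (j - i)) * (f z * (z ^ (j - i) * cnj z ^ i)))"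
      by (rule LL_lin[OF al be]) (intro continuous_intros fc)+
    also have "L1 al be (\<lambda>z. \<Sum>i<j. of_real (al + be * (-1) ^ (j - i)) * (f z * (z ^ (j - i) * cnj z ^ i))) = 
       (\<Sum>i<j. of_real (al + be * (-1) ^ (j - i)) * L1 al be (\<lambda>z. f z * (z ^ (j - i) * cnj z ^ i)))"
      by (rule LL_lincomb[OF al be finite_lessThan fm])
    also have "\<dots> = 0"
    proof (rule sum.neutral, rule ballI)
      fix i assume i: "i \<in> {..<j}"
      show "of_real (al + be * (-1) ^ (j - i)) * L1 al be (\<lambda>z. f z * (z ^ (j - i) * cnj z ^ i)) = 0"
      proof (cases "i = 0")
        \<comment> \<open>The term i = 0 is the power z^j itself, of exponent j rather than less, so
          the first claim is needed at this very j.\<close>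
        case True
        then show ?thesis using A i j by simp
      next
        case False
        then show ?thesis using i j by (simp add: low)
      qed
    qed
    also have "L1 al be (\<lambda>z. z * f z * cnj z ^ Suc j) = L1 al be (\<lambda>z. f z * cnj z ^ j)"
    proof (rule LL_cong)
      fix z assume "cmod z = 1"
      then have 1: "z * cnj z = 1" by (rule unit_cnj)
      have "z * f z * cnj z ^ Suc j = (z * cnj z) * (f z * cnj z ^ j)" by simp
      then show "z * f z * cnj z ^ Suc j = f z * cnj z ^ j" unfolding 1 by simp
    qed
    finally have "of_real (real m + real (Suc j) + 1 + 2 * (al + be)) * L1 al be (\<lambda>z. f z * cnj z ^ j) = 
      of_real (2 * (real j + 1 + al + be)) * L1 al be (\<lambda>z. f z * cnj z ^ j)" by simp
    then have "(of_real (real m + real (Suc j) + 1 + 2 * (al + be)) - of_real (2 * (real j + 1 + al + be))) * L1 al be (\<lambda>z. f z * cnj z ^ j) = 0"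
      by (simp only: left_diff_distrib) simp
    moreover have "of_real (real m + real (Suc j) + 1 + 2 * (al + be)) - of_real (2 * (real j + 1 + al + be)) = (of_real (real m - real j) :: complex)"
      unfolding of_real_diff[symmetric] by (rule arg_cong[where f = of_real]) simp
    ultimately have "of_real (real m - real j) * L1 al be (\<lambda>z. f z * cnj z ^ j) = 0" by simp
    moreover have "complex_of_real (real m - real j) \<noteq> 0" unfolding of_real_eq_0_iff using j by simp
    ultimately show ?thesis by simp
  qed
  show ?case
  proof (intro conjI impI)
    assume "j \<le> Suc m" "0 < j + m"
    then show "L1 al be (\<lambda>z. f z * z ^ j) = 0" using A B by (cases "j = 0") auto
  qed (rule B)
qed

section \<open>The reproducing kernel\<close>

text \<open>Shifting t by 2 pi / k leaves g(k t) unchanged and multiplies the exponential by a root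
  of unity, which differs from 1 unless k divides p.\<close>

lemma integral_cis_multiple:
  fixes g :: "real \<Rightarrow> complex"
  assumes cont: "continuous_on UNIV g" and per: "\<And>t. g (t + 2 * pi) = g t" and k: "k > 0"
  shows "integral {0..2 * pi} (\<lambda>t. cis (of_int p * t) * g (real k * t)) =
    (if int k dvd p then integral {0..2 * pi} (\<lambda>t. cis (of_int (p div int k) * t) * g t) else 0)"
proof (cases "int k dvd p")
  case True
  then obtain q where q: "p = int k * q" by auto
  have "integral {0..2 * pi} (\<lambda>t. cis (of_int q * (real k * t)) * g (real k * t)) = integral {0..2 * pi} (\<lambda>t. cis (of_int q * t) * g t)"
  proof (rule integral_periodic_multiple[where f = "\<lambda>t. cis (of_int q * t) * g t"])
    show "continuous_on UNIV (\<lambda>t. cis (of_int q * t) * g t)" by (intro continuous_intros cont)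
    show "cis (of_int q * (t + 2 * pi)) * g (t + 2 * pi) = cis (of_int q * t) * g t" for t
    proof -
      have "cis (of_int q * (t + 2 * pi)) = cis (of_int q * t) * cis (2 * pi * of_int q)" by (simp add: cis_mult algebra_simps)
      then show ?thesis by (simp add: per)
    qed
  qed (use k in auto)
  then show ?thesis using k q by (simp add: mult_ac)
next
  case False
  define c where "c = 2 * pi / real k"
  let ?f = "\<lambda>t. cis (of_int p * t) * g (real k * t)"
  have gk: "continuous_on UNIV (\<lambda>t. g (real k * t))"
    by (rule continuous_on_compose2[OF cont]) (auto intro!: continuous_intros)
  have fc: "continuous_on UNIV ?f" by (intro continuous_intros gk)
  have gper: "g (t + 2 * pi * real n) = g t" for t n
  proof (induction n)
    case (Suc n)
    then show ?case using per[of "t + 2 * pi * real n"] by (simp add: algebra_simps)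
  qed simp
  have fp: "?f (t + 2 * pi) = ?f t" for t
  proof -
    have "cis (of_int p * (t + 2 * pi)) = cis (of_int p * t) * cis (2 * pi * of_int p)" by (simp add: cis_mult algebra_simps)
    then have "cis (of_int p * (t + 2 * pi)) = cis (of_int p * t)" by simp
    moreover have "real k * (t + 2 * pi) = real k * t + 2 * pi * real k" by (simp add: algebra_simps)
    ultimately show ?thesis using gper[of "real k * t" k] by (simp only:)
  qed
  have "?f (t + c) = cis (of_int p * c) * ?f t" for t
  proof -
    have "real k * (t + c) = real k * t + 2 * pi" using k by (simp add: c_def field_simps)
    moreover have "cis (of_int p * (t + c)) = cis (of_int p * t) * cis (of_int p * c)" by (simp add: cis_mult algebra_simps)
    ultimately show ?thesis by (simp add: per)
  qed
  then have "integral {0..2 * pi} (\<lambda>t. cis (of_int p * c) * ?f t) = integral {0..2*pi} ?f"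
    using integral_periodic_shift[OF fc fp, of c] by simp
  then have "cis (of_int p * c) * integral {0..2*pi} ?f = integral {0..2*pi} ?f" by simp
  moreover have "cis (of_int p * c) \<noteq> 1"
  proof
    assume "cis (of_int p * c) = 1"
    then have "cos (of_int p * c) = 1" by (simp add: complex_eq_iff)
    then obtain n :: int where "of_int p * c = of_int n * 2 * pi" by (auto simp: cos_one_2pi_int)
    then have "(of_int p :: real) = of_int n * real k" using k by (simp add: c_def field_simps)
    then have "(of_int p :: real) = of_int (n * int k)" by simp
    then have "p = n * int k" by (simp only: of_int_eq_iff)
    then show False using False by simp
  qed
  ultimately show ?thesis using False by simp
qed

lemma unit_pow_mult:
  assumes "cmod z = 1" shows "z ^ p * cnj z ^ q = (if q \<le> p then z ^ (p - q) else cnj z ^ (q - p))"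
proof -
  have 1: "z * cnj z = 1" by (rule unit_cnj[OF assms])
  show ?thesis
  proof (cases "q \<le> p")
    case True
    then have "z ^ p = z ^ (p - q) * z ^ q" by (simp flip: power_add)
    then have "z ^ p * cnj z ^ q = z ^ (p - q) * (z * cnj z) ^ q" by (simp add: power_mult_distrib)
    then show ?thesis using True 1 by simp
  next
    case False
    then have "cnj z ^ q = cnj z ^ (q - p) * cnj z ^ p" by (simp flip: power_add)
    then have "z ^ p * cnj z ^ q = cnj z ^ (q - p) * (z * cnj z) ^ p" by (simp add: power_mult_distrib)
    then show ?thesis using False 1 by simp
  qed
qed

lemma hp_circle_0:
  assumes "hp n f" "\<And>z. cmod z = 1 \<Longrightarrow> f z = 0" shows "f z = 0"
proof (cases "z = 0")
  case True
  then have "f z = f (of_real 0 * 1)" by simp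
  also have "\<dots> = of_real 0 ^ n * f 1" by (rule hp_homogeneous[OF assms(1)])
  also have "f 1 = 0" by (rule assms(2)) simp
  finally show ?thesis by simp
next
  case False
  then have "f z = f (of_real (cmod z) * (z / of_real (cmod z)))" by simp
  also have "\<dots> = of_real (cmod z) ^ n * f (z / of_real (cmod z))" by (rule hp_homogeneous[OF assms(1)])
  also have "f (z / of_real (cmod z)) = 0" by (rule assms(2)) (use False in \<open>simp add: norm_divide\<close>)
  finally show ?thesis by simp
qed

text \<open>G is a finite sum of monomials in z with coefficients in x, so integrating over x just
  replaces each coefficient by a number. In this way \<open>SS\<close> passes under the integral by
  linearity.\<close>

lemma LL_hpp:
  assumes "al > 0" "be \<ge> 0" "hpp n G" "continuous_on UNIV f"
  shows "hp n (\<lambda>z. LL al be k (\<lambda>x. f x * G z x))"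
    and "off_lines N z \<Longrightarrow> (\<And>x. cmod x = 1 \<Longrightarrow> SS N ka (\<lambda>z. G z x) z = 0) \<Longrightarrow> SS N ka (\<lambda>z. LL al be k (\<lambda>x. f x * G z x)) z = 0"
proof -
  obtain c where c: "\<And>i. continuous_on UNIV (c i)" "\<And>z x. G z x = (\<Sum>i\<le>n. c i x * (z ^ (n - i) * cnj z ^ i))"
    using assms(3) by (auto simp: hpp_def)
  have fc: "continuous_on UNIV (\<lambda>x. f x * c i x)" for i by (intro continuous_on_mult assms c)
  have L: "LL al be k (\<lambda>x. \<Sum>i\<le>n. m i * (f x * c i x)) = (\<Sum>i\<le>n. m i * LL al be k (\<lambda>x. f x * c i x))" for m
    by (rule LL_lincomb[OF assms(1,2) finite_atMost fc])
  have eq: "LL al be k (\<lambda>x. f x * G z x) = (\<Sum>i\<le>n. LL al be k (\<lambda>x. f x * c i x) * (z ^ (n - i) * cnj z ^ i))" for z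
    using L[of "\<lambda>i. z ^ (n - i) * cnj z ^ i"] unfolding c(2) sum_distrib_left by (simp only: mult_ac)
  show "hp n (\<lambda>z. LL al be k (\<lambda>x. f x * G z x))"
    unfolding eq by (intro hp_sum hp_cmult hp_mono) simp
  assume z: "off_lines N z" and 0: "\<And>x. cmod x = 1 \<Longrightarrow> SS N ka (\<lambda>z. G z x) z = 0"
  let ?m = "\<lambda>i z::complex. z ^ (n - i) * cnj z ^ i"
  have hm: "hp n (?m i)" if "i \<in> {..n}" for i using that by (intro hp_mono) simp
  have S: "SS N ka (\<lambda>z. \<Sum>i\<le>n. d i * ?m i z) z = (\<Sum>i\<le>n. d i * SS N ka (?m i) z)" for d
    by (subst SS_sum[OF finite_atMost hp_cmult[OF hm] z]) (auto intro!: sum.cong SS_cmult[OF hm z])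
  have "SS N ka (\<lambda>z. LL al be k (\<lambda>x. f x * G z x)) z = (\<Sum>i\<le>n. SS N ka (?m i) z * LL al be k (\<lambda>x. f x * c i x))"
    unfolding eq S by (simp only: mult_ac)
  also have "\<dots> = LL al be k (\<lambda>x. \<Sum>i\<le>n. SS N ka (?m i) z * (f x * c i x))"
    by (rule L[symmetric])
  also have "\<dots> = LL al be k (\<lambda>x. 0 * f x)"
  proof (rule LL_cong)
    fix x :: complex assume "cmod x = 1"
    then have "(\<Sum>i\<le>n. c i x * SS N ka (?m i) z) = 0" using 0 unfolding c(2) S by blast
    then have "f x * (\<Sum>i\<le>n. c i x * SS N ka (?m i) z) = 0" by simp
    then show "(\<Sum>i\<le>n. SS N ka (?m i) z * (f x * c i x)) = 0 * f x" by (simp add: sum_distrib_left mult_ac)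
  qed
  also have "\<dots> = 0" by (subst LL_cmult) simp
  finally show "SS N ka (\<lambda>z. LL al be k (\<lambda>x. f x * G z x)) z = 0" .
qed

lemma dd_sym: "cmod z = 1 \<Longrightarrow> cmod x = 1 \<Longrightarrow> cnj (dd al be m x z) = dd al be m z x"
  using VV_sym[of z x al be] unit_cnj[of z] unit_cnj[of x] by (simp add: dd_def mult.commute)

definition FF :: "real \<Rightarrow> real \<Rightarrow> nat \<Rightarrow> nat \<Rightarrow> complex \<Rightarrow> complex \<Rightarrow> complex" where
  "FF al be k n z x = (z * cnj x) ^ (n mod k) * dd al be (n div k) (z ^ k) (x ^ k)"

text \<open>This is the sum of (cnj z x)^(n-j) F_j over j \<le> n. On the circle it reproduces every
  homogeneous polynomial of degree n, harmonic or not (\<open>Lk_KK\<close>).\<close>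

fun KK :: "real \<Rightarrow> real \<Rightarrow> nat \<Rightarrow> nat \<Rightarrow> complex \<Rightarrow> complex \<Rightarrow> complex" where
  "KK al be k 0 z x = FF al be k 0 z x"
| "KK al be k (Suc n) z x = FF al be k (Suc n) z x + cnj z * x * KK al be k n z x"

definition PP :: "real \<Rightarrow> real \<Rightarrow> nat \<Rightarrow> nat \<Rightarrow> complex \<Rightarrow> complex \<Rightarrow> complex" where
  "PP al be k n z x = FF al be k n z x + (if n = 0 then 0 else cnj z * x * cnj (FF al be k (n - 1) z x))"

lemma FF_0 [simp]: "FF al be k 0 z x = 1"
  by (simp add: FF_def dd_def)

lemma hpp_FF: "hpp n (FF al be k n)"
proof -
  have p: "continuous_on UNIV (\<lambda>x::complex. x ^ k)" by (intro continuous_intros)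
  have "hpp (n mod k) (\<lambda>z x. cnj x ^ (n mod k) * z ^ (n mod k))"
    using hpp_power[OF hpp_ident(1), of "n mod k"] by (intro hpp_scale continuous_intros) simp
  then have 1: "hpp (n mod k) (\<lambda>z x. (z * cnj x) ^ (n mod k))" by (simp add: power_mult_distrib mult.commute)
  have "hpp (n mod k + k * (n div k)) (\<lambda>z x. (z * cnj x) ^ (n mod k) * dd al be (n div k) (z ^ k) (x ^ k))"
    by (rule hpp_mult[OF 1 hpp_compose_power[OF hpp_dd p]])
  then show ?thesis by (simp add: FF_def[abs_def])
qed

lemma hpp_mult_cnj: "hpp n F \<Longrightarrow> hpp (Suc n) (\<lambda>z x. cnj z * x * F z x)"
  using hpp_scale[of "\<lambda>x. x", OF _ hpp_mult[OF hpp_ident(2)], of n F] by (simp add: mult_ac)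

lemma hpp_KK: "hpp n (KK al be k n)"
proof (induction n)
  case 0
  have "hpp 0 (\<lambda>z x. KK al be k 0 z x)" using hpp_coeff[of "\<lambda>_. 1"] by simp
  then show ?case by simp
next
  case (Suc n)
  have "hpp (Suc n) (\<lambda>z x. KK al be k (Suc n) z x)"
    unfolding KK.simps by (rule hpp_add[OF hpp_FF hpp_mult_cnj[OF Suc]])
  then show ?case by simp
qed

lemma hpp_PP: "hpp n (PP al be k n)"
proof (cases n)
  case 0
  have "hpp 0 (\<lambda>z x. PP al be k 0 z x)" using hpp_coeff[of "\<lambda>_. 1"] by (simp add: PP_def)
  then show ?thesis using 0 by simp
next
  case (Suc m)
  have "hpp (Suc m) (\<lambda>z x. FF al be k (Suc m) z x + cnj z * x * cnj (FF al be k m z x))"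
    by (rule hpp_add[OF hpp_FF hpp_mult_cnj[OF hpp_cnj[OF hpp_FF]]])
  then show ?thesis using Suc by (simp add: PP_def[abs_def])
qed

lemma FF_sym: "cmod z = 1 \<Longrightarrow> cmod x = 1 \<Longrightarrow> cnj (FF al be k n x z) = FF al be k n z x"
  by (simp add: FF_def dd_sym norm_power mult.commute)

lemma KK_sym: "cmod z = 1 \<Longrightarrow> cmod x = 1 \<Longrightarrow> cnj (KK al be k n x z) = KK al be k n z x"
  by (induction n) (simp_all add: FF_sym mult.commute)

lemma PP_sym: "cmod z = 1 \<Longrightarrow> cmod x = 1 \<Longrightarrow> cnj (PP al be k n x z) = PP al be k n z x"
  using FF_sym[of z x al be k] FF_sym[of x z al be k] by (simp add: PP_def mult.commute)

text \<open>If k does not divide n, then F_n = z cnj x F_(n-1) and the two summands of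
  \<open>PP\<close> are conjugate to each other. If n = k m > 0, the terms with V(m-1) cancel and
  V(m) - |z^k|^2 V(m-2) remains, where V(-1) is read as 0.\<close>

lemma PP_real:
  assumes x: "cmod x = 1" and k: "k > 0" shows "cnj (PP al be k n z x) = PP al be k n z x"
proof (cases n)
  case 0 then show ?thesis by (simp add: PP_def)
next
  case (Suc p)
  show ?thesis
  proof (cases "Suc p mod k = 0")
    case True
    define m where "m = Suc p div k"
    have n: "Suc p = m * k" using True by (auto simp: m_def)
    then obtain m' where m: "m = Suc m'" by (cases m) auto
    have p: "Suc p = k * m' + k" using n m by (simp add: algebra_simps)
    have pd1: "p div k = m'" by (rule div_nat_eqI) (use p k in auto)
    have pd: "p div k = m'" "p mod k = k - 1"
      using pd1 p k minus_mult_div_eq_mod[of p k] by auto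
    let ?y = "(z * cnj x) ^ k"
    have yy: "?y * cnj ?y = z ^ k * cnj z ^ k"
    proof -
      have "?y * cnj ?y = (z * cnj z * (x * cnj x)) ^ k" by (simp add: power_mult_distrib mult_ac)
      then show ?thesis unfolding unit_cnj[OF x] by (simp add: power_mult_distrib)
    qed
    have "cnj z * x * cnj ((z * cnj x) ^ (k - 1)) = cnj ?y" using k by (cases k) (simp_all add: mult_ac)
    then have "PP al be k n z x = VV al be m (z ^ k) (x ^ k) - cnj ?y * VV al be m' (z ^ k) (x ^ k)
      + cnj ?y * (VV al be m' (z ^ k) (x ^ k) - ?y * (if m' = 0 then 0 else VV al be (m' - 1) (z ^ k) (x ^ k)))"
      unfolding PP_def FF_def Suc using True m
      by (simp add: m_def[symmetric] pd dd_def power_mult_distrib mult.assoc[symmetric])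
    also have "\<dots> = VV al be m (z ^ k) (x ^ k) - (z ^ k * cnj z ^ k) * (if m' = 0 then 0 else VV al be (m' - 1) (z ^ k) (x ^ k))"
      unfolding yy[symmetric] by (simp add: algebra_simps)
    finally have e: "PP al be k n z x = \<dots>" .
    show ?thesis unfolding e by (simp add: mult.commute)
  next
    case False
    then have "Suc p mod k = Suc (p mod k)" "Suc p div k = p div k"
      by (auto simp: mod_Suc div_Suc split: if_splits)
    then have "FF al be k (Suc p) z x = z * cnj x * FF al be k p z x"
      by (simp add: FF_def mult.assoc)
    then show ?thesis by (simp add: PP_def Suc)
  qed
qed

text \<open>Reality and the difference formula need each other: as K_(n-1) is real it may be
  conjugated in the recursion for K_n, which produces cnj F_(n-1) and z cnj x K_(n-2).\<close>

lemma KK_PP: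
  assumes x: "cmod x = 1" and k: "k > 0"
  shows "cnj (KK al be k n z x) = KK al be k n z x \<and>
     KK al be k n z x = PP al be k n z x + (if n < 2 then 0 else z * cnj z * KK al be k (n - 2) z x)"
proof (induction n rule: less_induct)
  case (less n)
  consider "n = 0" | "n = 1" | p where "n = Suc (Suc p)" by (metis One_nat_def not0_implies_Suc)
  then show ?case
  proof cases
    case 1 then show ?thesis by (simp add: PP_def)
  next
    case 2
    have "KK al be k 1 z x = PP al be k 1 z x" by (simp add: PP_def)
    then show ?thesis using 2 PP_real[OF x k] by simp
  next
    case 3
    have r: "cnj (KK al be k p z x) = KK al be k p z x" "cnj (KK al be k (Suc p) z x) = KK al be k (Suc p) z x"
      by (rule less[THEN conjunct1], simp add: 3)+
    have "KK al be k n z x = FF al be k n z x + cnj z * x * cnj (KK al be k (Suc p) z x)"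
      unfolding r(2) using 3 by simp
    also have "\<dots> = PP al be k n z x + (z * cnj z) * (x * cnj x) * KK al be k p z x"
      using 3 by (simp add: PP_def r(1) algebra_simps)
    finally have e: "KK al be k n z x = PP al be k n z x + z * cnj z * KK al be k p z x"
      by (simp add: unit_cnj[OF x])
    moreover have "cnj (KK al be k n z x) = KK al be k n z x"
      unfolding e complex_cnj_add complex_cnj_mult r(1) PP_real[OF x k] complex_cnj_cnj by (simp only: mult_ac)
    ultimately show ?thesis using 3 by (simp del: KK.simps)
  qed
qed

text \<open>Covers I_2k and, with be = 0, the odd I_k. The assumption \<open>red\<close> says that
  the reflection part of the conjugate operator, applied to z^r h(z^k), collapses to that of I_2
  applied to h at z^k. All that follows depends on the group through these assumptions
  alone.\<close>

locale dih =
  fixes k N :: nat and ka :: "nat \<Rightarrow> real" and al be :: real and w :: "complex \<Rightarrow> real"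
  assumes k: "k > 0" and N: "N > 0" and al: "al > 0" and be: "be \<ge> 0"
    and ka: "\<forall>j<N. ka j \<ge> 0" and kasum: "(\<Sum>j<N. ka j) = real k * (al + be)"
    and off: "\<And>z. off_lines N z \<Longrightarrow> reg 2 (kap2 al be) (z ^ k)"
    and red: "\<And>z r h. off_lines N z \<Longrightarrow> r < k \<Longrightarrow>
      (\<Sum>j<N. of_real (ka j) * eps N j * dq N j (\<lambda>z. z ^ r * h (z ^ k)) z) =
      of_nat k * z ^ r * cnj z ^ (k - 1) * (\<Sum>j<2. of_real (kap2 al be j) * eps 2 j * dq 2 j h (z ^ k))"
    and wt: "\<And>t. w (cis t) = w1 al be (real k * t)"
begin

lemma Tb_red:
  assumes "off_lines N z" "r < k" "wd h (z ^ k)"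
  shows "Tb N ka (\<lambda>z. z ^ r * h (z ^ k)) z = of_nat k * z ^ r * cnj z ^ (k - 1) * Tb 2 (kap2 al be) h (z ^ k)"
proof -
  have "wirt (\<lambda>z. h (z ^ k)) (dz h (z ^ k) * (of_nat k * z ^ (k - 1))) (dzb h (z ^ k) * (of_nat k * cnj z ^ (k - 1))) z"
    using wirt_compose[OF wirt_power wd_wirt[OF assms(3)]] by simp
  from wirt_dz(2)[OF wirt_mult[OF wirt_power[of r] this]]
  have "dzb (\<lambda>z. z ^ r * h (z ^ k)) z = of_nat k * z ^ r * cnj z ^ (k - 1) * dzb h (z ^ k)" by (simp add: mult_ac)
  then show ?thesis unfolding Tb_def[of N] red[OF assms(1,2)] by (simp add: Tb_def right_diff_distrib)
qed

lemma Tb_FF: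
  assumes z: "off_lines N z" and x: "cmod x = 1"
  shows "Tb N ka (\<lambda>z. FF al be k n z x) z = 0"
proof -
  have h: "wd (\<lambda>y. dd al be (n div k) y (x ^ k)) (z ^ k)" by (rule hp_wd[OF hpp_hp[OF hpp_dd]])
  have "Tb N ka (\<lambda>z. cnj x ^ (n mod k) * (z ^ (n mod k) * dd al be (n div k) (z ^ k) (x ^ k))) z = 
    cnj x ^ (n mod k) * (of_nat k * z ^ (n mod k) * cnj z ^ (k - 1) * Tb 2 (kap2 al be) (\<lambda>y. dd al be (n div k) y (x ^ k)) (z ^ k))"
  proof (subst T_cmult)
    have "hp n (\<lambda>z. FF al be k n z 1)" by (rule hpp_hp[OF hpp_FF])
    have "hp (n mod k + k * (n div k)) (\<lambda>z. z ^ (n mod k) * dd al be (n div k) (z ^ k) (x ^ k))"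
      using hp_power[OF hp_ident(1), of "n mod k"] hpp_hp[OF hpp_compose_power[OF hpp_dd continuous_on_id, where k = k]]
      by (intro hp_mult) simp_all
    then show "wd (\<lambda>z. z ^ (n mod k) * dd al be (n div k) (z ^ k) (x ^ k)) z" by (rule hp_wd)
  qed (simp add: Tb_red[OF z _ h] k)
  also have "Tb 2 (kap2 al be) (\<lambda>y. dd al be (n div k) y (x ^ k)) (z ^ k) = 0"
  proof (rule Tb_dd[OF off[OF z]])
    show "x ^ k * cnj (x ^ k) = 1" using unit_cnj[of "x ^ k"] x by (simp add: norm_power)
  qed (use al be in auto)
  finally show ?thesis by (simp add: FF_def power_mult_distrib mult_ac)
qed

text \<open>\<open>Tb\<close> annihilates F_n and maps the conjugate half to a multiple of cnj
  F_(n-1), which \<open>Tz\<close> annihilates. The other order of the operators follows by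
  conjugation because P is real.\<close>

lemma SS_PP:
  assumes z: "off_lines N z" and x: "cmod x = 1"
  shows "SS N ka (\<lambda>z. PP al be k n z x) z = 0"
proof -
  note T0 = T_const
  have hP: "hp n (\<lambda>z. PP al be k n z x)" by (rule hpp_hp[OF hpp_PP])
  have T: "Tz N ka (Tb N ka (\<lambda>z. PP al be k n z x)) z = 0"
  proof (cases n)
    case 0
    have "Tb N ka (\<lambda>z. 1) = (\<lambda>_. 0)" by (rule ext) (rule T_const)
    then have "Tb N ka (\<lambda>z. PP al be k n z x) = (\<lambda>_. 0)" using 0 by (simp add: PP_def)
    then show ?thesis by (simp add: T_const)
  next
    case (Suc p)
    have hF: "hp p (\<lambda>z. FF al be k p z x)" "hp n (\<lambda>z. FF al be k n z x)" by (rule hpp_hp[OF hpp_FF])+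
    let ?C = "x * (of_nat p + 1 + of_real (\<Sum>j<N. ka j))"
    have "Tb N ka (\<lambda>z. PP al be k n z x) w = ?C * cnj (FF al be k p w x)" if w: "off_lines N w" for w
    proof -
      have w1: "wd (\<lambda>z. FF al be k n z x) w" "wd (\<lambda>z. z * FF al be k p z x) w" by (intro wd_mult wd_ident hp_wd[OF hF(1)] hp_wd[OF hF(2)])+
      have "(\<lambda>z. PP al be k n z x) = (\<lambda>z. 1 * FF al be k n z x + x * cnj (z * FF al be k p z x))"
        by (simp add: PP_def Suc fun_eq_iff mult_ac)
      then have "Tb N ka (\<lambda>z. PP al be k n z x) w = 1 * Tb N ka (\<lambda>z. FF al be k n z x) w + x * Tb N ka (\<lambda>z. cnj (z * FF al be k p z x)) w"
        using T_lin(2)[OF w1(1) wd_cnj[OF w1(2)], of N ka 1 x] by simp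
      then show ?thesis
        using Tb_FF[OF w x] T_cnj(2)[OF w1(2), of N ka] Tz_mult_of_Tb_0[OF hF(1) off_lines_reg[OF w] Tb_FF[OF w x]] by simp
    qed
    then have "Tz N ka (Tb N ka (\<lambda>z. PP al be k n z x)) z = Tz N ka (\<lambda>z. ?C * cnj (FF al be k p z x)) z"
      by (intro T_cong(1)[OF z] hp_Twd(2)[OF hP z])
    also have "\<dots> = ?C * cnj (Tb N ka (\<lambda>z. FF al be k p z x) z)"
      using T_cmult(1)[OF wd_cnj[OF hp_wd[OF hF(1)]], of N ka ?C z] T_cnj(1)[OF hp_wd[OF hF(1)], of N ka z] by simp
    finally show ?thesis using Tb_FF[OF z x] by simp
  qed
  have r: "(\<lambda>z. PP al be k n z x) = (\<lambda>z. cnj (PP al be k n z x))" using PP_real[OF x k] by simp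
  have "Tz N ka (\<lambda>z. PP al be k n z x) w = cnj (Tb N ka (\<lambda>z. PP al be k n z x) w)" for w
    by (subst r, rule T_cnj(1)[OF hp_wd[OF hP]])
  then have "Tb N ka (Tz N ka (\<lambda>z. PP al be k n z x)) z = cnj (Tz N ka (Tb N ka (\<lambda>z. PP al be k n z x)) z)"
  proof -
    have fe: "Tz N ka (\<lambda>z. PP al be k n z x) = (\<lambda>w. cnj (Tb N ka (\<lambda>z. PP al be k n z x) w))"
      by (rule ext) fact
    show ?thesis unfolding fe by (rule T_cnj(2)[OF hp_Twd(2)[OF hP z]])
  qed
  then show ?thesis by (simp add: SS_def T)
qed

text \<open>The Fourier filter of \<open>integral_cis_multiple\<close> leads back to I_2. For j
  \<le> n = k m + r the exponent q = (r + j)/k satisfies k q \<le> k m + 2 r < k (m + 2), so q may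
  be as large as m + 1.\<close>

lemma FF_orth:
  assumes x: "cmod x = 1"
  shows "(j \<le> n \<longrightarrow> 0 < n \<longrightarrow> LL al be k (\<lambda>z. FF al be k n z x * z ^ j) = 0) \<and>
    (j < n \<longrightarrow> LL al be k (\<lambda>z. FF al be k n z x * cnj z ^ j) = 0)"
proof -
  define m where "m = n div k"
  define r where "r = n mod k"
  have n: "n = k * m + r" and r: "r < k" using k by (simp_all add: m_def r_def)
  let ?d = "\<lambda>z. dd al be m z (x ^ k)"
  have hd: "hp m ?d" by (rule hpp_hp[OF hpp_dd])
  have Td: "Tb 2 (kap2 al be) ?d z = 0" if "off_lines 2 z" for z
    by (rule Tb_dd[OF off_lines_reg[OF that]]) (use al be unit_cnj[of "x ^ k"] x in \<open>auto simp: norm_power\<close>)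
  note orth = L1_orth[OF al be hd Td]
  define g where "g t = ?d (cis t) * of_real (w1 al be t)" for t
  have gc: "continuous_on UNIV g" using LL_integrand_cont[OF al be hp_continuous[OF hd], of UNIV "Suc 0"] by (simp add: g_def[abs_def])
  have gp: "g (t + 2 * pi) = g t" for t using cis_mult[of t "2 * pi"] by (simp add: g_def)
  have key: "integral {0..2 * pi} (\<lambda>t. FF al be k n (cis t) x * cis (of_int p * t) * of_real (w1 al be (real k * t))) =
     cnj x ^ r * (if int k dvd int r + p then integral {0..2 * pi} (\<lambda>t. cis (of_int ((int r + p) div int k) * t) * g t) else 0)" for p
  proof -
    have "FF al be k n (cis t) x * cis (of_int p * t) * of_real (w1 al be (real k * t)) = cnj x ^ r * (cis (of_int (int r + p) * t) * g (real k * t))" for t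
    proof -
      have "cis (of_int (int r + p) * t) = cis (real r * t) * cis (of_int p * t)" by (simp add: cis_mult algebra_simps)
      then have "cis (of_int (int r + p) * t) = cis t ^ r * cis (of_int p * t)" by (simp add: Complex.DeMoivre)
      then show ?thesis by (simp add: FF_def m_def[symmetric] r_def[symmetric] g_def Complex.DeMoivre power_mult_distrib)
    qed
    then show ?thesis using integral_cis_multiple[OF gc gp k, of "int r + p"] by simp
  qed
  have z: "LL al be k (\<lambda>z. FF al be k n z x * z ^ j) = 
     cnj x ^ r * (if k dvd r + j then L1 al be (\<lambda>z. ?d z * z ^ ((r + j) div k)) else 0)" for j
  proof -
    have "int k dvd int r + int j \<longleftrightarrow> k dvd r + j" by (metis of_nat_add of_nat_dvd_iff)
    moreover have "(int r + int j) div int k = int ((r + j) div k)" by (simp add: zdiv_int)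
    ultimately show ?thesis using key[of "int j"]
      by (simp add: LL_def g_def Complex.DeMoivre mult_ac)
  qed
  have zc: "LL al be k (\<lambda>z. FF al be k n z x * cnj z ^ j) = 
     cnj x ^ r * (if r \<le> j \<and> k dvd j - r then L1 al be (\<lambda>z. ?d z * cnj z ^ ((j - r) div k)) else 0)" for j
  proof (cases "r \<le> j")
    case True
    then have e: "int r + - int j = - int (j - r)" by simp
    have "int k dvd int r + - int j \<longleftrightarrow> k dvd j - r" unfolding e by simp
    moreover have "k dvd j - r \<Longrightarrow> (int r + - int j) div int k = - int ((j - r) div k)"
    proof -
      assume "k dvd j - r"
      then obtain q where q: "j - r = k * q" by auto
      have "int r + - int j = int k * (- int q)" unfolding e q by simp
      then show "(int r + - int j) div int k = - int ((j - r) div k)"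
        unfolding q using k nonzero_mult_div_cancel_left[of "int k" "- int q"] by simp
    qed
    moreover have "cnj (cis t) ^ i = cis (- (real i * t))" for i t by (simp add: cis_cnj Complex.DeMoivre)
    ultimately show ?thesis using key[of "- int j"] True
      by (auto simp: LL_def g_def mult_ac)
  next
    case False
    have "\<not> int k dvd int r + - int j"
    proof
      assume "int k dvd int r + - int j"
      moreover have "0 < int r + - int j" using False by simp
      ultimately have "int k \<le> int r + - int j" by (rule zdvd_imp_le)
      then show False using r by simp
    qed
    moreover have "cnj (cis t) ^ i = cis (- (real i * t))" for i t by (simp add: cis_cnj Complex.DeMoivre)
    ultimately show ?thesis using key[of "- int j"] False
      by (auto simp: LL_def mult_ac)
  qed
  show ?thesis
  proof (intro conjI impI)
    assume j: "j \<le> n" "0 < n"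
    show "LL al be k (\<lambda>z. FF al be k n z x * z ^ j) = 0"
    proof (cases "k dvd r + j")
      case True
      then obtain q where q: "r + j = k * q" by auto
      have "k * q < k * (m + 2)" using q j n r by (simp add: algebra_simps)
      then have "q < m + 2" by (simp only: mult_less_cancel1)
      then have "q \<le> Suc m" by simp
      moreover have "0 < q + m"
      proof (rule ccontr)
        assume "\<not> 0 < q + m"
        then have "n = 0" using q n by simp
        then show False using j by simp
      qed
      ultimately have "L1 al be (\<lambda>z. ?d z * z ^ q) = 0" using orth[of q] by simp
      then show ?thesis unfolding z using True q k by simp
    qed (simp add: z)
  next
    assume j: "j < n"
    show "LL al be k (\<lambda>z. FF al be k n z x * cnj z ^ j) = 0"
    proof (cases "r \<le> j \<and> k dvd j - r")
      case True
      then obtain q where q: "j - r = k * q" by auto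
      have "j = r + k * q" using q True by simp
      then have "k * q < k * m" using j n by linarith
      then have "q < m" by (simp only: mult_less_cancel1)
      then have "L1 al be (\<lambda>z. ?d z * cnj z ^ q) = 0" using orth[of q] by simp
      then show ?thesis unfolding zc using True q k by simp
    next
      case False
      then show ?thesis unfolding zc by (simp only: if_False mult_zero_right)
    qed
  qed
qed

section \<open>Reproducing properties of K and P\<close>

abbreviation "Lk \<equiv> LL al be k"

lemma Lk1_real: "cnj (Lk (\<lambda>z. 1)) = Lk (\<lambda>z. 1)"
  using LL_cnj[of al be k "\<lambda>z. 1"] by simp

text \<open>Since K is real, K_(n+1) = cnj F_(n+1) + z cnj x K_n. Against a monomial with at least
  one factor cnj z the first summand integrates to 0 and the second is the induction
  hypothesis.\<close>

lemma Lk_KK_mono: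
  assumes x: "cmod x = 1"
  shows "a + b = n \<Longrightarrow> Lk (\<lambda>z. z ^ a * cnj z ^ b * KK al be k n z x) = x ^ a * cnj x ^ b * Lk (\<lambda>z. 1)"
proof (induction n arbitrary: a b)
  case 0
  then show ?case by simp
next
  case (Suc n)
  have Kr: "cnj (KK al be k i z x) = KK al be k i z x" for i z using KK_PP[OF x k] by blast
  have A: "Lk (\<lambda>z. z ^ a * cnj z ^ Suc b * KK al be k (Suc n) z x) = x ^ a * cnj x ^ Suc b * Lk (\<lambda>z. 1)" if ab: "a + b = n" for a b
  proof -
    have c: "continuous_on UNIV (\<lambda>z. FF al be k i z x)" "continuous_on UNIV (\<lambda>z. KK al be k i z x)" for i
      by (rule hp_continuous[OF hpp_hp[OF hpp_FF]], rule hp_continuous[OF hpp_hp[OF hpp_KK]])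
    have "Lk (\<lambda>z. z ^ a * cnj z ^ Suc b * KK al be k (Suc n) z x) = 
       Lk (\<lambda>z. 1 * cnj (FF al be k (Suc n) z x * (z ^ Suc b * cnj z ^ a)) + cnj x * (z ^ a * cnj z ^ b * KK al be k n z x))"
    proof (rule LL_cong)
      fix z assume z: "cmod z = 1"
      have "KK al be k (Suc n) z x = cnj (FF al be k (Suc n) z x) + z * cnj x * KK al be k n z x"
        using arg_cong[OF KK.simps(2)[of al be k n z x], of cnj] unfolding Kr by (simp add: Kr del: KK.simps)
      then have "z ^ a * cnj z ^ Suc b * KK al be k (Suc n) z x = z ^ a * cnj z ^ Suc b * cnj (FF al be k (Suc n) z x)
         + (z * cnj z) * (cnj x * (z ^ a * cnj z ^ b * KK al be k n z x))"
        by (simp add: algebra_simps del: KK.simps)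
      then show "z ^ a * cnj z ^ Suc b * KK al be k (Suc n) z x = 1 * cnj (FF al be k (Suc n) z x * (z ^ Suc b * cnj z ^ a)) + cnj x * (z ^ a * cnj z ^ b * KK al be k n z x)"
        unfolding unit_cnj[OF z] by (simp add: mult_ac del: KK.simps)
    qed
    also have "\<dots> = 1 * Lk (\<lambda>z. cnj (FF al be k (Suc n) z x * (z ^ Suc b * cnj z ^ a))) + cnj x * Lk (\<lambda>z. z ^ a * cnj z ^ b * KK al be k n z x)"
      by (rule LL_lin[OF al be]) (intro continuous_intros c)+
    also have "Lk (\<lambda>z. cnj (FF al be k (Suc n) z x * (z ^ Suc b * cnj z ^ a))) = 0"
    proof -
      have "Lk (\<lambda>z. FF al be k (Suc n) z x * (z ^ Suc b * cnj z ^ a)) = 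
        (if a \<le> Suc b then Lk (\<lambda>z. FF al be k (Suc n) z x * z ^ (Suc b - a)) else Lk (\<lambda>z. FF al be k (Suc n) z x * cnj z ^ (a - Suc b)))"
        by (auto intro!: LL_cong simp: unit_pow_mult simp del: power_Suc)
      also have "\<dots> = 0" using FF_orth[OF x, of "Suc b - a" "Suc n"] FF_orth[OF x, of "a - Suc b" "Suc n"] ab by auto
      finally show ?thesis by (simp only: LL_cnj complex_cnj_zero)
    qed
    also have "Lk (\<lambda>z. z ^ a * cnj z ^ b * KK al be k n z x) = x ^ a * cnj x ^ b * Lk (\<lambda>z. 1)" by (rule Suc.IH[OF ab])
    finally show ?thesis by simp
  qed
  show ?case
  proof (cases b)
    case (Suc b')
    then show ?thesis using A[of a b'] Suc.prems by simp
  next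
    \<comment> \<open>The pure power z^(n+1) is the one monomial that is not orthogonal to cnj
      F_(n+1). It is obtained by conjugating the result for cnj z^(n+1).\<close>
    case 0
    then have a: "a = Suc n" using Suc.prems by simp
    have "Lk (\<lambda>z. z ^ a * cnj z ^ b * KK al be k (Suc n) z x) = Lk (\<lambda>z. cnj (z ^ 0 * cnj z ^ Suc n * KK al be k (Suc n) z x))"
      unfolding complex_cnj_mult Kr using 0 a by (simp add: mult_ac del: KK.simps)
    also have "\<dots> = cnj (x ^ 0 * cnj x ^ Suc n * Lk (\<lambda>z. 1))"
      unfolding LL_cnj by (subst A) auto
    finally show ?thesis using 0 a Lk1_real by simp
  qed
qed

lemma Lk_KK:
  assumes f: "hp n f" and x: "cmod x = 1"
  shows "Lk (\<lambda>z. f z * KK al be k n z x) = f x * Lk (\<lambda>z. 1)"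
proof -
  obtain c where c: "\<And>z. f z = (\<Sum>i\<le>n. c i * (z ^ (n - i) * cnj z ^ i))" using hp_coeffs[OF f] by blast
  have Kc: "continuous_on UNIV (\<lambda>z. KK al be k n z x)" by (rule hp_continuous[OF hpp_hp[OF hpp_KK]])
  have "Lk (\<lambda>z. \<Sum>i\<le>n. c i * (z ^ (n - i) * cnj z ^ i * KK al be k n z x)) = (\<Sum>i\<le>n. c i * Lk (\<lambda>z. z ^ (n - i) * cnj z ^ i * KK al be k n z x))"
    by (rule LL_lincomb[OF al be finite_atMost]) (intro continuous_intros Kc)
  also have "\<dots> = (\<Sum>i\<le>n. c i * (x ^ (n - i) * cnj x ^ i * Lk (\<lambda>z. 1)))"
    by (intro sum.cong refl) (subst Lk_KK_mono[OF x], auto)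
  finally show ?thesis unfolding c sum_distrib_right by (simp only: mult.assoc)
qed

text \<open>Let F and B be f integrated against P_n and K_(n-2). As K_n reproduces f, f - F = |z|^2
  B on the circle and, by homogeneity, everywhere. The left side is harmonic, so B = 0 by
  \<open>SS_rho_zero\<close> and f = F.\<close>

lemma Lk_PP:
  assumes f: "hp n f" and S: "\<And>z. off_lines N z \<Longrightarrow> SS N ka f z = 0" and x: "cmod x = 1"
  shows "Lk (\<lambda>z. f z * PP al be k n z x) = f x * Lk (\<lambda>z. 1)"
proof (cases "n < 2")
  case True
  then have "PP al be k n z x = KK al be k n z x" for z using KK_PP[OF x k, where n = n and z = z] by simp
  then show ?thesis using Lk_KK[OF f x] by simp
next
  case False
  then obtain p where p: "n = Suc (Suc p)" by (metis One_nat_def Suc_1 Suc_less_eq less_Suc_eq_0_disj not0_implies_Suc numeral_2_eq_2)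
  have fc: "continuous_on UNIV f" by (rule hp_continuous[OF f])
  define L where "L = Lk (\<lambda>z. 1)"
  have L0: "L \<noteq> 0" unfolding L_def by (rule LL_pos[OF al be k])
  define B where "B z = 1 / L * Lk (\<lambda>y. f y * KK al be k p z y)" for z
  define F where "F z = 1 / L * Lk (\<lambda>y. f y * PP al be k n z y)" for z
  have hB: "hp p B" unfolding B_def by (intro hp_cmult LL_hpp(1)[OF al be hpp_KK fc])
  have hF0: "hp n (\<lambda>z. Lk (\<lambda>y. f y * PP al be k n z y))" by (rule LL_hpp(1)[OF al be hpp_PP fc])
  have hF: "hp n F" unfolding F_def by (intro hp_cmult hF0)
  have SF: "SS N ka F z = 0" if z: "off_lines N z" for z
  proof -
    have "SS N ka (\<lambda>z. Lk (\<lambda>y. f y * PP al be k n z y)) z = 0"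
      by (rule LL_hpp(2)[OF al be hpp_PP fc z SS_PP[OF z]])
    then show ?thesis unfolding F_def SS_cmult[OF hF0 z] by simp
  qed
  have circ: "F z = 1 / L * Lk (\<lambda>y. f y * PP al be k n y z)" "F z = f z - z * cnj z * B z" if z: "cmod z = 1" for z
  proof -
    have sym: "PP al be k n z y = PP al be k n y z" "KK al be k i z y = KK al be k i y z" if y: "cmod y = 1" for y i
      using PP_sym[OF y z, where al = al and be = be and k = k and n = n] PP_real[OF y k, where al = al and be = be and z = z and n = n]
        KK_sym[OF y z, where al = al and be = be and k = k and n = i] KK_PP[OF y k, where al = al and be = be and z = z and n = i, THEN conjunct1] by simp_all
    show "F z = 1 / L * Lk (\<lambda>y. f y * PP al be k n y z)"
      unfolding F_def by (intro arg_cong2[where f = times] refl LL_cong) (simp add: sym)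
    also have "Lk (\<lambda>y. f y * PP al be k n y z) = Lk (\<lambda>y. f y * KK al be k n y z - f y * KK al be k p y z)"
    proof (rule LL_cong)
      fix y assume y: "cmod y = 1"
      have "KK al be k n y z = PP al be k n y z + y * cnj y * KK al be k p y z" using KK_PP[OF z k, where al = al and be = be and z = y and n = n] p by (simp del: KK.simps)
      then show "f y * PP al be k n y z = f y * KK al be k n y z - f y * KK al be k p y z"
        unfolding unit_cnj[OF y] by (simp add: algebra_simps del: KK.simps)
    qed
    also have "\<dots> = Lk (\<lambda>y. f y * KK al be k n y z) - Lk (\<lambda>y. f y * KK al be k p y z)"
      by (rule LL_diff[OF al be]; intro continuous_on_mult fc hp_continuous[OF hpp_hp[OF hpp_KK]])
    also have "Lk (\<lambda>y. f y * KK al be k p y z) = Lk (\<lambda>y. f y * KK al be k p z y)"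
      by (rule LL_cong) (simp add: sym(2))
    also have "Lk (\<lambda>y. f y * KK al be k n y z) = f z * L" unfolding L_def by (rule Lk_KK[OF f z])
    finally show "F z = f z - z * cnj z * B z"
      using L0 unit_cnj[OF z] by (simp add: B_def field_simps)
  qed
  have hr: "hp n (\<lambda>z. z * cnj z * B z)" using hp_mult_rho[OF hB] p by simp
  have "f z - F z - z * cnj z * B z = 0" for z
    by (rule hp_circle_0[where n = n]) (intro hp_diff f hF hr, simp add: circ(2))
  then have eq: "(\<lambda>z. z * cnj z * B z) = (\<lambda>z. f z + (-1) * F z)" by (simp add: fun_eq_iff algebra_simps)
  have "B z = 0" for z
  proof (rule SS_rho_zero[OF ka N hB, of 1])
    fix z assume z: "off_lines N z"
    have "SS N ka (\<lambda>z. f z + (-1) * F z) z = 0"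
      using SS_add[OF f hp_cmult[OF hF, of "-1"] z, of ka] SS_cmult[OF hF z, of ka "-1"] S[OF z] SF[OF z] by simp
    then show "SS N ka (\<lambda>z. (z * cnj z) ^ 1 * B z) z = 0" unfolding eq[symmetric] by simp
  qed simp
  then have "f x = 1 / L * Lk (\<lambda>y. f y * PP al be k n y x)" using circ[OF x] by simp
  then show ?thesis using L0 by (simp add: L_def field_simps)
qed

lemma circ_ip_LL:
  assumes "continuous_on UNIV f" "continuous_on UNIV g"
  shows "circ_ip w f g = Lk (\<lambda>z. f z * cnj (g z)) / Lk (\<lambda>z. 1)"
proof -
  have c: "continuous_on UNIV (\<lambda>z. f z * cnj (g z))" by (intro continuous_intros assms)
  have i: "set_integrable lborel {0..2*pi} (\<lambda>t. f (cis t) * cnj (g (cis t)) * of_real (w1 al be (real k * t)))"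
    by (rule borel_integrable_atLeastAtMost') (rule LL_integrand_cont[OF al be c])
  have i2: "set_integrable lborel {0..2*pi} (\<lambda>t. w1 al be (real k * t))"
    by (rule borel_integrable_atLeastAtMost') (rule w1_cont_k[OF al be])
  have "((\<lambda>t. w1 al be (real k * t)) has_integral integral {0..2*pi} (\<lambda>t. w1 al be (real k * t))) {0..2*pi}"
    by (intro integrable_integral integrable_continuous_real w1_cont_k al be)
  from integral_unique[OF has_integral_of_real[OF this]]
  have "Lk (\<lambda>z. 1) = of_real (integral {0..2*pi} (\<lambda>t. w1 al be (real k * t)))" by (simp add: LL_def)
  then show ?thesis
    unfolding circ_ip_def wt using set_borel_integral_eq_integral(2)[OF i] set_borel_integral_eq_integral(2)[OF i2] by (simp add: LL_def)
qed

theorem repker_PP: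
  assumes "cmod eta = 1"
  shows "repker N ka w n om eta = PP al be k n om eta"
proof -
  define P where "P om eta = (if cmod eta = 1 then PP al be k n om eta else 0)" for om eta
  have L0: "Lk (\<lambda>z. 1) \<noteq> 0" by (rule LL_pos[OF al be k])
  have Pc: "continuous_on UNIV (\<lambda>om. P om eta)" for eta
    unfolding P_def by (cases "cmod eta = 1") (simp_all add: hp_continuous[OF hpp_hp[OF hpp_PP]])
  have P1: "dunkl_harmonic N ka n (\<lambda>om. P om eta)" if "cmod eta = 1" for eta
    unfolding dunkl_harmonic_iff P_def using that SS_PP[OF _ that] hpp_hp[OF hpp_PP] by simp
  have P2: "circ_ip w f (\<lambda>om. P om eta) = f eta" if e: "cmod eta = 1" and f: "dunkl_harmonic N ka n f" for eta f
  proof -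
    have f': "hp n f" "\<And>z. off_lines N z \<Longrightarrow> SS N ka f z = 0" using f by (auto simp: dunkl_harmonic_iff)
    have "Lk (\<lambda>z. f z * cnj (P z eta)) = Lk (\<lambda>z. f z * PP al be k n z eta)"
      using e PP_real[OF e k] by (simp add: P_def)
    also have "\<dots> = f eta * Lk (\<lambda>z. 1)" by (rule Lk_PP[OF f' e])
    finally show ?thesis using L0 by (simp add: circ_ip_LL[OF hp_continuous[OF f'(1)] Pc])
  qed
  have "repker N ka w n = P"
    unfolding repker_def
  proof (rule the_equality)
    show "(\<forall>eta. cmod eta = 1 \<longrightarrow> dunkl_harmonic N ka n (\<lambda>om. P om eta)) \<and>
      (\<forall>eta om. cmod eta \<noteq> 1 \<longrightarrow> P om eta = 0) \<and>
      (\<forall>eta f. cmod eta = 1 \<longrightarrow> dunkl_harmonic N ka n f \<longrightarrow> circ_ip w f (\<lambda>om. P om eta) = f eta)"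
      using P1 P2 by (auto simp: P_def)
  next
    fix Q assume "(\<forall>eta. cmod eta = 1 \<longrightarrow> dunkl_harmonic N ka n (\<lambda>om. Q om eta)) \<and>
      (\<forall>eta om. cmod eta \<noteq> 1 \<longrightarrow> Q om eta = 0) \<and>
      (\<forall>eta f. cmod eta = 1 \<longrightarrow> dunkl_harmonic N ka n f \<longrightarrow> circ_ip w f (\<lambda>om. Q om eta) = f eta)"
    then have Q: "\<And>eta. cmod eta = 1 \<Longrightarrow> dunkl_harmonic N ka n (\<lambda>om. Q om eta)"
      "\<And>eta om. cmod eta \<noteq> 1 \<Longrightarrow> Q om eta = 0"
      "\<And>eta f. cmod eta = 1 \<Longrightarrow> dunkl_harmonic N ka n f \<Longrightarrow> circ_ip w f (\<lambda>om. Q om eta) = f eta" by auto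
    have Qh: "hp n (\<lambda>om. Q om eta)" if "cmod eta = 1" for eta using Q(1)[OF that] by (auto simp: dunkl_harmonic_iff)
    \<comment> \<open>Both kernels reproduce each other, which forces them to agree on the circle.\<close>
    have QP: "Q om eta = P om eta" if e: "cmod eta = 1" and o: "cmod om = 1" for om eta
    proof -
      have "Q om eta = Lk (\<lambda>z. Q z eta * cnj (P z om)) / Lk (\<lambda>z. 1)"
        using P2[OF o Q(1)[OF e]] circ_ip_LL[OF hp_continuous[OF Qh[OF e]] Pc] by simp
      also have "\<dots> = cnj (Lk (\<lambda>z. P z om * cnj (Q z eta)) / Lk (\<lambda>z. 1))"
        by (simp add: LL_cnj[symmetric] Lk1_real mult.commute)
      also have "Lk (\<lambda>z. P z om * cnj (Q z eta)) / Lk (\<lambda>z. 1) = P eta om"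
        using Q(3)[OF e P1[OF o]] circ_ip_LL[OF Pc hp_continuous[OF Qh[OF e]]] by simp
      also have "cnj (P eta om) = P om eta" using PP_sym[OF o e] e o by (simp add: P_def)
      finally show ?thesis .
    qed
    show "Q = P"
    proof (intro ext)
      fix om eta
      show "Q om eta = P om eta"
      proof (cases "cmod eta = 1")
        case True
        have "Q om eta - P om eta = 0"
          by (rule hp_circle_0[where n = n and f = "\<lambda>om. Q om eta - P om eta"])
             (use QP[OF True] P1[OF True] in \<open>auto intro!: hp_diff Qh[OF True] simp: dunkl_harmonic_iff\<close>)
        then show ?thesis by simp
      qed (simp add: Q(2) P_def)
    qed
  qed
  then show ?thesis using assms by (simp add: P_def)
qed

end

section \<open>Sums over roots of unity and the two families of dihedral groups\<close>

lemma sum_cis_roots: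
  assumes k: "k > 0"
  shows "(\<Sum>i<k. cis (2 * pi * real (i * n) / real k)) = (if k dvd n then of_nat k else 0)"
proof -
  define u where "u = cis (2 * pi * real n / real k)"
  have p: "cis (2 * pi * real (i * n) / real k) = u ^ i" for i
    unfolding u_def by (simp add: Complex.DeMoivre field_simps)
  have uk: "u ^ k = 1"
  proof -
    have "u ^ k = cis (2 * pi * real n)" unfolding u_def using k by (simp add: Complex.DeMoivre field_simps)
    then show ?thesis using cis_multiple_2pi[of "real n"] by simp
  qed
  show ?thesis
  proof (cases "u = 1")
    case True
    then have "cos (2 * pi * real n / real k) = 1" by (simp add: u_def complex_eq_iff)
    then obtain m :: int where "2 * pi * real n / real k = of_int m * 2 * pi" by (auto simp: cos_one_2pi_int)
    then have "real n = of_int m * real k" using k by (simp add: field_simps)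
    then have "(of_int (int n) :: real) = of_int (m * int k)" by simp
    then have "int n = m * int k" by (simp only: of_int_eq_iff)
    then have "k dvd n" by (metis dvd_triv_right of_nat_dvd_iff)
    then show ?thesis using True p by simp
  next
    case False
    have "\<not> k dvd n"
    proof
      assume "k dvd n"
      then obtain m where "n = k * m" by auto
      then have "2 * pi * real n / real k = 2 * pi * real m" using k by simp
      then show False using False cis_multiple_2pi[OF Ints_of_nat, of m] unfolding u_def by simp
    qed
    then show ?thesis unfolding p using geometric_sum[OF False, of k] uk by simp
  qed
qed

lemma diff_power_sum: "(z::complex) ^ k - c ^ k = (z - c) * (\<Sum>n<k. z ^ (k - Suc n) * c ^ n)"
  using power_diff_sumr2[of c k z] by (simp add: algebra_simps)

text \<open>As eps^k = 1, the quotient (z^k - q^k)/(z - eps q) is a geometric sum. Summation over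
  the roots of unity keeps only the term n = k - r.\<close>

lemma sum_roots_quotient:
  assumes k: "k > 0" and r: "1 \<le> r" "r \<le> k" and nz: "z ^ k \<noteq> q ^ k"
  shows "(\<Sum>i<k. eps k i ^ r / (z - eps k i * q)) = of_nat k * q ^ (k - r) * z ^ (r - 1) / (z ^ k - q ^ k)"
proof -
  have ek: "eps k i ^ k = 1" for i
  proof -
    have "eps k i ^ k = cis (2 * pi * real i)" using k by (simp add: eps_def Complex.DeMoivre)
    then show ?thesis using cis_multiple_2pi[of "real i"] by simp
  qed
  have t: "eps k i ^ r / (z - eps k i * q) = (\<Sum>n<k. z ^ (k - Suc n) * q ^ n * eps k i ^ (r + n)) / (z ^ k - q ^ k)" for i
  proof -
    have "z ^ k - q ^ k = (z - eps k i * q) * (\<Sum>n<k. z ^ (k - Suc n) * (eps k i * q) ^ n)"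
      using diff_power_sum[of z k "eps k i * q"] ek[of i] by (simp add: power_mult_distrib)
    moreover have "(\<Sum>n<k. z ^ (k - Suc n) * q ^ n * eps k i ^ (r + n)) = eps k i ^ r * (\<Sum>n<k. z ^ (k - Suc n) * (eps k i * q) ^ n)"
      unfolding sum_distrib_left by (intro sum.cong refl) (simp add: power_add power_mult_distrib)
    moreover have "z ^ k - q ^ k \<noteq> 0" using nz by simp
    moreover have "D \<noteq> 0 \<Longrightarrow> D = l * S \<Longrightarrow> e / l = (e * S) / D" for D l S e :: complex by simp
    ultimately show ?thesis by simp
  qed
  have e: "(\<Sum>i<k. eps k i ^ m) = (if k dvd m then of_nat k else 0)" for m
    using sum_cis_roots[OF k, of m] by (simp add: eps_def Complex.DeMoivre field_simps)
  have "(\<Sum>i<k. eps k i ^ r / (z - eps k i * q)) = (\<Sum>n<k. z ^ (k - Suc n) * q ^ n * (\<Sum>i<k. eps k i ^ (r + n))) / (z ^ k - q ^ k)"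
    unfolding t sum_divide_distrib[symmetric] sum_distrib_left by (subst sum.swap) simp
  also have "(\<Sum>n<k. z ^ (k - Suc n) * q ^ n * (\<Sum>i<k. eps k i ^ (r + n))) = (\<Sum>n<k. if n = k - r then of_nat k * q ^ (k - r) * z ^ (r - 1) else 0)"
  proof (intro sum.cong refl)
    fix n assume "n \<in> {..<k}"
    then have n: "n < k" by simp
    have "k dvd r + n \<longleftrightarrow> n = k - r"
    proof
      assume "k dvd r + n"
      then obtain m where m: "r + n = k * m" by auto
      have "k * m < k * 2" using m n r by linarith
      then have "m < 2" by (simp only: mult_less_cancel1)
      moreover have "m \<noteq> 0"
      proof
        assume "m = 0"
        then have "r + n = 0" using m by simp
        then show False using r by simp
      qed
      ultimately have "m = 1" by simp
      then show "n = k - r" using m by simp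
    qed (use r in simp)
    moreover have "n = k - r \<Longrightarrow> k - Suc n = r - 1" using r by simp
    ultimately show "z ^ (k - Suc n) * q ^ n * (\<Sum>i<k. eps k i ^ (r + n)) = (if n = k - r then of_nat k * q ^ (k - r) * z ^ (r - 1) else 0)"
      unfolding e by (auto simp: mult_ac)
  qed
  also have "\<dots> = of_nat k * q ^ (k - r) * z ^ (r - 1)" using r k by simp
  finally show ?thesis by (simp add: mult.assoc)
qed

text \<open>Two instances of \<open>sum_roots_quotient\<close>, with exponents 1 and r + 1; the
  latter is admissible because r < k.\<close>

lemma red_core:
  fixes h :: "complex \<Rightarrow> complex"
  assumes k: "k > 0" and r: "r < k" and nz: "z ^ k \<noteq> q ^ k"
  shows "(\<Sum>i<k. eps k i * ((z ^ r * h (z ^ k) - (eps k i * q) ^ r * h (q ^ k)) / (z - eps k i * q)))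
    = of_nat k * z ^ r * q ^ (k - 1) * ((h (z ^ k) - h (q ^ k)) / (z ^ k - q ^ k))"
proof -
  have "eps k i * ((z ^ r * h (z ^ k) - (eps k i * q) ^ r * h (q ^ k)) / (z - eps k i * q)) =
    z ^ r * h (z ^ k) * (eps k i ^ 1 / (z - eps k i * q)) - q ^ r * h (q ^ k) * (eps k i ^ Suc r / (z - eps k i * q))" for i
    by (simp add: power_mult_distrib diff_divide_distrib right_diff_distrib mult_ac)
  then have "(\<Sum>i<k. eps k i * ((z ^ r * h (z ^ k) - (eps k i * q) ^ r * h (q ^ k)) / (z - eps k i * q))) =
    z ^ r * h (z ^ k) * (\<Sum>i<k. eps k i ^ 1 / (z - eps k i * q)) - q ^ r * h (q ^ k) * (\<Sum>i<k. eps k i ^ Suc r / (z - eps k i * q))"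
    by (simp only: sum_subtractf sum_distrib_left)
  also have "\<dots> = z ^ r * h (z ^ k) * (of_nat k * q ^ (k - 1) * z ^ (1 - 1) / (z ^ k - q ^ k)) - q ^ r * h (q ^ k) * (of_nat k * q ^ (k - Suc r) * z ^ (Suc r - 1) / (z ^ k - q ^ k))"
    using sum_roots_quotient[OF k, of 1 z q] sum_roots_quotient[OF k, of "Suc r" z q] k r nz by simp
  also have "\<dots> = of_nat k * z ^ r * q ^ (k - 1) * ((h (z ^ k) - h (q ^ k)) / (z ^ k - q ^ k))"
  proof -
    have e: "q ^ r * q ^ (k - Suc r) = q ^ (k - 1)" using r by (simp flip: power_add)
    have E: "q ^ r * h (q ^ k) * (of_nat k * q ^ (k - Suc r) * z ^ (Suc r - 1) / (z ^ k - q ^ k)) = q ^ (k - 1) * (of_nat k * h (q ^ k) * z ^ r / (z ^ k - q ^ k))"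
      unfolding e[symmetric] diff_Suc_1 times_divide_eq_right by (simp only: mult_ac)
    show ?thesis unfolding E by (simp add: diff_divide_distrib algebra_simps)
  qed
  finally show ?thesis .
qed

lemma eps_pow_self: "k > 0 \<Longrightarrow> eps k i ^ k = 1"
proof -
  assume "k > 0"
  then have "eps k i ^ k = cis (2 * pi * real i)" by (simp add: eps_def Complex.DeMoivre)
  then show ?thesis using cis_multiple_2pi[of "real i"] by simp
qed

lemma eps_double: "eps (2 * k) (2 * i) = eps k i"
  by (simp add: eps_def mult.assoc)

text \<open>Otherwise z / cnj z would be a k-th root of unity, which puts z on a reflecting line.
  The lemma is applied with k and with 2 k.\<close>

lemma off_lines_odd: 
  assumes k: "k > 0" and z: "off_lines k z" shows "z ^ k \<noteq> cnj z ^ k"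
proof
  assume "z ^ k = cnj z ^ k"
  have nz: "cnj z \<noteq> 0" using off_lines_nz[OF k z] by simp
  then have "(z / cnj z) ^ k = 1" using \<open>z ^ k = cnj z ^ k\<close> by (simp add: power_divide)
  then have "z / cnj z \<in> (\<lambda>j. cis (2 * pi * real j / real k)) ` {..<k}"
    unfolding bij_betw_imp_surj_on[OF Complex.bij_betw_roots_unity[OF k]] by simp
  then obtain j where j: "j < k" "z / cnj z = cis (2 * pi * real j / real k)" by auto
  then have "z = eps k j * cnj z" using nz by (simp add: eps_def field_simps)
  then show False using z j by (auto simp: off_lines_iff)
qed

lemma sum_even_odd: "(\<Sum>j<2 * k. f j) = (\<Sum>i<k. f (2 * i) + f (Suc (2 * i)))" for f :: "nat \<Rightarrow> complex"
  by (induction k) (simp_all add: algebra_simps)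

lemma sum_even_odd_real: "(\<Sum>j<2 * k. f j) = (\<Sum>i<k. f (2 * i) + f (Suc (2 * i)))" for f :: "nat \<Rightarrow> real"
  by (induction k) (simp_all add: algebra_simps)

lemma Im_0_iff: "Im z = 0 \<longleftrightarrow> z = cnj z" "Re z = 0 \<longleftrightarrow> z = - cnj z"
  by (auto simp: complex_eq_iff)

lemma dih_odd:
  assumes k: "odd k" and al: "al > 0"
  shows "dih k k (kappa_odd al) al 0 (weight_odd k al)"
proof -
  have k0: "k > 0" using k by (cases k) auto
  have z0: "(0::real) \<le> 0" by simp
  have "\<forall>j<k. kappa_odd al j \<ge> 0" using al by (simp add: kappa_odd_def)
  have "(\<Sum>j<k. kappa_odd al j) = real k * (al + 0)" by (simp add: kappa_odd_def)
  have "reg 2 (kap2 al 0) (z ^ k)" if "off_lines k z" for z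
    using off_lines_odd[OF k0 that] by (simp add: reg2 Im_0_iff)
  have "weight_odd k al (cis t) = w1 al 0 (real k * t)" for t
    by (simp add: weight_odd_def w1_def Complex.DeMoivre)
  have "(\<Sum>j<k. of_real (kappa_odd al j) * eps k j * dq k j (\<lambda>z. z ^ r * h (z ^ k)) z) =
      of_nat k * z ^ r * cnj z ^ (k - 1) * (\<Sum>j<2. of_real (kap2 al 0 j) * eps 2 j * dq 2 j h (z ^ k))"
    if z: "off_lines k z" and r: "r < k" for z r h
  proof -
    have "(\<Sum>j<k. of_real (kappa_odd al j) * eps k j * dq k j (\<lambda>z. z ^ r * h (z ^ k)) z) =
      of_real al * (\<Sum>i<k. eps k i * ((z ^ r * h (z ^ k) - (eps k i * cnj z) ^ r * h (cnj z ^ k)) / (z - eps k i * cnj z)))"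
      unfolding sum_distrib_left dq_def kappa_odd_def
      by (simp add: power_mult_distrib eps_pow_self[OF k0] mult_ac)
    also have "\<dots> = of_real al * (of_nat k * z ^ r * cnj z ^ (k - 1) * ((h (z ^ k) - h (cnj z ^ k)) / (z ^ k - cnj z ^ k)))"
      unfolding red_core[OF k0 r off_lines_odd[OF k0 z]] ..
    finally show ?thesis by (simp add: sum2 dq_def)
  qed
  show ?thesis by (rule dih.intro) fact+
qed

lemma dih_even:
  assumes k: "k \<ge> 1" and al: "al > 0" and be: "be > 0"
  shows "dih k (2 * k) (kappa_even k al be) al be (weight_even k al be)"
proof -
  have k0: "k > 0" using k by simp
  have k2: "2 * k > 0" "be \<ge> 0" using k0 be by simp_all
  have "\<forall>j<2 * k. kappa_even k al be j \<ge> 0" using al be by (simp add: kappa_even_def)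
  have "(\<Sum>j<2 * k. kappa_even k al be j) = real k * (al + be)"
    unfolding sum_even_odd_real by (simp add: kappa_even_def algebra_simps)
  \<comment> \<open>The reflections of odd index arise from those of even index on replacing cnj z
    by c cnj z. Since c^k = -1, the second class induces the second reflection of I_2 at
    z^k.\<close>
  define c where "c = eps (2 * k) 1"
  have ck: "c ^ k = -1" using k0 by (simp add: c_def eps_def Complex.DeMoivre)
  have eo: "eps (2 * k) (Suc (2 * i)) = eps k i * c" for i
    using eps_add[of "2 * k" "2 * i" 1] by (simp add: eps_double c_def)
  have nz: "z ^ k \<noteq> cnj z ^ k" "z ^ k \<noteq> (c * cnj z) ^ k" if z: "off_lines (2 * k) z" for z
  proof -
    have z2: "z ^ (2 * k) \<noteq> cnj z ^ (2 * k)" using off_lines_odd[OF _ z] k0 by simp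
    then show "z ^ k \<noteq> cnj z ^ k" by (auto simp: power_mult mult.commute[of 2])
    show "z ^ k \<noteq> (c * cnj z) ^ k"
      using z2 by (auto simp: power_mult_distrib ck power_mult mult.commute[of 2])
  qed
  have "reg 2 (kap2 al be) (z ^ k)" if "off_lines (2 * k) z" for z
    using nz[OF that] by (simp add: reg2 Im_0_iff power_mult_distrib ck)
  have "weight_even k al be (cis t) = w1 al be (real k * t)" for t
    using be by (simp add: weight_even_def w1_def Complex.DeMoivre)
  have "(\<Sum>j<2 * k. of_real (kappa_even k al be j) * eps (2 * k) j * dq (2 * k) j (\<lambda>z. z ^ r * h (z ^ k)) z) =
      of_nat k * z ^ r * cnj z ^ (k - 1) * (\<Sum>j<2. of_real (kap2 al be j) * eps 2 j * dq 2 j h (z ^ k))"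
    if z: "off_lines (2 * k) z" and r: "r < k" for z r h
  proof -
    note n = nz[OF z]
    have "(\<Sum>j<2 * k. of_real (kappa_even k al be j) * eps (2 * k) j * dq (2 * k) j (\<lambda>z. z ^ r * h (z ^ k)) z) =
      of_real al * (\<Sum>i<k. eps k i * ((z ^ r * h (z ^ k) - (eps k i * cnj z) ^ r * h (cnj z ^ k)) / (z - eps k i * cnj z)))
      + of_real be * (c * (\<Sum>i<k. eps k i * ((z ^ r * h (z ^ k) - (eps k i * (c * cnj z)) ^ r * h ((c * cnj z) ^ k)) / (z - eps k i * (c * cnj z)))))"
      unfolding sum_even_odd sum_distrib_left sum.distrib[symmetric] dq_def
      by (intro sum.cong refl, simp only: eps_double eo, simp add: kappa_even_def power_mult_distrib eps_pow_self[OF k0] mult_ac)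
    also have "\<dots> = of_real al * (of_nat k * z ^ r * cnj z ^ (k - 1) * ((h (z ^ k) - h (cnj z ^ k)) / (z ^ k - cnj z ^ k)))
      + of_real be * (c * (of_nat k * z ^ r * (c * cnj z) ^ (k - 1) * ((h (z ^ k) - h ((c * cnj z) ^ k)) / (z ^ k - (c * cnj z) ^ k))))"
      unfolding red_core[OF k0 r n(1)] red_core[OF k0 r n(2)] ..
    also have "c * (of_nat k * z ^ r * (c * cnj z) ^ (k - 1) * ((h (z ^ k) - h ((c * cnj z) ^ k)) / (z ^ k - (c * cnj z) ^ k)))
      = of_nat k * z ^ r * cnj z ^ (k - 1) * (- ((h (z ^ k) - h (- (cnj z ^ k))) / (z ^ k + cnj z ^ k)))"
    proof -
      have "c * c ^ (k - 1) = -1" using ck k0 by (cases k) simp_all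
      moreover have "(c * cnj z) ^ k = - (cnj z ^ k)" by (simp add: power_mult_distrib ck)
      moreover have "c * (A * (c * cnj z) ^ (k - 1) * B) = (c * c ^ (k - 1)) * (A * cnj z ^ (k - 1) * B)" for A B by (simp add: power_mult_distrib mult_ac)
      ultimately show ?thesis by simp
    qed
    finally have F: "(\<Sum>j<2 * k. of_real (kappa_even k al be j) * eps (2 * k) j * dq (2 * k) j (\<lambda>z. z ^ r * h (z ^ k)) z) =
      of_real al * (of_nat k * z ^ r * cnj z ^ (k - 1) * ((h (z ^ k) - h (cnj z ^ k)) / (z ^ k - cnj z ^ k))) +
      of_real be * (of_nat k * z ^ r * cnj z ^ (k - 1) * (- ((h (z ^ k) - h (- (cnj z ^ k))) / (z ^ k + cnj z ^ k))))" .
    show ?thesis unfolding F by (simp add: sum2 dq_def algebra_simps diff_divide_distrib)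
  qed
  show ?thesis by (rule dih.intro) fact+
qed

section \<open>Laplace transforms\<close>

text \<open>Truncated powers; unlike \<open>powr\<close> they vanish on the negative axis.\<close>

definition pw :: "real \<Rightarrow> real \<Rightarrow> real" where
  "pw a t = (if t > 0 then t powr (a - 1) else 0)"

lemma pw_meas [measurable]: "pw a \<in> borel_measurable borel"
  unfolding pw_def by measurable

lemma pw_nonneg [simp]: "pw a t \<ge> 0" by (simp add: pw_def)

lemma pw_laplace:
  assumes a: "a > 0" and s: "s > 0"
  shows "integrable lborel (\<lambda>t. exp (- (s * t)) * pw a t)"
    and "(LINT t|lborel. exp (- (s * t)) * pw a t) = Gamma a * s powr (- a)"
proof -
  have "ennreal (Gamma a) = (\<integral>\<^sup>+t. ennreal (exp (- t) * pw a t) \<partial>lborel)"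
    unfolding Gamma_conv_nn_integral_real[OF a]
    by (intro nn_integral_cong) (auto simp: pw_def indicator_def exp_minus field_simps)
  also have "\<dots> = ennreal s * (\<integral>\<^sup>+t. ennreal (exp (- (s * t)) * pw a (s * t)) \<partial>lborel)"
    using nn_integral_real_affine[of "\<lambda>t. ennreal (exp (- t) * pw a t)" s 0] s by simp
  also have "(\<integral>\<^sup>+t. ennreal (exp (- (s * t)) * pw a (s * t)) \<partial>lborel) = 
     (\<integral>\<^sup>+t. ennreal (s powr (a - 1)) * ennreal (exp (- (s * t)) * pw a t) \<partial>lborel)"
    using s by (intro nn_integral_cong) (auto simp: pw_def zero_less_mult_iff powr_mult ennreal_mult[symmetric] mult_ac)
  also have "\<dots> = ennreal (s powr (a - 1)) * (\<integral>\<^sup>+t. ennreal (exp (- (s * t)) * pw a t) \<partial>lborel)"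
    by (rule nn_integral_cmult) measurable
  finally have e: "ennreal (Gamma a) = ennreal (s powr a) * (\<integral>\<^sup>+t. ennreal (exp (- (s * t)) * pw a t) \<partial>lborel)"
    using s by (simp add: mult.assoc[symmetric] ennreal_mult[symmetric] powr_diff)
  have "ennreal (Gamma a * s powr (- a)) = ennreal (s powr (- a)) * ennreal (Gamma a)"
    by (simp add: ennreal_mult[symmetric] Gamma_real_pos[OF a] less_imp_le mult.commute)
  also have "\<dots> = ennreal (s powr (- a) * s powr a) * (\<integral>\<^sup>+t. ennreal (exp (- (s * t)) * pw a t) \<partial>lborel)"
    unfolding e by (simp add: ennreal_mult mult.assoc)
  also have "s powr (- a) * s powr a = 1" using s by (simp add: powr_minus)
  finally have n: "(\<integral>\<^sup>+t. ennreal (exp (- (s * t)) * pw a t) \<partial>lborel) = ennreal (Gamma a * s powr (- a))" by simp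
  show i: "integrable lborel (\<lambda>t. exp (- (s * t)) * pw a t)"
    by (rule integrableI_nn_integral_finite[OF _ _ n]) auto
  have "ennreal (LINT t|lborel. exp (- (s * t)) * pw a t) = ennreal (Gamma a * s powr (- a))"
    using nn_integral_eq_integral[OF i] n by simp
  then show "(LINT t|lborel. exp (- (s * t)) * pw a t) = Gamma a * s powr (- a)"
    by (subst (asm) ennreal_inj) (auto intro!: integral_nonneg simp: Gamma_real_pos[OF a] less_imp_le)
qed

section \<open>Laplace transforms of generalised power series\<close>

lemma summable_pow_Gamma:
  fixes x a :: real
  assumes a: "a > 0"
  shows "summable (\<lambda>n. x ^ n / Gamma (a + real n))"
proof (rule summable_ratio_test[of "1/2" "nat \<lceil>2 * \<bar>x\<bar>\<rceil>"])
  fix n assume "n \<ge> nat \<lceil>2 * \<bar>x\<bar>\<rceil>"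
  then have "2 * \<bar>x\<bar> \<le> a + real n" using a by linarith
  then have r: "\<bar>x\<bar> / (a + real n) \<le> 1/2" using a by (simp add: field_simps)
  have "Gamma (a + real (Suc n)) = (a + real n) * Gamma (a + real n)"
  proof -
    have "a + real n \<notin> \<int>\<^sub>\<le>\<^sub>0" using a nonpos_Ints_nonpos[of "a + real n"] by fastforce
    then show ?thesis using Gamma_plus1[of "a + real n"] by (simp add: add_ac)
  qed
  then have "norm (x ^ Suc n / Gamma (a + real (Suc n))) = \<bar>x\<bar> / (a + real n) * norm (x ^ n / Gamma (a + real n))"
    using a by (simp add: abs_mult power_abs norm_divide)
  also have "\<dots> \<le> 1/2 * norm (x ^ n / Gamma (a + real n))" by (intro mult_right_mono r) simp
  finally show "norm (x ^ Suc n / Gamma (a + real (Suc n))) \<le> 1/2 * norm (x ^ n / Gamma (a + real n))" .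
qed simp

text \<open>t^(a+n-1)/Gamma(a+n) has Laplace transform s^(-a-n), so this is the termwise inverse
  transform of the series of h n * s^(-a-n).\<close>

definition psi :: "real \<Rightarrow> (nat \<Rightarrow> complex) \<Rightarrow> real \<Rightarrow> complex" where
  "psi a h t = (\<Sum>n. h n * of_real (pw (a + real n) t / Gamma (a + real n)))"

text \<open>Summability at a single s bounds h n by M s^n. The factor 1/Gamma(a+n) then makes the
  series converge at every t, and the interchange with the integral rests on the summable integrals
  of the norms.\<close>

lemma psi_laplace:
  assumes a: "a > 0" and s: "s > 0" and h: "summable (\<lambda>n. norm (h n) / s ^ n)"
  shows "\<And>t. summable (\<lambda>n. norm (h n * of_real (pw (a + real n) t / Gamma (a + real n))))"
    and "integrable lborel (\<lambda>t. exp (- (of_real s * of_real t)) * psi a h t)"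
    and "(LINT t|lborel. exp (- (of_real s * of_real t)) * psi a h t) = (\<Sum>n. h n * of_real (s powr (- (a + real n))))"
proof -
  have an: "a + real n > 0" for n using a by (simp add: add_pos_nonneg)
  have G: "Gamma (a + real n) > 0" for n using an by (rule Gamma_real_pos)
  have "Bseq (\<lambda>n. norm (h n) / s ^ n)" using h summable_LIMSEQ_zero convergent_imp_Bseq convergentI by blast
  then obtain M where M: "\<And>n. norm (norm (h n) / s ^ n) \<le> M" unfolding Bseq_def by blast
  have hM: "norm (h n) \<le> M * s ^ n" for n using M[of n] s by (simp add: field_simps abs_le_iff)
  have M0: "M \<ge> 0" using M[of 0] norm_ge_zero order_trans by blast
  show su: "summable (\<lambda>n. norm (h n * of_real (pw (a + real n) t / Gamma (a + real n))))" for t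
  proof (cases "t > 0")
    case True
    show ?thesis
    proof (rule summable_comparison_test'[where N = 0])
      show "summable (\<lambda>n. M * t powr (a - 1) * ((s * t) ^ n / Gamma (a + real n)))"
        by (intro summable_mult summable_pow_Gamma a)
      fix n
      have P: "pw (a + real n) t = t powr (a - 1) * t ^ n"
      proof -
        have "t powr (a + real n - 1) = t powr ((a - 1) + real n)" by (rule arg_cong[where f = "\<lambda>x. t powr x"]) simp
        then show ?thesis using True by (simp only: pw_def powr_add powr_realpow if_True)
      qed
      have "norm (norm (h n * of_real (pw (a + real n) t / Gamma (a + real n)))) = norm (h n) * (pw (a + real n) t / Gamma (a + real n))"
        using G[of n] by (simp add: norm_mult norm_divide less_imp_le)
      also have "\<dots> \<le> M * s ^ n * (pw (a + real n) t / Gamma (a + real n))"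
        using G[of n] by (intro mult_right_mono hM) (simp add: less_imp_le)
      also have "\<dots> = M * t powr (a - 1) * ((s * t) ^ n / Gamma (a + real n))"
        unfolding P by (simp add: power_mult_distrib mult_ac)
      finally show "norm (norm (h n * of_real (pw (a + real n) t / Gamma (a + real n)))) \<le> M * t powr (a - 1) * ((s * t) ^ n / Gamma (a + real n))" .
    qed
  qed (simp add: pw_def)
  let ?f = "\<lambda>n t. exp (- (of_real s * of_real t)) * (h n * of_real (pw (a + real n) t / Gamma (a + real n)))"
  have ef: "?f n t = h n * of_real (1 / Gamma (a + real n)) * of_real (exp (- (s * t)) * pw (a + real n) t)" for n t
    by (simp add: exp_of_real[symmetric] mult_ac)
  have fi: "integrable lborel (?f n)" for n
    unfolding ef by (intro integrable_mult_right integrable_of_real pw_laplace(1) an s)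
  have fI: "(LINT t|lborel. ?f n t) = h n * of_real (s powr (- (a + real n)))" for n
    unfolding ef integral_mult_right_zero integral_complex_of_real pw_laplace(2)[OF an s] using G[of n] by simp
  have nf: "norm (?f n t) = norm (h n) / Gamma (a + real n) * (exp (- (s * t)) * pw (a + real n) t)" for n t
    using G[of n] unfolding ef by (simp add: norm_mult norm_divide less_imp_le)
  have nI: "(LINT t|lborel. norm (?f n t)) = norm (h n) * s powr (- (a + real n))" for n
    unfolding nf integral_mult_right_zero pw_laplace(2)[OF an s] using G[of n] by simp
  have ps: "exp (- (of_real s * of_real t)) * psi a h t = (\<Sum>n. ?f n t)" for t
    unfolding psi_def by (rule suminf_mult[symmetric]) (rule summable_norm_cancel[OF su])
  have s1: "AE t in lborel. summable (\<lambda>n. norm (?f n t))"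
    by (rule AE_I2) (simp only: norm_mult[of "exp _"], intro summable_mult su)
  have "s powr (- (a + real n)) = s powr (- a) / s ^ n" for n
    using s by (simp add: powr_diff powr_realpow powr_minus[of _ "_ + _"] powr_add field_simps powr_minus)
  then have s2: "summable (\<lambda>n. LINT t|lborel. norm (?f n t))"
    unfolding nI using summable_mult[OF h, of "s powr (- a)"] by (simp add: mult_ac)
  show "integrable lborel (\<lambda>t. exp (- (of_real s * of_real t)) * psi a h t)"
    unfolding ps by (rule integrable_suminf[OF fi s1 s2])
  show "(LINT t|lborel. exp (- (of_real s * of_real t)) * psi a h t) = (\<Sum>n. h n * of_real (s powr (- (a + real n))))"
    unfolding ps using integral_suminf[OF fi s1 s2] fI by simp
qed

lemma psi_zero: "t \<le> 0 \<Longrightarrow> psi a h t = 0"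
  by (simp add: psi_def pw_def)

text \<open>After t^(a-1) is split off, a power series with infinite radius of convergence
  remains.\<close>

lemma psi_continuous:
  assumes a: "a > 0" and s: "s > 0" and h: "summable (\<lambda>n. norm (h n) / s ^ n)"
  shows "continuous_on {0<..} (psi a h)"
proof -
  have an: "a + real n > 0" for n using a by (simp add: add_pos_nonneg)
  have sm: "summable (\<lambda>n. h n * of_real (1 / Gamma (a + real n)) * z ^ n)" for z :: complex
  proof (rule summable_norm_cancel)
    have "summable (\<lambda>n. norm (h n * of_real (pw (a + real n) (norm z + 1) / Gamma (a + real n))))"
      by (rule psi_laplace(1)[OF a s h])
    then have "summable (\<lambda>n. (norm z + 1) powr (1 - a) * norm (h n * of_real (pw (a + real n) (norm z + 1) / Gamma (a + real n))))"
      by (rule summable_mult)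
    then show "summable (\<lambda>n. norm (h n * of_real (1 / Gamma (a + real n)) * z ^ n))"
    proof (rule summable_comparison_test'[where N = 0])
      fix n
      let ?t = "norm z + 1"
      have t: "?t > 0" by (simp add: add_nonneg_pos)
      have "?t powr (1 - a) * pw (a + real n) ?t = ?t ^ n"
        using t by (simp add: pw_def powr_add[symmetric] powr_realpow[symmetric])
      moreover have "norm z ^ n \<le> ?t ^ n" by (intro power_mono) auto
      moreover have G: "Gamma (a + real n) > 0" using an by (rule Gamma_real_pos)
      ultimately show "norm (norm (h n * of_real (1 / Gamma (a + real n)) * z ^ n)) \<le> ?t powr (1 - a) * norm (h n * of_real (pw (a + real n) ?t / Gamma (a + real n)))"
        by (simp add: norm_mult norm_divide norm_power field_simps less_imp_le mult_left_mono)
    qed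
  qed
  have "continuous_on UNIV (\<lambda>z. \<Sum>n. h n * of_real (1 / Gamma (a + real n)) * z ^ n)"
    by (rule continuous_at_imp_continuous_on, rule ballI, rule isCont_powser_converges_everywhere[OF sm])
  from continuous_on_compose2[OF this, of "{0<..}" "\<lambda>t::real. of_real t"]
  have c: "continuous_on {0<..} (\<lambda>t::real. of_real (t powr (a - 1)) * (\<Sum>n. h n * of_real (1 / Gamma (a + real n)) * of_real t ^ n))"
    by (intro continuous_intros) auto
  have "psi a h t = of_real (t powr (a - 1)) * (\<Sum>n. h n * of_real (1 / Gamma (a + real n)) * of_real t ^ n)" if "t > 0" for t
  proof -
    have "pw (a + real n) t = t powr (a - 1) * t ^ n" for n
    proof -
      have "t powr (a + real n - 1) = t powr ((a - 1) + real n)" by (rule arg_cong[where f = "\<lambda>x. t powr x"]) simp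
      then show ?thesis using that by (simp only: pw_def powr_add powr_realpow if_True)
    qed
    then show ?thesis unfolding psi_def
      by (subst suminf_mult[OF sm, symmetric]) (simp add: mult_ac)
  qed
  then show ?thesis using c by (subst continuous_on_cong[OF refl]) auto
qed

text \<open>Closed under convolution, with the parameters adding up (\<open>conv_cls\<close>). The
  power bound makes the singularity at 0 integrable for a > 0 and the transform exist for Re s > 0.
  The other two conditions are the normalisation used in \<open>gfun\<close>.\<close>

definition cls :: "real \<Rightarrow> (real \<Rightarrow> complex) \<Rightarrow> bool" where
  "cls a f \<longleftrightarrow> (\<forall>t\<le>0. f t = 0) \<and> continuous_on {0<..} f \<and> (\<exists>C. \<forall>t>0. norm (f t) \<le> C * t powr (a - 1))"

lemma zero_cont_meas:
  fixes f :: "real \<Rightarrow> complex"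
  assumes "\<forall>t\<le>0. f t = (0::complex)" "continuous_on {0<..} f"
  shows "f \<in> borel_measurable borel"
proof -
  have "(\<lambda>t. indicator {0<..} t *\<^sub>R f t) \<in> borel_measurable borel"
    by (rule borel_measurable_continuous_on_indicator[OF borel_open[OF open_greaterThan] assms(2)])
  also have "(\<lambda>t. indicator {0<..} t *\<^sub>R f t) = f" using assms(1) by (auto simp: fun_eq_iff indicator_def)
  finally show ?thesis .
qed

lemma cls_meas: "cls a f \<Longrightarrow> f \<in> borel_measurable borel"
  unfolding cls_def using zero_cont_meas by blast

lemma clsE:
  assumes "cls a f" obtains C where "C \<ge> 0" "\<And>t. norm (f t) \<le> C * pw a t"
proof -
  obtain C where C: "\<forall>t>0. norm (f t) \<le> C * t powr (a - 1)" using assms by (auto simp: cls_def)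
  have "norm (f 1) \<le> C" using C[rule_format, of 1] by simp
  then have "C \<ge> 0" using norm_ge_zero order_trans by blast
  moreover have "norm (f t) \<le> C * pw a t" for t
    using C assms by (auto simp: pw_def cls_def)
  ultimately show thesis using that by blast
qed

section \<open>Laplace transform and convolution\<close>

definition Lp :: "(real \<Rightarrow> complex) \<Rightarrow> complex \<Rightarrow> complex" where
  "Lp f s = (LINT t|lborel. exp (- (s * of_real t)) * f t)"

lemma cls_integrable:
  assumes f: "cls a f" and a: "a > 0" and s: "Re s > 0"
  shows "integrable lborel (\<lambda>t. exp (- (s * of_real t)) * f t)"
proof -
  obtain C where C: "C \<ge> 0" "\<And>t. norm (f t) \<le> C * pw a t" using clsE[OF f] by blast
  have [measurable]: "f \<in> borel_measurable borel" by (rule cls_meas[OF f])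
  show ?thesis
  proof (rule Bochner_Integration.integrable_bound)
    show "integrable lborel (\<lambda>t. C * (exp (- (Re s * t)) * pw a t))"
      by (intro integrable_mult_right pw_laplace a s)
    show "AE t in lborel. norm (exp (- (s * of_real t)) * f t) \<le> norm (C * (exp (- (Re s * t)) * pw a t))"
    proof (rule AE_I2)
      fix t
      have "norm (exp (- (s * of_real t)) * f t) = exp (- (Re s * t)) * norm (f t)" by (simp add: norm_mult)
      also have "\<dots> \<le> exp (- (Re s * t)) * (C * pw a t)" by (intro mult_left_mono C) simp
      finally show "norm (exp (- (s * of_real t)) * f t) \<le> norm (C * (exp (- (Re s * t)) * pw a t))"
        using C(1) by (simp add: mult_ac)
    qed
  qed measurable
qed

definition conv :: "(real \<Rightarrow> complex) \<Rightarrow> (real \<Rightarrow> complex) \<Rightarrow> real \<Rightarrow> complex" where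
  "conv f g t = (LINT x|lborel. f x * g (t - x))"

lemma conv_laplace:
  assumes f: "cls a f" "a > 0" and g: "cls b g" "b > 0" and s: "Re s > 0"
  shows "Lp (conv f g) s = Lp f s * Lp g s"
proof -
  have [measurable]: "f \<in> borel_measurable borel" "g \<in> borel_measurable borel" by (rule cls_meas f g)+
  define F where "F t = exp (- (s * of_real t)) * f t" for t
  define G where "G t = exp (- (s * of_real t)) * g t" for t
  have [measurable]: "F \<in> borel_measurable borel" "G \<in> borel_measurable borel" unfolding F_def G_def by measurable
  have Fi: "integrable lborel F" unfolding F_def[abs_def] by (rule cls_integrable[OF f s])
  have Gi: "integrable lborel G" unfolding G_def[abs_def] by (rule cls_integrable[OF g s])
  have Gs: "integrable lborel (\<lambda>t. G (t - x))" for x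
    using lborel_integrable_real_affine[OF Gi, of 1 "-x"] by simp
  have GI: "(LINT t|lborel. H (t - x)) = (LINT t|lborel. H t)" for H :: "real \<Rightarrow> 'b::{banach,second_countable_topology}" and x
    using lborel_integral_real_affine[of 1 H "-x"] by simp
  have int: "integrable (lborel \<Otimes>\<^sub>M lborel) (\<lambda>(x, t). F x * G (t - x))"
  proof (rule lborel_pair.Fubini_integrable)
    show "(\<lambda>(x, t). F x * G (t - x)) \<in> borel_measurable (lborel \<Otimes>\<^sub>M lborel)" by measurable
    have "(LINT t|lborel. norm (F x * G (t - x))) = norm (F x) * (LINT t|lborel. norm (G t))" for x
      using GI[of "\<lambda>t. norm (G t)" x] by (simp add: norm_mult)
    then show "integrable lborel (\<lambda>x. LINT t|lborel. norm (case (x, t) of (x, t) \<Rightarrow> F x * G (t - x)))"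
      using Fi by simp
    show "AE x in lborel. integrable lborel (\<lambda>t. case (x, t) of (x, t) \<Rightarrow> F x * G (t - x))"
      using Gs by simp
  qed
  have "Lp (conv f g) s = (LINT t|lborel. LINT x|lborel. F x * G (t - x))"
  proof -
    have "exp (- (s * of_real t)) * conv f g t = (LINT x|lborel. F x * G (t - x))" for t
    proof -
      have "F x * G (t - x) = exp (- (s * of_real t)) * (f x * g (t - x))" for x
      proof -
        have "exp (- (s * of_real x)) * exp (- (s * of_real (t - x))) = exp (- (s * of_real t))"
          by (simp add: exp_add[symmetric] algebra_simps)
        then show ?thesis by (simp add: F_def G_def mult_ac)
      qed
      then show ?thesis by (simp add: conv_def)
    qed
    then show ?thesis by (simp add: Lp_def)
  qed
  also have "\<dots> = (LINT x|lborel. LINT t|lborel. F x * G (t - x))"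
    by (rule lborel_pair.Fubini_integral[OF int])
  also have "\<dots> = (LINT x|lborel. F x * (LINT t|lborel. G t))"
    using GI[of G] by simp
  also have "\<dots> = Lp f s * Lp g s" by (simp add: Lp_def F_def G_def)
  finally show ?thesis .
qed

lemma Beta_integrable:
  assumes "a > 0" "b > 0" shows "integrable lborel (\<lambda>x. pw a x * pw b (1 - x))"
proof -
  have "(\<lambda>x. pw a x * pw b (1 - x)) = (\<lambda>x. indicator {0..1} x *\<^sub>R (x powr (a - 1) * (1 - x) powr (b - 1)))"
    by (auto simp: fun_eq_iff pw_def indicator_def)
  then show ?thesis using integrable_Beta[OF assms] by (simp add: set_integrable_def)
qed

lemma conv_cls:
  assumes f: "cls a f" "a > 0" and g: "cls b g" "b > 0"
  shows "cls (a + b) (conv f g)"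
proof -
  have [measurable]: "f \<in> borel_measurable borel" "g \<in> borel_measurable borel" by (rule cls_meas f g)+
  obtain C where C: "C \<ge> 0" "\<And>t. norm (f t) \<le> C * pw a t" using clsE[OF f(1)] by blast
  obtain D where D: "D \<ge> 0" "\<And>t. norm (g t) \<le> D * pw b t" using clsE[OF g(1)] by blast
  have f0: "t \<le> 0 \<Longrightarrow> f t = 0" and g0: "t \<le> 0 \<Longrightarrow> g t = 0" for t using f g by (auto simp: cls_def)
  let ?B = "\<lambda>x. pw a x * pw b (1 - x)"
  note Bi = Beta_integrable[OF f(2) g(2)]
  \<comment> \<open>Rescaling by t takes the dependence on t out of the domain of integration. The
    integrands are then dominated by multiples of one Beta density, which serves for the bound and
    for continuity.\<close>
  have sc: "conv f g t = of_real t * (LINT x|lborel. f (t * x) * g (t * (1 - x)))" if "t > 0" for t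
    using lborel_integral_real_affine[of t "\<lambda>x. f x * g (t - x)" 0] that
    by (simp add: conv_def right_diff_distrib scaleR_conv_of_real)
  have bd: "norm (f (t * x) * g (t * (1 - x))) \<le> C * D * t powr (a + b - 2) * ?B x" if t: "t > 0" for t x
  proof -
    have p: "pw c (t * y) = t powr (c - 1) * pw c y" for c y
      using t by (auto simp: pw_def zero_less_mult_iff powr_mult)
    have "norm (f (t * x) * g (t * (1 - x))) \<le> (C * pw a (t * x)) * (D * pw b (t * (1 - x)))"
      unfolding norm_mult by (intro mult_mono C D mult_nonneg_nonneg) auto
    also have "\<dots> = C * D * (t powr (a - 1) * t powr (b - 1)) * ?B x" unfolding p by (simp add: mult_ac)
    also have "t powr (a - 1) * t powr (b - 1) = t powr (a + b - 2)"
      unfolding powr_add[symmetric] by (rule arg_cong[where f = "\<lambda>x. t powr x"]) simp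
    finally show ?thesis .
  qed
  have z: "conv f g t = 0" if "t \<le> 0" for t
  proof -
    have "(\<lambda>x. f x * g (t - x)) = (\<lambda>x. 0)"
    proof
      show "f x * g (t - x) = 0" for x using f0[of x] g0[of "t - x"] that by (cases "x \<le> 0") auto
    qed
    then show ?thesis by (simp add: conv_def)
  qed
  have bound: "norm (conv f g t) \<le> (C * D * (LINT x|lborel. ?B x)) * t powr (a + b - 1)" if t: "t > 0" for t
  proof -
    have "norm (LINT x|lborel. f (t * x) * g (t * (1 - x))) \<le> (LINT x|lborel. C * D * t powr (a + b - 2) * ?B x)"
    proof (rule Bochner_Integration.integral_norm_bound_integral)
      show i: "integrable lborel (\<lambda>x. C * D * t powr (a + b - 2) * ?B x)" by (intro integrable_mult_right Bi)
      show "integrable lborel (\<lambda>x. f (t * x) * g (t * (1 - x)))"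
        by (rule Bochner_Integration.integrable_bound[OF i]) (measurable, intro AE_I2 order_trans[OF bd[OF t]], simp)
      show "norm (f (t * x) * g (t * (1 - x))) \<le> C * D * t powr (a + b - 2) * ?B x" for x by (rule bd[OF t])
    qed
    also have "\<dots> = C * D * (LINT x|lborel. ?B x) * t powr (a + b - 2)"
      unfolding integral_mult_right_zero by (simp only: mult_ac)
    finally have "norm (conv f g t) \<le> t * (C * D * (LINT x|lborel. ?B x) * t powr (a + b - 2))"
      unfolding sc[OF t] norm_mult using t by (simp add: mult_left_mono)
    also have "\<dots> = C * D * (LINT x|lborel. ?B x) * (t powr 1 * t powr (a + b - 2))" using t by simp
    also have "t powr 1 * t powr (a + b - 2) = t powr (a + b - 1)"
      unfolding powr_add[symmetric] by (rule arg_cong[where f = "\<lambda>x. t powr x"]) simp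
    finally show ?thesis .
  qed
  have fc: "isCont f t" and gc: "isCont g t" if "t > 0" for t
    using f(1) g(1) that by (auto simp: cls_def continuous_on_eq_continuous_at)
  have "continuous_on {0<..} (conv f g)"
    unfolding continuous_on_sequentially
  proof (intro allI ballI impI, elim conjE)
    fix u :: "nat \<Rightarrow> real" and t assume t: "t \<in> {0<..}" and u: "\<forall>n. u n \<in> {0<..}" and lim: "u \<longlonglongrightarrow> t"
    have "(\<lambda>n. u n powr (a + b - 2)) \<longlonglongrightarrow> t powr (a + b - 2)" by (intro tendsto_intros lim) (use t in auto)
    then have "Bseq (\<lambda>n. u n powr (a + b - 2))" using convergent_imp_Bseq convergentI by blast
    then obtain K where K: "\<And>n. norm (u n powr (a + b - 2)) \<le> K" unfolding Bseq_def by blast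
    have "(\<lambda>n. LINT x|lborel. f (u n * x) * g (u n * (1 - x))) \<longlonglongrightarrow> (LINT x|lborel. f (t * x) * g (t * (1 - x)))"
    proof (rule integral_dominated_convergence)
      show "integrable lborel (\<lambda>x. C * D * K * ?B x)" by (intro integrable_mult_right Bi)
      show "AE x in lborel. (\<lambda>n. f (u n * x) * g (u n * (1 - x))) \<longlonglongrightarrow> f (t * x) * g (t * (1 - x))"
      proof (rule AE_I2)
        fix x :: real
        consider "x \<le> 0" | "x \<ge> 1" | "0 < x" "x < 1" by linarith
        then show "(\<lambda>n. f (u n * x) * g (u n * (1 - x))) \<longlonglongrightarrow> f (t * x) * g (t * (1 - x))"
        proof cases
          case 1
          then have "u n * x \<le> 0" "t * x \<le> 0" for n using u t by (auto intro!: mult_nonneg_nonpos simp: less_imp_le)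
          then show ?thesis by (simp add: f0)
        next
          case 2
          then have "u n * (1 - x) \<le> 0" "t * (1 - x) \<le> 0" for n using u t by (auto intro!: mult_nonneg_nonpos simp: less_imp_le)
          then show ?thesis by (simp add: g0)
        next
          case 3
          then show ?thesis using t
            by (intro tendsto_mult isCont_tendsto_compose[OF fc] isCont_tendsto_compose[OF gc] tendsto_intros lim) auto
        qed
      qed
      show "AE x in lborel. norm (f (u n * x) * g (u n * (1 - x))) \<le> C * D * K * ?B x" for n
      proof (rule AE_I2)
        fix x
        have "norm (f (u n * x) * g (u n * (1 - x))) \<le> C * D * u n powr (a + b - 2) * ?B x" using bd u by simp
        also have "\<dots> \<le> C * D * K * ?B x"
          using K[of n] C D by (intro mult_right_mono mult_left_mono) auto
        finally show "norm (f (u n * x) * g (u n * (1 - x))) \<le> C * D * K * ?B x" .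
      qed
    qed measurable
    then have "(\<lambda>n. of_real (u n) * (LINT x|lborel. f (u n * x) * g (u n * (1 - x)))) \<longlonglongrightarrow> of_real t * (LINT x|lborel. f (t * x) * g (t * (1 - x)))"
      by (intro tendsto_mult tendsto_of_real lim)
    then show "(conv f g \<circ> u) \<longlonglongrightarrow> conv f g t"
      using u t sc by (simp add: o_def)
  qed
  then show ?thesis unfolding cls_def using z bound by blast
qed

section \<open>Complex powers as Laplace transforms\<close>

lemma pw_cls: "cls a (\<lambda>t. of_real (pw a t))"
  unfolding cls_def
proof (intro conjI exI)
  show "\<forall>t\<le>0. complex_of_real (pw a t) = 0" by (simp add: pw_def)
  have "continuous_on {0<..} (\<lambda>t::real. complex_of_real (t powr (a - 1)))"
    by (intro continuous_intros) auto
  then show "continuous_on {0<..} (\<lambda>t. complex_of_real (pw a t))"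
    by (rule continuous_on_eq) (simp add: pw_def)
  show "\<forall>t>0. norm (complex_of_real (pw a t)) \<le> 1 * t powr (a - 1)" by (simp add: pw_def)
qed

text \<open>In place of a rotation of the contour, exp(-(w - r) t) is expanded for a suitable real
  r. Transforming termwise gives the binomial series of (1 + (w - r)/r)^(-a), which carries the
  principal branch.\<close>

lemma pw_laplace_complex:
  fixes w :: complex
  assumes a: "a > 0" and w: "Re w > 0"
  shows "integrable lborel (\<lambda>t. exp (- (w * of_real t)) * of_real (pw a t))"
    and "(LINT t|lborel. exp (- (w * of_real t)) * of_real (pw a t)) = of_real (Gamma a) * w powr (- of_real a)"
proof -
  show "integrable lborel (\<lambda>t. exp (- (w * of_real t)) * of_real (pw a t))"
    by (rule cls_integrable[OF pw_cls a w])
  \<comment> \<open>For this r one has |w - r|^2 = r^2 - |w|^2 < r^2, so the binomial series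
    converges for every w in the right half plane.\<close>
  define r where "r = (cmod w)\<^sup>2 / Re w"
  define d where "d = w - of_real r"
  have w0: "w \<noteq> 0" using w by auto
  have r: "r > 0" using w w0 by (simp add: r_def)
  have "(cmod d)\<^sup>2 = (cmod w)\<^sup>2 - 2 * r * Re w + r\<^sup>2"
    unfolding cmod_power2 by (simp add: d_def power2_eq_square algebra_simps)
  also have "r * Re w = (cmod w)\<^sup>2" using w by (simp add: r_def)
  then have "(cmod w)\<^sup>2 - 2 * r * Re w + r\<^sup>2 = r\<^sup>2 - (cmod w)\<^sup>2" by simp
  also have "\<dots> < r\<^sup>2" using w0 by simp
  finally have dr: "cmod d < r" using r power2_less_imp_less less_imp_le by blast
  then have dr1: "cmod (d / of_real r) < 1" using r by (simp add: norm_divide)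
  have G: "Gamma a > 0" by (rule Gamma_real_pos[OF a])
  have poch: "Gamma (a + real n) = pochhammer a n * Gamma a" for n
  proof -
    have "a \<notin> \<int>\<^sub>\<le>\<^sub>0" using a nonpos_Ints_nonpos[of a] by linarith
    then show ?thesis using pochhammer_Gamma[of a n] G by simp
  qed
  have pp: "pochhammer a n > 0" for n by (rule pochhammer_pos[OF a])
  define h where "h n = (- d) ^ n / fact n * of_real (Gamma (a + real n))" for n
  have hb: "h n = of_real (Gamma a) * (((- of_real a) gchoose n) * d ^ n)" for n
    by (simp add: h_def poch gbinomial_pochhammer pochhammer_of_real power_minus[of d] mult_ac)
  have hs: "summable (\<lambda>n. norm (h n) / r ^ n)"
  proof -
    have "summable (\<lambda>n. norm (((- of_real a) gchoose n) * (d / of_real r) ^ n))"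
    proof (rule abs_summable_in_conv_radius)
      show "ereal (norm (d / of_real r)) < conv_radius (\<lambda>n. (- complex_of_real a) gchoose n)"
        using dr1 by (simp add: conv_radius_gchoose one_ereal_def)
    qed
    then have "summable (\<lambda>n. Gamma a * norm (((- of_real a) gchoose n) * (d / of_real r) ^ n))" by (rule summable_mult)
    then show ?thesis using G r unfolding hb by (simp add: norm_mult norm_power norm_divide power_divide)
  qed
  have psi: "psi a h t = exp (- (d * of_real t)) * of_real (pw a t)" for t
  proof (cases "t > 0")
    case True
    have "h n * of_real (pw (a + real n) t / Gamma (a + real n)) = of_real (pw a t) * ((- (d * of_real t)) ^ n /\<^sub>R fact n)" for n
    proof -
      have "Gamma (a + real n) \<noteq> 0" using poch pp[of n] G by simp
      moreover have "pw (a + real n) t = pw a t * t ^ n"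
      proof -
        have "t powr (a + real n - 1) = t powr ((a - 1) + real n)" by (rule arg_cong[where f = "\<lambda>x. t powr x"]) simp
        then show ?thesis using True by (simp only: pw_def powr_add powr_realpow if_True)
      qed
      moreover have "(- (d * of_real t)) ^ n = (- d) ^ n * of_real t ^ n" by (simp flip: power_mult_distrib)
      ultimately show ?thesis by (simp add: h_def scaleR_conv_of_real divide_inverse mult_ac)
    qed
    then show ?thesis unfolding psi_def exp_def
      by (subst suminf_mult2[OF summable_exp_generic]) (simp add: mult_ac)
  qed (simp add: psi_def pw_def)
  have "(LINT t|lborel. exp (- (w * of_real t)) * of_real (pw a t)) = (LINT t|lborel. exp (- (of_real r * of_real t)) * psi a h t)"
  proof -
    have "exp (- (w * of_real t)) = exp (- (of_real r * of_real t)) * exp (- (d * of_real t))" for t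
      by (simp add: d_def exp_add[symmetric] algebra_simps)
    then show ?thesis unfolding psi by (simp add: mult_ac)
  qed
  also have "\<dots> = (\<Sum>n. h n * of_real (r powr (- (a + real n))))" by (rule psi_laplace(3)[OF a r hs])
  also have "\<dots> = (\<Sum>n. of_real (Gamma a * r powr (- a)) * (((- of_real a) gchoose n) * (d / of_real r) ^ n))"
  proof -
    have "r powr (- (a + real n)) = r powr (- a) / r ^ n" for n
      using r powr_add[of r "- a" "- real n"] by (simp add: powr_minus powr_realpow divide_inverse)
    then show ?thesis unfolding hb by (simp add: power_divide mult_ac)
  qed
  also have "\<dots> = of_real (Gamma a * r powr (- a)) * (1 + d / of_real r) powr (- of_real a)"
    using gen_binomial_complex[OF dr1, of "- of_real a"] unfolding sums_iff by (simp add: suminf_mult)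
  also have "\<dots> = of_real (Gamma a) * (of_real r * (1 + d / of_real r)) powr (- of_real a)"
  proof -
    have nz: "1 + d / of_real r \<noteq> 0"
    proof
      assume "1 + d / of_real r = 0"
      then have "d / of_real r = -1" by (simp add: eq_neg_iff_add_eq_0 add.commute)
      then show False using dr1 by simp
    qed
    have "(of_real r * (1 + d / of_real r)) powr (- of_real a) = of_real r powr (- of_real a) * (1 + d / of_real r) powr (- of_real a)"
    proof -
      have "of_real r * (1 + d / of_real r) \<noteq> 0" using nz r by (simp only: mult_eq_0_iff of_real_eq_0_iff) simp
      then show ?thesis
        using nz r by (simp only: powr_def Ln_times_of_real[OF r nz] if_False of_real_eq_0_iff less_numeral_extra Ln_of_real[OF r]) (simp add: distrib_left exp_add[symmetric])
    qed
    moreover have "complex_of_real r powr (- of_real a) = of_real (r powr (- a))"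
      using powr_of_real[of r "- a"] r by simp
    ultimately show ?thesis by simp
  qed
  also have "of_real r * (1 + d / of_real r) = w" using r by (simp add: d_def field_simps)
  finally show "(LINT t|lborel. exp (- (w * of_real t)) * of_real (pw a t)) = of_real (Gamma a) * w powr (- of_real a)" .
qed

lemma exp_pw_cls:
  assumes c: "Re c = 0"
  shows "cls a (\<lambda>t. K * (exp (- (c * of_real t)) * of_real (pw a t)))"
  unfolding cls_def
proof (intro conjI exI)
  show "\<forall>t\<le>0. K * (exp (- (c * of_real t)) * complex_of_real (pw a t)) = 0" by (simp add: pw_def)
  have "continuous_on {0<..} (\<lambda>t. complex_of_real (pw a t))" using pw_cls[of a] by (simp add: cls_def)
  then show "continuous_on {0<..} (\<lambda>t. K * (exp (- (c * of_real t)) * complex_of_real (pw a t)))"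
    by (intro continuous_on_mult[OF continuous_on_const] continuous_on_mult[OF continuous_on_exp]) (intro continuous_intros)
  show "\<forall>t>0. norm (K * (exp (- (c * of_real t)) * complex_of_real (pw a t))) \<le> norm K * t powr (a - 1)"
    using c by (simp add: pw_def norm_mult)
qed

lemma exp_pw_laplace:
  assumes a: "a > 0" and c: "Re c = 0" and s: "Re s > 0"
  shows "Lp (\<lambda>t. K * (exp (- (c * of_real t)) * of_real (pw a t))) s = K * of_real (Gamma a) * (s + c) powr (- of_real a)"
proof -
  have "exp (- (s * of_real t)) * (K * (exp (- (c * of_real t)) * of_real (pw a t))) = K * (exp (- ((s + c) * of_real t)) * of_real (pw a t))" for t
  proof -
    have "exp (- ((s + c) * of_real t)) = exp (- (s * of_real t)) * exp (- (c * of_real t))"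
      by (simp add: exp_add[symmetric] algebra_simps)
    then show ?thesis by (simp only: mult_ac)
  qed
  note e = this
  show ?thesis using pw_laplace_complex(2)[OF a, of "s + c"] c s unfolding Lp_def e by simp
qed

lemma prod_powr_laplace:
  fixes c :: "nat \<Rightarrow> complex"
  assumes a: "a > 0" and c: "\<And>l. Re (c l) = 0"
  shows "\<exists>g. cls (real (Suc n) * a) g \<and> (\<forall>s. Re s > 0 \<longrightarrow> Lp g s = (\<Prod>l<Suc n. (s + c l) powr (- of_real a)))"
proof (induction n)
  case 0
  have "Gamma a \<noteq> 0" using Gamma_real_pos[OF a] by simp
  then show ?case
    using exp_pw_cls[OF c, of a "1 / of_real (Gamma a)" 0] exp_pw_laplace[OF a c, of _ "1 / of_real (Gamma a)" 0]
    by (intro exI[of _ "\<lambda>t. 1 / of_real (Gamma a) * (exp (- (c 0 * of_real t)) * of_real (pw a t))"]) simp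
next
  case (Suc n)
  then obtain g where g: "cls (real (Suc n) * a) g" "\<And>s. Re s > 0 \<Longrightarrow> Lp g s = (\<Prod>l<Suc n. (s + c l) powr (- of_real a))" by blast
  define f where "f t = 1 / of_real (Gamma a) * (exp (- (c (Suc n) * of_real t)) * of_real (pw a t))" for t
  have f: "cls a f" unfolding f_def[abs_def] by (rule exp_pw_cls[OF c])
  have "Gamma a \<noteq> 0" using Gamma_real_pos[OF a] by simp
  then have fl: "Re s > 0 \<Longrightarrow> Lp f s = (s + c (Suc n)) powr (- of_real a)" for s
    using exp_pw_laplace[OF a c, of s "1 / of_real (Gamma a)" "Suc n"] unfolding f_def[abs_def] by simp
  have p: "real (Suc n) * a > 0" using a by simp
  have e: "real (Suc n) * a + a = real (Suc (Suc n)) * a" by (simp add: algebra_simps)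
  show ?case
  proof (intro exI[of _ "conv g f"] conjI allI impI)
    show "cls (real (Suc (Suc n)) * a) (conv g f)" using conv_cls[OF g(1) p f a] unfolding e .
    show "Lp (conv g f) s = (\<Prod>l<Suc (Suc n). (s + c l) powr (- of_real a))" if "Re s > 0" for s
      unfolding conv_laplace[OF g(1) p f a that] g(2)[OF that] fl[OF that] by simp
  qed
qed

text \<open>In the variable x = exp(-t) all polynomial moments vanish, hence by Weierstrass also the
  integrals against continuous functions on [0,1]. A tent function near exp(-t0) then contradicts a
  nonzero value at t0.\<close>

lemma lerch_zero:
  fixes f :: "real \<Rightarrow> complex"
  assumes f0: "\<And>t. t \<le> 0 \<Longrightarrow> f t = 0" and fc: "continuous_on {0<..} f"
    and int: "integrable lborel (\<lambda>t. exp (- (of_real \<sigma> * of_real t)) * f t)"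
    and z: "\<And>n. Lp f (of_real (\<sigma> + real n)) = 0"
  shows "f t0 = 0"
proof (rule ccontr)
  assume nz: "f t0 \<noteq> 0"
  then have t0: "t0 > 0" using f0[of t0] by force
  define F where "F t = exp (- (of_real \<sigma> * of_real t)) * f t" for t
  have Fi: "integrable lborel F" using int by (simp add: F_def[abs_def])
  have [measurable]: "F \<in> borel_measurable borel" using borel_measurable_integrable[OF Fi] by simp
  have F0: "t \<le> 0 \<Longrightarrow> F t = 0" for t by (simp add: F_def f0)
  \<comment> \<open>F t0 * y = |F t0|^2, so this factor makes the real part positive at t0 and, by
    continuity, near it.\<close>
  define y where "y = cnj (F t0)"
  have Ft0: "F t0 \<noteq> 0" using nz by (simp add: F_def)
  have bd_int: "integrable lborel (\<lambda>t. F t * of_real (\<phi> (exp (- t))))"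
    if m: "\<phi> \<in> borel_measurable borel" and b: "\<And>x. x \<in> {0..1} \<Longrightarrow> \<bar>\<phi> x\<bar> \<le> C" for \<phi> :: "real \<Rightarrow> real" and C
  proof (rule Bochner_Integration.integrable_bound)
    show "integrable lborel (\<lambda>t. C * norm (F t))" using Fi by simp
    show "AE t in lborel. norm (F t * of_real (\<phi> (exp (- t)))) \<le> norm (C * norm (F t))"
    proof (rule AE_I2)
      fix t
      show "norm (F t * of_real (\<phi> (exp (- t)))) \<le> norm (C * norm (F t))"
      proof (cases "t \<le> 0")
        case False
        then have "\<bar>\<phi> (exp (- t))\<bar> \<le> C" by (intro b) simp
        then have "norm (F t) * \<bar>\<phi> (exp (- t))\<bar> \<le> norm (F t) * \<bar>C\<bar>" by (intro mult_left_mono) auto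
        then show ?thesis by (simp add: norm_mult abs_mult mult.commute)
      qed (simp add: F0)
    qed
  qed (use m in measurable)
  have pow: "(LINT t|lborel. F t * of_real (exp (- t) ^ n)) = 0" for n
  proof -
    have "F t * of_real (exp (- t) ^ n) = exp (- (of_real (\<sigma> + real n) * of_real t)) * f t" for t
      by (simp add: F_def exp_of_real[symmetric] exp_of_nat_mult[symmetric] exp_add[symmetric] algebra_simps)
    then show ?thesis using z[of n] by (simp add: Lp_def)
  qed
  have cont0: "(LINT t|lborel. F t * of_real (\<phi> (exp (- t)))) = 0" if c: "continuous_on UNIV \<phi>" for \<phi> :: "real \<Rightarrow> real"
  proof -
    have m: "\<phi> \<in> borel_measurable borel" by (rule borel_measurable_continuous_onI[OF c])
    have c1: "continuous_on {0..1} \<phi>" using c continuous_on_subset by blast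
    have "compact (\<phi> ` {0..1})" by (intro compact_continuous_image c1) simp
    then obtain C where C: "\<And>x. x \<in> {0..1} \<Longrightarrow> \<bar>\<phi> x\<bar> \<le> C" using compact_imp_bounded bounded_iff by (metis imageI real_norm_def)
    have "norm (LINT t|lborel. F t * of_real (\<phi> (exp (- t)))) \<le> e * (LINT t|lborel. norm (F t))" if e: "e > 0" for e
    proof -
      obtain p where p: "real_polynomial_function p" "\<And>x. x \<in> {0..1} \<Longrightarrow> \<bar>\<phi> x - p x\<bar> < e"
        using Stone_Weierstrass_real_polynomial_function[OF _ c1 e] by auto
      then obtain a n where pe: "p = (\<lambda>x. \<Sum>i\<le>n. a i * x ^ i)" using real_polynomial_function_iff_sum by blast
      have pm: "p \<in> borel_measurable borel" unfolding pe by measurable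
      have "(LINT t|lborel. F t * of_real (p (exp (- t)))) = (LINT t|lborel. (\<Sum>i\<le>n. of_real (a i) * (F t * of_real (exp (- t) ^ i))))"
        unfolding pe by (simp add: sum_distrib_left mult_ac)
      also have "\<dots> = (\<Sum>i\<le>n. of_real (a i) * (LINT t|lborel. F t * of_real (exp (- t) ^ i)))"
      proof -
        have "integrable lborel (\<lambda>t. F t * of_real (exp (- t) ^ i))" for i
          using bd_int[of "\<lambda>x. x ^ i" 1] by (simp add: power_le_one)
        then show ?thesis by (subst Bochner_Integration.integral_sum) auto
      qed
      also have "\<dots> = 0" using pow by simp
      finally have p0: "(LINT t|lborel. F t * of_real (p (exp (- t)))) = 0" .
      have bp: "x \<in> {0..1} \<Longrightarrow> \<bar>p x\<bar> \<le> C + e" for x using C[of x] p(2)[of x] by linarith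
      have bdp: "x \<in> {0..1} \<Longrightarrow> \<bar>\<phi> x - p x\<bar> \<le> e" for x using p(2)[of x] by simp
      have dm: "(\<lambda>x. \<phi> x - p x) \<in> borel_measurable borel" using m pm by measurable
      have di: "integrable lborel (\<lambda>t. F t * of_real (\<phi> (exp (- t)) - p (exp (- t))))"
        by (rule bd_int[OF dm bdp])
      have "(LINT t|lborel. F t * of_real (\<phi> (exp (- t)) - p (exp (- t)))) = (LINT t|lborel. F t * of_real (\<phi> (exp (- t))))"
        using Bochner_Integration.integral_diff[OF bd_int[OF m C] bd_int[OF pm bp]] p0 by (simp add: right_diff_distrib)
      moreover have "norm (LINT t|lborel. F t * of_real (\<phi> (exp (- t)) - p (exp (- t)))) \<le> (LINT t|lborel. e * norm (F t))"
      proof (rule Bochner_Integration.integral_norm_bound_integral[OF di])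
        show "integrable lborel (\<lambda>t. e * norm (F t))" using Fi by simp
        show "norm (F t * of_real (\<phi> (exp (- t)) - p (exp (- t)))) \<le> e * norm (F t)" for t
        proof (cases "t \<le> 0")
          case False
          then have "\<bar>\<phi> (exp (- t)) - p (exp (- t))\<bar> \<le> e" by (intro bdp) simp
          then have "norm (F t) * \<bar>\<phi> (exp (- t)) - p (exp (- t))\<bar> \<le> norm (F t) * e" by (intro mult_left_mono) auto
          then show ?thesis by (simp only: norm_mult norm_of_real mult.commute)
        qed (simp add: F0)
      qed
      ultimately show ?thesis by simp
    qed
    note le = this
    show ?thesis
    proof (rule ccontr)
      assume "(LINT t|lborel. F t * of_real (\<phi> (exp (- t)))) \<noteq> 0"
      then have n: "norm (LINT t|lborel. F t * of_real (\<phi> (exp (- t)))) > 0" (is "?N > 0") by simp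
      let ?I = "LINT t|lborel. norm (F t)"
      have I0: "?I \<ge> 0" by simp
      have I1: "2 * (?I + 1) > 0" using I0 by (simp add: add_nonneg_pos)
      have "?N \<le> ?N / (2 * (?I + 1)) * ?I" by (rule le, rule divide_pos_pos[OF n I1])
      also have "\<dots> = ?N * (?I / (2 * (?I + 1)))" by simp
      also have "\<dots> \<le> ?N * (1/2)" 
      proof -
        have "x / (2 * (x + 1)) \<le> 1/2" if "x \<ge> 0" for x :: real using that by (simp add: field_simps)
        from this[OF I0] show ?thesis by (rule mult_left_mono) simp
      qed
      finally show False using n by simp
    qed
  qed
  have Fc: "isCont F t" if "t > 0" for t
  proof -
    have "isCont f t" using fc that by (auto simp: continuous_on_eq_continuous_at)
    then show ?thesis unfolding F_def by (intro continuous_intros)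
  qed
  define G where "G t = Re (F t * y)" for t
  have Gt0: "G t0 > 0" using Ft0 unfolding complex_neq_0 by (simp add: G_def y_def power2_eq_square)
  have Gc: "isCont G t0" unfolding G_def
    by (intro continuous_Re continuous_mult Fc t0 continuous_const)
  obtain d1 where d1: "d1 > 0" "\<And>t. \<bar>t - t0\<bar> < d1 \<Longrightarrow> G t > 0"
  proof -
    have "eventually (\<lambda>t. G t > 0) (nhds t0)"
      using Gc Gt0 by (intro order_tendstoD(1)[of G "G t0"]) (auto simp: isCont_def tendsto_at_iff_tendsto_nhds)
    then show thesis using that unfolding eventually_nhds_metric dist_real_def by blast
  qed
  \<comment> \<open>d2 is chosen so that exp(-t) in the support of the tent around x0 forces t into
    the interval where G is positive; the product H is then nonnegative everywhere.\<close>
  define x0 where "x0 = exp (- t0)"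
  have "isCont (\<lambda>x. - ln x) x0" by (intro continuous_intros) (simp_all add: x0_def)
  then obtain d2 where d2: "d2 > 0" "\<And>x. \<bar>x - x0\<bar> < d2 \<Longrightarrow> \<bar>- ln x - (- ln x0)\<bar> < d1"
    unfolding continuous_at_eps_delta using d1(1) by (auto simp: dist_real_def)
  define \<phi> where "\<phi> x = max 0 (d2 - \<bar>x - x0\<bar>)" for x
  have pc: "continuous_on UNIV \<phi>" unfolding \<phi>_def by (intro continuous_intros)
  have pm: "\<phi> \<in> borel_measurable borel" by (rule borel_measurable_continuous_onI[OF pc])
  have pb: "\<bar>\<phi> x\<bar> \<le> d2" for x using d2 by (simp add: \<phi>_def)
  have hi: "integrable lborel (\<lambda>t. F t * of_real (\<phi> (exp (- t))))" by (rule bd_int[OF pm pb])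
  define H where "H t = G t * \<phi> (exp (- t))" for t
  have He: "H t = Re (y * (F t * of_real (\<phi> (exp (- t)))))" for t by (simp add: H_def G_def algebra_simps)
  have Hi: "integrable lborel H" unfolding He[abs_def] using hi by (intro integrable_Re integrable_mult_right)
  have HI: "(LINT t|lborel. H t) = 0"
    unfolding He using hi cont0[OF pc] by (subst integral_Re) auto
  have H0: "H t \<ge> 0" for t
  proof (cases "\<bar>exp (- t) - x0\<bar> < d2")
    case True
    then have "\<bar>t - t0\<bar> < d1" using d2(2)[OF True] by (simp add: x0_def)
    then have "G t > 0" by (rule d1(2))
    then show ?thesis by (simp add: H_def \<phi>_def)
  qed (simp add: H_def \<phi>_def)
  have Ht0: "H t0 > 0" using Gt0 d2(1) by (simp add: H_def \<phi>_def x0_def)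
  have Hc: "isCont H t0" unfolding H_def \<phi>_def by (intro continuous_intros Gc)
  obtain d where d: "d > 0" "\<And>t. \<bar>t - t0\<bar> < d \<Longrightarrow> H t > H t0 / 2"
  proof -
    have "eventually (\<lambda>t. H t > H t0 / 2) (nhds t0)"
      using Hc Ht0 by (intro order_tendstoD(1)[of H "H t0"]) (auto simp: isCont_def tendsto_at_iff_tendsto_nhds)
    then show thesis using that unfolding eventually_nhds_metric dist_real_def by blast
  qed
  have "(LINT t|lborel. H t0 / 2 * indicator {t0 - d / 2 .. t0 + d / 2} t) \<le> (LINT t|lborel. H t)"
  proof (rule integral_mono)
    show "integrable lborel (\<lambda>t. H t0 / 2 * indicator {t0 - d / 2 .. t0 + d / 2} t)"
      by (intro integrable_mult_right integrable_real_indicator) (simp_all add: emeasure_lborel_Icc_eq)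
    show "H t0 / 2 * indicator {t0 - d / 2 .. t0 + d / 2} t \<le> H t" for t
      using d(2)[of t] d(1) H0[of t] by (auto simp: indicator_def abs_if not_le intro!: less_imp_le)
  qed (rule Hi)
  also have "(LINT t|lborel. H t0 / 2 * indicator {t0 - d / 2 .. t0 + d / 2} t) = H t0 / 2 * d" using d(1) by simp
  finally show False using HI Ht0 d(1) by (simp add: mult_le_0_iff)
qed

lemma lerch:
  fixes f g :: "real \<Rightarrow> complex"
  assumes f: "\<And>t. t \<le> 0 \<Longrightarrow> f t = 0" "continuous_on {0<..} f"
    and g: "\<And>t. t \<le> 0 \<Longrightarrow> g t = 0" "continuous_on {0<..} g"
    and fi: "\<And>s. s \<ge> \<sigma> \<Longrightarrow> integrable lborel (\<lambda>t. exp (- (of_real s * of_real t)) * f t)"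
    and gi: "\<And>s. s \<ge> \<sigma> \<Longrightarrow> integrable lborel (\<lambda>t. exp (- (of_real s * of_real t)) * g t)"
    and e: "\<And>s. s \<ge> \<sigma> \<Longrightarrow> Lp f (of_real s) = Lp g (of_real s)"
  shows "f = g"
proof
  fix t
  have "f t - g t = 0"
  proof (rule lerch_zero[of "\<lambda>t. f t - g t" \<sigma> t])
    show "continuous_on {0<..} (\<lambda>t. f t - g t)" by (intro continuous_on_diff f g)
    show "integrable lborel (\<lambda>t. exp (- (of_real \<sigma> * of_real t)) * (f t - g t))"
      unfolding right_diff_distrib by (intro Bochner_Integration.integrable_diff fi gi) simp_all
    show "Lp (\<lambda>t. f t - g t) (of_real (\<sigma> + real n)) = 0" for n
    proof -
      have "\<sigma> + real n \<ge> \<sigma>" by simp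
      then show ?thesis using Bochner_Integration.integral_diff[OF fi[of "\<sigma> + real n"] gi[of "\<sigma> + real n"]] e[of "\<sigma> + real n"]
        unfolding Lp_def right_diff_distrib by simp
    qed
  qed (simp add: f g)
  then show "f t = g t" by simp
qed

text \<open>Resolves the definite description: any two candidates have equal transforms for real s
  \<ge> 1, so \<open>lerch\<close> identifies them.\<close>

lemma gfun_eq:
  assumes g: "cls a g" "a > 0" and L: "\<And>s. Re s > 0 \<Longrightarrow> Lp g s = Apow k b gam q s"
  shows "gfun k b gam q = g"
proof -
  have set: "set_integrable lborel {0<..} (\<lambda>t. exp (- (s * of_real t)) * h t) = integrable lborel (\<lambda>t. exp (- (s * of_real t)) * h t)"
    "(LINT t:{0<..}|lborel. exp (- (s * of_real t)) * h t) = Lp h s"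
    if "\<forall>t\<le>0. h t = 0" for h :: "real \<Rightarrow> complex" and s
  proof -
    have "(\<lambda>t. indicator {0<..} t *\<^sub>R (exp (- (s * of_real t)) * h t)) = (\<lambda>t. exp (- (s * of_real t)) * h t)"
      using that by (auto simp: fun_eq_iff indicator_def)
    then show "set_integrable lborel {0<..} (\<lambda>t. exp (- (s * of_real t)) * h t) = integrable lborel (\<lambda>t. exp (- (s * of_real t)) * h t)"
      "(LINT t:{0<..}|lborel. exp (- (s * of_real t)) * h t) = Lp h s"
      by (simp_all add: set_integrable_def set_lebesgue_integral_def Lp_def)
  qed
  have g0: "\<forall>t\<le>0. g t = 0" and gc: "continuous_on {0<..} g" using g by (auto simp: cls_def)
  show ?thesis unfolding gfun_def
  proof (rule the_equality)
    show "(\<forall>t\<le>0. g t = 0) \<and> continuous_on {0<..} g \<and> (\<forall>s. Re s > 0 \<longrightarrow>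
      set_integrable lborel {0<..} (\<lambda>t. exp (- (s * complex_of_real t)) * g t) \<and>
      (LINT t:{0<..}|lborel. exp (- (s * complex_of_real t)) * g t) = Apow k b gam q s)"
      using g0 gc L cls_integrable[OF g] by (simp add: set[OF g0])
  next
    fix h assume h: "(\<forall>t\<le>0. h t = 0) \<and> continuous_on {0<..} h \<and> (\<forall>s. Re s > 0 \<longrightarrow>
      set_integrable lborel {0<..} (\<lambda>t. exp (- (s * complex_of_real t)) * h t) \<and>
      (LINT t:{0<..}|lborel. exp (- (s * complex_of_real t)) * h t) = Apow k b gam q s)"
    then have h0: "\<forall>t\<le>0. h t = 0" by blast
    show "h = g"
    proof (rule lerch[where \<sigma> = 1])
      show "h t = 0" if "t \<le> 0" for t using h0 that by blast
      show "continuous_on {0<..} h" using h by blast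
      show "g t = 0" if "t \<le> 0" for t using g0 that by blast
      show "integrable lborel (\<lambda>t. exp (- (complex_of_real s * complex_of_real t)) * h t)" if "s \<ge> 1" for s
        using h that set(1)[OF h0, of "of_real s"] by simp
      show "integrable lborel (\<lambda>t. exp (- (complex_of_real s * complex_of_real t)) * g t)" if "s \<ge> 1" for s
        using cls_integrable[OF g, of "of_real s"] that by simp
      show "Lp h (of_real s) = Lp g (of_real s)" if "s \<ge> 1" for s
        using h L[of "of_real s"] that set(2)[OF h0, of "of_real s"] by simp
    qed (rule gc)
  qed
qed

text \<open>Lagrange interpolation at k + 1 distinct nodes is exact in degree at most k. Dividing
  the interpolation formula by the full product gives the partial fractions.\<close>

lemma lagrange_partial_fractions:
  fixes a :: "nat \<Rightarrow> complex"
  assumes inj: "inj_on a {0..k}" and p: "degree p \<le> k" and s: "s \<notin> a ` {0..k}"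
  shows "poly p s / (\<Prod>m\<in>{0..k}. s - a m) = (\<Sum>l\<le>k. poly p (a l) / (\<Prod>m\<in>{0..k} - {l}. a l - a m) / (s - a l))"
proof -
  define Q where "Q = (\<Sum>l\<in>{0..k}. smult (poly p (a l) / (\<Prod>m\<in>{0..k} - {l}. a l - a m)) (\<Prod>m\<in>{0..k} - {l}. [:- a m, 1:]))"
  have Qp: "poly Q x = (\<Sum>l\<in>{0..k}. poly p (a l) / (\<Prod>m\<in>{0..k} - {l}. a l - a m) * (\<Prod>m\<in>{0..k} - {l}. x - a m))" for x
    by (simp add: Q_def poly_sum poly_prod)
  have "p = Q"
  proof (rule poly_eqI_degree[where A = "a ` {0..k}"])
    fix x assume "x \<in> a ` {0..k}"
    then obtain j where j: "j \<in> {0..k}" "x = a j" by blast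
    have "poly Q (a j) = (\<Sum>l\<in>{0..k}. if l = j then poly p (a j) else 0)"
      unfolding Qp
    proof (intro sum.cong refl)
      fix l assume l: "l \<in> {0..k}"
      show "poly p (a l) / (\<Prod>m\<in>{0..k} - {l}. a l - a m) * (\<Prod>m\<in>{0..k} - {l}. a j - a m) = (if l = j then poly p (a j) else 0)"
      proof (cases "l = j")
        case True
        have "(\<Prod>m\<in>{0..k} - {j}. a j - a m) \<noteq> 0" using inj j(1) by (auto simp: inj_on_def)
        then show ?thesis using True by simp
      next
        case False
        then have "(\<Prod>m\<in>{0..k} - {l}. a j - a m) = 0" using j(1) by (intro prod_zero) auto
        then show ?thesis using False by simp
      qed
    qed
    also have "\<dots> = poly p (a j)" using j(1) by simp
    finally show "poly p x = poly Q x" using j by simp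
  next
    have c: "card (a ` {0..k}) = Suc k" using card_image[OF inj] by simp
    then show "degree p < card (a ` {0..k})" using p by simp
    have "degree Q \<le> k" unfolding Q_def
    proof (intro degree_sum_le order_trans[OF degree_smult_le])
      fix l assume l: "l \<in> {0..k}"
      show "degree (\<Prod>m\<in>{0..k} - {l}. [:- a m, 1:]) \<le> k"
        using degree_prod_sum_le[of "{0..k} - {l}" "\<lambda>m. [:- a m, 1:]"] l by simp
    qed simp
    then show "degree Q < card (a ` {0..k})" using c by simp
  qed
  then have "poly p s / (\<Prod>m\<in>{0..k}. s - a m) = (\<Sum>l\<in>{0..k}. poly p (a l) / (\<Prod>m\<in>{0..k} - {l}. a l - a m) * (\<Prod>m\<in>{0..k} - {l}. s - a m) / (\<Prod>m\<in>{0..k}. s - a m))"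
    using Qp[of s] by (simp only: sum_divide_distrib)
  also have "\<dots> = (\<Sum>l\<in>{0..k}. poly p (a l) / (\<Prod>m\<in>{0..k} - {l}. a l - a m) / (s - a l))"
  proof (intro sum.cong refl)
    fix l assume l: "l \<in> {0..k}"
    have "(\<Prod>m\<in>{0..k}. s - a m) = (s - a l) * (\<Prod>m\<in>{0..k} - {l}. s - a m)" using l by (simp add: prod.remove)
    moreover have "(\<Prod>m\<in>{0..k} - {l}. s - a m) \<noteq> 0" using s by auto
    ultimately show "poly p (a l) / (\<Prod>m\<in>{0..k} - {l}. a l - a m) * (\<Prod>m\<in>{0..k} - {l}. s - a m) / (\<Prod>m\<in>{0..k}. s - a m)
      = poly p (a l) / (\<Prod>m\<in>{0..k} - {l}. a l - a m) / (s - a l)" by simp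
  qed
  finally show ?thesis by (simp add: atMost_atLeast0)
qed

text \<open>The tau-integral is a convolution evaluated at t = 1. The exponential sum has transform
  A(s,q(1,1))/(B(s) A(s,q)), a proper fraction whose k + 1 poles are distinct by hypothesis.\<close>

lemma csum_gfun_integral:
  assumes k: "k \<ge> 1" and lam: "lam > 0" and inj: "inj_on (aroot k b om eta q) {0..k}"
  obtains f where "cls (real k * lam + 1) f"
    and "\<And>s. Re s > 0 \<Longrightarrow> Lp f s = Apow k b lam q s * (Apoly k b (qf k om eta 1 1) s / (Bpoly b om eta s * Apoly k b q s))"
    and "(LINT tau:{0..1}|lborel. csum k b om eta q tau * gfun k b lam q tau) = f 1"
proof -
  define a where "a = aroot k b om eta q"
  define c where "c = ccoef k b om eta q"
  have Ra: "Re (a l) = 0" for l by (simp add: a_def aroot_def)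
  obtain n where kn: "k = Suc n" using k by (cases k) auto
  obtain g where g: "cls (real k * lam) g" "\<And>s. Re s > 0 \<Longrightarrow> Lp g s = Apow k b lam q s"
    using prod_powr_laplace[OF lam, of "\<lambda>l. \<i> * complex_of_real (b * cos ((q + 2 * pi * real l) / real k))" n]
    unfolding Apow_def kn by auto
  have kl: "real k * lam > 0" using k lam by simp
  have gf: "gfun k b lam q = g" by (rule gfun_eq[OF g(1) kl g(2)])
  define E where "E t = (\<Sum>l\<le>k. c l * (exp (- (- a l * of_real t)) * of_real (pw 1 t)))" for t
  have El: "cls 1 (\<lambda>t. c l * (exp (- (- a l * of_real t)) * of_real (pw 1 t)))" for l
    by (rule exp_pw_cls) (simp add: Ra)
  have E: "cls 1 E" unfolding cls_def
  proof (intro conjI exI)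
    show "\<forall>t\<le>0. E t = 0" by (simp add: E_def pw_def)
    show "continuous_on {0<..} E" unfolding E_def[abs_def]
      using El by (intro continuous_on_sum) (simp add: cls_def)
    show "\<forall>t>0. norm (E t) \<le> (\<Sum>l\<le>k. norm (c l)) * t powr (1 - 1)"
    proof (intro allI impI)
      fix t :: real assume t: "t > 0"
      have "norm (E t) \<le> (\<Sum>l\<le>k. norm (c l * (exp (- (- a l * of_real t)) * of_real (pw 1 t))))"
        unfolding E_def by (rule norm_sum)
      then show "norm (E t) \<le> (\<Sum>l\<le>k. norm (c l)) * t powr (1 - 1)" using t by (simp add: norm_mult Ra pw_def)
    qed
  qed
  have EL: "Lp E s = Apoly k b (qf k om eta 1 1) s / (Bpoly b om eta s * Apoly k b q s)" if s: "Re s > 0" for s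
  proof -
    have "Lp E s = (LINT t|lborel. (\<Sum>l\<le>k. exp (- (s * of_real t)) * (c l * (exp (- (- a l * of_real t)) * of_real (pw 1 t)))))"
      unfolding Lp_def E_def by (simp only: sum_distrib_left)
    also have "\<dots> = (\<Sum>l\<le>k. Lp (\<lambda>t. c l * (exp (- (- a l * of_real t)) * of_real (pw 1 t))) s)"
      unfolding Lp_def by (rule Bochner_Integration.integral_sum) (rule cls_integrable[OF El _ s], simp)
    also have "\<dots> = (\<Sum>l\<le>k. c l / (s - a l))"
    proof (intro sum.cong refl)
      fix l
      have "Lp (\<lambda>t. c l * (exp (- (- a l * of_real t)) * of_real (pw 1 t))) s = c l * of_real (Gamma 1) * (s + - a l) powr (- of_real 1)"
        by (rule exp_pw_laplace) (simp_all add: s Ra)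
      moreover have "s - a l \<noteq> 0" using s Ra[of l] by auto
      ultimately show "Lp (\<lambda>t. c l * (exp (- (- a l * of_real t)) * of_real (pw 1 t))) s = c l / (s - a l)"
        by (simp add: powr_minus divide_inverse)
    qed
    also have "\<dots> = Apoly k b (qf k om eta 1 1) s / (\<Prod>m\<in>{0..k}. s - a m)"
    proof -
      define p where "p = (\<Prod>l<k. [:\<i> * complex_of_real (b * cos ((qf k om eta 1 1 + 2 * pi * real l) / real k)), 1:])"
      have pe: "poly p x = Apoly k b (qf k om eta 1 1) x" for x
        by (simp add: p_def Apoly_def poly_prod add.commute)
      have "degree p \<le> k"
        using degree_prod_sum_le[of "{..<k}" "\<lambda>l. [:\<i> * complex_of_real (b * cos ((qf k om eta 1 1 + 2 * pi * real l) / real k)), 1:]"]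
        by (simp add: p_def)
      moreover have "s \<notin> a ` {0..k}" using s Ra by force
      ultimately show ?thesis using lagrange_partial_fractions[of a k p s] inj
        by (simp add: a_def c_def pe ccoef_def)
    qed
    also have "(\<Prod>m\<in>{0..k}. s - a m) = Bpoly b om eta s * Apoly k b q s"
    proof -
      have "{0..k} = insert k {..<k}" by auto
      then have "(\<Prod>m\<in>{0..k}. s - a m) = (s - a k) * (\<Prod>m<k. s - a m)" by simp
      also have "(\<Prod>m<k. s - a m) = Apoly k b q s" unfolding Apoly_def by (intro prod.cong refl) (simp add: a_def aroot_def)
      finally show ?thesis by (simp add: a_def aroot_def Bpoly_def)
    qed
    finally show ?thesis .
  qed
  show thesis
  proof (rule that)
    show "cls (real k * lam + 1) (conv g E)" by (rule conv_cls[OF g(1) kl E]) simp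
    show "Lp (conv g E) s = Apow k b lam q s * (Apoly k b (qf k om eta 1 1) s / (Bpoly b om eta s * Apoly k b q s))"
      if "Re s > 0" for s
      unfolding conv_laplace[OF g(1) kl E zero_less_one that] g(2)[OF that] EL[OF that] ..
    show "(LINT tau:{0..1}|lborel. csum k b om eta q tau * gfun k b lam q tau) = conv g E 1"
      unfolding set_lebesgue_integral_def conv_def
    \<comment> \<open>At tau = 1 the integrands may differ: \<open>pw\<close> 1 vanishes at 0,
      whereas the exponential sum need not.\<close>
    proof (rule integral_discrete_difference[where X = "{1}"])
      fix x :: real assume "x \<notin> {1}"
      then consider "x \<le> 0" | "0 < x" "x < 1" | "x > 1" by force
      then show "indicator {0..1} x *\<^sub>R (csum k b om eta q x * gfun k b lam q x) = g x * E (1 - x)"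
      proof cases
        case 1
        then have "g x = 0" using g(1) by (simp add: cls_def)
        then show ?thesis by (simp add: gf)
      qed (simp_all add: gf csum_def E_def pw_def a_def c_def)
    qed simp_all
  qed
qed

section \<open>Double series\<close>

text \<open>An absolutely convergent double series, summed by rows, by columns and along the lines j
  + p i = n. The step p is 1 for binomial expansions, 2 for the Bessel series and k for the
  splitting n = r + k m.\<close>

lemma regroup:
  fixes u :: "nat \<Rightarrow> nat \<Rightarrow> 'a::banach"
  assumes ac: "0 \<le> a" "a < 1" "0 \<le> c" "c < 1" and u: "\<And>j i. norm (u j i) \<le> K * a ^ j * c ^ i" and p: "p \<ge> 1"
  shows regroup_row: "summable (\<lambda>i. norm (u j i))"
    and regroup_col: "summable (\<lambda>j. norm (u j i))"
    and regroup_norm: "summable (\<lambda>n. norm (\<Sum>i\<le>n div p. u (n - p * i) i))"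
    and regroup_sums: "(\<lambda>n. \<Sum>i\<le>n div p. u (n - p * i) i) sums (\<Sum>j. \<Sum>i. u j i)"
    and regroup_swap: "(\<Sum>j. \<Sum>i. u j i) = (\<Sum>i. \<Sum>j. u j i)"
    and regroup_rows_sums: "(\<lambda>j. \<Sum>i. u j i) sums (\<Sum>j. \<Sum>i. u j i)"
proof -
  have "norm (u 0 0) \<le> K" using u[of 0 0] by simp
  then have K: "K \<ge> 0" by (rule order_trans[OF norm_ge_zero])
  show row: "summable (\<lambda>i. norm (u j i))" for j
    by (rule summable_comparison_test'[where N = 0 and g = "\<lambda>i. K * a ^ j * c ^ i"]) (use ac u in \<open>auto intro!: summable_mult summable_geometric\<close>)
  show col: "summable (\<lambda>j. norm (u j i))" for i
  proof (rule summable_comparison_test'[where N = 0 and g = "\<lambda>j. K * c ^ i * a ^ j"])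
    show "summable (\<lambda>j. K * c ^ i * a ^ j)" using ac by (intro summable_mult summable_geometric) auto
    show "norm (norm (u j i)) \<le> K * c ^ i * a ^ j" for j using u[of j i] by (simp add: mult_ac)
  qed
  have geo: "x \<ge> 0 \<Longrightarrow> x < 1 \<Longrightarrow> ((\<lambda>i. x ^ i) has_sum (1 / (1 - x))) UNIV" for x :: real
    by (intro norm_summable_imp_has_sum geometric_sums) (simp_all add: power_abs summable_geometric)
  have "(\<lambda>(j, i). K * a ^ j * c ^ i) summable_on (UNIV \<times> UNIV)"
  proof (rule summable_on_SigmaI)
    show "((\<lambda>i. case (j, i) of (j, i) \<Rightarrow> K * a ^ j * c ^ i) has_sum (K * a ^ j * (1 / (1 - c)))) UNIV" for j :: nat
      using has_sum_cmult_right[OF geo[OF ac(3,4)], of "K * a ^ j"] by simp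
    have h: "((\<lambda>j. K / (1 - c) * a ^ j) has_sum (K / (1 - c) * (1 / (1 - a)))) UNIV"
      by (rule has_sum_cmult_right[OF geo[OF ac(1,2)]])
    have e: "K * a ^ j * (1 / (1 - c)) = K / (1 - c) * a ^ j" for j by simp
    show "(\<lambda>j. K * a ^ j * (1 / (1 - c))) summable_on UNIV"
      unfolding e by (rule has_sum_imp_summable[OF h])
  qed (use K ac in auto)
  then have ns: "(\<lambda>(j, i). norm (u j i)) summable_on (UNIV \<times> UNIV)"
    by (rule summable_on_comparison_test) (use u in auto)
  have us: "(\<lambda>(j, i). u j i) summable_on (UNIV \<times> UNIV)"
    by (rule abs_summable_summable) (use ns in \<open>simp add: case_prod_unfold\<close>)
  have gen: "(\<lambda>n. \<Sum>i\<le>n div p. v (n - p * i) i) sums T"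
    if v: "((\<lambda>(j, i). v j i) has_sum T) (UNIV \<times> UNIV)" for v :: "nat \<Rightarrow> nat \<Rightarrow> 'b::banach" and T
  proof -
    have "((\<lambda>(n, i). v (n - p * i) i) has_sum T) (Sigma UNIV (\<lambda>n. {..n div p}))"
    proof (rule iffD2[OF has_sum_reindex_bij_witness v, where j1 = "\<lambda>(n, i). (n - p * i, i)" and i1 = "\<lambda>(j, i). (j + p * i, i)"])
    qed (use p in \<open>auto simp: less_eq_div_iff_mult_less_eq mult.commute\<close>)
    then have "((\<lambda>n. \<Sum>i\<le>n div p. v (n - p * i) i) has_sum T) UNIV"
      by (rule has_sum_SigmaD) (auto intro!: has_sum_finiteI)
    then show ?thesis by (rule has_sum_imp_sums)
  qed
  obtain S where S: "((\<lambda>(j, i). u j i) has_sum S) (UNIV \<times> UNIV)" using us by (auto simp: summable_on_def)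
  have r: "((\<lambda>j. \<Sum>i. u j i) has_sum S) UNIV"
    by (rule has_sum_SigmaD[OF S]) (simp add: norm_summable_imp_has_sum[OF row summable_sums[OF summable_norm_cancel[OF row]]])
  have c: "((\<lambda>i. \<Sum>j. u j i) has_sum S) UNIV"
  proof (rule has_sum_SigmaD)
    show "((\<lambda>(i, j). u j i) has_sum S) (UNIV \<times> UNIV)"
      using iffD1[OF has_sum_swap S] by (simp add: case_prod_unfold)
  qed (simp add: norm_summable_imp_has_sum[OF col summable_sums[OF summable_norm_cancel[OF col]]])
  have rS: "(\<Sum>j. \<Sum>i. u j i) = S" using has_sum_imp_sums[OF r] by (simp add: sums_iff)
  show "(\<Sum>j. \<Sum>i. u j i) = (\<Sum>i. \<Sum>j. u j i)" using has_sum_imp_sums[OF c] rS by (simp add: sums_iff)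
  show "(\<lambda>j. \<Sum>i. u j i) sums (\<Sum>j. \<Sum>i. u j i)" using has_sum_imp_sums[OF r] rS by simp
  show "(\<lambda>n. \<Sum>i\<le>n div p. u (n - p * i) i) sums (\<Sum>j. \<Sum>i. u j i)" using gen[OF S] rS by simp
  obtain T where T: "((\<lambda>(j, i). norm (u j i)) has_sum T) (UNIV \<times> UNIV)" using ns by (auto simp: summable_on_def)
  show "summable (\<lambda>n. norm (\<Sum>i\<le>n div p. u (n - p * i) i))"
    by (rule summable_comparison_test'[where N = 0, OF sums_summable[OF gen[OF T]]]) (simp add: norm_sum)
qed

text \<open>The falling product is at most x^i, and x^i / i! is a single term of the exponential
  series. The bound is crude but geometric along x = 2 m + nu.\<close>

lemma gchoose_exp_bound:
  fixes x :: real
  assumes "real i \<le> x"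
  shows "0 \<le> x gchoose i" "x gchoose i \<le> exp x"
proof -
  have x: "x \<ge> 0" using assms by simp
  show "0 \<le> x gchoose i" unfolding gbinomial_prod_rev
    using assms by (intro divide_nonneg_nonneg prod_nonneg) auto
  have "(\<Prod>t = 0..<i. x - of_nat t) \<le> (\<Prod>t = 0..<i. x)"
    using assms by (intro prod_mono) auto
  then have "x gchoose i \<le> x ^ i /\<^sub>R fact i"
    unfolding gbinomial_prod_rev by (simp add: divide_right_mono divide_inverse mult.commute)
  also have "\<dots> = sum (\<lambda>n. x ^ n /\<^sub>R fact n) {i}" by simp
  also have "\<dots> \<le> exp x" unfolding exp_def using x
    by (intro sum_le_suminf summable_exp_generic) auto
  finally show "x gchoose i \<le> exp x" .
qed

text \<open>An N-fold forward difference in a. By Pascal's rule each difference lowers the lower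
  index by one.\<close>

lemma gchoose_difference:
  fixes a :: real
  assumes "N \<le> M"
  shows "(\<Sum>m\<le>N. (-1) ^ (N + m) * real (N choose m) * ((a + real m) gchoose M)) = a gchoose (M - N)"
  using assms
proof (induction N arbitrary: a)
  case (Suc N)
  define f where "f m = ((a + real m) gchoose M)" for m
  have "(\<Sum>m\<le>Suc N. (-1) ^ (Suc N + m) * real (Suc N choose m) * f m) =
      (-1) ^ Suc N * f 0 + (\<Sum>m\<le>N. (-1) ^ (N + m) * (real (N choose m) + real (N choose Suc m)) * f (Suc m))"
    by (subst sum.atMost_Suc_shift) simp
  also have "\<dots> = (\<Sum>m\<le>N. (-1) ^ (N + m) * real (N choose m) * f (Suc m)) - ((-1) ^ N * f 0 + (\<Sum>m\<le>N. (-1) ^ (N + Suc m) * real (N choose Suc m) * f (Suc m)))"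
    by (simp add: algebra_simps sum.distrib sum_negf)
  also have "(-1) ^ N * f 0 + (\<Sum>m\<le>N. (-1) ^ (N + Suc m) * real (N choose Suc m) * f (Suc m)) = (\<Sum>m\<le>Suc N. (-1) ^ (N + m) * real (N choose m) * f m)"
    by (subst sum.atMost_Suc_shift) simp
  also have "\<dots> = (\<Sum>m\<le>N. (-1) ^ (N + m) * real (N choose m) * f m)" by simp
  also have "\<dots> = a gchoose (M - N)" unfolding f_def using Suc by simp
  also have "(\<Sum>m\<le>N. (-1) ^ (N + m) * real (N choose m) * f (Suc m)) = (a + 1) gchoose (M - N)"
    using Suc.IH[of "a + 1"] Suc.prems unfolding f_def by (simp add: algebra_simps)
  also have "M - N = Suc (M - Suc N)" using Suc.prems by simp
  finally show ?case unfolding f_def by (simp add: gbinomial_Suc_Suc)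
qed simp

text \<open>Expanding (1 + y)^(-2m-nu-1), the coefficient of y^N is an N-th difference of a polynomial of
  degree N with leading coefficient 1/N!, hence 1.\<close>

lemma binomial_gf:
  fixes y nu :: real
  assumes y: "\<bar>y\<bar> \<le> 1/100" and nu: "nu \<ge> 0"
  shows "(\<lambda>m. ((2 * real m + nu) gchoose m) * (y / (1 + y)\<^sup>2) ^ m) sums ((1 + y) powr (nu + 1) / (1 - y))"
proof -
  have y1: "1 + y > 0" using y by linarith
  define u where "u m l = ((2 * real m + nu) gchoose m) * y ^ m * (((- (2 * real m + nu + 1)) gchoose l) * y ^ l)" for m l
  have neg: "(- (2 * real m + nu + 1)) gchoose l = (-1) ^ l * ((2 * real m + nu + real l) gchoose l)" for m l
    by (subst gbinomial_minus) (simp add: algebra_simps)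
  \<comment> \<open>By \<open>gchoose_exp_bound\<close> the binomials contribute exp 4 per step in m
    and exp 1 per step in l. From exp 4 \<le> 3^4 = 81 < 100 it follows that 1/100 is small enough a
    bound on y.\<close>
  have e3: "exp (1::real) \<le> 3" by (rule exp_le) 
  have e4: "exp (4::real) \<le> 81"
  proof -
    have "exp (4::real) = exp 1 ^ 4" using exp_of_nat_mult[of 4 "1::real"] by simp
    also have "\<dots> \<le> 3 ^ 4" using e3 by (intro power_mono) auto
    finally show ?thesis by simp
  qed
  have bd: "norm (u m l) \<le> exp (2 * nu) * (81/100) ^ m * (3/100) ^ l" for m l
  proof -
    have "norm (u m l) = ((2 * real m + nu) gchoose m) * ((2 * real m + nu + real l) gchoose l) * (\<bar>y\<bar> ^ m * \<bar>y\<bar> ^ l)"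
      unfolding u_def neg using gchoose_exp_bound(1)[of m "2 * real m + nu"] gchoose_exp_bound(1)[of l "2 * real m + nu + real l"] nu
      by (simp add: abs_mult power_abs mult_ac)
    also have "\<dots> \<le> (exp (2 * real m + nu) * exp (2 * real m + nu + real l)) * ((1/100) ^ m * (1/100) ^ l)"
      using gchoose_exp_bound[of m "2 * real m + nu"] gchoose_exp_bound[of l "2 * real m + nu + real l"] nu y
      by (intro mult_mono power_mono mult_nonneg_nonneg) auto
    also have "exp (2 * real m + nu) * exp (2 * real m + nu + real l) = exp (2 * nu) * exp 4 ^ m * exp 1 ^ l"
      by (simp add: exp_of_nat_mult[symmetric] exp_add[symmetric] algebra_simps)
    also have "exp (2 * nu) * exp 4 ^ m * exp 1 ^ l * ((1/100) ^ m * (1/100) ^ l) = exp (2 * nu) * (exp 4 / 100) ^ m * (exp 1 / 100) ^ l"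
      by (simp add: power_divide)
    also have "\<dots> \<le> exp (2 * nu) * (81/100) ^ m * (3/100) ^ l"
      using e3 e4 by (intro mult_mono power_mono mult_nonneg_nonneg) auto
    finally show ?thesis .
  qed
  note R = regroup[where u = u and a = "81/100" and c = "3/100" and p = 1, OF _ _ _ _ bd]
  have inner: "(\<Sum>i\<le>n div 1. u (n - 1 * i) i) = y ^ n" for n
  proof -
    have "(\<Sum>i\<le>n. u (n - i) i) = (\<Sum>m\<le>n. u m (n - m))"
      by (rule sum.reindex_bij_witness[of _ "\<lambda>m. n - m" "\<lambda>m. n - m"]) auto
    also have "\<dots> = (\<Sum>m\<le>n. y ^ n * ((-1) ^ (n + m) * real (n choose m) * ((nu + real n + real m) gchoose n)))"
    proof (intro sum.cong refl)
      fix m assume "m \<in> {..n}"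
      then have m: "m \<le> n" by simp
      \<comment> \<open>Trinomial revision turns the product of two binomials into a binomial
        coefficient of n times a polynomial in m, the shape of an n-th difference.\<close>
      have "((nu + real n + real m) gchoose n) * (of_nat n gchoose (n - m)) = ((nu + real n + real m) gchoose (n - m)) * ((nu + real n + real m - of_nat (n - m)) gchoose (n - (n - m)))"
        by (rule gbinomial_trinomial_revision) simp
      moreover have "of_nat n gchoose (n - m) = real (n choose m)"
        using m by (simp add: binomial_gbinomial[symmetric] binomial_symmetric[of m n])
      moreover have "nu + real n + real m - of_nat (n - m) = 2 * real m + nu" "n - (n - m) = m" "2 * real m + nu + real (n - m) = nu + real n + real m"
        using m by (simp_all add: of_nat_diff)
      moreover have "y ^ m * y ^ (n - m) = y ^ n" using m by (simp flip: power_add)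
      moreover have "(-1::real) ^ (n - m) = (-1) ^ (n + m)" using m by (simp add: minus_one_power_iff)
      ultimately show "u m (n - m) = y ^ n * ((-1) ^ (n + m) * real (n choose m) * ((nu + real n + real m) gchoose n))"
        unfolding u_def neg by (simp add: mult_ac) (simp add: add_ac)
    qed
    also have "\<dots> = y ^ n" unfolding sum_distrib_left[symmetric] gchoose_difference[OF order_refl] by simp
    finally show ?thesis by simp
  qed
  have rows: "(\<Sum>l. u m l) = ((2 * real m + nu) gchoose m) * (y / (1 + y)\<^sup>2) ^ m * (1 + y) powr (- (nu + 1))" for m
  proof -
    have "(\<lambda>l. ((- (2 * real m + nu + 1)) gchoose l) * y ^ l) sums (1 + y) powr (- (2 * real m + nu + 1))"
      by (rule gen_binomial_real) (use y in linarith)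
    then have "(\<Sum>l. u m l) = ((2 * real m + nu) gchoose m) * y ^ m * (1 + y) powr (- (2 * real m + nu + 1))"
      unfolding u_def by (simp add: sums_iff suminf_mult)
    also have "- (2 * real m + nu + 1) = - (nu + 1) + - real (2 * m)" by simp
    then have "(1 + y) powr (- (2 * real m + nu + 1)) = (1 + y) powr (- (nu + 1)) * inverse ((1 + y) ^ (2 * m))"
      using y1 by (simp only: powr_add powr_minus powr_realpow)
    finally show ?thesis unfolding power_mult[of "1 + y"] power_divide divide_inverse by (simp only: mult_ac power_mult_distrib power_inverse)
  qed
  have "(\<lambda>n. y ^ n) sums (\<Sum>j. \<Sum>i. u j i)" using R(4) unfolding inner by simp
  moreover have "(\<lambda>n. y ^ n) sums (1 / (1 - y))" by (rule geometric_sums) (use y in auto)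
  ultimately have "(\<Sum>j. \<Sum>i. u j i) = 1 / (1 - y)" using sums_unique2 by blast
  then have "(\<lambda>m. ((2 * real m + nu) gchoose m) * (y / (1 + y)\<^sup>2) ^ m * (1 + y) powr (- (nu + 1))) sums (1 / (1 - y))"
    using R(6) unfolding rows by simp
  then have "(\<lambda>m. (1 + y) powr (nu + 1) * (((2 * real m + nu) gchoose m) * (y / (1 + y)\<^sup>2) ^ m * (1 + y) powr (- (nu + 1)))) sums ((1 + y) powr (nu + 1) * (1 / (1 - y)))"
    by (rule sums_mult)
  moreover have inv: "(1 + y) powr (nu + 1) * (x * (1 + y) powr (- (nu + 1))) = x" for x
  proof -
    have "(1 + y) powr (nu + 1) * (1 + y) powr (- (nu + 1)) = 1" using y1 unfolding powr_add[symmetric] by simp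
    then show ?thesis by (metis mult.left_commute mult.right_neutral)
  qed
  ultimately show ?thesis unfolding inv by simp
qed

section \<open>Generating functions\<close>

definition CX :: "real \<Rightarrow> nat \<Rightarrow> real \<Rightarrow> real" where
  "CX s m X = (\<Sum>i\<le>m. cmi s m i * X ^ (m - 2 * i))"

text \<open>\<open>FX\<close> and \<open>PX\<close> are \<open>FF\<close> and \<open>PP\<close> on the unit circle before averaging over X, with e = omega cnj eta.\<close>

definition FX :: "real \<Rightarrow> nat \<Rightarrow> real \<Rightarrow> complex \<Rightarrow> nat \<Rightarrow> complex" where
  "FX s k X e n = e ^ (n mod k) * (of_real (CX s (n div k) X) - cnj e ^ k * (if n div k = 0 then 0 else of_real (CX s (n div k - 1) X)))"

definition PX :: "real \<Rightarrow> nat \<Rightarrow> real \<Rightarrow> complex \<Rightarrow> nat \<Rightarrow> complex" where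
  "PX s k X e n = FX s k X e n + (if n = 0 then 0 else cnj e * cnj (FX s k X e (n - 1)))"

text \<open>Up to sign these are the coefficients of the binomial series with exponent -s, which
  converges at 1/2.\<close>

lemma pochhammer_fact_bound:
  fixes s :: real
  obtains K where "K \<ge> 0" "\<And>n. pochhammer s n / fact n \<le> K * 2 ^ n"
proof -
  have "summable (\<lambda>n. ((- s) gchoose n) * (1/2) ^ n)"
    using gen_binomial_real[of "1/2" "- s"] by (simp add: sums_iff)
  then have "Bseq (\<lambda>n. ((- s) gchoose n) * (1/2) ^ n)" using summable_LIMSEQ_zero convergent_imp_Bseq convergentI by blast
  then obtain K where K: "\<And>n. norm (((- s) gchoose n) * (1/2) ^ n) \<le> K" unfolding Bseq_def by blast
  have "pochhammer s n / fact n \<le> K * 2 ^ n" for n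
  proof -
    have "\<bar>pochhammer s n / fact n\<bar> / 2 ^ n \<le> K"
      using K[of n] by (simp add: gbinomial_pochhammer abs_mult power_abs power_divide)
    then have "\<bar>pochhammer s n / fact n\<bar> \<le> K * 2 ^ n" by (simp add: divide_le_eq mult_ac)
    then show ?thesis by linarith
  qed
  moreover have "K \<ge> 0" using K[of 0] norm_ge_zero order_trans by blast
  ultimately show thesis using that by blast
qed

lemma cmi_alt: "2 * i \<le> m \<Longrightarrow> cmi s m i = (-1) ^ i * (pochhammer s (m - i) / fact (m - i)) * real ((m - i) choose i) * 2 ^ (m - 2 * i)"
proof -
  assume i: "2 * i \<le> m"
  have "real ((m - i) choose i) = fact (m - i) / (fact i * fact (m - i - i))"
    by (rule binomial_fact) (use i in simp)
  moreover have "m - i - i = m - 2 * i" by simp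
  ultimately show ?thesis using i by (simp add: cmi_def)
qed

text \<open>16^m collects a factor 2^m from each of the Pochhammer quotient, the binomial
  coefficient, the explicit power of 2 and the number m + 1 of summands.\<close>

lemma CX_bound:
  assumes s: "s > 0"
  obtains K where "K \<ge> 0" "\<And>m X. \<bar>X\<bar> \<le> 1 \<Longrightarrow> \<bar>CX s m X\<bar> \<le> K * 16 ^ m"
proof -
  obtain K where K: "K \<ge> 0" "\<And>n. pochhammer s n / fact n \<le> K * 2 ^ n" using pochhammer_fact_bound by blast
  have p0: "pochhammer s n / fact n \<ge> 0" for n using pochhammer_pos[OF s, of n] by simp
  have "\<bar>CX s m X\<bar> \<le> K * 16 ^ m" if X: "\<bar>X\<bar> \<le> 1" for m X
  proof -
    have "\<bar>CX s m X\<bar> \<le> (\<Sum>i\<le>m. \<bar>cmi s m i * X ^ (m - 2 * i)\<bar>)" unfolding CX_def by (rule sum_abs)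
    also have "\<dots> \<le> (\<Sum>i\<le>m. K * 8 ^ m)"
    proof (rule sum_mono)
      fix i
      show "\<bar>cmi s m i * X ^ (m - 2 * i)\<bar> \<le> K * 8 ^ m"
      proof (cases "2 * i \<le> m")
        case True
        have "\<bar>cmi s m i\<bar> * \<bar>X\<bar> ^ (m - 2 * i) \<le> \<bar>cmi s m i\<bar> * 1"
          using X by (intro mult_left_mono power_le_one) auto
        also have "\<bar>cmi s m i\<bar> * 1 = (pochhammer s (m - i) / fact (m - i)) * real ((m - i) choose i) * 2 ^ (m - 2 * i)"
          unfolding cmi_alt[OF True] using pochhammer_pos[OF s, of "m - i"] by (simp add: abs_mult power_abs)
        also have "\<dots> \<le> (K * 2 ^ (m - i)) * 2 ^ (m - i) * 2 ^ m"
        proof (intro mult_mono K)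
          have "real ((m - i) choose i) \<le> real (2 ^ (m - i))" by (simp only: of_nat_le_iff binomial_le_pow2)
          then show "real ((m - i) choose i) \<le> 2 ^ (m - i)" by simp
        qed (use K(1) p0 in auto)
        also have "\<dots> \<le> (K * 2 ^ m) * 2 ^ m * 2 ^ m"
          using K(1) by (intro mult_mono mult_left_mono power_increasing mult_nonneg_nonneg) auto
        also have "\<dots> = K * 8 ^ m" by (simp add: mult.assoc flip: power_mult_distrib)
        finally show ?thesis by (simp add: abs_mult power_abs)
      qed (use K(1) in \<open>simp add: cmi_def\<close>)
    qed
    also have "\<dots> = real (Suc m) * (K * 8 ^ m)" by simp
    also have "\<dots> \<le> 2 ^ m * (K * 8 ^ m)"
    proof (rule mult_right_mono)
      have "Suc m \<le> 2 ^ m" by (rule Suc_leI[OF less_exp])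
      then have "real (Suc m) \<le> real (2 ^ m)" by (simp only: of_nat_le_iff)
      then show "real (Suc m) \<le> 2 ^ m" by simp
    qed (use K(1) in simp)
    also have "\<dots> = K * 16 ^ m" by (simp add: mult.left_commute flip: power_mult_distrib)
    finally show ?thesis .
  qed
  then show thesis using that K(1) by blast
qed

text \<open>With w = z (2 X - z), the binomial series of (1 - w)^(-s) is expanded once more in each
  w^n. For |z| \<le> 1/16 the double series has ratio 2 * 4/16 = 1/2 in n, and |w| < 1 justifies the
  principal branch.\<close>

lemma CX_gf:
  fixes z :: complex
  assumes s: "s > 0" and X: "\<bar>X\<bar> \<le> 1" and z: "cmod z \<le> 1/16"
  shows "(\<lambda>m. of_real (CX s m X) * z ^ m) sums (1 - 2 * of_real X * z + z ^ 2) powr (- of_real s)"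
proof -
  obtain K where K: "K \<ge> 0" "\<And>n. pochhammer s n / fact n \<le> K * 2 ^ n" using pochhammer_fact_bound by blast
  have p0: "pochhammer s n / fact n \<ge> 0" for n using pochhammer_pos[OF s, of n] by simp
  define u where "u n i = of_real (pochhammer s n / fact n) * (z ^ n * (of_nat (n choose i) * (- z) ^ i * (2 * of_real X) ^ (n - i)))" for n i
  have bd: "norm (u n i) \<le> K * (1/2) ^ n * (1/16) ^ i" for n i
  proof -
    have "norm (u n i) = (pochhammer s n / fact n) * (cmod z ^ n * (real (n choose i) * cmod z ^ i * (2 * \<bar>X\<bar>) ^ (n - i)))"
      using pochhammer_pos[OF s, of n] by (simp add: u_def norm_mult norm_power norm_divide)
    also have "\<dots> \<le> (K * 2 ^ n) * ((1/16) ^ n * (2 ^ n * (1/16) ^ i * 2 ^ n))"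
    proof (intro mult_mono K power_mono z)
      have "real (n choose i) \<le> real (2 ^ n)" by (simp only: of_nat_le_iff binomial_le_pow2)
      then show "real (n choose i) \<le> 2 ^ n" by simp
      have "(2 * \<bar>X\<bar>) ^ (n - i) \<le> 2 ^ (n - i)" using X by (intro power_mono) auto
      also have "\<dots> \<le> (2::real) ^ n" by (intro power_increasing) auto
      finally show "(2 * \<bar>X\<bar>) ^ (n - i) \<le> 2 ^ n" .
    qed (use K(1) in auto)
    also have "\<dots> = K * (2 * ((1/16) * (2 * 2))) ^ n * (1/16) ^ i" by (simp only: power_mult_distrib mult_ac)
    finally show ?thesis by simp
  qed
  note R = regroup[where u = u and a = "1/2" and c = "1/16" and p = 1, OF _ _ _ _ bd]
  have inner: "(\<Sum>i\<le>m div 1. u (m - 1 * i) i) = of_real (CX s m X) * z ^ m" for m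
  proof -
    have "u (m - i) i = of_real (cmi s m i * X ^ (m - 2 * i)) * z ^ m" if i: "i \<le> m" for i
    proof (cases "2 * i \<le> m")
      case True
      have e: "m - i - i = m - 2 * i" by simp
      have "z ^ (m - i) * z ^ i = z ^ m" using i by (simp flip: power_add)
      moreover have "(- z) ^ i = (-1) ^ i * z ^ i" by (rule power_minus)
      moreover have "u (m - i) i = of_real (pochhammer s (m - i) / fact (m - i)) * of_nat ((m - i) choose i) * (-1) ^ i * (2 ^ (m - 2 * i) * of_real X ^ (m - 2 * i)) * (z ^ (m - i) * z ^ i)"
        unfolding u_def e power_minus[of z] power_mult_distrib by (simp only: mult_ac)
      ultimately show ?thesis unfolding cmi_alt[OF True] by (simp add: mult_ac)
    next
      case False
      then have "m - i < i" by linarith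
      then show ?thesis using False by (simp add: u_def cmi_def)
    qed
    then show ?thesis by (simp add: CX_def sum_distrib_right)
  qed
  define w where "w = z * (2 * of_real X - z)"
  have row: "(\<Sum>i. u n i) = ((- of_real s) gchoose n) * (- w) ^ n" for n
  proof -
    have "(\<Sum>i. u n i) = (\<Sum>i\<le>n. u n i)" by (rule suminf_finite) (simp_all add: u_def)
    also have "\<dots> = of_real (pochhammer s n / fact n) * (z ^ n * (- z + 2 * of_real X) ^ n)"
      unfolding u_def binomial_ring sum_distrib_left ..
    also have "z ^ n * (- z + 2 * of_real X) ^ n = w ^ n" by (simp add: w_def flip: power_mult_distrib)
    also have "of_real (pochhammer s n / fact n) * w ^ n = ((- of_real s) gchoose n) * (- w) ^ n"
    proof -
      have "(-1) ^ n * (-1) ^ n = (1::complex)" by (simp flip: power_mult_distrib)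
      then show ?thesis unfolding gbinomial_pochhammer power_minus[of w] by (simp add: pochhammer_of_real mult_ac)
    qed
    finally show ?thesis .
  qed
  have "cmod w \<le> (1/16) * (2 + 1/16)"
  proof -
    have "cmod (2 * of_real X - z) \<le> cmod (2 * of_real X) + cmod z" by (rule norm_triangle_ineq4)
    also have "\<dots> \<le> 2 + 1/16" using X z by (simp add: norm_mult)
    finally show ?thesis unfolding w_def norm_mult using z by (intro mult_mono) auto
  qed
  then have "(\<lambda>n. ((- of_real s) gchoose n) * (- w) ^ n) sums (1 + - w) powr (- of_real s)"
    by (intro gen_binomial_complex) simp
  then have "(\<Sum>j. \<Sum>i. u j i) = (1 + - w) powr (- of_real s)" unfolding row by (simp add: sums_iff)
  then have "(\<lambda>m. of_real (CX s m X) * z ^ m) sums (1 + - w) powr (- of_real s)"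
    using R(4) unfolding inner by simp
  moreover have w': "1 + - w = 1 - 2 * of_real X * z + z ^ 2" by (simp add: w_def algebra_simps power2_eq_square)
  ultimately show ?thesis unfolding w' by blast
qed

lemma cnj_FX: "cnj (FX s k X e n) = FX s k X (cnj e) n"
  by (simp add: FX_def)

lemma FX_bound:
  assumes K: "K \<ge> 0" "\<And>m. \<bar>CX s m X\<bar> \<le> K * 16 ^ m" and e: "cmod e = 1"
  shows "cmod (FX s k X e n) \<le> 2 * K * 16 ^ (n div k)"
proof -
  have "cmod (cnj e ^ k * (if n div k = 0 then 0 else of_real (CX s (n div k - 1) X))) \<le> K * 16 ^ (n div k)"
  proof (cases "n div k = 0")
    case False
    have "cmod (cnj e ^ k * (if n div k = 0 then 0 else of_real (CX s (n div k - 1) X))) = \<bar>CX s (n div k - 1) X\<bar>"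
      using False e by (simp add: norm_mult norm_power)
    also have "\<dots> \<le> K * 16 ^ (n div k - 1)" by (rule K)
    also have "\<dots> \<le> K * 16 ^ (n div k)" using K(1) by (intro mult_left_mono power_increasing) auto
    finally show ?thesis .
  qed (use K(1) in simp)
  then have "cmod (of_real (CX s (n div k) X) - cnj e ^ k * (if n div k = 0 then 0 else of_real (CX s (n div k - 1) X))) \<le> K * 16 ^ (n div k) + K * 16 ^ (n div k)"
    using K(2)[of "n div k"] by (intro order_trans[OF norm_triangle_ineq4] add_mono) simp_all
  then show ?thesis by (simp add: FX_def norm_mult norm_power e)
qed

lemma PX_bound:
  assumes K: "K \<ge> 0" "\<And>m. \<bar>CX s m X\<bar> \<le> K * 16 ^ m" and e: "cmod e = 1"
  shows "cmod (PX s k X e n) \<le> 4 * K * 16 ^ n"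
proof -
  have b: "cmod (FX s k X e j) \<le> 2 * K * 16 ^ n" if "j \<le> n" for j
  proof -
    have "cmod (FX s k X e j) \<le> 2 * K * 16 ^ (j div k)" by (rule FX_bound[OF K e])
    also have "\<dots> \<le> 2 * K * 16 ^ n" using K(1) order_trans[OF div_le_dividend that]
      by (intro mult_left_mono power_increasing) simp_all
    finally show ?thesis .
  qed
  have "cmod (if n = 0 then 0 else cnj e * cnj (FX s k X e (n - 1))) \<le> 2 * K * 16 ^ n"
    using b[of "n - 1"] e K(1) by (simp add: norm_mult)
  then show ?thesis unfolding PX_def using b[of n] by (intro order_trans[OF norm_triangle_ineq]) simp
qed

text \<open>For n = r + k m the sum over r < k is a geometric sum, and the sum over m is the
  Gegenbauer generating function at z^k times 1 - cnj e^k z^k. The radius 1/32 leaves ratio 1/2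
  against the growth 16^m.\<close>

lemma FX_gf:
  assumes k: "k \<ge> 1" and s: "s > 0" and X: "\<bar>X\<bar> \<le> 1" and z: "cmod z \<le> 1/32" and e: "cmod e = 1"
  shows "(\<lambda>n. FX s k X e n * z ^ n) sums
    ((1 - z ^ k * e ^ k) / (1 - z * e) * ((1 - cnj e ^ k * z ^ k) * (1 - 2 * of_real X * z ^ k + (z ^ k) ^ 2) powr (- of_real s)))"
proof -
  obtain K where K: "K \<ge> 0" "\<And>m X. \<bar>X\<bar> \<le> 1 \<Longrightarrow> \<bar>CX s m X\<bar> \<le> K * 16 ^ m" using CX_bound[OF s] by blast
  define g where "g m = of_real (CX s m X) - cnj e ^ k * (if m = 0 then 0 else of_real (CX s (m - 1) X))" for m
  have gF: "g m = FX s k X e (m * k)" for m using k by (simp add: g_def FX_def)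
  have gb: "cmod (g m) \<le> 2 * K * 16 ^ m" for m
    unfolding gF using FX_bound[OF K(1) K(2)[OF X] e, of k "m * k"] k by simp
  have zk: "cmod (z ^ k) \<le> 1/32"
  proof -
    have "cmod z ^ k \<le> cmod z ^ 1" using k z by (intro power_decreasing) auto
    then show ?thesis using z by (simp add: norm_power)
  qed
  define u where "u r m = (if r < k then (z * e) ^ r * (g m * (z ^ k) ^ m) else 0)" for r m
  have bd: "norm (u r m) \<le> (2 * K) * (1/2) ^ r * (1/2) ^ m" for r m
  proof (cases "r < k")
    case True
    have "norm (u r m) = cmod z ^ r * (cmod (g m) * cmod (z ^ k) ^ m)" using True e by (simp add: u_def norm_mult norm_power)
    also have "\<dots> \<le> (1/2) ^ r * ((2 * K * 16 ^ m) * (1/32) ^ m)"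
      using z K(1) by (intro mult_mono power_mono gb zk) auto
    also have "\<dots> = 2 * K * (1/2) ^ r * (16 * (1/32)) ^ m" by (simp only: power_mult_distrib mult_ac)
    finally show ?thesis by simp
  qed (use K(1) in \<open>simp add: u_def\<close>)
  note R = regroup[where u = u and a = "1/2" and c = "1/2" and p = k, OF _ _ _ _ bd k]
  have inner: "(\<Sum>i\<le>n div k. u (n - k * i) i) = FX s k X e n * z ^ n" for n
  proof -
    have "(\<Sum>i\<le>n div k. u (n - k * i) i) = (\<Sum>i\<le>n div k. if i = n div k then FX s k X e n * z ^ n else 0)"
    proof (intro sum.cong refl)
      fix i assume i: "i \<in> {..n div k}"
      show "u (n - k * i) i = (if i = n div k then FX s k X e n * z ^ n else 0)"
      proof (cases "i = n div k")
        case True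
        have m: "n - k * i = n mod k" using True by (simp add: minus_mult_div_eq_mod)
        have "z ^ (n mod k) * (z ^ k) ^ (n div k) = z ^ n"
          by (simp flip: power_mult power_add)
        moreover have "u (n mod k) (n div k) = e ^ (n mod k) * g (n div k) * (z ^ (n mod k) * (z ^ k) ^ (n div k))"
          using k by (simp add: u_def power_mult_distrib mult_ac)
        ultimately show ?thesis using True m by (simp add: FX_def g_def)
      next
        case False
        then have "Suc i \<le> n div k" using i by simp
        then have "k * Suc i \<le> n" using k by (simp add: less_eq_div_iff_mult_less_eq mult.commute)
        then have "\<not> n - k * i < k" by simp
        then show ?thesis using False by (simp add: u_def)
      qed
    qed
    then show ?thesis by simp
  qed
  have ze: "z * e \<noteq> 1"
  proof
    assume "z * e = 1"
    then have "cmod z * cmod e = 1" by (metis norm_mult norm_one)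
    then show False using z e by simp
  qed
  have col: "(\<Sum>r. u r m) = (1 - z ^ k * e ^ k) / (1 - z * e) * (g m * (z ^ k) ^ m)" for m
  proof -
    have "(\<Sum>r. u r m) = (\<Sum>r<k. u r m)" by (rule suminf_finite) (simp_all add: u_def)
    also have "\<dots> = (\<Sum>r<k. (z * e) ^ r) * (g m * (z ^ k) ^ m)" unfolding sum_distrib_right by (simp add: u_def)
    also have "(\<Sum>r<k. (z * e) ^ r) = (1 - z ^ k * e ^ k) / (1 - z * e)"
    proof -
      have "(\<Sum>r<k. (z * e) ^ r) = ((z * e) ^ k - 1) / (z * e - 1)" by (rule geometric_sum[OF ze])
      also have "\<dots> = (1 - (z * e) ^ k) / (1 - z * e)" by (metis minus_diff_eq minus_divide_divide)
      finally show ?thesis by (simp add: power_mult_distrib)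
    qed
    finally show ?thesis .
  qed
  define G where "G = (1 - 2 * of_real X * z ^ k + (z ^ k) ^ 2) powr (- of_real s)"
  have C: "(\<lambda>m. of_real (CX s m X) * (z ^ k) ^ m) sums G"
    unfolding G_def by (rule CX_gf[OF s X]) (use zk in simp)
  have "(\<lambda>m. cnj e ^ k * z ^ k * (of_real (CX s m X) * (z ^ k) ^ m)) sums (cnj e ^ k * z ^ k * G)"
    by (rule sums_mult[OF C])
  then have "(\<lambda>m. (\<lambda>m. cnj e ^ k * (if m = 0 then 0 else of_real (CX s (m - 1) X)) * (z ^ k) ^ m) (Suc m)) sums (cnj e ^ k * z ^ k * G)"
    by (simp add: mult_ac)
  then have "(\<lambda>m. cnj e ^ k * (if m = 0 then 0 else of_real (CX s (m - 1) X)) * (z ^ k) ^ m) sums (cnj e ^ k * z ^ k * G)"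
    by (subst (asm) sums_Suc_iff) simp
  from sums_diff[OF C this] have "(\<lambda>m. g m * (z ^ k) ^ m) sums ((1 - cnj e ^ k * z ^ k) * G)"
    by (simp add: g_def left_diff_distrib)
  from sums_mult[OF this, of "(1 - z ^ k * e ^ k) / (1 - z * e)"]
  have "(\<Sum>m. \<Sum>r. u r m) = (1 - z ^ k * e ^ k) / (1 - z * e) * ((1 - cnj e ^ k * z ^ k) * G)"
    unfolding col by (simp only: sums_iff)
  then have "(\<Sum>j. \<Sum>i. u j i) = (1 - z ^ k * e ^ k) / (1 - z * e) * ((1 - cnj e ^ k * z ^ k) * G)"
    using R(5) by simp
  then show ?thesis using R(4) unfolding inner G_def by simp
qed

text \<open>The two halves combine through 1/(1 - z e) + z cnj e/(1 - z cnj e) = (1 - z^2)/((1 - z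
  e)(1 - z cnj e)), the Poisson kernel, valid because |e| = 1.\<close>

lemma PX_gf:
  assumes k: "k \<ge> 1" and s: "s > 0" and X: "\<bar>X\<bar> \<le> 1" and z: "cmod z \<le> 1/32" and e: "cmod e = 1"
  shows "(\<lambda>n. PX s k X e n * z ^ n) sums
    ((1 - z ^ 2) * ((1 - z ^ k * e ^ k) * (1 - z ^ k * cnj e ^ k)) / ((1 - z * e) * (1 - z * cnj e))
      * (1 - 2 * of_real X * z ^ k + (z ^ k) ^ 2) powr (- of_real s))"
proof -
  define G where "G = (1 - 2 * of_real X * z ^ k + (z ^ k) ^ 2) powr (- of_real s)"
  define N where "N = (1 - z ^ k * e ^ k) * (1 - z ^ k * cnj e ^ k) * G"
  have nz: "1 - z * f \<noteq> 0" if "cmod f = 1" for f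
  proof
    assume "1 - z * f = 0"
    then have "z * f = 1" by simp
    then have "cmod z * cmod f = 1" by (metis norm_mult norm_one)
    then show False using z that by simp
  qed
  have ee: "e * cnj e = 1" using e by (simp add: complex_norm_square[symmetric])
  have F1: "(\<lambda>n. FX s k X e n * z ^ n) sums (N / (1 - z * e))"
    using FX_gf[OF k s X z e] by (simp add: N_def G_def mult_ac)
  have "(\<lambda>n. FX s k X (cnj e) n * z ^ n) sums (N / (1 - z * cnj e))"
    using FX_gf[OF k s X z, of "cnj e"] e by (simp add: N_def G_def mult_ac)
  from sums_mult[OF this, of "cnj e * z"]
  have "(\<lambda>n. (\<lambda>n. (if n = 0 then 0 else cnj e * cnj (FX s k X e (n - 1))) * z ^ n) (Suc n)) sums (cnj e * z * (N / (1 - z * cnj e)))"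
    by (simp add: cnj_FX mult_ac)
  then have F2: "(\<lambda>n. (if n = 0 then 0 else cnj e * cnj (FX s k X e (n - 1))) * z ^ n) sums (cnj e * z * (N / (1 - z * cnj e)))"
    by (subst (asm) sums_Suc_iff) simp
  have "N / (1 - z * e) + cnj e * z * (N / (1 - z * cnj e)) = (N * (1 - z * cnj e) + cnj e * z * N * (1 - z * e)) / ((1 - z * e) * (1 - z * cnj e))"
    using nz[OF e] nz[of "cnj e"] e by (simp add: add_divide_distrib)
  also have "N * (1 - z * cnj e) + cnj e * z * N * (1 - z * e) = N * (1 - z * z * (e * cnj e))" by (simp add: algebra_simps)
  finally have "N / (1 - z * e) + cnj e * z * (N / (1 - z * cnj e)) = N * (1 - z ^ 2) / ((1 - z * e) * (1 - z * cnj e))"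
    by (simp add: ee power2_eq_square)
  then show ?thesis using sums_add[OF F1 F2] unfolding PX_def distrib_right by (simp add: N_def G_def mult_ac)
qed

section \<open>Products over roots of unity\<close>

lemma prod_roots_of_unity:
  assumes k: "k > 0"
  shows "(\<Prod>l<k. x - eps k l * a) = x ^ k - a ^ k"
proof (cases "a = 0")
  case False
  have inj: "inj_on (\<lambda>l. eps k l * a) {..<k}"
    using bij_betw_imp_inj_on[OF Complex.bij_betw_roots_unity[OF k]] False
    by (simp add: inj_on_def eps_def)
  have "(\<Prod>l<k. [:- (eps k l * a), 1:]) = monom 1 k - [:a ^ k:]"
  proof (rule poly_eqI_degree_lead_coeff[where A = "(\<lambda>l. eps k l * a) ` {..<k}" and n = k])
    fix y assume "y \<in> (\<lambda>l. eps k l * a) ` {..<k}"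
    then obtain l where l: "l < k" "y = eps k l * a" by auto
    then have "poly (\<Prod>l<k. [:- (eps k l * a), 1:]) y = 0" unfolding poly_prod by (intro prod_zero) auto
    moreover have "poly (monom 1 k - [:a ^ k:]) y = 0" using l eps_pow_self[OF k, of l] by (simp add: poly_monom power_mult_distrib)
    ultimately show "poly (\<Prod>l<k. [:- (eps k l * a), 1:]) y = poly (monom 1 k - [:a ^ k:]) y" by simp
  next
    show "degree (\<Prod>l<k. [:- (eps k l * a), 1:]) \<le> k"
      using degree_prod_sum_le[of "{..<k}" "\<lambda>l. [:- (eps k l * a), 1:]"] by simp
    show "degree (monom 1 k - [:a ^ k:]) \<le> k" by (intro degree_diff_le) (simp_all add: degree_monom_le)
    have "degree (\<Prod>l<k. [:- (eps k l * a), 1:]) = k" by (subst degree_prod_eq_sum_degree) simp_all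
    then have "coeff (\<Prod>l<k. [:- (eps k l * a), 1:]) k = 1"
      using lead_coeff_prod[of "\<lambda>l. [:- (eps k l * a), 1:]" "{..<k}"] by simp
    moreover have "coeff (monom 1 k - [:a ^ k:]) k = 1" using k by (simp add: coeff_pCons split: nat.split)
    ultimately show "coeff (\<Prod>l<k. [:- (eps k l * a), 1:]) k = coeff (monom 1 k - [:a ^ k:]) k" by simp
    show "k \<le> card ((\<lambda>l. eps k l * a) ` {..<k})" using card_image[OF inj] by simp
  qed
  then have "poly (\<Prod>l<k. [:- (eps k l * a), 1:]) x = poly (monom 1 k - [:a ^ k:]) x" by simp
  then show ?thesis by (simp add: poly_prod poly_monom)
qed (use k in \<open>simp add: power_0_left\<close>)

text \<open>Each quadratic is (1 - e^(it) z)(1 - e^(-it) z). As l runs through all values, e^(it)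
  runs through the k-th roots of e^(iq).\<close>

lemma prod_cos_factor:
  fixes z :: complex
  assumes k: "k > 0"
  shows "(\<Prod>l<k. 1 - 2 * z * of_real (cos ((q + 2 * pi * real l) / real k)) + z ^ 2) = 1 - 2 * of_real (cos q) * z ^ k + (z ^ k) ^ 2"
proof -
  have quad: "1 - 2 * z * of_real (cos t) + z ^ 2 = (1 - cis t * z) * (1 - cis (- t) * z)" for t z
  proof -
    have "cis t + cis (- t) = 2 * of_real (cos t)" by (simp add: complex_eq_iff)
    moreover have "cis t * cis (- t) = 1" by (simp add: cis_mult)
    moreover have "(1 - cis t * z) * (1 - cis (- t) * z) = 1 - (cis t + cis (- t)) * z + cis t * cis (- t) * z ^ 2"
      by (simp add: algebra_simps power2_eq_square)
    ultimately show ?thesis by (simp add: mult_ac)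
  qed
  have c: "cis ((q + 2 * pi * real l) / real k) = eps k l * cis (q / real k)" for l q
    by (simp add: eps_def cis_mult add_divide_distrib add.commute)
  have p1: "(\<Prod>l<k. 1 - cis ((q + 2 * pi * real l) / real k) * z) = 1 - cis q * z ^ k" for z
    unfolding c using prod_roots_of_unity[OF k, of 1 "cis (q / real k) * z"] k
    by (simp add: power_mult_distrib Complex.DeMoivre mult.assoc)
  have p2: "(\<Prod>l<k. 1 - cis (- ((q + 2 * pi * real l) / real k)) * z) = 1 - cis (- q) * z ^ k"
  proof -
    have "cnj (\<Prod>l<k. 1 - cis ((q + 2 * pi * real l) / real k) * cnj z) = cnj (1 - cis q * cnj z ^ k)" unfolding p1 ..
    then show ?thesis by (simp add: cis_cnj)
  qed
  show ?thesis unfolding quad prod.distrib p1 p2 using quad[of "z ^ k" q] by (simp add: mult_ac)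
qed

section \<open>The Bessel series as a Laplace transform\<close>

definition bessel_term :: "real \<Rightarrow> real \<Rightarrow> nat \<Rightarrow> nat \<Rightarrow> real" where
  "bessel_term g b j i = (-1) ^ i * (b / 2) ^ (j + 2 * i) / (fact i * Gamma (real i + (real j + g) + 1))"

text \<open>Rewrites a Bessel coefficient so that Gamma depends on n = j + 2 i only. This is what
  permits regrouping the double series by n into the form of \<open>psi\<close>.\<close>

lemma gchoose_Gamma:
  fixes g :: real
  assumes g: "g > 0"
  shows "1 / (fact i * Gamma (real i + (real j + g) + 1)) = ((real (j + 2 * i) + g) gchoose i) / Gamma (g + 1 + real (j + 2 * i))"
proof -
  have n: "real (j + 2 * i) + g + 1 \<notin> \<int>\<^sub>\<le>\<^sub>0" using g nonpos_Ints_nonpos[of "real (j + 2 * i) + g + 1"] by linarith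
  have A: "((real (j + 2 * i) + g) gchoose i) = Gamma (real (j + 2 * i) + g + 1) / (fact i * Gamma (real (j + 2 * i) + g - of_nat i + 1))"
    by (rule gbinomial_Gamma[OF n])
  have e1: "real (j + 2 * i) + g - of_nat i + 1 = real i + (real j + g) + 1" by simp
  have e2: "g + 1 + real (j + 2 * i) = real (j + 2 * i) + g + 1" by simp
  have "Gamma (real (j + 2 * i) + g + 1) > 0" using g by (intro Gamma_real_pos) (simp add: add_nonneg_pos)
  then show ?thesis unfolding A e1 e2 by simp
qed

text \<open>Reciprocal Gamma values decay faster than any geometric sequence. The base 64 is taken
  so that kernels growing like 16^j still leave the ratio 1/4; T also absorbs the exponential bound
  on the binomial coefficient.\<close>

lemma bessel_term_bound:
  assumes g: "g > 0" and b: "b > 0"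
  obtains B where "B \<ge> 0" "\<And>j i. \<bar>bessel_term g b j i\<bar> \<le> B * (1/64) ^ j * (1/2) ^ i"
proof -
  define T where "T = 64 * (exp 1 * (b / 2))"
  have T: "T > 0" using b by (simp add: T_def)
  have "summable (\<lambda>n. T ^ n / Gamma (g + 1 + real n))" by (rule summable_pow_Gamma) (use g in simp)
  then have "Bseq (\<lambda>n. T ^ n / Gamma (g + 1 + real n))" using summable_LIMSEQ_zero convergent_imp_Bseq convergentI by blast
  then obtain K where K: "\<And>n. norm (T ^ n / Gamma (g + 1 + real n)) \<le> K" unfolding Bseq_def by blast
  have K0: "K \<ge> 0" using K[of 0] norm_ge_zero order_trans by blast
  have "\<bar>bessel_term g b j i\<bar> \<le> exp g * K * (1/64) ^ j * (1/2) ^ i" for j i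
  proof -
    let ?n = "j + 2 * i"
    have G: "Gamma (g + 1 + real ?n) > 0" using g by (intro Gamma_real_pos) (simp add: add_pos_nonneg)
    have Gi: "Gamma (real i + (real j + g) + 1) > 0" using g by (intro Gamma_real_pos) (simp add: add_pos_nonneg)
    have "\<bar>bessel_term g b j i\<bar> = (b / 2) ^ ?n * (1 / (fact i * Gamma (real i + (real j + g) + 1)))"
      using Gi b by (simp add: bessel_term_def abs_mult power_abs)
    also have "\<dots> = (b / 2) ^ ?n * (((real ?n + g) gchoose i) / Gamma (g + 1 + real ?n))" unfolding gchoose_Gamma[OF g] ..
    also have "\<dots> \<le> (b / 2) ^ ?n * (exp (real ?n + g) / Gamma (g + 1 + real ?n))"
      using gchoose_exp_bound(2)[of i "real ?n + g"] g G b by (intro mult_left_mono divide_right_mono) auto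
    also have "exp (real ?n + g) = exp g * exp 1 ^ ?n" by (simp only: exp_of_nat_mult[symmetric] exp_add[symmetric] mult_1_right add.commute)
    also have "(b / 2) ^ ?n * (exp g * exp 1 ^ ?n / Gamma (g + 1 + real ?n)) = exp g * (T ^ ?n / Gamma (g + 1 + real ?n)) * (1/64) ^ ?n"
    proof -
      have "T ^ ?n * (1/64) ^ ?n = exp 1 ^ ?n * (b / 2) ^ ?n" unfolding power_mult_distrib[symmetric] T_def by (simp add: mult_ac)
      then have "exp g * (T ^ ?n / Gamma (g + 1 + real ?n)) * (1/64) ^ ?n = exp g * ((exp 1 ^ ?n * (b / 2) ^ ?n) / Gamma (g + 1 + real ?n))"
        by (simp only: times_divide_eq_left times_divide_eq_right mult.assoc)
      then show ?thesis by (simp only: times_divide_eq_right mult_ac)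
    qed
    also have "\<dots> \<le> exp g * K * ((1/64) ^ j * (1/2) ^ i)"
    proof (intro mult_mono mult_left_mono)
      show "T ^ ?n / Gamma (g + 1 + real ?n) \<le> K"
        using K[of ?n] by (metis abs_ge_self order_trans real_norm_def)
      have "((1/64) ^ 2) ^ i \<le> (1/2 :: real) ^ i" by (intro power_mono) (simp_all add: power2_eq_square)
      then have "(1/64) ^ j * ((1/64) ^ 2) ^ i \<le> (1/64 :: real) ^ j * (1/2) ^ i" by (intro mult_left_mono) auto
      then show "(1/64 :: real) ^ ?n \<le> (1/64) ^ j * (1/2) ^ i" by (simp only: power_add power_mult)
    qed (use K0 T G in auto)
    finally show ?thesis by (simp only: mult.assoc)
  qed
  then show thesis using that[of "exp g * K"] K0 by simp
qed

lemma besselJ_terms: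
  assumes g: "g > 0" and b: "b > 0"
  shows "b powr (- g) * besselJ (real j + g) b = 2 powr (- g) * (\<Sum>i. bessel_term g b j i)"
proof -
  obtain B where B: "B \<ge> 0" "\<And>j i. \<bar>bessel_term g b j i\<bar> \<le> B * (1/64) ^ j * (1/2) ^ i" using bessel_term_bound[OF g b] by blast
  have sm: "summable (\<lambda>i. bessel_term g b j i)"
    by (rule summable_comparison_test'[where N = 0 and g = "\<lambda>i. B * (1/64) ^ j * (1/2) ^ i"]) (use B in \<open>auto intro!: summable_mult summable_geometric\<close>)
  have "(-1) ^ i / (fact i * Gamma (real i + (real j + g) + 1)) * (b / 2) powr (2 * real i + (real j + g)) = (b / 2) powr g * bessel_term g b j i" for i
  proof -
    have "2 * real i + (real j + g) = real (j + 2 * i) + g" by simp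
    then have "(b / 2) powr (2 * real i + (real j + g)) = (b / 2) ^ (j + 2 * i) * (b / 2) powr g"
      using b by (simp only: powr_add) (simp only: powr_realpow)
    then show ?thesis by (simp add: bessel_term_def)
  qed
  then have "besselJ (real j + g) b = (b / 2) powr g * (\<Sum>i. bessel_term g b j i)"
    unfolding besselJ_def by (simp only: suminf_mult[OF sm])
  moreover have "b powr (- g) * (b / 2) powr g = 2 powr (- g)"
    using b by (simp add: powr_divide powr_minus_divide)
  ultimately show ?thesis by (simp only: mult.assoc[symmetric])
qed

lemma besselJ_bound:
  assumes g: "g > 0" and b: "b > 0"
  obtains B where "B \<ge> 0" "\<And>j. \<bar>b powr (- g) * besselJ (real j + g) b\<bar> \<le> B * (1/64) ^ j"
proof -
  obtain B where B: "B \<ge> 0" "\<And>j i. \<bar>bessel_term g b j i\<bar> \<le> B * (1/64) ^ j * (1/2) ^ i" using bessel_term_bound[OF g b] by blast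
  have "\<bar>b powr (- g) * besselJ (real j + g) b\<bar> \<le> (2 powr (- g) * (B * 2)) * (1/64) ^ j" for j
  proof -
    have gs: "(\<lambda>i. B * (1/64) ^ j * (1/2) ^ i) sums (B * (1/64) ^ j * (1 / (1 - 1/2)))"
      by (intro sums_mult geometric_sums) simp
    have "norm (\<Sum>i. bessel_term g b j i) \<le> (\<Sum>i. B * (1/64) ^ j * (1/2) ^ i)"
      by (rule norm_suminf_le) (use B(2) gs in \<open>auto simp: sums_iff\<close>)
    also have "\<dots> = B * (1/64) ^ j * 2" using gs by (simp add: sums_iff)
    finally show ?thesis unfolding besselJ_terms[OF g b] abs_mult by simp
  qed
  then show thesis using that[of "2 powr (- g) * (B * 2)"] B(1) by simp
qed

text \<open>Chosen so that \<open>psi (g + 1) (hh g b P)\<close> at t = 1 is, up to (2/b)^g, the Bessel series with coefficients P.\<close>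

definition hh :: "real \<Rightarrow> real \<Rightarrow> (nat \<Rightarrow> complex) \<Rightarrow> nat \<Rightarrow> complex" where
  "hh g b P n = (- (\<i> * of_real (b / 2))) ^ n * (\<Sum>i\<le>n div 2. of_real ((real n + g) gchoose i) * P (n - 2 * i))"

lemma ipow: "(- \<i>) ^ (j + 2 * i) = (- \<i>) ^ j * (-1) ^ i"
  by (simp add: power_add power_mult)

lemma psi_one:
  assumes g: "g > 0" and b: "b > 0" and K: "K \<ge> 0" and P: "\<And>n. cmod (P n) \<le> K * 16 ^ n"
  shows "(\<lambda>j. (- \<i>) ^ j * of_real (b powr (- g) * besselJ (real j + g) b) * P j) sums (of_real (2 powr (- g)) * psi (g + 1) (hh g b P) 1)"
proof -
  obtain B where B: "B \<ge> 0" "\<And>j i. \<bar>bessel_term g b j i\<bar> \<le> B * (1/64) ^ j * (1/2) ^ i" using bessel_term_bound[OF g b] by blast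
  have sm: "summable (\<lambda>i. bessel_term g b j i)" for j
    by (rule summable_comparison_test'[where N = 0 and g = "\<lambda>i. B * (1/64) ^ j * (1/2) ^ i"]) (use B in \<open>auto intro!: summable_mult summable_geometric\<close>)
  define u where "u j i = (- \<i>) ^ j * P j * of_real (bessel_term g b j i)" for j i
  have bd: "norm (u j i) \<le> (K * B) * (1/4) ^ j * (1/2) ^ i" for j i
  proof -
    have "norm (u j i) = cmod (P j) * \<bar>bessel_term g b j i\<bar>" by (simp add: u_def norm_mult norm_power)
    also have "\<dots> \<le> (K * 16 ^ j) * (B * (1/64) ^ j * (1/2) ^ i)" using K by (intro mult_mono P B) auto
    also have "\<dots> = (K * B) * (16 * (1/64)) ^ j * (1/2) ^ i" by (simp only: power_mult_distrib mult_ac)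
    finally show ?thesis by simp
  qed
  note R = regroup[where u = u and a = "1/4" and c = "1/2" and p = 2, OF _ _ _ _ bd]
  have inner: "(\<Sum>i\<le>n div 2. u (n - 2 * i) i) = hh g b P n * of_real (pw (g + 1 + real n) 1 / Gamma (g + 1 + real n))" for n
  proof -
    have "u (n - 2 * i) i = (- (\<i> * of_real (b / 2))) ^ n * (of_real ((real n + g) gchoose i) * P (n - 2 * i)) * of_real (1 / Gamma (g + 1 + real n))"
      if "i \<in> {..n div 2}" for i
    proof -
      define j where "j = n - 2 * i"
      have n: "n = j + 2 * i" using that by (simp add: j_def)
      have "bessel_term g b j i = (-1) ^ i * (b / 2) ^ n * (((real n + g) gchoose i) / Gamma (g + 1 + real n))"
        unfolding n gchoose_Gamma[OF g, symmetric] by (simp add: bessel_term_def)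
      moreover have "(- (\<i> * of_real (b / 2))) ^ n = (- \<i>) ^ j * (-1) ^ i * of_real (b / 2) ^ n"
        unfolding n ipow[symmetric] power_mult_distrib[symmetric] by simp
      ultimately show ?thesis unfolding j_def[symmetric] u_def by simp
    qed
    then show ?thesis by (simp add: hh_def pw_def sum_distrib_left sum_divide_distrib)
  qed
  have S: "(\<Sum>j. \<Sum>i. u j i) = psi (g + 1) (hh g b P) 1"
    using R(4) unfolding inner by (simp add: psi_def sums_iff)
  have row: "(\<Sum>i. u j i) = (- \<i>) ^ j * P j * of_real (\<Sum>i. bessel_term g b j i)" for j
    using sums_mult[OF sums_of_real[OF summable_sums[OF sm[of j]]], of "(- \<i>) ^ j * P j"]
    unfolding u_def by (simp only: sums_iff)
  have "(\<lambda>j. (- \<i>) ^ j * P j * of_real (\<Sum>i. bessel_term g b j i)) sums (psi (g + 1) (hh g b P) 1)"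
    unfolding row[symmetric] S[symmetric] by (rule R(6)) simp_all
  from sums_mult[OF this, of "of_real (2 powr (- g))"] show ?thesis
    unfolding besselJ_terms[OF g b] by (simp add: mult_ac)
qed

text \<open>Let beta = b/(2s) = r/(1 - r^2). Summed by j, the inner series is
  \<open>binomial_gf\<close> at y = -r^2 and nu = j + g, and its value turns beta^j into r^j times a
  common factor. A series in 1/s thus becomes a power series in -i r.\<close>

lemma hh_laplace:
  assumes g: "g > 0" and b: "b > 0" and K: "K \<ge> 0" and P: "\<And>n. cmod (P n) \<le> K * 16 ^ n"
    and r: "0 < r" "r \<le> 1/128" and s: "s = b * (1 - r\<^sup>2) / (2 * r)"
  shows "summable (\<lambda>n. norm (hh g b P n) / s ^ n)"
    and "(\<Sum>n. hh g b P n * of_real (s powr (- (g + 1 + real n)))) =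
      of_real ((s / (1 - r\<^sup>2)) powr (- (g + 1)) / (1 + r\<^sup>2)) * (\<Sum>j. P j * (- \<i> * of_real r) ^ j)"
proof -
  have r2: "0 < r\<^sup>2" "r\<^sup>2 \<le> 1/16384"
    using r power_mono[of r "1/128" 2] by (simp_all add: power2_eq_square)
  \<comment> \<open>r \<le> 1/128 yields beta \<le> 1/100, and with growth 16^j and exp 1 \<le> 3
    the double series has ratio 16 * 3/100 = 48/100 in j.\<close>
  define \<beta> where "\<beta> = r / (1 - r\<^sup>2)"
  have b0: "\<beta> > 0" using r r2 by (simp add: \<beta>_def)
  have b1: "\<beta> \<le> 1/100"
  proof -
    have "100 * r \<le> 1 - r\<^sup>2" using r r2 by linarith
    then show ?thesis using r2 by (simp add: \<beta>_def divide_le_eq)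
  qed
  have s0: "s > 0" using r r2 b by (simp add: s)
  have bs: "b / (2 * s) = \<beta>"
  proof -
    have "1 - r\<^sup>2 \<noteq> 0" using r2 by linarith
    then show ?thesis using r b by (simp add: s \<beta>_def)
  qed
  have e3: "exp (1::real) \<le> 3" by (rule exp_le)
  define u where "u j i = (- \<i>) ^ j * P j * of_real ((-1) ^ i * \<beta> ^ (j + 2 * i) * ((real (j + 2 * i) + g) gchoose i))" for j i
  have bd: "norm (u j i) \<le> (K * exp g) * (48/100) ^ j * (9/10000) ^ i" for j i
  proof -
    have "norm (u j i) = cmod (P j) * (\<beta> ^ (j + 2 * i) * ((real (j + 2 * i) + g) gchoose i))"
      using b0 g gchoose_exp_bound(1)[of i "real (j + 2 * i) + g"] by (simp add: u_def norm_mult norm_power abs_mult power_abs)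
    also have "\<dots> \<le> (K * 16 ^ j) * ((1/100) ^ (j + 2 * i) * exp (real (j + 2 * i) + g))"
      using b0 b1 g K gchoose_exp_bound[of i "real (j + 2 * i) + g"] by (intro mult_mono P power_mono) auto
    also have "exp (real (j + 2 * i) + g) = exp g * exp 1 ^ (j + 2 * i)" by (simp only: exp_of_nat_mult[symmetric] exp_add[symmetric] mult_1_right add.commute)
    also have "(K * 16 ^ j) * ((1/100) ^ (j + 2 * i) * (exp g * exp 1 ^ (j + 2 * i))) \<le> (K * 16 ^ j) * ((1/100) ^ (j + 2 * i) * (exp g * 3 ^ (j + 2 * i)))"
      using e3 K by (intro mult_left_mono power_mono) auto
    also have "\<dots> = (K * exp g) * (16 * ((1/100) * 3)) ^ j * ((1/100)\<^sup>2 * 3\<^sup>2) ^ i"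
      by (simp only: power_add power_mult power_mult_distrib) (simp only: mult_ac)
    finally show ?thesis by (simp add: power2_eq_square)
  qed
  note R = regroup[where u = u and a = "48/100" and c = "9/10000" and p = 2, OF _ _ _ _ bd]
  have inner: "(\<Sum>i\<le>n div 2. u (n - 2 * i) i) = hh g b P n / of_real (s ^ n)" for n
  proof -
    have "u (n - 2 * i) i = (- (\<i> * of_real (b / 2))) ^ n * (of_real ((real n + g) gchoose i) * P (n - 2 * i)) / of_real (s ^ n)"
      if "i \<in> {..n div 2}" for i
    proof -
      define j where "j = n - 2 * i"
      have n: "n = j + 2 * i" using that by (simp add: j_def)
      have "\<beta> ^ n = (b / 2) ^ n / s ^ n" unfolding bs[symmetric] by (simp add: power_divide power_mult_distrib)
      then have "u j i = (- \<i>) ^ j * P j * of_real ((-1) ^ i * ((b / 2) ^ n / s ^ n) * ((real n + g) gchoose i))"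
        unfolding u_def n[symmetric] by simp
      moreover have "(- (\<i> * of_real (b / 2))) ^ n = (- \<i>) ^ j * (-1) ^ i * of_real (b / 2) ^ n"
        unfolding n ipow[symmetric] power_mult_distrib[symmetric] by simp
      ultimately show ?thesis unfolding j_def[symmetric] by simp
    qed
    then show ?thesis by (simp add: hh_def sum_distrib_left sum_divide_distrib)
  qed
  show "summable (\<lambda>n. norm (hh g b P n) / s ^ n)"
    using R(3) s0 unfolding inner by (simp add: norm_divide norm_power)
  have row: "(\<Sum>i. u j i) = of_real ((1 - r\<^sup>2) powr (g + 1) / (1 + r\<^sup>2)) * (P j * (- \<i> * of_real r) ^ j)" for j
  proof -
    have "(\<lambda>i. ((2 * real i + (real j + g)) gchoose i) * (- r\<^sup>2 / (1 + - r\<^sup>2)\<^sup>2) ^ i) sums ((1 + - r\<^sup>2) powr (real j + g + 1) / (1 - - r\<^sup>2))"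
      by (rule binomial_gf) (use r2 g in auto)
    moreover have "2 * real i + (real j + g) = real (j + 2 * i) + g" for i by simp
    moreover have "(- r\<^sup>2 / (1 + - r\<^sup>2)\<^sup>2) ^ i = (-1) ^ i * \<beta> ^ (2 * i)" for i
      by (simp add: \<beta>_def power_mult power_divide power_minus[of "r\<^sup>2 / (1 - r\<^sup>2)\<^sup>2"])
    ultimately have "(\<lambda>i. ((real (j + 2 * i) + g) gchoose i) * ((-1) ^ i * \<beta> ^ (2 * i))) sums ((1 - r\<^sup>2) powr (real j + g + 1) / (1 + r\<^sup>2))" by simp
    from sums_mult[OF sums_of_real[OF this, where 'a = complex], of "(- \<i>) ^ j * P j * of_real (\<beta> ^ j)"]
    have "(\<lambda>i. u j i) sums ((- \<i>) ^ j * P j * of_real (\<beta> ^ j) * of_real ((1 - r\<^sup>2) powr (real j + g + 1) / (1 + r\<^sup>2)))"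
      by (simp add: u_def power_add mult_ac)
    moreover have "\<beta> ^ j * (1 - r\<^sup>2) powr (real j + g + 1) = r ^ j * (1 - r\<^sup>2) powr (g + 1)"
    proof -
      have p: "1 - r\<^sup>2 > 0" using r2 by linarith
      have "(1 - r\<^sup>2) powr (real j + g + 1) = (1 - r\<^sup>2) powr (real j + (g + 1))" by (simp add: add.assoc)
      also have "\<dots> = (1 - r\<^sup>2) ^ j * (1 - r\<^sup>2) powr (g + 1)" using p by (simp only: powr_add powr_realpow)
      finally show ?thesis using p by (simp add: \<beta>_def power_divide)
    qed
    then have "\<beta> ^ j * ((1 - r\<^sup>2) powr (real j + g + 1) / (1 + r\<^sup>2)) = r ^ j * ((1 - r\<^sup>2) powr (g + 1) / (1 + r\<^sup>2))"
      by (simp only: times_divide_eq_right)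
    then have "(- \<i>) ^ j * P j * of_real (\<beta> ^ j) * of_real ((1 - r\<^sup>2) powr (real j + g + 1) / (1 + r\<^sup>2)) = (- \<i>) ^ j * P j * of_real (r ^ j * ((1 - r\<^sup>2) powr (g + 1) / (1 + r\<^sup>2)))"
      by (simp only: mult.assoc of_real_mult[symmetric])
    moreover have "(- \<i> * of_real r) ^ j = (- \<i>) ^ j * of_real (r ^ j)" by (simp only: power_mult_distrib of_real_power)
    ultimately show ?thesis by (simp add: sums_iff mult_ac)
  qed
  have "(\<Sum>n. hh g b P n * of_real (s powr (- (g + 1 + real n)))) = (\<Sum>n. of_real (s powr (- (g + 1))) * (hh g b P n / of_real (s ^ n)))"
  proof -
    have "s powr (- (g + 1 + real n)) = s powr (- (g + 1)) / s ^ n" for n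
    proof -
      have "- (g + 1 + real n) = - (g + 1) - real n" by simp
      then show ?thesis using s0 by (simp only: powr_diff powr_realpow)
    qed
    then show ?thesis by (simp add: mult_ac)
  qed
  also have "\<dots> = of_real (s powr (- (g + 1))) * (\<Sum>j. \<Sum>i. u j i)"
  proof -
    have "(\<lambda>n. hh g b P n / of_real (s ^ n)) sums (\<Sum>j. \<Sum>i. u j i)"
      unfolding inner[symmetric] by (rule R(4)) simp_all
    from sums_unique[OF sums_mult[OF this, of "of_real (s powr (- (g + 1)))"]] show ?thesis by (rule sym)
  qed
  also have "(\<Sum>j. \<Sum>i. u j i) = of_real ((1 - r\<^sup>2) powr (g + 1) / (1 + r\<^sup>2)) * (\<Sum>j. P j * (- \<i> * of_real r) ^ j)"
  proof -
    have "cmod (P j * (- \<i> * of_real r) ^ j) \<le> K * (1/8) ^ j" for j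
    proof -
      have "cmod (P j * (- \<i> * of_real r) ^ j) = cmod (P j) * r ^ j" using r by (simp add: norm_mult norm_power)
      also have "\<dots> \<le> (K * 16 ^ j) * (1/128) ^ j" using r K by (intro mult_mono P power_mono) auto
      also have "\<dots> = K * (16 * (1/128)) ^ j" by (simp only: power_mult_distrib mult_ac)
      finally show ?thesis by simp
    qed
    note le = this
    have "summable (\<lambda>j. P j * (- \<i> * of_real r) ^ j)"
    proof (rule summable_comparison_test'[where N = 0])
      show "summable (\<lambda>j. K * (1/8) ^ j)" by (intro summable_mult summable_geometric) simp
      show "cmod (P j * (- \<i> * of_real r) ^ j) \<le> K * (1/8) ^ j" for j by (rule le)
    qed
    then show ?thesis unfolding row by (rule suminf_mult)
  qed
  also have "of_real (s powr (- (g + 1))) * (of_real ((1 - r\<^sup>2) powr (g + 1) / (1 + r\<^sup>2)) * (\<Sum>j. P j * (- \<i> * of_real r) ^ j)) = 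
     of_real (s powr (- (g + 1)) * (1 - r\<^sup>2) powr (g + 1) / (1 + r\<^sup>2)) * (\<Sum>j. P j * (- \<i> * of_real r) ^ j)" by simp
  also have "s powr (- (g + 1)) * (1 - r\<^sup>2) powr (g + 1) = (s / (1 - r\<^sup>2)) powr (- (g + 1))"
  proof -
    have p: "1 - r\<^sup>2 > 0" using r2 by linarith
    then have "(s / (1 - r\<^sup>2)) powr (- (g + 1)) = s powr (- (g + 1)) / (1 - r\<^sup>2) powr (- (g + 1))" using s0 by (simp only: powr_divide less_imp_le)
    then show ?thesis by (simp only: powr_minus[of "1 - r\<^sup>2"] divide_inverse inverse_inverse_eq)
  qed
  finally show "(\<Sum>n. hh g b P n * of_real (s powr (- (g + 1 + real n)))) =
      of_real ((s / (1 - r\<^sup>2)) powr (- (g + 1)) / (1 + r\<^sup>2)) * (\<Sum>j. P j * (- \<i> * of_real r) ^ j)" .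
qed

text \<open>Principal powers multiply as long as the arguments add up to less than pi in absolute
  value. Each logarithm is bounded by 2 \<delta>, and the second condition on \<delta> controls
  their sum.\<close>

lemma prod_powr_small:
  fixes w :: "nat \<Rightarrow> complex"
  assumes w: "\<And>l. l < k \<Longrightarrow> cmod (w l - 1) \<le> \<delta>" and d: "\<delta> < 1/2" "real k * (2 * \<delta>) < pi"
  shows "(\<Prod>l<k. w l powr c) = (\<Prod>l<k. w l) powr c"
proof -
  have nz: "w l \<noteq> 0" if "l < k" for l
  proof
    assume "w l = 0"
    then show False using w[OF that] d by simp
  qed
  have ln: "cmod (Ln (w l)) \<le> 2 * \<delta>" if "l < k" for l
    using norm_Ln_le[of "w l - 1"] w[OF that] d by simp
  have "cmod (\<Sum>l<k. Ln (w l)) \<le> (\<Sum>l<k. 2 * \<delta>)"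
    by (rule order_trans[OF norm_sum sum_mono]) (use ln in simp)
  then have im: "\<bar>Im (\<Sum>l<k. Ln (w l))\<bar> < pi"
    using d abs_Im_le_cmod[of "\<Sum>l<k. Ln (w l)"] by simp
  have "exp (\<Sum>l<k. Ln (w l)) = (\<Prod>l<k. w l)"
    unfolding exp_sum[OF finite_lessThan] by (intro prod.cong refl) (simp add: nz)
  then have L: "Ln (\<Prod>l<k. w l) = (\<Sum>l<k. Ln (w l))" by (rule Ln_unique) (use im in linarith)+
  have "(\<Prod>l<k. w l powr c) = (\<Prod>l<k. exp (c * Ln (w l)))" by (intro prod.cong refl) (simp add: powr_def nz)
  also have "\<dots> = exp (c * (\<Sum>l<k. Ln (w l)))" by (simp add: exp_sum[symmetric] sum_distrib_left)
  also have "\<dots> = (\<Prod>l<k. w l) powr c"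
  proof -
    have "(\<Prod>l<k. w l) \<noteq> 0" using nz by simp
    then show ?thesis by (simp add: powr_def L)
  qed
  finally show ?thesis .
qed

lemma unit_quadratic:
  assumes "cmod y = 1"
  shows "1 - 2 * of_real (Re y) * z + z ^ 2 = (1 - z * y) * (1 - z * cnj y)"
proof -
  have "y * cnj y = 1" using assms by (simp add: complex_norm_square[symmetric])
  moreover have "y + cnj y = 2 * of_real (Re y)" by (simp add: complex_eq_iff)
  moreover have "(1 - z * y) * (1 - z * cnj y) = 1 - (y + cnj y) * z + (y * cnj y) * z ^ 2"
    by (simp add: algebra_simps power2_eq_square)
  ultimately show ?thesis by simp
qed

section \<open>Matching the two Laplace transforms\<close>

lemma Xf_1_1: "Xf k om eta 1 1 = Re ((om * cnj eta) ^ k)"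
  by (simp add: Xf_def power_mult_distrib flip: complex_cnj_power)

lemma cos_qf_1_1:
  assumes "cmod om = 1" "cmod eta = 1"
  shows "cos (qf k om eta 1 1) = Re ((om * cnj eta) ^ k)"
proof -
  have "cmod ((om * cnj eta) ^ k) = 1" using assms by (simp add: norm_mult norm_power)
  then have "\<bar>Re ((om * cnj eta) ^ k)\<bar> \<le> 1" using abs_Re_le_cmod by metis
  then show ?thesis by (simp add: qf_def Xf_1_1 abs_le_iff)
qed

text \<open>The bound 1/(128 k) on r keeps all k factors of A, divided by S > 0, within 3 r of 1, so
  that the principal powers assemble to W^(-lam). Together with the 1/W of the partial fractions
  this is the power -(lam + 1) in the generating function.\<close>

lemma laplace_identity:
  assumes k: "k \<ge> 1" and lam: "lam > 0" and b: "b > 0" and X: "\<bar>X\<bar> \<le> 1"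
    and om: "cmod om = 1" and eta: "cmod eta = 1"
    and r: "0 < r" "r \<le> 1 / (128 * real k)" and s: "s = b * (1 - r\<^sup>2) / (2 * r)"
  shows "of_real ((s / (1 - r\<^sup>2)) powr (- (real k * lam + 1)) / (1 + r\<^sup>2)) * (\<Sum>j. PX (lam + 1) k X (om * cnj eta) j * (- \<i> * of_real r) ^ j)
    = Apow k b lam (arccos X) (of_real s) * (Apoly k b (qf k om eta 1 1) (of_real s) / (Bpoly b om eta (of_real s) * Apoly k b (arccos X) (of_real s)))"
proof -
  define e where "e = om * cnj eta"
  have e: "cmod e = 1" using om eta by (simp add: e_def norm_mult)
  have ek: "cmod (e ^ k) = 1" by (simp add: norm_power e)
  have k0: "k > 0" using k by simp
  have r1: "r \<le> 1/128"
  proof -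
    have "1 / (128 * real k) \<le> 1 / (128 * 1)" using k by (intro divide_left_mono) auto
    then show ?thesis using r(2) by simp
  qed
  have rk: "real k * r \<le> 1/128" using r k0 by (simp add: field_simps)
  have r2: "0 < r\<^sup>2" "r\<^sup>2 \<le> r" "r\<^sup>2 < 1"
  proof -
    show "0 < r\<^sup>2" using r by simp
    show "r\<^sup>2 \<le> r" using r r1 by (simp add: power2_eq_square mult_le_cancel_left1)
    then show "r\<^sup>2 < 1" using r1 by linarith
  qed
  define \<zeta> where "\<zeta> = - \<i> * complex_of_real r"
  have z2: "\<zeta> ^ 2 = - of_real (r\<^sup>2)" by (simp add: \<zeta>_def power_mult_distrib)
  have zn: "cmod \<zeta> = r" using r by (simp add: \<zeta>_def norm_mult)
  define S where "S = s / (1 - r\<^sup>2)"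
  have S': "S = b / (2 * r)" using r2 unfolding S_def s by simp
  have S0: "S > 0" using r b by (simp add: S')
  have fac: "of_real s + \<i> * complex_of_real (b * c) = of_real S * (1 - 2 * \<zeta> * of_real c + \<zeta> ^ 2)" for c
  proof -
    have "s = S * (1 - r\<^sup>2)" using r2 by (simp add: S_def)
    moreover have "b = S * (2 * r)" using r by (simp add: S')
    ultimately show ?thesis unfolding z2 by (simp add: \<zeta>_def complex_eq_iff)
  qed
  have A: "Apoly k b q (of_real s) = of_real S ^ k * (1 - 2 * of_real (cos q) * \<zeta> ^ k + (\<zeta> ^ k) ^ 2)" for q
    unfolding Apoly_def fac prod.distrib prod_cos_factor[OF k0] by simp
  define N where "N = (1 - \<zeta> ^ k * e ^ k) * (1 - \<zeta> ^ k * cnj e ^ k)"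
  define D where "D = (1 - \<zeta> * e) * (1 - \<zeta> * cnj e)"
  define W where "W = 1 - 2 * of_real X * \<zeta> ^ k + (\<zeta> ^ k) ^ 2"
  have cX: "cos (arccos X) = X" using X by (simp add: abs_le_iff)
  have AX: "Apoly k b (arccos X) (of_real s) = of_real S ^ k * W"
    unfolding A cX W_def ..
  have A1: "Apoly k b (qf k om eta 1 1) (of_real s) = of_real S ^ k * N"
    unfolding A cos_qf_1_1[OF om eta] e_def[symmetric] unit_quadratic[OF ek] N_def by simp
  have B: "Bpoly b om eta (of_real s) = of_real S * D"
    unfolding Bpoly_def fac D_def e_def[symmetric] using unit_quadratic[OF e, of \<zeta>] by (simp add: mult_ac)
  have W0: "W \<noteq> 0"
  proof
    assume "W = 0"
    then have "1 = 2 * of_real X * \<zeta> ^ k - (\<zeta> ^ k) ^ 2" unfolding W_def by (simp add: algebra_simps)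
    then have "cmod (2 * of_real X * \<zeta> ^ k - (\<zeta> ^ k) ^ 2) = 1" by (metis norm_one)
    moreover have "cmod (2 * of_real X * \<zeta> ^ k - (\<zeta> ^ k) ^ 2) \<le> 2 * 1 * r + 1 * r"
    proof (rule order_trans[OF norm_triangle_ineq4], intro add_mono)
      have rp: "r ^ k \<le> r" using power_decreasing[of 1 k r] k r r1 by simp
      have "r ^ k \<le> 1" using rp r1 by linarith
      show "cmod (2 * of_real X * \<zeta> ^ k) \<le> 2 * 1 * r"
        unfolding norm_mult norm_power zn using X rp r by (intro mult_mono) auto
      show "cmod ((\<zeta> ^ k) ^ 2) \<le> 1 * r"
        unfolding power2_eq_square norm_mult norm_power zn using rp \<open>r ^ k \<le> 1\<close> r by (intro mult_mono) auto
    qed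
    ultimately show False using r1 by linarith
  qed
  define Wl where "Wl = W powr (- of_real lam)"
  have Wp: "W powr (- of_real (lam + 1)) = Wl / W"
  proof -
    have "- (of_real (lam + 1) * Ln W) = - (of_real lam * Ln W) - Ln W" by (simp add: algebra_simps)
    then have "exp (- (of_real (lam + 1) * Ln W)) = exp (- (of_real lam * Ln W)) / exp (Ln W)"
      by (simp only: exp_diff)
    then show ?thesis by (simp only: Wl_def powr_def W0 if_False mult_minus_left exp_Ln[OF W0])
  qed
  define Sg where "Sg = S powr (- (real k * lam))"
  have Ap: "Apow k b lam (arccos X) (of_real s) = of_real Sg * Wl"
  proof -
    define w where "w l = 1 - 2 * \<zeta> * of_real (cos ((arccos X + 2 * pi * real l) / real k)) + \<zeta> ^ 2" for l
    have w1: "cmod (w l - 1) \<le> 3 * r" for l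
    proof -
      have "w l - 1 = \<zeta> ^ 2 - 2 * \<zeta> * of_real (cos ((arccos X + 2 * pi * real l) / real k))" by (simp add: w_def)
      then have "cmod (w l - 1) \<le> cmod (\<zeta> ^ 2) + cmod (2 * \<zeta> * of_real (cos ((arccos X + 2 * pi * real l) / real k)))"
        using norm_triangle_ineq4 by metis
      also have "\<dots> \<le> r + 2 * r * 1"
      proof (intro add_mono)
        show "cmod (\<zeta> ^ 2) \<le> r" using r2 by (simp add: norm_power zn)
        show "cmod (2 * \<zeta> * of_real (cos ((arccos X + 2 * pi * real l) / real k))) \<le> 2 * r * 1"
          unfolding norm_mult zn norm_of_real using r by (intro mult_mono) auto
      qed
      finally show ?thesis by simp
    qed
    have "Apow k b lam (arccos X) (of_real s) = (\<Prod>l<k. (of_real S * w l) powr (- of_real lam))"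
      unfolding Apow_def fac w_def ..
    also have "\<dots> = (\<Prod>l<k. of_real (S powr (- lam)) * w l powr (- of_real lam))"
    proof (intro prod.cong refl)
      fix l
      have "complex_of_real S powr (- of_real lam) = of_real (S powr (- lam))" using powr_of_real[of S "- lam"] S0 by simp
      then show "(of_real S * w l) powr (- of_real lam) = of_real (S powr (- lam)) * w l powr (- of_real lam)"
        using powr_times_real_left[of "of_real S" "w l"] S0 by simp
    qed
    also have "\<dots> = of_real ((S powr (- lam)) ^ k) * (\<Prod>l<k. w l powr (- of_real lam))"
      by (simp add: prod.distrib)
    also have "(\<Prod>l<k. w l powr (- of_real lam)) = (\<Prod>l<k. w l) powr (- of_real lam)"
    proof (rule prod_powr_small[where \<delta> = "3 * r"])
      show "real k * (2 * (3 * r)) < pi" using rk pi_gt3 by linarith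
    qed (use w1 r1 in auto)
    also have "(\<Prod>l<k. w l) = W" unfolding w_def prod_cos_factor[OF k0] cX W_def ..
    also have "(S powr (- lam)) ^ k = Sg"
      using powr_realpow[of "S powr (- lam)" k] S0 by (simp add: Sg_def powr_powr mult.commute)
    finally show ?thesis by (simp add: Wl_def)
  qed
  have gf: "(\<Sum>j. PX (lam + 1) k X e j * \<zeta> ^ j) = (1 - \<zeta> ^ 2) * N / D * (Wl / W)"
    using PX_gf[OF k _ X _ e, of "lam + 1" \<zeta>] lam zn r1
    unfolding N_def[symmetric] D_def[symmetric] W_def[symmetric] Wp by (simp add: sums_iff)
  have Sg1: "S powr (- (real k * lam + 1)) = Sg / S"
  proof -
    have "- (real k * lam + 1) = - (real k * lam) - 1" by simp
    then show ?thesis using S0 unfolding Sg_def by (simp only: powr_diff powr_one)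
  qed
  have R0: "complex_of_real (1 + r\<^sup>2) \<noteq> 0"
  proof -
    have "1 + r\<^sup>2 \<noteq> 0" using r2 by linarith
    then show ?thesis by (simp only: of_real_eq_0_iff not_False_eq_True)
  qed
  have alg: "x / t / R * (R * n / d * (v / w)) = x * v * (t ^ k * n / (t * d * (t ^ k * w)))"
    if "R \<noteq> 0" "t \<noteq> 0" for x t R n d v w :: complex
    using that by simp
  have "of_real (S powr (- (real k * lam + 1)) / (1 + r\<^sup>2)) * (\<Sum>j. PX (lam + 1) k X e j * \<zeta> ^ j)
    = of_real Sg / of_real S / of_real (1 + r\<^sup>2) * (of_real (1 + r\<^sup>2) * N / D * (Wl / W))"
    unfolding gf Sg1 z2 by simp
  also have "\<dots> = of_real Sg * Wl * (of_real S ^ k * N / (of_real S * D * (of_real S ^ k * W)))"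
    by (rule alg[OF R0]) (use S0 in simp)
  finally show ?thesis unfolding Ap AX A1 B S_def[symmetric] e_def[symmetric] \<zeta>_def .
qed

lemma csum_integral_sums:
  assumes k: "k \<ge> 1" and lam: "lam > 0" and b: "b > 0" and X: "\<bar>X\<bar> \<le> 1"
    and om: "cmod om = 1" and eta: "cmod eta = 1"
    and inj: "inj_on (aroot k b om eta (arccos X)) {0..k}"
  shows "(\<lambda>j. (- \<i>) ^ j * of_real (b powr (- (real k * lam)) * besselJ (real j + real k * lam) b) * PX (lam + 1) k X (om * cnj eta) j) sums
    (of_real (2 powr (- (real k * lam))) * (LINT tau:{0..1}|lborel. csum k b om eta (arccos X) tau * gfun k b lam (arccos X) tau))"
proof -
  define g where "g = real k * lam"
  have g: "g > 0" "g + 1 > 0" using k lam by (simp_all add: g_def add_pos_nonneg)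
  define P where "P = PX (lam + 1) k X (om * cnj eta)"
  have e: "cmod (om * cnj eta) = 1" using om eta by (simp add: norm_mult)
  obtain K where K: "K \<ge> 0" "\<And>m X. \<bar>X\<bar> \<le> 1 \<Longrightarrow> \<bar>CX (lam + 1) m X\<bar> \<le> K * 16 ^ m" using CX_bound[of "lam + 1"] lam by auto
  have P: "cmod (P n) \<le> (4 * K) * 16 ^ n" for n unfolding P_def by (rule PX_bound[OF K(1) K(2)[OF X] e])
  have K4: "4 * K \<ge> 0" using K by simp
  obtain f where f: "cls (g + 1) f"
    "\<And>s. Re s > 0 \<Longrightarrow> Lp f s = Apow k b lam (arccos X) s * (Apoly k b (qf k om eta 1 1) s / (Bpoly b om eta s * Apoly k b (arccos X) s))"
    "(LINT tau:{0..1}|lborel. csum k b om eta (arccos X) tau * gfun k b lam (arccos X) tau) = f 1"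
    using csum_gfun_integral[OF k lam inj] unfolding g_def by metis
  \<comment> \<open>The relation b r^2 + 2 s r = b implies 2 s r \<le> b, and for s \<ge> s1 this
    gives r \<le> 1/(128 k).\<close>
  define s1 where "s1 = b * (64 * real k)"
  have s1: "s1 > 0" using b k by (simp add: s1_def)
  have ex: "\<exists>r. 0 < r \<and> r \<le> 1 / (128 * real k) \<and> s = b * (1 - r\<^sup>2) / (2 * r)" if s: "s \<ge> s1" for s
  proof -
    have s0: "s > 0" using s s1 by linarith
    \<comment> \<open>The positive root of b r^2 + 2 s r = b.\<close>
    define r where "r = (sqrt (s\<^sup>2 + b\<^sup>2) - s) / b"
    have "s\<^sup>2 < s\<^sup>2 + b\<^sup>2" using b by simp
    then have "sqrt (s\<^sup>2) < sqrt (s\<^sup>2 + b\<^sup>2)" by (simp only: real_sqrt_less_iff)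
    then have "s < sqrt (s\<^sup>2 + b\<^sup>2)" using s0 by simp
    then have r0: "r > 0" using b by (simp add: r_def)
    have "b * r + s = sqrt (s\<^sup>2 + b\<^sup>2)" using b by (simp add: r_def)
    then have "(b * r + s)\<^sup>2 = s\<^sup>2 + b\<^sup>2" by (metis real_sqrt_pow2 add_nonneg_nonneg zero_le_power2)
    then have "b * (b * r\<^sup>2 + 2 * s * r) = b * b" by (simp add: power2_eq_square algebra_simps)
    then have q: "b * r\<^sup>2 + 2 * s * r = b" using b by simp
    have "2 * s * r \<le> b" using q b zero_le_power2[of r] mult_nonneg_nonneg[of b "r\<^sup>2"] by linarith
    moreover have "2 * s1 * r \<le> 2 * s * r" using s r0 by (intro mult_right_mono) auto
    ultimately have "b * (128 * real k * r) \<le> b * 1" by (simp add: s1_def mult_ac)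
    then have "128 * real k * r \<le> 1" using b by (simp only: mult_le_cancel_left_pos)
    then have "r \<le> 1 / (128 * real k)" using k by (simp add: field_simps)
    moreover have "s = b * (1 - r\<^sup>2) / (2 * r)" using q r0 by (simp add: field_simps)
    ultimately show ?thesis using r0 by blast
  qed
  have k128: "1 / (128 * real k) \<le> 1 / 128"
  proof -
    have "1 / (128 * real k) \<le> 1 / (128 * 1)" using k by (intro divide_left_mono) auto
    then show ?thesis by simp
  qed
  have sm: "summable (\<lambda>n. norm (hh g b P n) / s ^ n)" if "s \<ge> s1" for s
  proof -
    from ex[OF that] obtain r where r: "0 < r" "r \<le> 1 / (128 * real k)" "s = b * (1 - r\<^sup>2) / (2 * r)" by blast
    show ?thesis by (rule hh_laplace(1)[OF g(1) b K4 P r(1) order_trans[OF r(2) k128] r(3)])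
  qed
  have "f = psi (g + 1) (hh g b P)"
  proof (rule lerch[where \<sigma> = s1])
    show "f t = 0" if "t \<le> 0" for t using f(1) that by (simp add: cls_def)
    show "continuous_on {0<..} f" using f(1) by (simp add: cls_def)
    show "psi (g + 1) (hh g b P) t = 0" if "t \<le> 0" for t using that by (rule psi_zero)
    show "continuous_on {0<..} (psi (g + 1) (hh g b P))" by (rule psi_continuous[OF g(2) s1 sm[OF order_refl]])
    fix s assume s: "s \<ge> s1"
    then have s0: "s > 0" using s1 by linarith
    show "integrable lborel (\<lambda>t. exp (- (complex_of_real s * complex_of_real t)) * f t)"
      by (rule cls_integrable[OF f(1) g(2)]) (use s0 in simp)
    show "integrable lborel (\<lambda>t. exp (- (complex_of_real s * complex_of_real t)) * psi (g + 1) (hh g b P) t)"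
      by (rule psi_laplace(2)[OF g(2) s0 sm[OF s]])
    from ex[OF s] obtain r where r: "0 < r" "r \<le> 1 / (128 * real k)" "s = b * (1 - r\<^sup>2) / (2 * r)" by blast
    have "Lp (psi (g + 1) (hh g b P)) (of_real s) = (\<Sum>n. hh g b P n * of_real (s powr (- (g + 1 + real n))))"
      unfolding Lp_def by (rule psi_laplace(3)[OF g(2) s0 sm[OF s]])
    also have "\<dots> = of_real ((s / (1 - r\<^sup>2)) powr (- (g + 1)) / (1 + r\<^sup>2)) * (\<Sum>j. P j * (- \<i> * of_real r) ^ j)"
      by (rule hh_laplace(2)[OF g(1) b K4 P r(1) order_trans[OF r(2) k128] r(3)])
    also have "\<dots> = Apow k b lam (arccos X) (of_real s) * (Apoly k b (qf k om eta 1 1) (of_real s) / (Bpoly b om eta (of_real s) * Apoly k b (arccos X) (of_real s)))"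
      unfolding P_def g_def by (rule laplace_identity[OF k lam b X om eta r])
    finally show "Lp f (of_real s) = Lp (psi (g + 1) (hh g b P)) (of_real s)" using f(2)[of "of_real s"] s0 by simp
  qed
  then show ?thesis using psi_one[OF g(1) b K4 P] f(3) unfolding g_def P_def by simp
qed

section \<open>Moments of the measures\<close>

definition nu :: "real \<Rightarrow> real \<Rightarrow> real" where
  "nu g w = indicator {-1..1} w * dmu g w"

text \<open>The even part of the density without its normalising constant; the factor 1 + w adds the
  odd part w \<open>pm\<close>.\<close>

definition pm :: "real \<Rightarrow> real \<Rightarrow> real" where
  "pm g w = indicator {-1..1} w * (1 - w\<^sup>2) powr (g - 1)"

lemma nu_pm: "nu g w = 1 / Beta (1/2) g * (pm g w + w * pm g w)"
  by (simp add: nu_def pm_def dmu_def algebra_simps add_divide_distrib)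

lemma pm_affine: "pm g w = 4 powr (g - 1) * (pw g (1/2 + 1/2 * w) * pw g (1 - (1/2 + 1/2 * w)))"
proof (cases "-1 < w \<and> w < 1")
  case True
  have "1 - w\<^sup>2 = 4 * ((1/2 + 1/2 * w) * (1 - (1/2 + 1/2 * w)))" by (simp add: power2_eq_square algebra_simps)
  then have "(1 - w\<^sup>2) powr (g - 1) = 4 powr (g - 1) * ((1/2 + 1/2 * w) powr (g - 1) * (1 - (1/2 + 1/2 * w)) powr (g - 1))"
    using True by (simp add: powr_mult)
  then show ?thesis using True by (simp add: pm_def pw_def)
next
  case False
  then consider "w = 1" | "w = -1" | "w < -1 \<or> w > 1" by linarith
  then show ?thesis by cases (auto simp: pm_def pw_def indicator_def)
qed

text \<open>Reconciles two forms of the normalising constant: B(g,g), which the substitution x = (1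
  + w)/2 produces, and B(1/2,g) in \<open>dmu\<close>.\<close>

lemma Gamma_legendre_real:
  fixes g :: real
  assumes "g > 0"
  shows "Gamma g * Gamma (g + 1/2) = 2 powr (1 - 2 * g) * sqrt pi * Gamma (2 * g)"
proof -
  have n: "complex_of_real x \<notin> \<int>\<^sub>\<le>\<^sub>0" if "x > 0" for x
    using that by (auto simp: of_real_in_nonpos_Ints_iff dest: nonpos_Ints_nonpos)
  have "Gamma (complex_of_real g) * Gamma (complex_of_real g + 1/2) = exp ((1 - 2 * complex_of_real g) * of_real (ln 2)) * of_real (sqrt pi) * Gamma (2 * complex_of_real g)"
    by (rule Gamma_legendre_duplication) (use n[of g] n[of "g + 1/2"] assms in auto)
  moreover have "exp ((1 - 2 * complex_of_real g) * of_real (ln 2)) = of_real (2 powr (1 - 2 * g))"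
    by (simp add: powr_def exp_of_real[symmetric] mult.commute)
  moreover have "Gamma (complex_of_real g + 1/2) = of_real (Gamma (g + 1/2))" "Gamma (2 * complex_of_real g) = of_real (Gamma (2 * g))"
    using Gamma_complex_of_real[of "g + 1/2"] Gamma_complex_of_real[of "2 * g"] by simp_all
  ultimately have "complex_of_real (Gamma g * Gamma (g + 1/2)) = of_real (2 powr (1 - 2 * g) * sqrt pi * Gamma (2 * g))"
    by (simp add: Gamma_complex_of_real)
  then show ?thesis by (simp only: of_real_eq_iff)
qed

lemma Beta_integral:
  assumes "a > 0" "b > 0" shows "(LINT x|lborel. pw a x * pw b (1 - x)) = Beta a b"
proof -
  have "(\<lambda>x. pw a x * pw b (1 - x)) = (\<lambda>x. indicator {0..1} x *\<^sub>R (x powr (a - 1) * (1 - x) powr (b - 1)))"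
    by (auto simp: fun_eq_iff pw_def indicator_def)
  then show ?thesis
    using set_borel_integral_eq_integral(2)[OF integrable_Beta[OF assms]] integral_unique[OF has_integral_Beta_real[OF assms]]
    by (simp add: set_lebesgue_integral_def)
qed

lemma pm_integral:
  assumes g: "g > 0"
  shows "integrable lborel (pm g)" and "(LINT w|lborel. pm g w) = Beta (1/2) g"
proof -
  let ?B = "\<lambda>x. pw g x * pw g (1 - x)"
  have Bi: "integrable lborel ?B" by (rule Beta_integrable[OF g g])
  have "integrable lborel (\<lambda>w. ?B (1/2 + 1/2 * w))"
    using lborel_integrable_real_affine[OF Bi, of "1/2" "1/2"] by simp
  then show "integrable lborel (pm g)" unfolding pm_affine[abs_def] by (rule integrable_mult_right)
  have "(LINT w|lborel. pm g w) = 4 powr (g - 1) * (2 * (LINT x|lborel. ?B x))"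
    unfolding pm_affine integral_mult_right_zero
    using lborel_integral_real_affine[of "1/2" ?B "1/2"] by simp
  also have "(LINT x|lborel. ?B x) = Beta g g" by (rule Beta_integral[OF g g])
  also have "4 powr (g - 1) * (2 * Beta g g) = Beta (1/2) g"
  proof -
    have G: "Gamma g > 0" "Gamma (g + 1/2) > 0" "Gamma (2 * g) > 0" using g by (auto intro!: Gamma_real_pos)
    have p: "4 powr (g - 1) * 2 = (2::real) powr (2 * g - 1)"
    proof -
      have "(4::real) = 2 powr 2" by simp
      then have "(4::real) powr (g - 1) = 2 powr (2 * (g - 1))" by (simp only: powr_powr)
      moreover have "(2::real) powr (2 * (g - 1)) * 2 powr 1 = 2 powr (2 * g - 1)" unfolding powr_add[symmetric] by (simp add: algebra_simps)
      ultimately show ?thesis by simp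
    qed
    have p1: "(2::real) powr (2 * g - 1) * 2 powr (1 - 2 * g) = 1" unfolding powr_add[symmetric] by simp
    have "2 powr (2 * g - 1) * Gamma g * (Gamma g * Gamma (g + 1/2)) = (2 powr (2 * g - 1) * 2 powr (1 - 2 * g)) * (Gamma g * sqrt pi * Gamma (2 * g))"
      unfolding Gamma_legendre_real[OF g] by (simp only: mult_ac)
    then have "2 powr (2 * g - 1) * Gamma g * Gamma g / Gamma (2 * g) = sqrt pi * Gamma g / Gamma (g + 1/2)"
      unfolding p1 using G by (simp add: field_simps)
    then have "2 powr (2 * g - 1) * Beta g g = Beta (1/2) g"
      by (simp add: Beta_def Gamma_one_half_real add.commute)
    then show ?thesis using p by (simp only: mult.assoc[symmetric])
  qed
  finally show "(LINT w|lborel. pm g w) = Beta (1/2) g" .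
qed

lemma pm_nonneg [simp]: "pm g w \<ge> 0" by (simp add: pm_def)

lemma pm_meas [measurable]: "pm g \<in> borel_measurable borel"
  unfolding pm_def[abs_def] by measurable

lemma pm_pow_integrable:
  assumes g: "g > 0" shows "integrable lborel (\<lambda>w. w ^ j * pm g w)"
proof (rule Bochner_Integration.integrable_bound[OF pm_integral(1)[OF g]])
  show "AE w in lborel. norm (w ^ j * pm g w) \<le> norm (pm g w)"
  proof (rule AE_I2)
    fix w
    show "norm (w ^ j * pm g w) \<le> norm (pm g w)"
    proof (cases "w \<in> {-1..1}")
      case True
      then have "\<bar>w\<bar> ^ j \<le> 1" by (intro power_le_one) auto
      then show ?thesis by (simp add: abs_mult power_abs mult_left_le_one_le)
    qed (simp add: pm_def)
  qed
qed measurable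

definition pmom :: "real \<Rightarrow> nat \<Rightarrow> real" where
  "pmom g j = (LINT w|lborel. w ^ j * pm g w)"

lemma pmom_odd: "odd j \<Longrightarrow> pmom g j = 0"
proof -
  assume j: "odd j"
  have "pmom g j = (LINT w|lborel. (- w) ^ j * pm g (- w))"
    unfolding pmom_def using lborel_integral_real_affine[of "-1" "\<lambda>w. w ^ j * pm g w" 0] by simp
  also have "(\<lambda>w. (- w) ^ j * pm g (- w)) = (\<lambda>w. - (w ^ j * pm g w))"
    using j by (auto simp: fun_eq_iff pm_def indicator_def)
  finally show ?thesis by (simp add: pmom_def)
qed

text \<open>The derivative of w^(j+1) (1 - w^2)^g integrates to zero since this function vanishes at
  both ends.\<close>

lemma pmom_rec:
  assumes g: "g > 0"
  shows "(real (Suc j) + 2 * g) * pmom g (Suc (Suc j)) = real (Suc j) * pmom g j"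
proof -
  define F where "F w = w ^ Suc j * (1 - w\<^sup>2) powr g" for w
  define f where "f w = real (Suc j) * (w ^ j * (1 - w\<^sup>2) powr (g - 1)) - (real (Suc j) + 2 * g) * (w ^ Suc (Suc j) * (1 - w\<^sup>2) powr (g - 1))" for w
  have hi: "((\<lambda>w. w ^ i * (1 - w\<^sup>2) powr (g - 1)) has_integral pmom g i) {-1..1}" for i
  proof -
    have e: "w ^ i * pm g w = indicator {-1..1} w *\<^sub>R (w ^ i * (1 - w\<^sup>2) powr (g - 1))" for w
      by (simp add: pm_def mult_ac)
    have "set_integrable lborel {-1..1} (\<lambda>w. w ^ i * (1 - w\<^sup>2) powr (g - 1))"
      using pm_pow_integrable[OF g, of i] unfolding e set_integrable_def .
    from set_borel_integral_eq_integral[OF this] show ?thesis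
      unfolding pmom_def e set_lebesgue_integral_def by (simp add: has_integral_integral)
  qed
  have "(f has_integral (real (Suc j) * pmom g j - (real (Suc j) + 2 * g) * pmom g (Suc (Suc j)))) {-1..1}"
    unfolding f_def[abs_def] by (intro has_integral_diff has_integral_mult_right hi)
  moreover have "(f has_integral (F 1 - F (-1))) {-1..1}"
  proof (rule fundamental_theorem_of_calculus_interior)
    show "continuous_on {-1..1} F" unfolding F_def using g
      by (intro continuous_on_mult continuous_on_powr' continuous_intros) (auto simp: abs_square_le_1 abs_le_iff)
    show "(F has_vector_derivative f w) (at w)" if w: "w \<in> {-1<..<1}" for w
    proof -
      have p: "1 - w\<^sup>2 > 0" using w by (simp add: abs_square_less_1 abs_less_iff)
      have "(F has_real_derivative (real (Suc j) * w ^ j * (1 - w\<^sup>2) powr g + w ^ Suc j * (g * (1 - w\<^sup>2) powr (g - 1) * (- (2 * w))))) (at w)"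
      proof -
        have d1: "((\<lambda>w. w ^ Suc j) has_real_derivative real (Suc j) * w ^ j) (at w)"
          using DERIV_pow[of "Suc j" w] by simp
        have "((\<lambda>w. 1 - w\<^sup>2) has_real_derivative - (2 * w)) (at w)" by (auto intro!: derivative_eq_intros)
        from DERIV_fun_powr[OF this p, of g]
        have d2: "((\<lambda>w. (1 - w\<^sup>2) powr g) has_real_derivative g * (1 - w\<^sup>2) powr (g - 1) * (- (2 * w))) (at w)" by simp
        show ?thesis unfolding F_def[abs_def] using DERIV_mult[OF d1 d2] by (simp only: mult_ac)
      qed
      moreover have "(1 - w\<^sup>2) powr g = (1 - w\<^sup>2) * (1 - w\<^sup>2) powr (g - 1)"
        using p by (simp add: powr_diff)
      then have "real (Suc j) * w ^ j * (1 - w\<^sup>2) powr g + w ^ Suc j * (g * (1 - w\<^sup>2) powr (g - 1) * (- (2 * w))) = f w"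
        unfolding f_def by (simp only: power_Suc power2_eq_square) (simp add: algebra_simps)
      ultimately show ?thesis by (simp add: has_real_derivative_iff_has_vector_derivative)
    qed
  qed simp
  ultimately have "real (Suc j) * pmom g j - (real (Suc j) + 2 * g) * pmom g (Suc (Suc j)) = F 1 - F (-1)"
    by (rule has_integral_unique)
  then show ?thesis by (simp add: F_def)
qed

lemma nu_nonneg: "g > 0 \<Longrightarrow> nu g w \<ge> 0"
proof -
  assume g: "g > 0"
  have "Beta (1/2) g \<ge> 0" using g by (simp add: Beta_def Gamma_real_nonneg add_nonneg_nonneg)
  then show ?thesis by (auto simp: nu_def dmu_def indicator_def)
qed

lemma nu_meas [measurable]: "nu g \<in> borel_measurable borel"
  unfolding nu_pm[abs_def] by measurable

lemma nu_outside: "\<bar>w\<bar> > 1 \<Longrightarrow> nu g w = 0" by (auto simp: nu_def indicator_def)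

text \<open>Up to normalisation the j-th moment is \<open>pmom\<close> g j + \<open>pmom\<close> g
  (j + 1), of which only the one of even index survives. Hence the moments change only from even j
  to j + 1, by the factor of \<open>pmom_rec\<close>, as in \<open>am\<close>.\<close>

lemma nu_moment:
  assumes g: "g > 0"
  shows "integrable lborel (\<lambda>w. nu g w * w ^ j)" and "(LINT w|lborel. nu g w * w ^ j) = am g j"
proof -
  have e: "nu g w * w ^ j = 1 / Beta (1/2) g * (w ^ j * pm g w + w ^ Suc j * pm g w)" for w j
    by (simp add: nu_pm algebra_simps add_divide_distrib)
  show "integrable lborel (\<lambda>w. nu g w * w ^ j)"
    unfolding e by (intro integrable_mult_right Bochner_Integration.integrable_add pm_pow_integrable g)
  have B: "Beta (1/2) g > 0" using g by (simp add: Beta_def Gamma_real_pos add_pos_pos)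
  have I: "(LINT w|lborel. nu g w * w ^ j) = (pmom g j + pmom g (Suc j)) / Beta (1/2) g" for j
    unfolding e pmom_def
    by (subst integral_mult_right_zero, subst Bochner_Integration.integral_add) (simp_all only: pm_pow_integrable[OF g], simp)
  have "am g j = (pmom g j + pmom g (Suc j)) / Beta (1/2) g"
  proof (induction j)
    case 0
    have "pmom g 0 = Beta (1/2) g" using pm_integral(2)[OF g] by (simp add: pmom_def)
    then show ?case using B pmom_odd[of 1 g] by simp
  next
    case (Suc j)
    have J: "real (Suc j) + 2 * g > 0" "real (Suc j) > 0" using g by (simp_all add: add_pos_pos)
    show ?case
    proof (cases "even j")
      case True
      then have "pmom g (Suc j) = 0" by (intro pmom_odd) simp
      moreover have "pmom g (Suc (Suc j)) = real (Suc j) * pmom g j / (real (Suc j) + 2 * g)"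
        using pmom_rec[OF g, of j] J by (metis mult.commute nonzero_mult_div_cancel_right less_irrefl)
      ultimately show ?thesis using Suc.IH True by (simp add: mult.commute)
    next
      case False
      then have "pmom g j = 0" "pmom g (Suc (Suc j)) = 0" by (auto intro!: pmom_odd)
      then show ?thesis using Suc.IH False by (simp del: of_nat_Suc)
    qed
  qed
  then show "(LINT w|lborel. nu g w * w ^ j) = am g j" unfolding I ..
qed

section \<open>Averaging over u and v\<close>

lemma nu_bounded_integral:
  fixes f :: "real \<Rightarrow> complex"
  assumes g: "g > 0" and [measurable]: "f \<in> borel_measurable borel" and M: "\<And>u. \<bar>u\<bar> \<le> 1 \<Longrightarrow> cmod (f u) \<le> M"
  shows "integrable lborel (\<lambda>u. of_real (nu g u) * f u)"
    and "(LINT u|lborel. norm (of_real (nu g u) * f u)) \<le> M"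
    and "cmod (LINT u|lborel. of_real (nu g u) * f u) \<le> M"
proof -
  have ni: "integrable lborel (nu g)" "(LINT u|lborel. nu g u) = 1" using nu_moment[OF g, of 0] by simp_all
  have b: "norm (of_real (nu g u) * f u) \<le> M * nu g u" for u
  proof (cases "\<bar>u\<bar> \<le> 1")
    case True
    then show ?thesis using mult_left_mono[OF M[OF True] nu_nonneg[OF g, of u]] nu_nonneg[OF g, of u] by (simp add: norm_mult mult.commute)
  qed (simp add: nu_outside)
  have Mi: "integrable lborel (\<lambda>u. M * nu g u)" using ni by simp
  show i: "integrable lborel (\<lambda>u. of_real (nu g u) * f u)"
  proof (rule Bochner_Integration.integrable_bound[OF Mi])
    show "AE u in lborel. norm (of_real (nu g u) * f u) \<le> norm (M * nu g u)"
      by (rule AE_I2, rule order_trans[OF b]) simp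
  qed measurable
  have "(LINT u|lborel. norm (of_real (nu g u) * f u)) \<le> (LINT u|lborel. M * nu g u)"
    by (rule integral_mono[OF integrable_norm[OF i] Mi b])
  then show n: "(LINT u|lborel. norm (of_real (nu g u) * f u)) \<le> M" using ni by simp
  show "cmod (LINT u|lborel. of_real (nu g u) * f u) \<le> M"
    by (rule order_trans[OF integral_norm_bound n])
qed

lemma nu_sums:
  fixes f :: "nat \<Rightarrow> real \<Rightarrow> complex"
  assumes g: "g > 0" and m: "\<And>n. f n \<in> borel_measurable borel" and q: "0 \<le> q" "q < 1"
    and M: "\<And>n u. \<bar>u\<bar> \<le> 1 \<Longrightarrow> cmod (f n u) \<le> M * q ^ n"
  shows "(\<lambda>n. LINT u|lborel. of_real (nu g u) * f n u) sums (LINT u|lborel. of_real (nu g u) * (\<Sum>n. f n u))"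
proof -
  note N = nu_bounded_integral[OF g m M]
  have geo: "summable (\<lambda>n. M * q ^ n)" using q by (intro summable_mult summable_geometric) simp
  have fs: "summable (\<lambda>n. norm (f n u))" if "\<bar>u\<bar> \<le> 1" for u
    by (rule summable_comparison_test'[OF geo, of 0]) (simp add: M[OF that])
  have s1: "summable (\<lambda>n. norm (of_real (nu g u) * f n u))" for u
  proof (cases "\<bar>u\<bar> \<le> 1")
    case True
    then show ?thesis unfolding norm_mult by (intro summable_mult fs)
  qed (simp add: nu_outside)
  have s2: "summable (\<lambda>n. LINT u|lborel. norm (of_real (nu g u) * f n u))"
    by (rule summable_comparison_test'[OF geo, of 0]) (simp add: N(2))
  have S: "(\<lambda>n. LINT u|lborel. of_real (nu g u) * f n u) sums (LINT u|lborel. (\<Sum>n. of_real (nu g u) * f n u))"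
    by (rule sums_integral[OF N(1) AE_I2 s2]) (simp_all add: s1)
  have e: "(\<Sum>n. of_real (nu g u) * f n u) = of_real (nu g u) * (\<Sum>n. f n u)" for u
  proof (cases "\<bar>u\<bar> \<le> 1")
    case True
    show ?thesis by (rule suminf_mult[OF summable_norm_cancel[OF fs[OF True]]])
  qed (simp add: nu_outside)
  show ?thesis using S unfolding e .
qed

text \<open>\<open>FX\<close> with the Gegenbauer values replaced by a real sequence C. By linearity
  in C an average over u or v can be moved onto the sequence; in \<open>PXg\<close> the conjugate is
  written as the same expression at cnj e.\<close>

definition FXg :: "(nat \<Rightarrow> real) \<Rightarrow> nat \<Rightarrow> complex \<Rightarrow> nat \<Rightarrow> complex" where
  "FXg C k e n = e ^ (n mod k) * (of_real (C (n div k)) - cnj e ^ k * (if n div k = 0 then 0 else of_real (C (n div k - 1))))"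

definition PXg :: "(nat \<Rightarrow> real) \<Rightarrow> nat \<Rightarrow> complex \<Rightarrow> nat \<Rightarrow> complex" where
  "PXg C k e n = FXg C k e n + (if n = 0 then 0 else cnj e * FXg C k (cnj e) (n - 1))"

lemma PX_PXg: "PX s k X e n = PXg (\<lambda>m. CX s m X) k e n"
  by (simp add: PX_def PXg_def FX_def FXg_def)

lemma PXg_meas:
  assumes [measurable]: "\<And>m. C m \<in> borel_measurable borel"
  shows "(\<lambda>u. PXg (\<lambda>m. C m u) k e n) \<in> borel_measurable borel"
  unfolding PXg_def FXg_def by (cases "n = 0"; cases "n div k = 0"; cases "(n - 1) div k = 0") simp_all

lemma FXg_integral:
  assumes i: "\<And>m. integrable lborel (\<lambda>u. D m u :: real)"
  shows "integrable lborel (\<lambda>u. FXg (\<lambda>m. D m u) k e n)"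
    and "(LINT u|lborel. FXg (\<lambda>m. D m u) k e n) = FXg (\<lambda>m. LINT u|lborel. D m u) k e n"
proof -
  have ci: "integrable lborel (\<lambda>u. complex_of_real (D m u))" for m using i by simp
  have ii: "integrable lborel (\<lambda>u. (if n div k = 0 then 0 else complex_of_real (D (n div k - 1) u)))"
    using ci[of "n div k - 1"] by (cases "n div k = 0") simp_all
  show "integrable lborel (\<lambda>u. FXg (\<lambda>m. D m u) k e n)"
    unfolding FXg_def by (intro integrable_mult_right Bochner_Integration.integrable_diff ci ii)
  have "(LINT u|lborel. (if n div k = 0 then 0 else complex_of_real (D (n div k - 1) u))) = (if n div k = 0 then 0 else of_real (LINT u|lborel. D (n div k - 1) u))"
    by simp
  then show "(LINT u|lborel. FXg (\<lambda>m. D m u) k e n) = FXg (\<lambda>m. LINT u|lborel. D m u) k e n"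
    unfolding FXg_def integral_mult_right_zero
    by (subst Bochner_Integration.integral_diff[OF ci integrable_mult_right[OF ii]]) (simp only: integral_mult_right_zero integral_complex_of_real)
qed

lemma PXg_integral:
  assumes i: "\<And>m. integrable lborel (\<lambda>u. nu g u * C m u)"
  shows "(LINT u|lborel. of_real (nu g u) * PXg (\<lambda>m. C m u) k e n) = PXg (\<lambda>m. LINT u|lborel. nu g u * C m u) k e n"
proof -
  have F: "of_real c * FXg D k e n = FXg (\<lambda>m. c * D m) k e n" for c D e n
    by (simp add: FXg_def algebra_simps)
  note I = FXg_integral[of "\<lambda>m u. nu g u * C m u", OF i]
  have P: "of_real (nu g u) * PXg (\<lambda>m. C m u) k e n = FXg (\<lambda>m. nu g u * C m u) k e n + (if n = 0 then 0 else cnj e * FXg (\<lambda>m. nu g u * C m u) k (cnj e) (n - 1))" for u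
    unfolding PXg_def F[symmetric] by (simp add: distrib_left mult.left_commute)
  have i2: "integrable lborel (\<lambda>u. if n = 0 then 0 else cnj e * FXg (\<lambda>m. nu g u * C m u) k (cnj e) (n - 1))"
    using I(1) by (cases "n = 0") simp_all
  have I2: "(LINT u|lborel. (if n = 0 then 0 else cnj e * FXg (\<lambda>m. nu g u * C m u) k (cnj e) (n - 1))) = (if n = 0 then 0 else cnj e * FXg (\<lambda>m. LINT u|lborel. nu g u * C m u) k (cnj e) (n - 1))"
    using I(2) by (cases "n = 0") simp_all
  show ?thesis unfolding P unfolding PXg_def Bochner_Integration.integral_add[OF I(1) i2] I(2) I2 ..
qed

lemma nu_poly_integral:
  assumes g: "g > 0"
  shows "integrable lborel (\<lambda>u. nu g u * (\<Sum>i\<le>m. K i * (\<Sum>j\<le>p i. L i j * u ^ d i j)))"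
    and "(LINT u|lborel. nu g u * (\<Sum>i\<le>m. K i * (\<Sum>j\<le>p i. L i j * u ^ d i j))) = (\<Sum>i\<le>m. K i * (\<Sum>j\<le>p i. L i j * am g (d i j)))"
proof -
  have e: "nu g u * (\<Sum>i\<le>m. K i * (\<Sum>j\<le>p i. L i j * u ^ d i j)) = (\<Sum>i\<le>m. \<Sum>j\<le>p i. K i * L i j * (nu g u * u ^ d i j))" for u
    by (simp add: sum_distrib_left mult_ac)
  show "integrable lborel (\<lambda>u. nu g u * (\<Sum>i\<le>m. K i * (\<Sum>j\<le>p i. L i j * u ^ d i j)))"
    unfolding e by (intro Bochner_Integration.integrable_sum integrable_mult_right nu_moment(1) g)
  show "(LINT u|lborel. nu g u * (\<Sum>i\<le>m. K i * (\<Sum>j\<le>p i. L i j * u ^ d i j))) = (\<Sum>i\<le>m. K i * (\<Sum>j\<le>p i. L i j * am g (d i j)))"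
    unfolding e
    by (subst Bochner_Integration.integral_sum, intro Bochner_Integration.integrable_sum integrable_mult_right nu_moment(1) g,
        subst Bochner_Integration.integral_sum, intro integrable_mult_right nu_moment(1) g)
      (simp add: nu_moment(2)[OF g] sum_distrib_left mult_ac)
qed

text \<open>The average of \<open>CX\<close> s m (a u + w) over u, see \<open>CX_integral\<close>.
  It is kept as an explicit polynomial in w so that the average over v is again a matter of
  moments.\<close>

definition CI :: "real \<Rightarrow> real \<Rightarrow> real \<Rightarrow> nat \<Rightarrow> real \<Rightarrow> real" where
  "CI s al a m w = (\<Sum>i\<le>m. cmi s m i * (\<Sum>j\<le>m - 2 * i. real (m - 2 * i choose j) * w ^ j * a ^ (m - 2 * i - j) * am al (m - 2 * i - j)))"

lemma CX_integral:
  assumes al: "al > 0"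
  shows "integrable lborel (\<lambda>u. nu al u * CX s m (a * u + w))" and "(LINT u|lborel. nu al u * CX s m (a * u + w)) = CI s al a m w"
proof -
  have e: "CX s m (a * u + w) = (\<Sum>i\<le>m. cmi s m i * (\<Sum>j\<le>m - 2 * i. real (m - 2 * i choose j) * w ^ j * a ^ (m - 2 * i - j) * u ^ (m - 2 * i - j)))" for u
    unfolding CX_def add.commute[of "a * u"] binomial_ring by (simp add: power_mult_distrib mult_ac)
  show "integrable lborel (\<lambda>u. nu al u * CX s m (a * u + w))" "(LINT u|lborel. nu al u * CX s m (a * u + w)) = CI s al a m w"
    unfolding e CI_def by (rule nu_poly_integral[OF al])+
qed

lemma CI_integral:
  assumes be: "be > 0"
  shows "integrable lborel (\<lambda>v. nu be v * CI s al a m (c * v))"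
    and "(LINT v|lborel. nu be v * CI s al a m (c * v)) = (\<Sum>i\<le>m. cmi s m i * (\<Sum>j\<le>m - 2 * i. real (m - 2 * i choose j) * am be j * am al (m - 2 * i - j) * (c ^ j * a ^ (m - 2 * i - j))))"
proof -
  have e: "CI s al a m (c * v) = (\<Sum>i\<le>m. cmi s m i * (\<Sum>j\<le>m - 2 * i. (real (m - 2 * i choose j) * am al (m - 2 * i - j) * (c ^ j * a ^ (m - 2 * i - j))) * v ^ j))" for v
    unfolding CI_def by (simp add: power_mult_distrib mult_ac)
  show "integrable lborel (\<lambda>v. nu be v * CI s al a m (c * v))"
    unfolding e by (rule nu_poly_integral[OF be])
  show "(LINT v|lborel. nu be v * CI s al a m (c * v)) = (\<Sum>i\<le>m. cmi s m i * (\<Sum>j\<le>m - 2 * i. real (m - 2 * i choose j) * am be j * am al (m - 2 * i - j) * (c ^ j * a ^ (m - 2 * i - j))))"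
    unfolding e nu_poly_integral(2)[OF be] by (simp add: mult_ac)
qed

lemma VV_unit:
  assumes "cmod z = 1"
  shows "VV al be m z x = of_real (\<Sum>i\<le>m. cmi (al + be + 1) m i * (\<Sum>j\<le>m - 2 * i. real (m - 2 * i choose j) * am be j * am al (m - 2 * i - j) *
    ((Re z * Re x) ^ j * (Im z * Im x) ^ (m - 2 * i - j))))"
proof -
  have "z * cnj z = 1" using assms by (simp add: complex_norm_square[symmetric])
  then show ?thesis unfolding VV_def YY_def cmon_def by (simp add: power_mult_distrib mult_ac)
qed

lemma PP_PXg:
  assumes om: "cmod om = 1" and C: "\<And>m. VV al be m (om ^ k) (eta ^ k) = of_real (C m)"
  shows "PP al be k n om eta = PXg C k (om * cnj eta) n"
proof -
  have F: "FF al be k j om eta = FXg C k (om * cnj eta) j" for j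
    unfolding FF_def dd_def FXg_def C by (simp add: power_mult_distrib)
  have "cnj (FXg C k (om * cnj eta) j) = FXg C k (cnj (om * cnj eta)) j" for j by (simp add: FXg_def)
  then show ?thesis unfolding PP_def PXg_def F by simp
qed

section \<open>Distinctness of the roots\<close>

lemma cos_mult_eq: "cos x = cos y \<Longrightarrow> cos (real k * x) = cos (real k * y)"
proof -
  assume "cos x = cos y"
  then obtain n where n: "n \<in> \<int>" "x = y + 2 * n * pi \<or> x = - y + 2 * n * pi" unfolding cos_eq by blast
  have "real k * n \<in> \<int>" using n(1) by simp
  moreover have "real k * x = real k * y + 2 * (real k * n) * pi \<or> real k * x = - (real k * y) + 2 * (real k * n) * pi"
    using n(2)
  proof
    assume x: "x = - y + 2 * n * pi"
    show ?thesis unfolding x by (simp add: algebra_simps)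
  next
    assume x: "x = y + 2 * n * pi"
    show ?thesis unfolding x by (simp add: algebra_simps)
  qed
  ultimately show ?thesis unfolding cos_eq by blast
qed

definition bad :: "nat \<Rightarrow> complex \<Rightarrow> complex \<Rightarrow> real set" where
  "bad k om eta = {1, -1, cos (real k * arccos (Re (om * cnj eta)))}"

text \<open>Two roots of A(s,q) coincide only for q in {0, pi}, and a root of A(s,q) is a root of B only if
  cos q is the k-th Chebyshev value of Re(omega cnj eta).\<close>

lemma inj_aroot:
  assumes k: "k \<ge> 1" and b: "b > 0" and X: "\<bar>X\<bar> \<le> 1" and e: "\<bar>Re (om * cnj eta)\<bar> \<le> 1" and nb: "X \<notin> bad k om eta"
  shows "inj_on (aroot k b om eta (arccos X)) {0..k}"
proof (rule linorder_inj_onI')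
  define q where "q = arccos X"
  have cq: "cos q = X" using X by (simp add: q_def abs_le_iff)
  have k0: "real k > 0" using k by simp
  fix l m assume lm: "l \<in> {0..k}" "m \<in> {0..k}" "l < m"
  then have lk: "l < k" by simp
  show "aroot k b om eta (arccos X) l \<noteq> aroot k b om eta (arccos X) m"
  proof
    assume eq: "aroot k b om eta (arccos X) l = aroot k b om eta (arccos X) m"
    have kx: "real k * ((q + 2 * pi * real l) / real k) = q + 2 * pi * real l" using k0 by simp
    show False
    proof (cases "m < k")
      case True
      have "b * cos ((q + 2 * pi * real l) / real k) = b * cos ((q + 2 * pi * real m) / real k)"
        using eq lk True unfolding aroot_def q_def[symmetric]
        by (simp only: if_True mult_cancel_left neg_equal_0_iff_equal complex_i_not_zero of_real_eq_iff) simp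
      then have "cos ((q + 2 * pi * real l) / real k) = cos ((q + 2 * pi * real m) / real k)" using b by simp
      then obtain n where n: "n \<in> \<int>" "(q + 2 * pi * real l) / real k = (q + 2 * pi * real m) / real k + 2 * n * pi \<or> (q + 2 * pi * real l) / real k = - ((q + 2 * pi * real m) / real k) + 2 * n * pi"
        unfolding cos_eq by blast
      from n(1) obtain i where i: "n = of_int i" by (auto elim: Ints_cases)
      from n(2) show False
      proof
        assume "(q + 2 * pi * real l) / real k = (q + 2 * pi * real m) / real k + 2 * n * pi"
        then have "q + 2 * pi * real l = q + 2 * pi * real m + 2 * n * pi * real k"
          using k0 by (simp add: field_simps)
        then have "pi * real l = pi * (real m + n * real k)" by (simp add: algebra_simps)
        then have "real l = real m + n * real k" by simp
        then have "real_of_int (int l) = of_int (int m + i * int k)" by (simp add: i)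
        then have "int l = int m + i * int k" by (simp only: of_int_eq_iff)
        then have mk: "int m - int l = - i * int k" by simp
        have "0 < int m - int l" "int m - int l < int k" using lm True by simp_all
        then have "0 < - i * int k" "- i * int k < 1 * int k" unfolding mk by simp_all
        moreover from this(1) have "0 < - i" using k by (simp add: zero_less_mult_iff mult_less_0_iff)
        then have "1 * int k \<le> - i * int k" by (intro mult_right_mono) auto
        ultimately show False by linarith
      next
        assume "(q + 2 * pi * real l) / real k = - ((q + 2 * pi * real m) / real k) + 2 * n * pi"
        then have "q + 2 * pi * real l = - (q + 2 * pi * real m) + 2 * n * pi * real k"
          using k0 by (simp add: field_simps)
        then have "q = of_int (i * int k - int l - int m) * pi" by (simp add: i algebra_simps)
        then have "sin q = 0" unfolding sin_zero_iff_int2 by blast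
        then have "(cos q)\<^sup>2 = 1" using sin_cos_squared_add[of q] by simp
        then have "X = 1 \<or> X = -1" unfolding cq by (simp add: power2_eq_1_iff)
        then show False using nb by (auto simp: bad_def)
      qed
    next
      case False
      have "b * cos ((q + 2 * pi * real l) / real k) = b * Re (om * cnj eta)"
        using eq lk False unfolding aroot_def q_def[symmetric]
        by (simp only: if_True if_False mult_cancel_left neg_equal_0_iff_equal complex_i_not_zero of_real_eq_iff) simp
      then have "cos ((q + 2 * pi * real l) / real k) = cos (arccos (Re (om * cnj eta)))"
        using b e by (simp add: abs_le_iff)
      from cos_mult_eq[OF this, of k] have "cos (q + 2 * pi * real l) = cos (real k * arccos (Re (om * cnj eta)))"
        unfolding kx .
      moreover have "cos (q + 2 * pi * real l) = cos q"
        by (rule cos_eq[THEN iffD2]) (auto intro!: bexI[of _ "real l"])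
      ultimately have "X = cos (real k * arccos (Re (om * cnj eta)))" unfolding cq by simp
      then show False using nb by (simp add: bad_def)
    qed
  qed
qed

text \<open>Turns an almost-everywhere hypothesis into a plain one where X is constant and the
  condition therefore does not involve the variable.\<close>

lemma AE_Icc_const:
  assumes "AE u in lborel. u \<in> {-1..1::real} \<longrightarrow> P"
  shows P
proof (rule ccontr)
  assume "\<not> P"
  then have "AE u in lborel. u \<notin> {-1..1::real}" using assms by simp
  moreover have "{u \<in> space lborel. \<not> u \<notin> {-1..1::real}} = {-1..1}" by auto
  ultimately have "emeasure lborel {-1..1::real} = 0"
    using AE_iff_measurable[of "{-1..1::real}" lborel "\<lambda>u. u \<notin> {-1..1}"] by (metis atLeastAtMost_borel sets_lborel)
  then show False by simp
qed

section \<open>Averages of the tau-integral\<close>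

lemma set_integral_nu:
  fixes f :: "real \<Rightarrow> complex"
  shows "(LINT u:{-1..1}|lborel. complex_of_real (dmu g u) * f u) = (LINT u|lborel. of_real (nu g u) * f u)"
  unfolding set_lebesgue_integral_def nu_def by (simp add: scaleR_conv_of_real mult.assoc)

definition II :: "nat \<Rightarrow> real \<Rightarrow> real \<Rightarrow> complex \<Rightarrow> complex \<Rightarrow> real \<Rightarrow> complex" where
  "II k lam b om eta X = (LINT tau:{0..1}|lborel. csum k b om eta (arccos X) tau * gfun k b lam (arccos X) tau)"

text \<open>The coefficient of the n-th reproducing kernel in the Dunkl kernel, apart from the
  common factor 2^g Gamma(g + 1).\<close>

definition bt :: "real \<Rightarrow> real \<Rightarrow> nat \<Rightarrow> complex" where
  "bt g b n = (- \<i>) ^ n * of_real (b powr (- g) * besselJ (real n + g) b)"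

text \<open>Decay 64^(-n) of the Bessel factor against growth 16^n of the kernels. The bound is
  uniform in X, which lets the averages pass through the series.\<close>

lemma bt_PX_bound:
  assumes lam: "lam > 0" and g: "g > 0" and b: "b > 0"
  obtains M where "M \<ge> 0" "\<And>n k X e. \<bar>X\<bar> \<le> 1 \<Longrightarrow> cmod e = 1 \<Longrightarrow> cmod (bt g b n * PX (lam + 1) k X e n) \<le> M * (1/4) ^ n"
proof -
  obtain B where B: "B \<ge> 0" "\<And>j. \<bar>b powr (- g) * besselJ (real j + g) b\<bar> \<le> B * (1/64) ^ j" using besselJ_bound[OF g b] by blast
  obtain K where K: "K \<ge> 0" "\<And>m X. \<bar>X\<bar> \<le> 1 \<Longrightarrow> \<bar>CX (lam + 1) m X\<bar> \<le> K * 16 ^ m" using CX_bound[of "lam + 1"] lam by auto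
  have "cmod (bt g b n * PX (lam + 1) k X e n) \<le> (B * (4 * K)) * (1/4) ^ n" if X: "\<bar>X\<bar> \<le> 1" and e: "cmod e = 1" for n k X e
  proof -
    have "cmod (bt g b n * PX (lam + 1) k X e n) = \<bar>b powr (- g) * besselJ (real n + g) b\<bar> * cmod (PX (lam + 1) k X e n)"
      unfolding bt_def norm_mult norm_power norm_of_real by simp
    also have "\<dots> \<le> (B * (1/64) ^ n) * (4 * K * 16 ^ n)"
      using B(1) by (intro mult_mono B(2) PX_bound K e X) auto
    also have "\<dots> = (B * (4 * K)) * ((1/64) * 16) ^ n" by (simp only: power_mult_distrib mult_ac)
    finally show ?thesis by simp
  qed
  then show thesis using that[of "B * (4 * K)"] B K by simp
qed

text \<open>For a \<noteq> 0 the argument a u + w takes one of the three exceptional values for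
  finitely many u only. For a = 0 it is constant, and distinctness of the roots has to be
  supplied.\<close>

lemma inner_integral:
  assumes k: "k \<ge> 1" and lam: "lam > 0" and al: "al > 0" and b: "b > 0"
    and om: "cmod om = 1" and eta: "cmod eta = 1" and aw: "\<bar>a\<bar> + \<bar>w\<bar> \<le> 1"
    and ok: "a \<noteq> 0 \<or> inj_on (aroot k b om eta (arccos w)) {0..k}"
    and M: "\<And>n X. \<bar>X\<bar> \<le> 1 \<Longrightarrow> cmod (bt (real k * lam) b n * PX (lam + 1) k X (om * cnj eta) n) \<le> M * (1/4) ^ n"
  shows "(\<lambda>n. bt (real k * lam) b n * PXg (\<lambda>m. CI (lam + 1) al a m w) k (om * cnj eta) n) sums
      (of_real (2 powr (- (real k * lam))) * (LINT u|lborel. of_real (nu al u) * II k lam b om eta (a * u + w)))"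
    and "cmod (bt (real k * lam) b n * PXg (\<lambda>m. CI (lam + 1) al a m w) k (om * cnj eta) n) \<le> M * (1/4) ^ n"
proof -
  define g where "g = real k * lam"
  define e where "e = om * cnj eta"
  have e1: "cmod e = 1" using om eta by (simp add: e_def norm_mult)
  have X1: "\<bar>a * u + w\<bar> \<le> 1" if "\<bar>u\<bar> \<le> 1" for u
  proof -
    have "\<bar>a * u\<bar> \<le> \<bar>a\<bar> * 1" unfolding abs_mult using that by (intro mult_left_mono) auto
    then show ?thesis using aw by linarith
  qed
  define f where "f n u = bt g b n * PX (lam + 1) k (a * u + w) e n" for n u
  have fm: "f n \<in> borel_measurable borel" for n
  proof -
    have "(\<lambda>u. CX (lam + 1) m (a * u + w)) \<in> borel_measurable borel" for m unfolding CX_def by measurable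
    from PXg_meas[of "\<lambda>m u. CX (lam + 1) m (a * u + w)", OF this]
    show ?thesis unfolding f_def[abs_def] PX_PXg by (intro borel_measurable_times borel_measurable_const)
  qed
  have fM: "cmod (f n u) \<le> M * (1/4) ^ n" if "\<bar>u\<bar> \<le> 1" for n u
    unfolding f_def g_def e_def by (rule M[OF X1[OF that]])
  have fI: "(LINT u|lborel. of_real (nu al u) * f n u) = bt g b n * PXg (\<lambda>m. CI (lam + 1) al a m w) k e n" for n
  proof -
    have e: "of_real (nu al u) * f n u = bt g b n * (of_real (nu al u) * PXg (\<lambda>m. CX (lam + 1) m (a * u + w)) k e n)" for u
      unfolding f_def PX_PXg by (rule mult.left_commute)
    show ?thesis unfolding e using PXg_integral[of al "\<lambda>m u. CX (lam + 1) m (a * u + w)" k e n, OF CX_integral(1)[OF al]]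
      by (simp add: CX_integral(2)[OF al])
  qed
  have S: "(\<lambda>n. bt g b n * PXg (\<lambda>m. CI (lam + 1) al a m w) k e n) sums (LINT u|lborel. of_real (nu al u) * (\<Sum>n. f n u))"
    unfolding fI[symmetric] by (rule nu_sums[OF al fm _ _ fM]) simp_all
  define U where "U = {u. \<bar>u\<bar> \<le> 1 \<and> \<not> inj_on (aroot k b om eta (arccos (a * u + w))) {0..k}}"
  have "finite U"
  proof (cases "a = 0")
    case False
    have "U \<subseteq> (\<lambda>x. (x - w) / a) ` bad k om eta"
    proof
      fix u assume u: "u \<in> U"
      have "\<bar>Re (om * cnj eta)\<bar> \<le> 1" using abs_Re_le_cmod[of e] e1 by (simp add: e_def)
      then have "a * u + w \<in> bad k om eta" using inj_aroot[OF k b X1, of u om eta] u by (auto simp: U_def)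
      then show "u \<in> (\<lambda>x. (x - w) / a) ` bad k om eta" using False by (intro image_eqI[of _ _ "a * u + w"]) auto
    qed
    then show ?thesis by (rule finite_subset) (simp add: bad_def)
  qed (use ok in \<open>simp add: U_def\<close>)
  then have cU: "countable U" by (rule countable_finite)
  \<comment> \<open>Off the finite set U both integrands agree pointwise, so the integral of
    \<open>II\<close> takes its value from that of the series.\<close>
  have "(LINT u|lborel. of_real (nu al u) * (\<Sum>n. f n u)) = (LINT u|lborel. of_real (2 powr (- g)) * (of_real (nu al u) * II k lam b om eta (a * u + w)))"
  proof (rule integral_discrete_difference[OF cU])
    fix u assume "u \<notin> U"
    show "of_real (nu al u) * (\<Sum>n. f n u) = of_real (2 powr (- g)) * (of_real (nu al u) * II k lam b om eta (a * u + w))"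
    proof (cases "\<bar>u\<bar> \<le> 1")
      case True
      then have inj: "inj_on (aroot k b om eta (arccos (a * u + w))) {0..k}" using \<open>u \<notin> U\<close> by (simp add: U_def)
      have "(\<Sum>n. f n u) = of_real (2 powr (- g)) * II k lam b om eta (a * u + w)"
        using csum_integral_sums[OF k lam b X1[OF True] om eta inj] unfolding f_def bt_def g_def e_def II_def by (simp only: sums_iff)
      then show ?thesis by (simp only: mult.left_commute)
    qed (simp add: nu_outside)
  qed simp_all
  then show "(\<lambda>n. bt (real k * lam) b n * PXg (\<lambda>m. CI (lam + 1) al a m w) k (om * cnj eta) n) sums
      (of_real (2 powr (- (real k * lam))) * (LINT u|lborel. of_real (nu al u) * II k lam b om eta (a * u + w)))"
    using S unfolding g_def e_def by simp
  show "cmod (bt (real k * lam) b n * PXg (\<lambda>m. CI (lam + 1) al a m w) k (om * cnj eta) n) \<le> M * (1/4) ^ n"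
    using nu_bounded_integral(3)[OF al fm fM] unfolding fI unfolding g_def e_def .
qed

text \<open>For a = c = 0 the value X is constant, so distinctness of the roots cannot be had by discarding finitely many points.\<close>

lemma outer_integral:
  assumes k: "k \<ge> 1" and lam: "lam > 0" and al: "al > 0" and be: "be > 0" and b: "b > 0"
    and om: "cmod om = 1" and eta: "cmod eta = 1" and ac: "\<bar>a\<bar> + \<bar>c\<bar> \<le> 1"
    and ok: "a = 0 \<Longrightarrow> c = 0 \<Longrightarrow> inj_on (aroot k b om eta (arccos 0)) {0..k}"
  shows "(\<lambda>n. bt (real k * lam) b n * PXg (\<lambda>m. LINT v|lborel. nu be v * CI (lam + 1) al a m (c * v)) k (om * cnj eta) n) sums
      (of_real (2 powr (- (real k * lam))) * (LINT v|lborel. of_real (nu be v) * (LINT u|lborel. of_real (nu al u) * II k lam b om eta (a * u + c * v))))"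
proof -
  define g where "g = real k * lam"
  define e where "e = om * cnj eta"
  have g: "g > 0" using k lam by (simp add: g_def)
  have e1: "cmod e = 1" using om eta by (simp add: e_def norm_mult)
  have re: "\<bar>Re (om * cnj eta)\<bar> \<le> 1" using abs_Re_le_cmod[of e] e1 by (simp add: e_def)
  obtain M where M: "\<And>n X. \<bar>X\<bar> \<le> 1 \<Longrightarrow> cmod (bt g b n * PX (lam + 1) k X e n) \<le> M * (1/4) ^ n"
    using bt_PX_bound[OF lam g b] e1 by metis
  note M' = M[unfolded g_def e_def]
  have cv: "\<bar>c * v\<bar> \<le> \<bar>c\<bar>" if "\<bar>v\<bar> \<le> 1" for v
    unfolding abs_mult using that mult_left_mono[of "\<bar>v\<bar>" 1 "\<bar>c\<bar>"] by simp
  have acv: "\<bar>a\<bar> + \<bar>c * v\<bar> \<le> 1" if "\<bar>v\<bar> \<le> 1" for v using cv[OF that] ac by linarith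
  define V where "V = {v. \<bar>v\<bar> \<le> 1 \<and> \<not> (a \<noteq> 0 \<or> inj_on (aroot k b om eta (arccos (c * v))) {0..k})}"
  have "finite V"
  proof (cases "a = 0 \<and> c \<noteq> 0")
    case True
    have "V \<subseteq> (\<lambda>x. x / c) ` bad k om eta"
    proof
      fix v assume v: "v \<in> V"
      then have "\<bar>c * v\<bar> \<le> 1" using acv[of v] by (simp add: V_def)
      then have "c * v \<in> bad k om eta" using inj_aroot[OF k b _ re, of "c * v"] v by (auto simp: V_def)
      then show "v \<in> (\<lambda>x. x / c) ` bad k om eta" using True by (intro image_eqI[of _ _ "c * v"]) auto
    qed
    then show ?thesis by (rule finite_subset) (simp add: bad_def)
  next
    case False
    then have "V = {}" using ok by (auto simp: V_def)
    then show ?thesis by simp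
  qed
  then have cV: "countable V" by (rule countable_finite)
  have inner: "(\<Sum>n. bt g b n * PXg (\<lambda>m. CI (lam + 1) al a m (c * v)) k e n) = of_real (2 powr (- g)) * (LINT u|lborel. of_real (nu al u) * II k lam b om eta (a * u + c * v))"
    if "\<bar>v\<bar> \<le> 1" "v \<notin> V" for v
  proof -
    have o: "a \<noteq> 0 \<or> inj_on (aroot k b om eta (arccos (c * v))) {0..k}" using that by (simp add: V_def)
    show ?thesis unfolding g_def e_def
      using sums_unique[OF inner_integral(1)[OF k lam al b om eta acv[OF that(1)] o M']] by simp
  qed
  define f where "f n v = bt g b n * PXg (\<lambda>m. CI (lam + 1) al a m (c * v)) k e n" for n v
  have fm: "f n \<in> borel_measurable borel" for n
  proof -
    have "(\<lambda>v. CI (lam + 1) al a m (c * v)) \<in> borel_measurable borel" for m unfolding CI_def by measurable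
    from PXg_meas[of "\<lambda>m v. CI (lam + 1) al a m (c * v)", OF this]
    show ?thesis unfolding f_def[abs_def] by (intro borel_measurable_times borel_measurable_const)
  qed
  have fM: "cmod (f n v) \<le> M * (1/4) ^ n" if v: "\<bar>v\<bar> \<le> 1" for n v
  proof -
    have "(LINT u|lborel. of_real (nu al u) * (bt g b n * PX (lam + 1) k (a * u + c * v) e n)) = f n v"
    proof -
      have e: "of_real (nu al u) * (bt g b n * PX (lam + 1) k (a * u + c * v) e n) = bt g b n * (of_real (nu al u) * PXg (\<lambda>m. CX (lam + 1) m (a * u + c * v)) k e n)" for u
        unfolding PX_PXg by (rule mult.left_commute)
      show ?thesis unfolding e using PXg_integral[of al "\<lambda>m u. CX (lam + 1) m (a * u + c * v)" k e n, OF CX_integral(1)[OF al]]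
        by (simp add: CX_integral(2)[OF al] f_def)
    qed
    moreover have "cmod (LINT u|lborel. of_real (nu al u) * (bt g b n * PX (lam + 1) k (a * u + c * v) e n)) \<le> M * (1/4) ^ n"
    proof (rule nu_bounded_integral(3)[OF al])
      have "(\<lambda>u. CX (lam + 1) m (a * u + c * v)) \<in> borel_measurable borel" for m unfolding CX_def by measurable
      from PXg_meas[of "\<lambda>m u. CX (lam + 1) m (a * u + c * v)", OF this]
      show "(\<lambda>u. bt g b n * PX (lam + 1) k (a * u + c * v) e n) \<in> borel_measurable borel"
        unfolding PX_PXg by (intro borel_measurable_times borel_measurable_const)
      fix u :: real assume u: "\<bar>u\<bar> \<le> 1"
      have "\<bar>a * u\<bar> \<le> \<bar>a\<bar> * 1" unfolding abs_mult using u by (intro mult_left_mono) auto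
      then have "\<bar>a * u + c * v\<bar> \<le> 1" using acv[OF v] by linarith
      then show "cmod (bt g b n * PX (lam + 1) k (a * u + c * v) e n) \<le> M * (1/4) ^ n" by (rule M)
    qed
    ultimately show ?thesis by simp
  qed
  have fI: "(LINT v|lborel. of_real (nu be v) * f n v) = bt g b n * PXg (\<lambda>m. LINT v|lborel. nu be v * CI (lam + 1) al a m (c * v)) k e n" for n
  proof -
    have e: "of_real (nu be v) * f n v = bt g b n * (of_real (nu be v) * PXg (\<lambda>m. CI (lam + 1) al a m (c * v)) k e n)" for v
      unfolding f_def by (rule mult.left_commute)
    show ?thesis unfolding e using PXg_integral[of be "\<lambda>m v. CI (lam + 1) al a m (c * v)" k e n, OF CI_integral(1)[OF be]] by simp
  qed
  have S: "(\<lambda>n. bt g b n * PXg (\<lambda>m. LINT v|lborel. nu be v * CI (lam + 1) al a m (c * v)) k e n) sums (LINT v|lborel. of_real (nu be v) * (\<Sum>n. f n v))"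
    unfolding fI[symmetric] by (rule nu_sums[OF be fm _ _ fM]) simp_all
  have "(LINT v|lborel. of_real (nu be v) * (\<Sum>n. f n v)) = (LINT v|lborel. of_real (2 powr (- g)) * (of_real (nu be v) * (LINT u|lborel. of_real (nu al u) * II k lam b om eta (a * u + c * v))))"
  proof (rule integral_discrete_difference[OF cV])
    fix v assume "v \<notin> V"
    show "of_real (nu be v) * (\<Sum>n. f n v) = of_real (2 powr (- g)) * (of_real (nu be v) * (LINT u|lborel. of_real (nu al u) * II k lam b om eta (a * u + c * v)))"
    proof (cases "\<bar>v\<bar> \<le> 1")
      case True
      show ?thesis unfolding f_def inner[OF True \<open>v \<notin> V\<close>] by (rule mult.left_commute)
    qed (simp add: nu_outside)
  qed simp_all
  then show ?thesis using S unfolding g_def e_def by simp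
qed

text \<open>Keeps X(u,v) within [-1,1] for u and v in [-1,1], so that cos undoes the arccos in
  q.\<close>

lemma Re_Im_unit:
  assumes "cmod z = 1" "cmod x = 1"
  shows "\<bar>Im z * Im x\<bar> + \<bar>Re z * Re x\<bar> \<le> 1"
proof -
  have u: "(Re y)\<^sup>2 + (Im y)\<^sup>2 = 1" if "cmod y = 1" for y using that cmod_power2[of y] by simp
  have am: "2 * \<bar>p * q\<bar> \<le> p\<^sup>2 + q\<^sup>2" for p q :: real
    using sum_squares_bound[of "\<bar>p\<bar>" "\<bar>q\<bar>"] by (simp add: abs_mult)
  show ?thesis using am[of "Im z" "Im x"] am[of "Re z" "Re x"] u[OF assms(1)] u[OF assms(2)] by linarith
qed

theorem theorem17:
  fixes k :: nat and al be :: real and z1 z2 om eta :: complex and b :: real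
  assumes "z1 \<noteq> 0" and "z2 \<noteq> 0"
    and "om = z1 / complex_of_real (cmod z1)" and "eta = z2 / complex_of_real (cmod z2)"
    and "b = cmod z1 * cmod z2"
  shows
   "(k \<ge> 1 \<and> al > 0 \<and> be > 0 \<and>
     (AE v in lborel. v \<in> {-1..1} \<longrightarrow>
        (AE u in lborel. u \<in> {-1..1} \<longrightarrow> inj_on (aroot k b om eta (qf k om eta u v)) {0..k}))
     \<longrightarrow>
     dunkl_kernel (2 * k) (kappa_even k al be) (weight_even k al be) z1 z2 =
     complex_of_real (Gamma (real k * (al + be) + 1)) *
     (LINT v:{-1..1}|lborel. complex_of_real (dmu be v) *
       (LINT u:{-1..1}|lborel. complex_of_real (dmu al u) *
         (LINT tau:{0..1}|lborel.
            csum k b om eta (qf k om eta u v) tau * gfun k b (al + be) (qf k om eta u v) tau))))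
    \<and>
    (odd k \<and> al > 0 \<and>
     (AE u in lborel. u \<in> {-1..1} \<longrightarrow> inj_on (aroot k b om eta (qf k om eta u 1)) {0..k})
     \<longrightarrow>
     dunkl_kernel k (kappa_odd al) (weight_odd k al) z1 z2 =
     complex_of_real (Gamma (real k * al + 1)) *
       (LINT u:{-1..1}|lborel. complex_of_real (dmu al u) *
         (LINT tau:{0..1}|lborel.
            csum k b om eta (qf k om eta u 1) tau * gfun k b al (qf k om eta u 1) tau)))"
proof -
  have om1: "cmod om = 1" and eta1: "cmod eta = 1" and b: "b > 0"
    using assms by (simp_all add: norm_divide)
  have omk: "cmod (om ^ k) = 1" and etak: "cmod (eta ^ k) = 1" by (simp_all add: norm_power om1 eta1)
  define a where "a = Im (om ^ k) * Im (eta ^ k)"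
  define c where "c = Re (om ^ k) * Re (eta ^ k)"
  have ac: "\<bar>a\<bar> + \<bar>c\<bar> \<le> 1" unfolding a_def c_def by (rule Re_Im_unit[OF omk etak])
  have q: "qf k om eta u v = arccos (a * u + c * v)" for u v by (simp add: qf_def Xf_def a_def c_def)
  \<comment> \<open>The factor 2^g of the Dunkl kernel cancels the 2^(-g) that the Bessel series
    carries since \<open>psi_one\<close>.\<close>
  have kernel: "dunkl_kernel N ka w z1 z2 = of_real (Gamma (g + 1)) * I"
    if "(\<Sum>j<N. ka j) = g" "(\<lambda>n. bt g b n * repker N ka w n om eta) sums (of_real (2 powr (- g)) * I)" for N ka w g I
  proof -
    have "dunkl_kernel N ka w z1 z2 = of_real (2 powr g * Gamma (g + 1)) * (\<Sum>n. bt g b n * repker N ka w n om eta)"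
      unfolding dunkl_kernel_def Let_def bt_def that(1) assms(3-5) ..
    also have "\<dots> = of_real (2 powr g * Gamma (g + 1)) * (of_real (2 powr (- g)) * I)"
      unfolding sums_unique[OF that(2), symmetric] ..
    also have "\<dots> = of_real (2 powr g * 2 powr (- g)) * (of_real (Gamma (g + 1)) * I)" by simp
    also have "(2::real) powr g * 2 powr (- g) = 1" unfolding powr_add[symmetric] by simp
    finally show ?thesis by simp
  qed
  show ?thesis
  proof (intro conjI impI; elim conjE)
    assume k: "k \<ge> 1" and al: "al > 0" and be: "be > 0"
      and inj: "AE v in lborel. v \<in> {-1..1} \<longrightarrow>
        (AE u in lborel. u \<in> {-1..1} \<longrightarrow> inj_on (aroot k b om eta (qf k om eta u v)) {0..k})"
    interpret D: dih k "2 * k" "kappa_even k al be" al be "weight_even k al be" by (rule dih_even[OF k al be])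
    have R: "repker (2 * k) (kappa_even k al be) (weight_even k al be) n om eta =
      PXg (\<lambda>m. LINT v|lborel. nu be v * CI (al + be + 1) al a m (c * v)) k (om * cnj eta) n" for n
      unfolding D.repker_PP[OF eta1]
      by (rule PP_PXg[OF om1]) (simp only: VV_unit[OF omk] CI_integral(2)[OF be] a_def c_def)
    \<comment> \<open>If a = c = 0 then X(u,v) = 0 throughout, and the almost-everywhere hypothesis
      on the roots reduces, in v and then in u, to one statement at X = 0.\<close>
    have ok: "inj_on (aroot k b om eta (arccos 0)) {0..k}" if "a = 0" "c = 0"
    proof (rule AE_Icc_const)
      show "AE u in lborel. u \<in> {-1..1} \<longrightarrow> inj_on (aroot k b om eta (arccos 0)) {0..k}"
        by (rule AE_Icc_const) (use inj in \<open>simp add: q that\<close>)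
    qed
    have lam: "al + be > 0" using al be by simp
    show "dunkl_kernel (2 * k) (kappa_even k al be) (weight_even k al be) z1 z2 =
     complex_of_real (Gamma (real k * (al + be) + 1)) *
     (LINT v:{-1..1}|lborel. complex_of_real (dmu be v) *
       (LINT u:{-1..1}|lborel. complex_of_real (dmu al u) *
         (LINT tau:{0..1}|lborel.
            csum k b om eta (qf k om eta u v) tau * gfun k b (al + be) (qf k om eta u v) tau)))"
      unfolding set_integral_nu q II_def[symmetric]
      by (rule kernel[OF D.kasum]) (unfold R, rule outer_integral[OF k lam al be b om1 eta1 ac ok])
  next
    assume k: "odd k" and al: "al > 0"
      and inj: "AE u in lborel. u \<in> {-1..1} \<longrightarrow> inj_on (aroot k b om eta (qf k om eta u 1)) {0..k}"
    have k1: "k \<ge> 1" using k by (cases k) auto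
    interpret D: dih k k "kappa_odd al" al 0 "weight_odd k al" by (rule dih_odd[OF k al])
    have R: "repker k (kappa_odd al) (weight_odd k al) n om eta = PXg (\<lambda>m. CI (al + 1) al a m c) k (om * cnj eta) n" for n
      unfolding D.repker_PP[OF eta1]
    proof (rule PP_PXg[OF om1])
      \<comment> \<open>For be = 0 all moments \<open>am\<close> 0 j equal 1, so the average over v
        is evaluation at v = 1 and the argument is a u + c.\<close>
      show "VV al 0 m (om ^ k) (eta ^ k) = of_real (CI (al + 1) al a m c)" for m
        unfolding VV_unit[OF omk] CI_def a_def c_def by (simp add: am_0 mult_ac)
    qed
    \<comment> \<open>For a = 0 the value X(u,1) = c does not depend on u, so the hypothesis on the
      roots holds at c itself.\<close>
    have ok: "a \<noteq> 0 \<or> inj_on (aroot k b om eta (arccos c)) {0..k}"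
    proof (cases "a = 0")
      case True
      have "inj_on (aroot k b om eta (arccos c)) {0..k}"
        by (rule AE_Icc_const) (use inj True in \<open>simp add: q\<close>)
      then show ?thesis ..
    qed simp
    have g: "real k * al > 0" using k1 al by simp
    have e1: "cmod (om * cnj eta) = 1" by (simp add: norm_mult om1 eta1)
    obtain M where M: "\<And>n X. \<bar>X\<bar> \<le> 1 \<Longrightarrow> cmod (bt (real k * al) b n * PX (al + 1) k X (om * cnj eta) n) \<le> M * (1/4) ^ n"
      using bt_PX_bound[OF al g b] e1 by metis
    have "(\<Sum>j<k. kappa_odd al j) = real k * al" using D.kasum by simp
    then show "dunkl_kernel k (kappa_odd al) (weight_odd k al) z1 z2 =
     complex_of_real (Gamma (real k * al + 1)) *
       (LINT u:{-1..1}|lborel. complex_of_real (dmu al u) *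
         (LINT tau:{0..1}|lborel.
            csum k b om eta (qf k om eta u 1) tau * gfun k b al (qf k om eta u 1) tau))"
      unfolding set_integral_nu q mult_1_right II_def[symmetric]
      by (rule kernel) (unfold R, rule inner_integral(1)[OF k1 al al b om1 eta1 ac ok M])
  qed
qed

end
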